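(* Let $\mathbb{L}_1$ and $\mathbb{L}_2$ be finite extensions of $\mathbb{Q}$, and let $U$ and $G$ be algebraic groups over $\mathbb{L}_1$ and $\mathbb{L}_2$, respectively. Assume that $U$ is unipotent. Let $\phi: U(\mathbb{L}_1)\to G(\mathbb{L}_2)$ be an abstract group homomorphism. (1) If $\mathbb{L}_1=\mathbb{L}_2=\mathbb{Q}$, then there is a unique algebraic $\mathbb{Q}$-homomorphism $\psi: U\to G$ such that $\phi$ is the restriction of $\psi$ to $U(\mathbb{Q})$. (2) There exists a unique $\mathbb{Q}$-homomorphism $\psi':\mathcal{R}_{\mathbb{L}_1/\mathbb{Q}}(U)\to\mathcal{R}_{\mathbb{L}_2/\mathbb{Q}}(G)$ such that $\phi(x)=\pi_2\circ\psi'\circ\pi_1^{-1}(x)$ for all $x\in U(\mathbb{L}_1)$, where $\pi_1:\mathcal{R}_{\mathbb{L}_1/\mathbb{Q}}(U)\to U$ is the natural projection over $\mathbb{L}_1$ inducing an isomorphism of groups $\pi_1:\mathcal{R}_{\mathbb{L}_1/\mathbb{Q}}(U)(\mathbb{Q})\to U(\mathbb{L}_1)$, and analogously $\pi_2:\mathcal{R}_{\mathbb{L}_2/\mathbb{Q}}(G)\to G$ is the natural projection over $\mathbb{L}_2$ inducing an isomorphism of groups $\pi_2:\mathcal{R}_{\mathbb{L}_2/\mathbb{Q}}(G)(\mathbb{Q})\to G(\mathbb{L}_2)$.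
   Context: Algebraic groups are linear algebraic groups; $A(\mathbb{L})$ is the group of $\mathbb{L}$-rational points of $A$. An abstract homomorphism is a homomorphism of abstract groups. $\mathcal{R}_{\mathbb{L}/\mathbb{Q}}$ denotes Weil restriction of scalars; a $\mathbb{Q}$-homomorphism is a homomorphism of algebraic groups defined over $\mathbb{Q}$. *)

theory Defs
  imports
    "Jordan_Normal_Form.Determinant"
    "Jordan_Normal_Form.VS_Connect"
    "HOL-Algebra.Subrings"
    "HOL-Library.FuncSet"
begin

text \<open>
  Conventions are the classical ones: all varieties are identified with their sets of points over
  an algebraically closed field \<open>'c\<close> of characteristic 0 (the universal domain), and fields of
  definition are subfields of \<open>'c\<close>.
\<close>

definition number_field :: "'c::field_char_0 set \<Rightarrow> bool" where
  "number_field L \<longleftrightarrow> subfield L class_ring \<and>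
     (\<exists>B. finite B \<and> L = {(\<Sum>b\<in>B. c b * b) | c. \<forall>b\<in>B. c b \<in> \<rat>})"

inductive_set generated_algebra :: "'c::comm_ring_1 set \<Rightarrow> ('p \<Rightarrow> 'c) set \<Rightarrow> ('p \<Rightarrow> 'c) set"
  for k :: "'c set" and C :: "('p \<Rightarrow> 'c) set" where
  const: "a \<in> k \<Longrightarrow> (\<lambda>_. a) \<in> generated_algebra k C"
| gen: "f \<in> C \<Longrightarrow> f \<in> generated_algebra k C"
| add: "f \<in> generated_algebra k C \<Longrightarrow> g \<in> generated_algebra k C
        \<Longrightarrow> (\<lambda>x. f x + g x) \<in> generated_algebra k C"
| mult: "f \<in> generated_algebra k C \<Longrightarrow> g \<in> generated_algebra k C
        \<Longrightarrow> (\<lambda>x. f x * g x) \<in> generated_algebra k C"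

text \<open>
  The ambient space is a set \<open>X\<close> of points together with a set \<open>C\<close> of coordinate functions,
  so that \<open>generated_algebra k C\<close> (restricted to \<open>X\<close>) is the \<open>k\<close>-form \<open>k[X]\<close> of its coordinate
  ring. It is used for affine space \<open>X = carrier_vec N\<close> and for the general linear group.
\<close>

definition vec_coords :: "nat \<Rightarrow> ('c vec \<Rightarrow> 'c) set" where
  "vec_coords N = {\<lambda>v. v $ i | i. i < N}"

definition GL_coords :: "nat \<Rightarrow> ('c::field mat \<Rightarrow> 'c) set" where
  "GL_coords n = {\<lambda>A. A $$ (i, j) | i j. i < n \<and> j < n} \<union> {\<lambda>A. inverse (det A)}"

definition zariski_closed :: "'p set \<Rightarrow> ('p \<Rightarrow> 'c::field) set \<Rightarrow> 'p set \<Rightarrow> bool" where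
  "zariski_closed X C V \<longleftrightarrow>
     (\<exists>S \<subseteq> generated_algebra UNIV C. V = {x \<in> X. \<forall>f\<in>S. f x = 0})"

definition vanishing_ideal :: "'c::field set \<Rightarrow> ('p \<Rightarrow> 'c) set \<Rightarrow> 'p set \<Rightarrow> ('p \<Rightarrow> 'c) set" where
  "vanishing_ideal k C V = {f \<in> generated_algebra k C. \<forall>x\<in>V. f x = 0}"

text \<open>
  A closed set is defined over \<open>k\<close> if its full vanishing ideal is generated by the
  elements of that ideal with coefficients in \<open>k\<close>.
\<close>

definition variety_over :: "'c::field set \<Rightarrow> 'p set \<Rightarrow> ('p \<Rightarrow> 'c) set \<Rightarrow> 'p set \<Rightarrow> bool" where
  "variety_over k X C V \<longleftrightarrow> zariski_closed X C V \<and>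
     (\<forall>f \<in> vanishing_ideal UNIV C V.
        \<exists>F c. finite F \<and> F \<subseteq> vanishing_ideal k C V \<and> (\<forall>g\<in>F. c g \<in> generated_algebra UNIV C) \<and>
              (\<forall>x\<in>X. f x = (\<Sum>g\<in>F. c g x * g x)))"

text \<open>
  Morphisms defined over \<open>k\<close>: the comorphism maps \<open>k[V']\<close> into \<open>k[V]\<close>. They are taken to be
  extensional so that they are equal as soon as they agree on \<open>V\<close>.
\<close>

definition morphisms_over ::
  "'c::field set \<Rightarrow> ('p \<Rightarrow> 'c) set \<Rightarrow> 'p set \<Rightarrow> ('q \<Rightarrow> 'c) set \<Rightarrow> 'q set \<Rightarrow> ('p \<Rightarrow> 'q) set" where
  "morphisms_over k C V C' V' =
     {f \<in> V \<rightarrow>\<^sub>E V'. \<forall>h \<in> generated_algebra k C'. \<exists>g \<in> generated_algebra k C. \<forall>x\<in>V. h (f x) = g x}"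

definition GL :: "nat \<Rightarrow> 'c::field mat monoid" where
  "GL n = units_of (ring_mat TYPE('c) n ())"

definition algebraic_group :: "'c::field set \<Rightarrow> nat \<Rightarrow> 'c mat set \<Rightarrow> bool" where
  "algebraic_group k n G \<longleftrightarrow>
     subgroup G (GL n) \<and> variety_over k (carrier (GL n)) (GL_coords n) G"

definition unipotent_group :: "nat \<Rightarrow> 'c::field mat set \<Rightarrow> bool" where
  "unipotent_group n U \<longleftrightarrow> (\<forall>A\<in>U. \<exists>k. (A - 1\<^sub>m n) ^\<^sub>m k = 0\<^sub>m n n)"

definition rational_points :: "'c::field set \<Rightarrow> nat \<Rightarrow> 'c mat set \<Rightarrow> 'c mat monoid" where
  "rational_points k n G = (GL n)\<lparr>carrier := {A \<in> G. elements_mat A \<subseteq> k}\<rparr>"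

definition algebraic_homs ::
  "'c::field set \<Rightarrow> nat \<Rightarrow> 'c mat set \<Rightarrow> nat \<Rightarrow> 'c mat set \<Rightarrow> ('c mat \<Rightarrow> 'c mat) set" where
  "algebraic_homs k n G m H =
     morphisms_over k (GL_coords n) G (GL_coords m) H
     \<inter> hom ((GL n)\<lparr>carrier := G\<rparr>) ((GL m)\<lparr>carrier := H\<rparr>)"

text \<open>
  \<open>(R, p)\<close> is the restriction of scalars of the \<open>L\<close>-group \<open>U\<close> from \<open>L\<close> to \<open>\<rat>\<close> together with its
  natural projection, given by the universal property: \<open>p\<close> is universal among the \<open>L\<close>-morphisms
  to \<open>U\<close> from affine varieties defined over \<open>\<rat>\<close>. This determines \<open>(R, p)\<close> up to a unique
  \<open>\<rat>\<close>-isomorphism of algebraic groups.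
\<close>

definition weil_restriction ::
  "'c::field_char_0 set \<Rightarrow> nat \<Rightarrow> 'c mat set \<Rightarrow> nat \<Rightarrow> 'c mat set \<Rightarrow> ('c mat \<Rightarrow> 'c mat) \<Rightarrow> bool" where
  "weil_restriction L n U r R p \<longleftrightarrow>
     algebraic_group \<rat> r R \<and> p \<in> algebraic_homs L r R n U \<and>
     (\<forall>N V f. variety_over \<rat> (carrier_vec N) (vec_coords N) V \<longrightarrow>
        f \<in> morphisms_over L (vec_coords N) V (GL_coords n) U \<longrightarrow>
        (\<exists>!g. g \<in> morphisms_over \<rat> (vec_coords N) V (GL_coords r) R \<and> (\<forall>x\<in>V. f x = p (g x))))"

end

theory Submission
  imports Defs "Berlekamp_Zassenhaus.Factor_Bound" "HOL-Computational_Algebra.Formal_Power_Series"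
    "Jordan_Normal_Form.Char_Poly"
begin

text \<open>
  Let \<open>U\<close> and \<open>G\<close> first be groups over \<open>\<rat>\<close> and \<open>\<phi>\<close> an abstract homomorphism from \<open>U(\<rat>)\<close> to \<open>G(\<rat>)\<close>.
  Since \<open>U\<close> is unipotent, every \<open>u \<in> U(\<rat>)\<close> has rational powers \<open>u\<^sup>t = exp (t log u)\<close>, again in
  \<open>U(\<rat>)\<close>. The point at which abstract homomorphisms become tame is arithmetic: \<open>\<phi> u\<close> is a rational
  matrix that has rational roots of all orders, compatible with each other, and such a matrix is
  unipotent (\<open>divisible_rational_unipotent\<close>). The eigenvalues \<open>x\<close> of all these roots have degree at
  most \<open>m\<close>, and some power \<open>x\<^sup>N\<close> is a root of one fixed polynomial; by the bounds of Mignotte and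
  Mahler for the coefficients of divisors there are only finitely many such numbers. A nonzero number
  with roots of all orders in a finite set is a root of unity, so for some \<open>M\<close> all these eigenvalues
  satisfy \<open>x\<^sup>M = 1\<close>; since \<open>\<phi> u\<close> is the \<open>M\<close>-th power of one of the matrices, it has only the
  eigenvalue 1.

  Unipotent roots of unipotent matrices are unique, so \<open>\<phi> (u\<^sup>t) = (\<phi> u)\<^sup>t\<close> for rational \<open>t\<close>, and the right hand
  side is a polynomial in \<open>t\<close>. That \<open>\<phi>\<close> as a whole is given by polynomials (\<open>polynomial_extension\<close>)
  follows by descending induction along the filtration of the augmentation algebra, the span of all products
  of elements \<open>u - 1\<close>, by the lengths of the products. Kolchin's theorem
  (\<open>unipotent_products_vanish\<close>) makes this filtration finite. In each layer \<open>u\<close> is the product of an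
  element of a smaller part and of a power \<open>u\<^sub>0\<^sup>t\<close> of a fixed \<open>u\<^sub>0\<close>, where \<open>t\<close> depends linearly on \<open>u\<close>.

  The resulting polynomial map sends \<open>U\<close> to \<open>G\<close>, is multiplicative, and is unique because \<open>U(\<rat>)\<close> is
  Zariski dense in \<open>U\<close>. Density holds since \<open>exp\<close> is a polynomial parametrisation, with rational
  coefficients, of \<open>U\<close> by its Lie algebra, which is a rational linear space (\<open>parametrisation\<close>). The
  Lie algebra is introduced as the space annihilated by the linear parts of the rational equations
  of \<open>U\<close>. Its elements are nilpotent because they lie in the augmentation algebra, and \<open>exp\<close> maps
  them into \<open>U\<close> because the ideal of \<open>U\<close> is stable under the corresponding derivations. This gives
  the first part of the result (\<open>rational_hom_extends\<close>).

  For the second part \<open>\<phi>\<close> is transported to the rational points of the restrictions of scalars \<open>R\<^sub>1\<close> and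
  \<open>R\<^sub>2\<close>, and the first part is applied to the transported homomorphism. Two consequences of the
  universal property are used. With a point as test variety it says that the projection is
  bijective from the rational points of \<open>R\<close> to the points of \<open>U\<close> over the number field
  (\<open>weil_restriction_iso\<close>). With the product of \<open>R\<close> and an affine line it lifts \<open>p(y)\<^sup>t\<close>, a polynomial in
  \<open>t\<close>, to a family of points of \<open>R\<close> that takes the value \<open>y\<^sup>i\<close> at every natural number \<open>t = i\<close>; the
  powers of \<open>y\<close> then depend polynomially on the exponent, so \<open>y\<close> is unipotent
  (\<open>weil_restriction_unipotent\<close>).
\<close>

section \<open>Regular functions\<close>

text \<open>
  Functions are compared on the set \<open>D\<close> only, so \<open>regular k C D\<close> is the coordinate ring of \<open>D\<close> over \<open>k\<close>.
\<close>

definition regular :: "'c::field set \<Rightarrow> ('p \<Rightarrow> 'c) set \<Rightarrow> 'p set \<Rightarrow> ('p \<Rightarrow> 'c) \<Rightarrow> bool" where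
  "regular k C D h \<longleftrightarrow> (\<exists>g\<in>generated_algebra k C. \<forall>x\<in>D. h x = g x)"

lemma regular_const: "a \<in> k \<Longrightarrow> regular k C D (\<lambda>_. a)"
  unfolding regular_def by (rule bexI[of _ "\<lambda>_. a"]) (auto intro: generated_algebra.const)

lemma regular_gen: "c \<in> C \<Longrightarrow> regular k C D c"
  unfolding regular_def by (auto intro: generated_algebra.gen)

lemma regular_generated: "f \<in> generated_algebra k C \<Longrightarrow> regular k C D f"
  unfolding regular_def by auto

lemma regular_add:
  assumes "regular k C D f" "regular k C D g"
  shows "regular k C D (\<lambda>x. f x + g x)"
proof -
  obtain f' g' where "f' \<in> generated_algebra k C" "g' \<in> generated_algebra k C"
    "\<forall>x\<in>D. f x = f' x" "\<forall>x\<in>D. g x = g' x"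
    using assms unfolding regular_def by blast
  then show ?thesis unfolding regular_def
    by (intro bexI[of _ "\<lambda>x. f' x + g' x"]) (auto intro: generated_algebra.add)
qed

lemma regular_mult:
  assumes "regular k C D f" "regular k C D g"
  shows "regular k C D (\<lambda>x. f x * g x)"
proof -
  obtain f' g' where "f' \<in> generated_algebra k C" "g' \<in> generated_algebra k C"
    "\<forall>x\<in>D. f x = f' x" "\<forall>x\<in>D. g x = g' x"
    using assms unfolding regular_def by blast
  then show ?thesis unfolding regular_def
    by (intro bexI[of _ "\<lambda>x. f' x * g' x"]) (auto intro: generated_algebra.mult)
qed

lemma regular_cong: "(\<And>x. x \<in> D \<Longrightarrow> f x = g x) \<Longrightarrow> regular k C D f \<longleftrightarrow> regular k C D g"
  by (simp add: regular_def)

lemma regular_subset: "regular k C D f \<Longrightarrow> D' \<subseteq> D \<Longrightarrow> regular k C D' f"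
  unfolding regular_def by blast

lemma generated_algebra_mono:
  assumes "f \<in> generated_algebra k C" "k \<subseteq> k'"
  shows "f \<in> generated_algebra k' C"
  using assms by (induction) (auto intro: generated_algebra.intros)

lemma regular_mono: "regular k C D f \<Longrightarrow> k \<subseteq> k' \<Longrightarrow> regular k' C D f"
  unfolding regular_def by (meson generated_algebra_mono)

lemma regular_sum:
  assumes "0 \<in> k" "\<And>i. i \<in> I \<Longrightarrow> regular k C D (f i)"
  shows "regular k C D (\<lambda>x. \<Sum>i\<in>I. f i x)"
  using assms(2)
proof (induction I rule: infinite_finite_induct)
  case (insert i I)
  then have "regular k C D (\<lambda>x. f i x + (\<Sum>i\<in>I. f i x))" by (intro regular_add) auto
  then show ?case using insert by simp
qed (use assms(1) in \<open>auto intro: regular_const\<close>)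

lemma regular_prod:
  assumes "1 \<in> k" "\<And>i. i \<in> I \<Longrightarrow> regular k C D (f i)"
  shows "regular k C D (\<lambda>x. \<Prod>i\<in>I. f i x)"
  using assms(2)
proof (induction I rule: infinite_finite_induct)
  case (insert i I)
  then have "regular k C D (\<lambda>x. f i x * (\<Prod>i\<in>I. f i x))" by (intro regular_mult) auto
  then show ?case using insert by simp
qed (use assms(1) in \<open>auto intro: regular_const\<close>)

lemma regular_power:
  assumes "1 \<in> k" "regular k C D f"
  shows "regular k C D (\<lambda>x. f x ^ i)"
  using regular_prod[of k "{..<i}" C D "\<lambda>_. f"] assms by simp

lemma regular_compose:
  assumes "h \<in> generated_algebra k C'" "\<And>c. c \<in> C' \<Longrightarrow> regular k C D (\<lambda>x. c (F x))"
  shows "regular k C D (\<lambda>x. h (F x))"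
  using assms(1) by induction (auto intro: regular_const regular_add regular_mult assms(2))

lemma generated_algebra_values:
  assumes "f \<in> generated_algebra k C" "\<And>c. c \<in> C \<Longrightarrow> c x \<in> k"
    "\<And>a b. a \<in> k \<Longrightarrow> b \<in> k \<Longrightarrow> a + b \<in> k" "\<And>a b. a \<in> k \<Longrightarrow> b \<in> k \<Longrightarrow> a * b \<in> k"
  shows "f x \<in> k"
  using assms(1) by induction (auto intro: assms(2-))

lemma regular_values:
  assumes "regular k C D f" "x \<in> D" "\<And>c. c \<in> C \<Longrightarrow> c x \<in> k"
    "\<And>a b. a \<in> k \<Longrightarrow> b \<in> k \<Longrightarrow> a + b \<in> k" "\<And>a b. a \<in> k \<Longrightarrow> b \<in> k \<Longrightarrow> a * b \<in> k"
  shows "f x \<in> k"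
proof -
  obtain g where g: "g \<in> generated_algebra k C" "f x = g x"
    using assms(1,2) unfolding regular_def by blast
  show ?thesis unfolding g(2) by (rule generated_algebra_values[OF g(1) assms(3-5)])
qed

text \<open>
  On the affine line, with the identity as the only coordinate, regular functions are polynomials.
\<close>

lemma regular_imp_poly:
  assumes "regular k {\<lambda>t. t} UNIV h"
  shows "\<exists>p. \<forall>t. h t = poly p t"
proof -
  obtain g where g: "g \<in> generated_algebra k {\<lambda>t. t}" "\<forall>x. h x = g x"
    using assms unfolding regular_def by auto
  from g(1) have "\<exists>p. \<forall>t. g t = poly p t"
  proof induction
    case (const a) then show ?case by (intro exI[of _ "[:a:]"]) simp
  next
    case (gen f) then show ?case by (intro exI[of _ "[:0,1:]"]) simp
  next
    case (add f g) then show ?case by (metis poly_add)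
  next
    case (mult f g) then show ?case by (metis poly_mult)
  qed
  with g(2) show ?thesis by simp
qed

lemma subfield_closed:
  fixes L :: "'c::field set"
  assumes "subfield L class_ring"
  shows "0 \<in> L" "1 \<in> L" "a \<in> L \<Longrightarrow> b \<in> L \<Longrightarrow> a + b \<in> L" "a \<in> L \<Longrightarrow> b \<in> L \<Longrightarrow> a * b \<in> L"
    "a \<in> L \<Longrightarrow> - a \<in> L" "a \<in> L \<Longrightarrow> inverse a \<in> L"
    "a \<in> L \<Longrightarrow> b \<in> L \<Longrightarrow> a - b \<in> L" "a \<in> L \<Longrightarrow> b \<in> L \<Longrightarrow> a / b \<in> L"
proof -
  interpret clr: field "class_ring :: 'c ring" by (rule class_field)
  have sr: "subring L (class_ring :: 'c ring)" using subfieldE(1) assms by blast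
  note E = subringE[OF sr]
  show z: "0 \<in> L" using E(2) by (simp add: class_ring_simps)
  show "1 \<in> L" using E(3) by (simp add: class_ring_simps)
  show p: "a \<in> L \<Longrightarrow> b \<in> L \<Longrightarrow> a + b \<in> L" for a b using E(7)[of a b] by (simp add: class_ring_simps)
  show t: "a \<in> L \<Longrightarrow> b \<in> L \<Longrightarrow> a * b \<in> L" for a b using E(6)[of a b] by (simp add: class_ring_simps)
  show m: "a \<in> L \<Longrightarrow> - a \<in> L" for a using E(5)[of a] by (simp add: class_ring_simps)
  show i: "a \<in> L \<Longrightarrow> inverse a \<in> L" for a
  proof (cases "a = 0")
    case False
    assume a: "a \<in> L"
    interpret L: subfield L "class_ring :: 'c ring" by fact
    have "a \<in> Units (class_ring\<lparr>carrier := L\<rparr>)"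
      using L.subfield_Units a False by (auto simp: class_ring_simps)
    then obtain b where b: "b \<in> L" "a * b = 1" by (auto simp: Units_def)
    then have "b = inverse a" by (metis inverse_unique)
    with b show ?thesis by simp
  qed (use z in simp)
  show "a \<in> L \<Longrightarrow> b \<in> L \<Longrightarrow> a - b \<in> L" for a b using p[of a "- b"] m[of b] by simp
  show "a \<in> L \<Longrightarrow> b \<in> L \<Longrightarrow> a / b \<in> L" for a b using t[of a "inverse b"] i[of b] by (simp add: field_simps)
qed

section \<open>Endomorphisms\<close>

text \<open>
  Matrices of all sizes are embedded in one ring, the endomorphisms of the space of all sequences.
  This gives a unital ring as a type, in which power series of nilpotent elements, spans and traces
  can be handled without carrying the size along. An invertible matrix \<open>x\<close> acts on the first \<open>n\<close>
  coordinates and is continued by the identity (\<open>stab\<close>), whereas a difference \<open>x - 1\<close> is continued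
  by 0 (\<open>emb\<close>).
\<close>

typedef (overloaded) 'c endo =
  "{f :: (nat \<Rightarrow> 'c::field) \<Rightarrow> nat \<Rightarrow> 'c. (\<forall>u v. f (\<lambda>i. u i + v i) = (\<lambda>i. f u i + f v i)) \<and>
     (\<forall>c u. f (\<lambda>i. c * u i) = (\<lambda>i. c * f u i))}"
  morphisms app Abs_endo
  by (rule exI[of _ "\<lambda>u i. 0"]) auto

setup_lifting type_definition_endo

instantiation endo :: (field) ring_1
begin
lift_definition zero_endo :: "'a endo" is "\<lambda>u i. 0" by auto
lift_definition one_endo :: "'a endo" is "\<lambda>u. u" by auto
lift_definition plus_endo :: "'a endo \<Rightarrow> 'a endo \<Rightarrow> 'a endo" is "\<lambda>f g u i. f u i + g u i"
  by (auto simp: algebra_simps)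
lift_definition minus_endo :: "'a endo \<Rightarrow> 'a endo \<Rightarrow> 'a endo" is "\<lambda>f g u i. f u i - g u i"
  by (auto simp: algebra_simps)
lift_definition uminus_endo :: "'a endo \<Rightarrow> 'a endo" is "\<lambda>f u i. - f u i"
  by (auto simp: algebra_simps)
lift_definition times_endo :: "'a endo \<Rightarrow> 'a endo \<Rightarrow> 'a endo" is "\<lambda>f g u. f (g u)"
  by auto
instance
proof
  show "(0::'a endo) \<noteq> 1"
  proof transfer
    show "(\<lambda>u i. 0) \<noteq> (\<lambda>u::nat \<Rightarrow> 'a. u)"
    proof
      assume "(\<lambda>u i. 0) = (\<lambda>u::nat \<Rightarrow> 'a. u)"
      then have "(\<lambda>f. f (\<lambda>_. 1) 0) (\<lambda>u i. 0) = (\<lambda>f. f (\<lambda>_. 1) 0) (\<lambda>u::nat \<Rightarrow> 'a. u)" by (rule arg_cong)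
      then show False by simp
    qed
  qed
qed (transfer; auto simp: algebra_simps)+
end

lift_definition sc :: "'c::field \<Rightarrow> 'c endo" is "\<lambda>c u i. c * u i"
  by (auto simp: algebra_simps)

lemma sc_simps: "sc 0 = 0" "sc 1 = 1" "sc (a + b) = sc a + sc b" "sc (a * b) = sc a * sc b"
  "sc (- a) = - sc a" "sc (a - b) = sc a - sc b"
  by (transfer; auto simp: algebra_simps)+

lemma sc_commute: "X * sc c = sc c * X"
  by transfer auto

lemma sc_left_commute: "X * (sc c * Y) = sc c * (X * Y)"
  by (metis mult.assoc sc_commute)

lemma sc_sum: "sc (sum f I) = (\<Sum>i\<in>I. sc (f i))"
  by (induction I rule: infinite_finite_induct) (auto simp: sc_simps)

lemma sc_mult_power: "(sc a * X) ^ k = sc (a ^ k) * X ^ k"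
proof (induction k)
  case (Suc k)
  have "(sc a * X) ^ Suc k = sc a * (X * (sc (a ^ k) * X ^ k))" by (simp add: Suc mult.assoc)
  also have "\<dots> = sc a * (sc (a ^ k) * (X * X ^ k))" by (simp only: sc_left_commute[of X])
  finally show ?case by (simp add: sc_simps mult.assoc)
qed (simp add: sc_simps)

definition ent :: "'c::field endo \<Rightarrow> nat \<Rightarrow> nat \<Rightarrow> 'c" where
  "ent f i j = app f (\<lambda>k. if k = j then 1 else 0) i"

lemma app_simps: "app 0 u i = 0" "app 1 u i = u i" "app (f + g) u i = app f u i + app g u i"
  "app (f - g) u i = app f u i - app g u i" "app (- f) u i = - app f u i" "app (f * g) u i = app f (app g u) i"
  "app (sc c) u i = c * u i"
  by (transfer; simp)+

lemma ent_simps: "ent 0 i j = 0" "ent 1 i j = (if i = j then 1 else 0)" "ent (f + g) i j = ent f i j + ent g i j"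
  "ent (f - g) i j = ent f i j - ent g i j" "ent (- f) i j = - ent f i j" "ent (sc c) i j = (if i = j then c else 0)"
  "ent (sc c * f) i j = c * ent f i j"
  by (auto simp: ent_def app_simps)

lemma ent_sum: "ent (sum f I) i j = (\<Sum>a\<in>I. ent (f a) i j)"
  by (induction I rule: infinite_finite_induct) (auto simp: ent_simps)

lemma app_add: "app f (\<lambda>i. u i + v i) = (\<lambda>i. app f u i + app f v i)"
  and app_scale: "app f (\<lambda>i. c * u i) = (\<lambda>i. c * app f u i)"
  by (transfer, simp)+

lemma app_zero: "app f (\<lambda>i. 0) = (\<lambda>i. 0)"
  using app_scale[of f 0 "\<lambda>_. 0"] by simp

lemma app_sum: "app f (\<lambda>i. \<Sum>a\<in>I. u a i) = (\<lambda>i. \<Sum>a\<in>I. app f (u a) i)"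
  by (induction I rule: infinite_finite_induct) (auto simp: app_add app_zero)

lemma app_finite:
  assumes "\<And>k. k \<ge> n \<Longrightarrow> u k = 0"
  shows "app f u i = (\<Sum>k<n. ent f i k * u k)"
proof -
  have "u = (\<lambda>i. \<Sum>k<n. u k * (if i = k then 1 else 0))"
    using assms by (auto simp: if_distrib cong: if_cong)
  then have "app f u i = app f (\<lambda>i. \<Sum>k<n. u k * (if i = k then 1 else 0)) i"
    by simp
  then show ?thesis by (simp add: app_sum app_scale ent_def mult.commute)
qed

text \<open>
  Endomorphisms that preserve the span of the first \<open>n\<close> unit vectors.
\<close>

definition Cfin :: "nat \<Rightarrow> 'c::field endo set" where
  "Cfin n = {f. \<forall>j<n. \<forall>i\<ge>n. ent f i j = 0}"

lemma ent_mult: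
  assumes "g \<in> Cfin n" "j < n"
  shows "ent (f * g) i j = (\<Sum>k<n. ent f i k * ent g k j)"
proof -
  have "ent (f * g) i j = app f (\<lambda>k. ent g k j) i"
    by (simp add: ent_def app_simps)
  also have "\<dots> = (\<Sum>k<n. ent f i k * ent g k j)"
    using assms by (intro app_finite) (auto simp: Cfin_def)
  finally show ?thesis .
qed

lemma Cfin_closed: "0 \<in> Cfin n" "1 \<in> Cfin n" "sc c \<in> Cfin n" "f \<in> Cfin n \<Longrightarrow> g \<in> Cfin n \<Longrightarrow> f + g \<in> Cfin n"
  "f \<in> Cfin n \<Longrightarrow> g \<in> Cfin n \<Longrightarrow> f - g \<in> Cfin n"  "f \<in> Cfin n \<Longrightarrow> - f \<in> Cfin n"
  by (auto simp: Cfin_def ent_simps)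

lemma Cfin_mult: "f \<in> Cfin n \<Longrightarrow> g \<in> Cfin n \<Longrightarrow> f * g \<in> Cfin n"
proof -
  assume f: "f \<in> Cfin n" and g: "g \<in> Cfin n"
  have "ent (f * g) i j = 0" if "j < n" "i \<ge> n" for i j
    using f that by (simp add: ent_mult[OF g] Cfin_def)
  then show ?thesis by (simp add: Cfin_def)
qed

lemma Cfin_power: "f \<in> Cfin n \<Longrightarrow> f ^ k \<in> Cfin n"
  by (induction k) (auto intro: Cfin_closed Cfin_mult)

lift_definition emb :: "'c::field mat \<Rightarrow> 'c endo" is
  "\<lambda>A u i. if i < dim_row A then \<Sum>j<dim_col A. A $$ (i,j) * u j else 0"
  by (auto simp: algebra_simps sum.distrib sum_distrib_left intro!: ext)

text \<open>
  The upper left block of size \<open>n\<close>.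
\<close>

definition mt :: "nat \<Rightarrow> 'c::field endo \<Rightarrow> 'c mat" where
  "mt n f = mat n n (\<lambda>(i,j). ent f i j)"

lemma mt_carrier[simp]: "mt n f \<in> carrier_mat n n" "dim_row (mt n f) = n" "dim_col (mt n f) = n"
  by (auto simp: mt_def)

lemma mt_index[simp]: "i < n \<Longrightarrow> j < n \<Longrightarrow> mt n f $$ (i,j) = ent f i j"
  by (auto simp: mt_def)

lemma app_emb: "app (emb A) u i = (if i < dim_row A then \<Sum>j<dim_col A. A $$ (i,j) * u j else 0)"
  by (simp add: emb.rep_eq)

lemma ent_emb: "ent (emb A) i j = (if i < dim_row A \<and> j < dim_col A then A $$ (i,j) else 0)"
proof -
  have "(\<Sum>k<dim_col A. A $$ (i, k) * (if k = j then 1 else 0)) = (\<Sum>k<dim_col A. if k = j then A $$ (i, k) else 0)"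
    by (intro sum.cong) auto
  then show ?thesis by (simp add: ent_def app_emb)
qed

lemma endo_eqI: "(\<And>u i. app f u i = app g u i) \<Longrightarrow> f = g"
  by (rule app_inject[THEN iffD1]) (intro ext)

lemma mt_emb[simp]: "A \<in> carrier_mat n n \<Longrightarrow> mt n (emb A) = A"
  by (intro eq_matI) (auto simp: ent_emb)

lemma emb_add: "A \<in> carrier_mat n n \<Longrightarrow> B \<in> carrier_mat n n \<Longrightarrow> emb (A + B) = emb A + emb B"
  by (intro endo_eqI) (auto simp: app_emb app_simps algebra_simps sum.distrib)

lemma emb_minus: "A \<in> carrier_mat n n \<Longrightarrow> B \<in> carrier_mat n n \<Longrightarrow> emb (A - B) = emb A - emb B"
  by (intro endo_eqI) (auto simp: app_emb app_simps algebra_simps sum_subtractf)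

lemma emb_smult: "emb (c \<cdot>\<^sub>m A) = sc c * emb A"
  by (intro endo_eqI) (auto simp: app_emb app_simps algebra_simps sum_distrib_left)

lemma emb_zero: "emb (0\<^sub>m n n) = 0"
  by (intro endo_eqI) (auto simp: app_emb app_simps)

lemma emb_mult: "A \<in> carrier_mat n n \<Longrightarrow> B \<in> carrier_mat n n \<Longrightarrow> emb (A * B) = emb A * emb B"
proof (intro endo_eqI)
  fix u i assume A: "A \<in> carrier_mat n n" and B: "B \<in> carrier_mat n n"
  show "app (emb (A * B)) u i = app (emb A * emb B) u i"
  proof (cases "i < n")
    case True
    have "app (emb (A * B)) u i = (\<Sum>j<n. (\<Sum>k<n. A $$ (i,k) * B $$ (k,j)) * u j)"
      using A B True by (auto simp: app_emb scalar_prod_def atLeast0LessThan intro!: sum.cong)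
    also have "\<dots> = (\<Sum>j<n. \<Sum>k<n. A $$ (i,k) * B $$ (k,j) * u j)"
      by (simp add: sum_distrib_right)
    also have "\<dots> = (\<Sum>k<n. \<Sum>j<n. A $$ (i,k) * B $$ (k,j) * u j)"
      by (rule sum.swap)
    also have "\<dots> = app (emb A * emb B) u i"
      using A B True by (auto simp: app_emb app_simps sum_distrib_left mult.assoc intro!: sum.cong)
    finally show ?thesis .
  qed (use A B in \<open>auto simp: app_emb app_simps\<close>)
qed

definition Efin :: "nat \<Rightarrow> 'c::field endo set" where
  "Efin n = emb ` carrier_mat n n"

lemma Efin_iff: "f \<in> Efin n \<longleftrightarrow> emb (mt n f) = f"
proof
  assume "emb (mt n f) = f" then show "f \<in> Efin n" unfolding Efin_def by (metis image_eqI mt_carrier(1))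
qed (auto simp: Efin_def)

lemma Efin_emb: "A \<in> carrier_mat n n \<Longrightarrow> emb A \<in> Efin n"
  by (auto simp: Efin_def)

lemma emb_mt: "f \<in> Efin n \<Longrightarrow> emb (mt n f) = f"
  by (simp add: Efin_iff)

lemma Efin_Cfin: "f \<in> Efin n \<Longrightarrow> f \<in> Cfin n"
  by (auto simp: Efin_def Cfin_def ent_emb)

lemma Efin_closed: "0 \<in> Efin n" "f \<in> Efin n \<Longrightarrow> g \<in> Efin n \<Longrightarrow> f + g \<in> Efin n"
  "f \<in> Efin n \<Longrightarrow> g \<in> Efin n \<Longrightarrow> f - g \<in> Efin n"
  "f \<in> Efin n \<Longrightarrow> g \<in> Efin n \<Longrightarrow> f * g \<in> Efin n" "f \<in> Efin n \<Longrightarrow> sc c * f \<in> Efin n"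
proof -
  show "0 \<in> Efin n" using Efin_emb[OF zero_carrier_mat, of n] by (simp add: emb_zero)
  show "f + g \<in> Efin n" if "f \<in> Efin n" "g \<in> Efin n"
    using Efin_emb[OF add_carrier_mat, of "mt n g" n "mt n f"] that by (simp add: emb_add[of _ n] emb_mt)
  show "f - g \<in> Efin n" if "f \<in> Efin n" "g \<in> Efin n"
    using Efin_emb[OF minus_carrier_mat, of "mt n g" n "mt n f"] that by (simp add: emb_minus[of _ n] emb_mt)
  show "f * g \<in> Efin n" if "f \<in> Efin n" "g \<in> Efin n"
    using Efin_emb[OF mult_carrier_mat, of "mt n f" n n "mt n g"] that by (simp add: emb_mult[of _ n] emb_mt)
  show "sc c * f \<in> Efin n" if "f \<in> Efin n"
    using Efin_emb[OF smult_carrier_mat, of "mt n f" n c] that by (simp add: emb_smult emb_mt)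
qed

lemma Efin_sum: "(\<And>i. i \<in> I \<Longrightarrow> f i \<in> Efin n) \<Longrightarrow> sum f I \<in> Efin n"
  by (induction I rule: infinite_finite_induct) (auto intro: Efin_closed)

lemma Efin_power: "f \<in> Efin n \<Longrightarrow> k > 0 \<Longrightarrow> f ^ k \<in> Efin n"
proof (induction k)
  case (Suc k) then show ?case by (cases "k = 0") (auto intro: Efin_closed)
qed auto

lemma Efin_eqI:
  assumes "f \<in> Efin n" "g \<in> Efin n" "\<And>i j. i < n \<Longrightarrow> j < n \<Longrightarrow> ent f i j = ent g i j"
  shows "f = g"
proof -
  have "mt n f = mt n g" using assms(3) by (intro eq_matI) auto
  then show ?thesis using assms(1,2) by (metis emb_mt)
qed

definition stab :: "nat \<Rightarrow> 'c::field mat \<Rightarrow> 'c endo" where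
  "stab n x = 1 + emb (x - 1\<^sub>m n)"

lemma stab_mt: "f - 1 \<in> Efin n \<Longrightarrow> stab n (mt n f) = f"
proof -
  assume f: "f - 1 \<in> Efin n"
  have "mt n f - 1\<^sub>m n = mt n (f - 1)" by (intro eq_matI) (auto simp: ent_simps)
  then show ?thesis using emb_mt[OF f] by (simp add: stab_def)
qed

lemma mt_stab: "x \<in> carrier_mat n n \<Longrightarrow> mt n (stab n x) = x"
  by (intro eq_matI) (auto simp: stab_def ent_simps ent_emb)

lemma stab_minus_1: "x \<in> carrier_mat n n \<Longrightarrow> stab n x - 1 \<in> Efin n"
  by (auto simp: stab_def Efin_def minus_carrier_mat)

lemma stab_Cfin: "x \<in> carrier_mat n n \<Longrightarrow> stab n x \<in> Cfin n"
  using stab_minus_1[of x n] Efin_Cfin Cfin_closed(2,4) by (metis add.commute diff_add_cancel)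

lemma mt_mult: "g \<in> Cfin n \<Longrightarrow> mt n (f * g) = mt n f * mt n g"
  by (intro eq_matI) (auto simp: ent_mult scalar_prod_def atLeast0LessThan)

lemma mt_one: "mt n 1 = 1\<^sub>m n"
  by (intro eq_matI) (auto simp: ent_simps)

lemma stab_one: "stab n (1\<^sub>m n) = 1"
  using stab_mt[of 1 n] by (simp add: mt_one Efin_closed)

lemma Efin_mult_minus_1:
  assumes "f - 1 \<in> Efin n" "g - 1 \<in> Efin n"
  shows "f * g - 1 \<in> Efin n"
proof -
  have eq: "f * g - 1 = (f - 1) * (g - 1) + ((f - 1) + (g - 1))" by (simp add: algebra_simps)
  show ?thesis unfolding eq by (intro Efin_closed assms)
qed

lemma stab_mult:
  assumes x: "x \<in> carrier_mat n n" and y: "y \<in> carrier_mat n n"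
  shows "stab n (x * y) = stab n x * stab n y"
proof -
  have "mt n (stab n x * stab n y) = x * y"
    using x y by (simp add: mt_mult stab_Cfin mt_stab)
  then show ?thesis
    using stab_mt[of "stab n x * stab n y" n] Efin_mult_minus_1 stab_minus_1 x y by metis
qed

lemma mt_power: "f \<in> Cfin n \<Longrightarrow> mt n (f ^ k) = mt n f ^\<^sub>m k"
proof (induction k)
  case (Suc k)
  have "mt n (f ^ Suc k) = mt n (f ^ k * f)" by (simp add: power_commutes)
  then show ?case using Suc by (simp add: mt_mult)
qed (simp add: mt_one)

section \<open>Power series in nilpotent elements\<close>

text \<open>
  The value of the power series \<open>f\<close> at \<open>N\<close>, meaningful if \<open>N ^ J = 0\<close>. The sum is cut off at a fixed \<open>J\<close>
  rather than at the order of nilpotency of \<open>N\<close>, so that it is a polynomial function of \<open>N\<close>.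
\<close>

definition ev :: "nat \<Rightarrow> 'c::field_char_0 endo \<Rightarrow> 'c fps \<Rightarrow> 'c endo" where
  "ev J N f = (\<Sum>k<J. sc (fps_nth f k) * N ^ k)"

lemma nilpotent_power_zero: "N ^ J = 0 \<Longrightarrow> k \<ge> J \<Longrightarrow> N ^ k = (0 :: 'a::ring_1)"
  by (metis le_add_diff_inverse mult_zero_left power_add)

lemma ev_one: "N ^ J = 0 \<Longrightarrow> ev J N 1 = 1"
  by (cases J) (simp_all add: ev_def lessThan_Suc_eq_insert_0 sum.insert_remove sc_simps sum.reindex)

lemma ev_minus: "ev J N (f - g) = ev J N f - ev J N g"
  by (simp add: ev_def sc_simps left_diff_distrib sum_subtractf)

lemma ev_X:
  assumes "N ^ J = 0" shows "ev J N fps_X = N"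
proof -
  have "ev J N fps_X = (\<Sum>k<J. if k = 1 then N else 0)"
    unfolding ev_def by (intro sum.cong) (auto simp: sc_simps fps_X_def)
  also have "\<dots> = N" using assms nilpotent_power_zero[OF assms, of 1] by (cases "1 < J") (auto simp: not_less)
  finally show ?thesis .
qed

lemma ev_mult:
  assumes N: "N ^ J = 0"
  shows "ev J N (f * g) = ev J N f * ev J N g"
proof -
  let ?t = "\<lambda>i j. sc (fps_nth f i) * sc (fps_nth g j) * N ^ (i + j)"
  have "ev J N f * ev J N g = (\<Sum>i<J. \<Sum>j<J. ?t i j)"
    unfolding ev_def sum_product
    by (intro sum.cong refl) (simp add: power_add mult.assoc sc_left_commute[of "N ^ _"])
  also have "\<dots> = (\<Sum>i<J. \<Sum>j<J. if i + j < J then ?t i j else 0)"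
    by (intro sum.cong refl) (auto simp: nilpotent_power_zero[OF N])
  also have "\<dots> = (\<Sum>(i,j)\<in>{(i,j). i + j < J}. ?t i j)"
  proof -
    have "(\<Sum>i<J. \<Sum>j<J. if i + j < J then ?t i j else 0)
        = (\<Sum>x\<in>{..<J} \<times> {..<J}. if fst x + snd x < J then ?t (fst x) (snd x) else 0)"
      by (simp add: sum.cartesian_product case_prod_beta)
    also have "\<dots> = (\<Sum>x\<in>{x\<in>{..<J} \<times> {..<J}. fst x + snd x < J}. ?t (fst x) (snd x))"
      by (subst sum.inter_filter) auto
    also have "{x\<in>{..<J} \<times> {..<J}. fst x + snd x < J} = {(i,j). i + j < J}"
      by auto
    finally show ?thesis by (simp add: case_prod_beta)
  qed
  also have "\<dots> = (\<Sum>k<J. \<Sum>i\<le>k. ?t i (k - i))"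
    by (rule sum.triangle_reindex)
  also have "\<dots> = ev J N (f * g)"
    unfolding ev_def
    by (intro sum.cong refl)
      (simp add: fps_mult_nth sc_sum sc_simps sum_distrib_right atLeast0AtMost)
  finally show ?thesis by simp
qed

lemma ev_power: "N ^ J = 0 \<Longrightarrow> ev J N (f ^ k) = ev J N f ^ k"
  by (induction k) (auto simp: ev_one ev_mult)

text \<open>
  Substitution of power series turns the identities between \<open>exp\<close> and \<open>ln\<close> as formal series into
  identities between the matrix functions \<open>Exp\<close> and \<open>Log\<close>.
\<close>

lemma ev_compose:
  assumes N: "N ^ J = 0" and g: "fps_nth g 0 = 0"
  shows "ev J (ev J N g) f = ev J N (f oo g)"
proof -
  have z: "fps_nth (g ^ i) k = 0" if "k < i" for i k
    using g that by (rule startsby_zero_power_prefix[rule_format])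
  have "ev J N (f oo g) = (\<Sum>k<J. \<Sum>i<J. sc (fps_nth f i) * (sc (fps_nth (g ^ i) k) * N ^ k))"
    unfolding ev_def
  proof (intro sum.cong refl)
    fix k assume k: "k \<in> {..<J}"
    have "fps_nth (f oo g) k = (\<Sum>i\<in>{0..k}. fps_nth f i * fps_nth (g ^ i) k)"
      by (simp add: fps_compose_nth)
    also have "\<dots> = (\<Sum>i<J. fps_nth f i * fps_nth (g ^ i) k)"
      using k z by (intro sum.mono_neutral_left) auto
    finally show "sc (fps_nth (f oo g) k) * N ^ k = (\<Sum>i<J. sc (fps_nth f i) * (sc (fps_nth (g ^ i) k) * N ^ k))"
      by (simp add: sc_sum sc_simps sum_distrib_right mult.assoc)
  qed
  also have "\<dots> = (\<Sum>i<J. \<Sum>k<J. sc (fps_nth f i) * (sc (fps_nth (g ^ i) k) * N ^ k))"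
    by (rule sum.swap)
  also have "\<dots> = (\<Sum>i<J. sc (fps_nth f i) * ev J N (g ^ i))"
    unfolding ev_def by (simp add: sum_distrib_left)
  also have "\<dots> = ev J (ev J N g) f"
    unfolding ev_def[of J "ev J N g"] by (simp add: ev_power[OF N])
  finally show ?thesis by simp
qed

lemma ev_nilpotent:
  assumes N: "N ^ J = 0" and g: "fps_nth g 0 = 0"
  shows "ev J N g ^ J = 0"
proof -
  have "ev J N g ^ J = ev J N (g ^ J)" by (simp add: ev_power[OF N])
  also have "\<dots> = 0" unfolding ev_def
    using startsby_zero_power_prefix[rule_format, OF g] by (auto intro!: sum.neutral simp: sc_simps)
  finally show ?thesis .
qed

definition Exp :: "nat \<Rightarrow> 'c::field_char_0 endo \<Rightarrow> 'c endo" where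
  "Exp J X = ev J X (fps_exp 1)"

definition Log :: "nat \<Rightarrow> 'c::field_char_0 endo \<Rightarrow> 'c endo" where
  "Log J u = ev J (u - 1) (fps_ln 1)"

lemma ev_sc: "ev J (sc t * X) f = ev J X (f oo (fps_const t * fps_X))"
proof -
  have "fps_nth (f oo (fps_const t * fps_X)) k = fps_nth f k * t ^ k" for k
    by (simp add: fps_compose_linear)
  then show ?thesis unfolding ev_def by (intro sum.cong refl) (simp only: sc_mult_power sc_simps mult.assoc)
qed

lemma Exp_sc: "Exp J (sc t * X) = ev J X (fps_exp t)"
  unfolding Exp_def ev_sc by (simp add: fps_exp_compose_linear)

lemma nilpotent_sc: "X ^ J = 0 \<Longrightarrow> (sc t * X) ^ J = 0"
  by (simp add: sc_mult_power)

lemma Exp_add: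
  assumes "X ^ J = 0"
  shows "Exp J (sc (s + t) * X) = Exp J (sc s * X) * Exp J (sc t * X)"
  unfolding Exp_sc fps_exp_add_mult by (rule ev_mult[OF assms])

lemma Exp_sc_zero: "X ^ J = 0 \<Longrightarrow> Exp J (sc 0 * X) = 1"
  by (simp only: Exp_sc fps_exp_0 ev_one)

lemma Exp_power:
  assumes "X ^ J = 0"
  shows "Exp J (sc (of_nat k * t) * X) = Exp J (sc t * X) ^ k"
  unfolding Exp_sc ev_power[OF assms, symmetric] by (simp add: fps_exp_power_mult)

lemma Exp_minus_nilpotent:
  assumes "X ^ J = 0"
  shows "Exp J X - 1 = ev J X (fps_exp 1 - 1)" "(Exp J X - 1) ^ J = 0"
proof -
  show eq: "Exp J X - 1 = ev J X (fps_exp 1 - 1)"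
    by (simp add: Exp_def ev_minus ev_one[OF assms])
  show "(Exp J X - 1) ^ J = 0" unfolding eq by (rule ev_nilpotent[OF assms]) simp
qed

lemma Log_nilpotent: "(u - 1) ^ J = 0 \<Longrightarrow> Log J u ^ J = 0"
  unfolding Log_def by (rule ev_nilpotent) simp_all

lemma fps_exp_ln: "(fps_exp 1 - 1) oo fps_ln 1 = (fps_X :: 'c::field_char_0 fps)"
  unfolding fps_ln_fps_exp_inv[OF one_neq_zero] by (rule fps_inv_right) simp_all

lemma fps_ln_exp: "fps_ln 1 oo (fps_exp 1 - 1) = (fps_X :: 'c::field_char_0 fps)"
  unfolding fps_ln_fps_exp_inv[OF one_neq_zero] by (rule fps_inv) simp_all

lemma Exp_Log:
  assumes "(u - 1) ^ J = 0"
  shows "Exp J (Log J u) = u"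
proof -
  have "Exp J (Log J u) - 1 = ev J (Log J u) (fps_exp 1 - 1)"
    by (rule Exp_minus_nilpotent(1)[OF Log_nilpotent[OF assms]])
  also have "\<dots> = ev J (u - 1) ((fps_exp 1 - 1) oo fps_ln 1)"
    unfolding Log_def by (rule ev_compose[OF assms]) simp
  also have "\<dots> = u - 1" unfolding fps_exp_ln by (rule ev_X[OF assms])
  finally show ?thesis by simp
qed

lemma Log_Exp:
  assumes "X ^ J = 0"
  shows "Log J (Exp J X) = X"
proof -
  have "Log J (Exp J X) = ev J (ev J X (fps_exp 1 - 1)) (fps_ln 1)"
    unfolding Log_def Exp_minus_nilpotent(1)[OF assms] ..
  also have "\<dots> = ev J X (fps_ln 1 oo (fps_exp 1 - 1))"
    by (rule ev_compose[OF assms]) simp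
  also have "\<dots> = X" unfolding fps_ln_exp by (rule ev_X[OF assms])
  finally show ?thesis .
qed

lemma ev_Efin:
  assumes X: "X \<in> Efin n" and g: "fps_nth g 0 = 0"
  shows "ev J X g \<in> Efin n"
  unfolding ev_def
proof (rule Efin_sum)
  fix k show "sc (fps_nth g k) * X ^ k \<in> Efin n"
  proof (cases k)
    case 0 then show ?thesis by (simp only: g sc_simps mult_zero_left Efin_closed)
  next
    case (Suc j) then show ?thesis by (intro Efin_closed(5) Efin_power X) simp
  qed
qed

lemma Log_Efin: "u - 1 \<in> Efin n \<Longrightarrow> Log J u \<in> Efin n"
  unfolding Log_def by (rule ev_Efin) simp_all

lemma Exp_Efin: "X \<in> Efin n \<Longrightarrow> X ^ J = 0 \<Longrightarrow> Exp J X - 1 \<in> Efin n"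
  unfolding Exp_minus_nilpotent(1) by (rule ev_Efin) simp_all

section \<open>Regular maps into matrices\<close>

definition regmat :: "'c::field set \<Rightarrow> ('p \<Rightarrow> 'c) set \<Rightarrow> 'p set \<Rightarrow> nat \<Rightarrow> ('p \<Rightarrow> 'c endo) \<Rightarrow> bool" where
  "regmat k C D m F \<longleftrightarrow> (\<forall>x\<in>D. F x \<in> Cfin m) \<and> (\<forall>i<m. \<forall>j<m. regular k C D (\<lambda>x. ent (F x) i j))"

lemma regmat_const:
  assumes "f \<in> Cfin m" "\<And>i j. i < m \<Longrightarrow> j < m \<Longrightarrow> ent f i j \<in> k"
  shows "regmat k C D m (\<lambda>_. f)"
  using assms by (auto simp: regmat_def intro: regular_const)

lemma regmat_sc:
  assumes "0 \<in> k" "regular k C D h"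
  shows "regmat k C D m (\<lambda>x. sc (h x))"
proof -
  have "regular k C D (\<lambda>x. if i = j then h x else 0)" for i j :: nat
    using assms by (cases "i = j") (auto intro: regular_const)
  then show ?thesis by (simp add: regmat_def Cfin_closed ent_simps)
qed

lemma regmat_one: "0 \<in> k \<Longrightarrow> 1 \<in> k \<Longrightarrow> regmat k C D m (\<lambda>x. 1)"
  using regmat_sc[of k C D "\<lambda>_. 1" m] by (simp add: regular_const sc_simps)

lemma regmat_add: "regmat k C D m F \<Longrightarrow> regmat k C D m G \<Longrightarrow> regmat k C D m (\<lambda>x. F x + G x)"
  by (auto simp: regmat_def Cfin_closed ent_simps intro: regular_add)

lemma regmat_mult:
  assumes "0 \<in> k" "regmat k C D m F" "regmat k C D m G"
  shows "regmat k C D m (\<lambda>x. F x * G x)"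
  unfolding regmat_def
proof (intro conjI allI impI ballI)
  fix i j assume ij: "i < m" "j < m"
  have "regular k C D (\<lambda>x. \<Sum>l<m. ent (F x) i l * ent (G x) l j)"
    using assms ij by (intro regular_sum regular_mult) (auto simp: regmat_def)
  moreover have "ent (F x * G x) i j = (\<Sum>l<m. ent (F x) i l * ent (G x) l j)" if "x \<in> D" for x
    using assms(3) that ij by (intro ent_mult) (auto simp: regmat_def)
  ultimately show "regular k C D (\<lambda>x. ent (F x * G x) i j)" by (simp cong: regular_cong)
qed (use assms in \<open>auto simp: regmat_def Cfin_mult\<close>)

lemma regmat_minus:
  assumes "0 \<in> k" "- 1 \<in> k" "regmat k C D m F" "regmat k C D m G"
  shows "regmat k C D m (\<lambda>x. F x - G x)"
proof -
  have "regmat k C D m (\<lambda>x. F x + sc (- 1) * G x)"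
    using assms by (intro regmat_add regmat_mult regmat_sc regular_const)
  then show ?thesis by (simp add: sc_simps)
qed

lemma regmat_power:
  assumes "0 \<in> k" "1 \<in> k" "regmat k C D m F"
  shows "regmat k C D m (\<lambda>x. F x ^ i)"
  by (induction i) (use assms in \<open>auto intro: regmat_one regmat_mult\<close>)

lemma regmat_sum:
  assumes "0 \<in> k" "\<And>i. i \<in> I \<Longrightarrow> regmat k C D m (F i)"
  shows "regmat k C D m (\<lambda>x. \<Sum>i\<in>I. F i x)"
  using assms(2)
proof (induction I rule: infinite_finite_induct)
  case (insert i I)
  then show ?case using regmat_add[of k C D m "F i" "\<lambda>x. \<Sum>i\<in>I. F i x"] by simp
qed (use assms(1) in \<open>auto simp: regmat_def Cfin_closed ent_simps intro: regular_const\<close>)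

lemma regmat_ev:
  assumes "0 \<in> k" "1 \<in> k" "\<And>i. i < J \<Longrightarrow> fps_nth f i \<in> k" "regmat k C D m F"
  shows "regmat k C D m (\<lambda>x. ev J (F x) f)"
  unfolding ev_def using assms
  by (intro regmat_sum regmat_mult regmat_sc regmat_power regular_const) auto

lemma regmat_mono: "regmat k C D m F \<Longrightarrow> k \<subseteq> k' \<Longrightarrow> regmat k' C D m F"
  unfolding regmat_def using regular_mono by meson

lemma regmat_compose:
  assumes "regmat k C' D' m F" "\<And>c. c \<in> C' \<Longrightarrow> regular k C D (\<lambda>x. c (G x))" "G ` D \<subseteq> D'"
  shows "regmat k C D m (\<lambda>x. F (G x))"
  unfolding regmat_def
proof (intro conjI allI impI ballI)
  fix i j assume ij: "i < m" "j < m"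
  then obtain g where g: "g \<in> generated_algebra k C'" "\<forall>x\<in>D'. ent (F x) i j = g x"
    using assms(1) unfolding regmat_def regular_def by meson
  have "regular k C D (\<lambda>x. g (G x))" by (rule regular_compose[OF g(1) assms(2)])
  then show "regular k C D (\<lambda>x. ent (F (G x)) i j)"
    using g(2) assms(3) by (subst regular_cong[of D _ "\<lambda>x. g (G x)"]) auto
qed (use assms in \<open>auto simp: regmat_def\<close>)

text \<open>
  The closure properties of a field of definition on which exponential series and determinants rely.
\<close>

definition Qclosed :: "'c::field_char_0 set \<Rightarrow> bool" where
  "Qclosed k \<longleftrightarrow> \<rat> \<subseteq> k \<and> (\<forall>a\<in>k. \<forall>b\<in>k. a + b \<in> k \<and> a * b \<in> k)"

lemma QclosedD:
  assumes "Qclosed k"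
  shows "0 \<in> k" "1 \<in> k" "- 1 \<in> k" "a \<in> \<rat> \<Longrightarrow> a \<in> k" "a \<in> k \<Longrightarrow> b \<in> k \<Longrightarrow> a + b \<in> k"
    "a \<in> k \<Longrightarrow> b \<in> k \<Longrightarrow> a * b \<in> k" "a \<in> k \<Longrightarrow> - a \<in> k" "a \<in> k \<Longrightarrow> b \<in> k \<Longrightarrow> a - b \<in> k"
proof -
  note * = assms[unfolded Qclosed_def]
  show "0 \<in> k" "1 \<in> k" and m: "- 1 \<in> k" and "a \<in> \<rat> \<Longrightarrow> a \<in> k" using * by auto
  show "a \<in> k \<Longrightarrow> b \<in> k \<Longrightarrow> a + b \<in> k" "a \<in> k \<Longrightarrow> b \<in> k \<Longrightarrow> a * b \<in> k" for a b using * by auto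
  show n: "a \<in> k \<Longrightarrow> - a \<in> k" for a using * m by (metis mult_minus1)
  show "a \<in> k \<Longrightarrow> b \<in> k \<Longrightarrow> a - b \<in> k" for a b using * n by (metis diff_conv_add_uminus)
qed

lemma Qclosed_UNIV: "Qclosed UNIV" and Qclosed_Rats: "Qclosed \<rat>"
  by (auto simp: Qclosed_def)

lemma Qclosed_sum: "Qclosed k \<Longrightarrow> (\<And>i. i \<in> I \<Longrightarrow> f i \<in> k) \<Longrightarrow> sum f I \<in> k"
  by (induction I rule: infinite_finite_induct) (auto intro: QclosedD)

lemma subfield_Qclosed: "subfield L class_ring \<Longrightarrow> Qclosed (L :: 'c::field_char_0 set)"
proof -
  assume L: "subfield L (class_ring :: 'c ring)"
  note * = subfield_closed[OF L]
  have nat: "of_nat k \<in> L" for k by (induction k) (auto intro: *)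
  have int: "of_int k \<in> L" for k by (cases k rule: int_cases2) (auto intro: * nat)
  have "\<rat> \<subseteq> L"
  proof
    fix x :: 'c assume "x \<in> \<rat>"
    then obtain a b where "x = of_int a / of_int b" by (auto elim: Rats_cases')
    then show "x \<in> L" using *(8) int by auto
  qed
  then show ?thesis using * by (auto simp: Qclosed_def)
qed

lemma ln_coeff_Rats: "fps_nth (fps_ln 1) i \<in> (\<rat> :: 'c::field_char_0 set)"
  by (auto simp: fps_ln_nth)

lemma exp_coeff_Rats: "fps_nth (fps_exp 1) i \<in> (\<rat> :: 'c::field_char_0 set)"
  by simp (metis Rats_1 Rats_divide Rats_of_nat of_nat_fact)

lemma regmat_Exp: "Qclosed k \<Longrightarrow> regmat k C D m F \<Longrightarrow> regmat k C D m (\<lambda>x. Exp J (F x))"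
  unfolding Exp_def by (rule regmat_ev) (blast intro: QclosedD exp_coeff_Rats)+

lemma regmat_Log: "Qclosed k \<Longrightarrow> regmat k C D m F \<Longrightarrow> regmat k C D m (\<lambda>x. Log J (F x))"
  unfolding Log_def by (intro regmat_ev regmat_minus regmat_one) (auto intro: QclosedD ln_coeff_Rats)

section \<open>Triangular form and unipotent matrices\<close>

lemma exists_invertible_with_first_column:
  fixes v :: "'a::field vec"
  assumes v: "v \<in> carrier_vec n" "v \<noteq> 0\<^sub>v n"
  obtains P Q where "P \<in> carrier_mat n n" "Q \<in> carrier_mat n n" "P * Q = 1\<^sub>m n" "Q * P = 1\<^sub>m n" "col P 0 = v"
proof -
  obtain k where k: "k < n" "v $ k \<noteq> 0" using v by (metis eq_vecI carrier_vecD index_zero_vec)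
  define \<tau> where "\<tau> j = (if j = k then 0 else if j = 0 then k else j)" for j :: nat
  define P where "P = mat n n (\<lambda>(i,j). if j = 0 then v $ i else if i = \<tau> j then 1 else 0)"
  have P: "P \<in> carrier_mat n n" by (simp add: P_def)
  have \<tau>: "\<tau> j < n" if "j < n" for j using that k by (auto simp: \<tau>_def)
  have \<tau>_inj: "\<tau> i = \<tau> j \<longleftrightarrow> i = j" for i j by (auto simp: \<tau>_def)
  have "det P \<noteq> 0"
  proof
    assume "det P = 0"
    then obtain w where w: "w \<in> carrier_vec n" "w \<noteq> 0\<^sub>v n" "P *\<^sub>v w = 0\<^sub>v n"
      using det_0_iff_vec_prod_zero_field[OF P] by auto
    have eq: "v $ i * w $ 0 + (\<Sum>j\<in>{1..<n}. if i = \<tau> j then w $ j else 0) = 0" if "i < n" for i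
    proof -
      have "0 = (P *\<^sub>v w) $ i" using w(3) that by simp
      also have "\<dots> = (\<Sum>j\<in>{0..<n}. P $$ (i,j) * w $ j)"
        using that w(1) P by (auto simp: scalar_prod_def intro!: sum.cong)
      also have "\<dots> = P $$ (i,0) * w $ 0 + (\<Sum>j\<in>{1..<n}. P $$ (i,j) * w $ j)"
        using k(1) by (subst sum.atLeast_Suc_lessThan) auto
      also have "\<dots> = v $ i * w $ 0 + (\<Sum>j\<in>{1..<n}. if i = \<tau> j then w $ j else 0)"
        using that k(1) by (auto simp: P_def intro!: sum.cong arg_cong2[of _ _ _ _ "(+)"])
      finally show ?thesis by simp
    qed
    have k0: "k = \<tau> 0" by (auto simp: \<tau>_def)
    have "(\<Sum>j\<in>{1..<n}. if k = \<tau> j then w $ j else 0) = 0"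
      by (intro sum.neutral) (auto simp: k0 \<tau>_inj)
    then have w0: "w $ 0 = 0" using eq[OF k(1)] k(2) by simp
    have "w $ j = 0" if "j < n" for j
    proof (cases "j = 0")
      case False
      have "0 = (\<Sum>i\<in>{1..<n}. if \<tau> j = \<tau> i then w $ i else 0)" using eq[OF \<tau>[OF that]] w0 by simp
      also have "\<dots> = (\<Sum>i\<in>{1..<n}. if i = j then w $ i else 0)"
        by (intro sum.cong) (auto simp: \<tau>_inj)
      also have "\<dots> = w $ j" using that False by simp
      finally show ?thesis by simp
    qed (simp add: w0)
    then show False using w(1,2) by (metis eq_vecI carrier_vecD index_zero_vec)
  qed
  from det_non_zero_imp_unit[OF P this, of "()"] obtain Q where
    "Q \<in> carrier_mat n n" "P * Q = 1\<^sub>m n" "Q * P = 1\<^sub>m n"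
    unfolding Units_def ring_mat_def by auto
  moreover have "col P 0 = v" using v(1) k(1) by (intro eq_vecI) (auto simp: P_def)
  ultimately show ?thesis using that P by blast
qed

lemma triangular_form:
  fixes A :: "'a::alg_closed_field mat"
  assumes "A \<in> carrier_mat n n"
  shows "\<exists>B. upper_triangular B \<and> similar_mat A B"
  using assms
proof (induction n arbitrary: A)
  case 0
  then show ?case by (intro exI[of _ A]) (auto intro: similar_mat_refl)
next
  case (Suc n)
  note A = Suc.prems
  have "degree (char_poly A) > 0" using degree_monic_char_poly[OF A] by simp
  then obtain e where "poly (char_poly A) e = 0" using alg_closed_imp_poly_has_root by blast
  then have "eigenvalue A e" using eigenvalue_root_char_poly[OF A] by simp
  then obtain v where v: "v \<in> carrier_vec (Suc n)" "v \<noteq> 0\<^sub>v (Suc n)" "A *\<^sub>v v = e \<cdot>\<^sub>v v"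
    using A by (auto simp: eigenvalue_def eigenvector_def)
  obtain P Q where PQ: "P \<in> carrier_mat (Suc n) (Suc n)" "Q \<in> carrier_mat (Suc n) (Suc n)"
    "P * Q = 1\<^sub>m (Suc n)" "Q * P = 1\<^sub>m (Suc n)" "col P 0 = v"
    using exists_invertible_with_first_column[OF v(1,2)] by metis
  define A' where "A' = Q * A * P"
  have A': "A' \<in> carrier_mat (Suc n) (Suc n)" using PQ A by (auto simp: A'_def)
  have sim: "similar_mat A' A"
    by (rule similar_matI[of _ _ Q P "Suc n"]) (use PQ A A' in \<open>auto simp: A'_def\<close>)
  have "col A' 0 = (Q * A) *\<^sub>v col P 0" unfolding A'_def by (rule col_mult2) (use PQ A in auto)
  also have "\<dots> = Q *\<^sub>v (A *\<^sub>v v)" unfolding PQ(5) by (rule assoc_mult_mat_vec) (use PQ A v in auto)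
  also have "\<dots> = e \<cdot>\<^sub>v (Q *\<^sub>v v)" unfolding v(3) by (rule mult_mat_vec) (use PQ v in auto)
  also have "Q *\<^sub>v v = col (Q * P) 0" unfolding PQ(5)[symmetric] by (rule col_mult2[symmetric]) (use PQ in auto)
  also have "\<dots> = unit_vec (Suc n) 0" by (simp add: PQ(4))
  finally have col0: "col A' 0 = e \<cdot>\<^sub>v unit_vec (Suc n) 0" .
  obtain A1 A2 A0 A3 where split: "split_block A' 1 1 = (A1,A2,A0,A3)"
    by (cases "split_block A' 1 1", auto)
  have dims: "dim_row A' = 1 + n" "dim_col A' = 1 + n" using A' by auto
  note sb = split_block[OF split dims]
  have A0: "A0 = 0\<^sub>m n 1"
  proof (rule eq_matI)
    fix i j assume ij: "i < dim_row (0\<^sub>m n 1)" "j < dim_col (0\<^sub>m n 1)"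
    have "A0 $$ (i,j) = A' $$ (i + 1, 0)"
      using split ij dims unfolding split_block_def Let_def by auto
    also have "\<dots> = col A' 0 $ (i + 1)" using ij dims by simp
    also have "\<dots> = 0" unfolding col0 using ij by simp
    finally show "A0 $$ (i,j) = 0\<^sub>m n 1 $$ (i,j)" using ij by simp
  qed (use sb in auto)
  obtain B3 where B3: "upper_triangular B3" "similar_mat A3 B3" using Suc.IH[OF sb(4)] by auto
  have B3c: "B3 \<in> carrier_mat n n" using similar_matD[OF B3(2)] sb(4) by auto
  obtain B2 where B2: "similar_mat (four_block_mat A1 A2 (0\<^sub>m n 1) A3) (four_block_mat A1 B2 (0\<^sub>m n 1) B3)"
    using similar_mat_four_block_0_ex[OF similar_mat_refl[OF sb(1)] B3(2) sb(2) sb(1) sb(4)] by auto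
  have ut1: "upper_triangular A1" using sb(1) by auto
  have "upper_triangular (four_block_mat A1 B2 (0\<^sub>m n 1) B3)"
    by (rule upper_triangular_four_block[OF sb(1) B3c ut1 B3(1)])
  moreover have "similar_mat A (four_block_mat A1 B2 (0\<^sub>m n 1) B3)"
    using B2 sb(5) A0 similar_mat_sym[OF sim] similar_mat_trans by metis
  ultimately show ?case by blast
qed

lemma triangular_form_wit:
  fixes A :: "'a::alg_closed_field mat"
  assumes A: "A \<in> carrier_mat n n"
  obtains B P Q where "similar_mat_wit A B P Q" "upper_triangular B" "B \<in> carrier_mat n n"
  using triangular_form[OF A] similar_mat_witD2(5)[OF A] unfolding similar_mat_def by blast

lemma upper_triangular_mult:
  fixes A :: "'a::semiring_0 mat"
  assumes A: "A \<in> carrier_mat n n" "upper_triangular A" and B: "B \<in> carrier_mat n n" "upper_triangular B"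
  shows "upper_triangular (A * B)" "i < n \<Longrightarrow> (A * B) $$ (i,i) = A $$ (i,i) * B $$ (i,i)"
proof -
  have AB: "(A * B) $$ (i,j) = (\<Sum>k\<in>{0..<n}. A $$ (i,k) * B $$ (k,j))" if "i < n" "j < n" for i j
    using A B that by (auto simp: scalar_prod_def)
  show "upper_triangular (A * B)"
  proof (rule upper_triangularI)
    fix i j assume ij: "j < i" "i < dim_row (A * B)"
    have "A $$ (i,k) * B $$ (k,j) = 0" if "k < n" for k
    proof (cases "k < i")
      case True then show ?thesis using A ij by (auto simp: upper_triangularD[OF A(2)])
    next
      case False then show ?thesis using B ij that by (auto simp: upper_triangularD[OF B(2)])
    qed
    then show "(A * B) $$ (i,j) = 0" using ij A by (simp add: AB)
  qed
  assume i: "i < n"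
  have "(\<Sum>k\<in>{0..<n}. A $$ (i,k) * B $$ (k,i)) = (\<Sum>k\<in>{i}. A $$ (i,k) * B $$ (k,i))"
  proof (rule sum.mono_neutral_right)
    show "\<forall>k\<in>{0..<n} - {i}. A $$ (i, k) * B $$ (k, i) = 0"
    proof
      fix k assume k: "k \<in> {0..<n} - {i}"
      show "A $$ (i, k) * B $$ (k, i) = 0"
      proof (cases "k < i")
        case True then show ?thesis using A i by (auto simp: upper_triangularD[OF A(2)])
      next
        case False then show ?thesis using B k by (auto simp: upper_triangularD[OF B(2)])
      qed
    qed
  qed (use i in auto)
  then show "(A * B) $$ (i,i) = A $$ (i,i) * B $$ (i,i)" by (simp add: AB[OF i i])
qed

lemma upper_triangular_pow:
  fixes A :: "'a::comm_semiring_1 mat"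
  assumes A: "A \<in> carrier_mat n n" "upper_triangular A"
  shows "upper_triangular (A ^\<^sub>m k)" "i < n \<Longrightarrow> (A ^\<^sub>m k) $$ (i,i) = A $$ (i,i) ^ k"
proof -
  have "upper_triangular (A ^\<^sub>m k) \<and> (\<forall>i<n. (A ^\<^sub>m k) $$ (i,i) = A $$ (i,i) ^ k)"
  proof (induction k)
    case (Suc k)
    have c: "A ^\<^sub>m k \<in> carrier_mat n n" using A by simp
    show ?case using upper_triangular_mult[OF c _ A] Suc by (auto simp: mult.commute)
  qed (use A in auto)
  then show "upper_triangular (A ^\<^sub>m k)" "i < n \<Longrightarrow> (A ^\<^sub>m k) $$ (i,i) = A $$ (i,i) ^ k" by auto
qed

lemma strictly_upper_triangular_nilpotent:
  fixes A :: "'a::comm_semiring_1 mat"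
  assumes A: "A \<in> carrier_mat n n" "upper_triangular A" "\<And>i. i < n \<Longrightarrow> A $$ (i,i) = 0"
  shows "A ^\<^sub>m n = 0\<^sub>m n n"
proof -
  have z: "A $$ (i,j) = 0" if "i < n" "j \<le> i" for i j
    using that A upper_triangularD[OF A(2), of j i] by (cases "i = j") auto
  have *: "(A ^\<^sub>m k) $$ (i,j) = 0" if "i < n" "j < n" "j < i + k" for i j k
    using that
  proof (induction k arbitrary: i j)
    case (Suc k)
    have "(A ^\<^sub>m Suc k) $$ (i,j) = (\<Sum>l\<in>{0..<n}. (A ^\<^sub>m k) $$ (i,l) * A $$ (l,j))"
      using A(1) Suc.prems by (auto simp: scalar_prod_def)
    also have "\<dots> = 0"
    proof (rule sum.neutral, rule ballI)
      fix l assume l: "l \<in> {0..<n}"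
      show "(A ^\<^sub>m k) $$ (i,l) * A $$ (l,j) = 0"
      proof (cases "l < i + k")
        case True then show ?thesis using Suc l by simp
      next
        case False then show ?thesis using z[of l j] Suc.prems l by simp
      qed
    qed
    finally show ?case .
  qed (use A in auto)
  show ?thesis by (rule eq_matI) (use A * in auto)
qed

lemma similar_mat_wit_minus_one:
  fixes A :: "'a::comm_ring_1 mat"
  assumes "A \<in> carrier_mat n n" "similar_mat_wit A B P Q"
  shows "similar_mat_wit (A - 1\<^sub>m n) (B - 1\<^sub>m n) P Q"
proof -
  note w = similar_mat_witD2[OF assms]
  have "P * (B - 1\<^sub>m n) * Q = (P * B - P * 1\<^sub>m n) * Q"
    by (subst mult_minus_distrib_mat[of _ n n _ n]) (use w in auto)
  also have "\<dots> = P * B * Q - P * Q"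
    by (subst minus_mult_distrib_mat[of _ n n _ _ n]) (use w in auto)
  also have "\<dots> = A - 1\<^sub>m n" using w by simp
  finally show ?thesis
    by (intro similar_mat_witI[of _ _ n]) (use w in auto)
qed

lemma similar_nilpotent:
  fixes A :: "'a::comm_ring_1 mat"
  assumes A: "A \<in> carrier_mat n n" and sim: "similar_mat_wit A B P Q" and k: "A ^\<^sub>m k = 0\<^sub>m n n"
  shows "B ^\<^sub>m k = 0\<^sub>m n n"
proof -
  note w = similar_mat_witD2[OF A sim]
  have "B ^\<^sub>m k = Q * A ^\<^sub>m k * P" using similar_mat_wit_pow_id[OF similar_mat_wit_sym[OF sim]] .
  then show ?thesis using k w by simp
qed

definition mtrace :: "'a::comm_monoid_add mat \<Rightarrow> 'a" where
  "mtrace A = (\<Sum>i<dim_row A. A $$ (i,i))"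

lemma mtrace_mult_commute:
  fixes A :: "'a::comm_semiring_0 mat"
  assumes "A \<in> carrier_mat n n" "B \<in> carrier_mat n n"
  shows "mtrace (A * B) = mtrace (B * A)"
proof -
  have "mtrace (A * B) = (\<Sum>i<n. \<Sum>k<n. A $$ (i,k) * B $$ (k,i))"
    using assms by (auto simp: mtrace_def scalar_prod_def atLeast0LessThan)
  also have "\<dots> = (\<Sum>k<n. \<Sum>i<n. A $$ (i,k) * B $$ (k,i))" by (rule sum.swap)
  also have "\<dots> = mtrace (B * A)"
    using assms by (auto simp: mtrace_def scalar_prod_def atLeast0LessThan mult.commute)
  finally show ?thesis .
qed

lemma mtrace_similar:
  fixes A :: "'a::comm_ring_1 mat"
  assumes A: "A \<in> carrier_mat n n" and sim: "similar_mat_wit A B P Q"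
  shows "mtrace A = mtrace B"
proof -
  note w = similar_mat_witD2[OF A sim]
  have "mtrace A = mtrace (P * (B * Q))" using w by simp
  also have "\<dots> = mtrace ((B * Q) * P)" by (rule mtrace_mult_commute[of _ n]) (use w in auto)
  also have "(B * Q) * P = B * (Q * P)" using w by (intro assoc_mult_mat) auto
  finally show ?thesis using w by simp
qed

lemma mtrace_nilpotent:
  fixes A :: "'a::alg_closed_field mat"
  assumes A: "A \<in> carrier_mat n n" and k: "A ^\<^sub>m k = 0\<^sub>m n n"
  shows "mtrace A = 0"
proof -
  obtain B P Q where B: "similar_mat_wit A B P Q" "upper_triangular B" "B \<in> carrier_mat n n"
    using triangular_form_wit[OF A] .
  have "B $$ (i,i) = 0" if "i < n" for i
    using upper_triangular_pow(2)[OF B(3,2) that, of k] similar_nilpotent[OF A B(1) k] that by simp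
  then show ?thesis using mtrace_similar[OF A B(1)] B(3) by (simp add: mtrace_def)
qed

text \<open>
  If all power sums vanish, so does the sum of the values of every polynomial without constant term.
  A polynomial that vanishes at 0 and at all the \<open>f i\<close> other than \<open>f a\<close> then forces \<open>f a = 0\<close>.
\<close>

lemma power_sums_zero_imp_zero:
  fixes f :: "'i \<Rightarrow> 'a::field_char_0"
  assumes I: "finite I" and z: "\<And>k. k \<ge> 1 \<Longrightarrow> (\<Sum>i\<in>I. f i ^ k) = 0" and a: "a \<in> I"
  shows "f a = 0"
proof (rule ccontr)
  assume fa: "f a \<noteq> 0"
  have pz: "(\<Sum>i\<in>I. poly p (f i)) = 0" if "Polynomial.coeff p 0 = 0" for p
  proof -
    have "(\<Sum>i\<in>I. poly p (f i)) = (\<Sum>i\<in>I. \<Sum>k\<le>degree p. Polynomial.coeff p k * f i ^ k)"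
      by (simp add: poly_altdef)
    also have "\<dots> = (\<Sum>k\<le>degree p. Polynomial.coeff p k * (\<Sum>i\<in>I. f i ^ k))"
      by (subst sum.swap) (simp add: sum_distrib_left)
    also have "\<dots> = 0"
    proof (rule sum.neutral, rule ballI)
      fix k show "Polynomial.coeff p k * (\<Sum>i\<in>I. f i ^ k) = 0" by (cases "k = 0") (simp_all add: that z)
    qed
    finally show ?thesis .
  qed
  define p where "p = [:0,1:] * (\<Prod>\<mu>\<in>f ` I - {f a}. [:- \<mu>, 1:])"
  have p: "poly p x = x * (\<Prod>\<mu>\<in>f ` I - {f a}. x - \<mu>)" for x by (simp add: p_def poly_prod)
  have "0 = (\<Sum>i\<in>I. poly p (f i))" by (rule pz[symmetric]) (simp add: p_def)
  also have "\<dots> = (\<Sum>i\<in>I. if f i = f a then poly p (f a) else 0)"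
  proof (rule sum.cong[OF refl])
    fix i assume "i \<in> I"
    show "poly p (f i) = (if f i = f a then poly p (f a) else 0)"
    proof (cases "f i = f a")
      case False
      then have "(\<Prod>\<mu>\<in>f ` I - {f a}. f i - \<mu>) = 0"
        using I \<open>i \<in> I\<close> by (intro prod_zero) auto
      then show ?thesis using False by (simp add: p)
    qed simp
  qed
  also have "\<dots> = of_nat (card {i\<in>I. f i = f a}) * poly p (f a)"
    using I by (simp add: sum.If_cases Int_def conj_commute)
  finally have "of_nat (card {i\<in>I. f i = f a}) * poly p (f a) = 0" by simp
  moreover have "card {i\<in>I. f i = f a} \<noteq> 0" using I a by auto
  moreover have "poly p (f a) \<noteq> 0" using fa I by (auto simp: p)
  ultimately show False by simp
qed

lemma nilpotent_if_traces_zero: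
  fixes A :: "'a::{alg_closed_field,field_char_0} mat"
  assumes A: "A \<in> carrier_mat n n" and k: "\<And>k. k \<ge> 1 \<Longrightarrow> mtrace (A ^\<^sub>m k) = 0"
  shows "A ^\<^sub>m n = 0\<^sub>m n n"
proof -
  obtain B P Q where B: "similar_mat_wit A B P Q" "upper_triangular B" "B \<in> carrier_mat n n"
    using triangular_form_wit[OF A] .
  have "(\<Sum>i<n. (B $$ (i,i)) ^ k) = 0" if "k \<ge> 1" for k
  proof -
    have "mtrace (A ^\<^sub>m k) = mtrace (B ^\<^sub>m k)"
      by (rule mtrace_similar[OF _ similar_mat_wit_pow[OF B(1)]]) (use A in auto)
    also have "\<dots> = (\<Sum>i<n. (B $$ (i,i)) ^ k)"
      using B(3) by (simp add: mtrace_def upper_triangular_pow(2)[OF B(3,2)])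
    finally show ?thesis using k[OF that] by simp
  qed
  then have "B $$ (i,i) = 0" if "i < n" for i
    using power_sums_zero_imp_zero[of "{..<n}" "\<lambda>i. B $$ (i,i)" i] that by simp
  then have "B ^\<^sub>m n = 0\<^sub>m n n" by (intro strictly_upper_triangular_nilpotent B)
  then show ?thesis using similar_nilpotent[OF B(3) similar_mat_wit_sym[OF B(1)]] by simp
qed

lemma det_unipotent:
  fixes A :: "'a::alg_closed_field mat"
  assumes A: "A \<in> carrier_mat n n" and k: "(A - 1\<^sub>m n) ^\<^sub>m k = 0\<^sub>m n n"
  shows "det A = 1"
proof -
  obtain B P Q where B: "similar_mat_wit A B P Q" "upper_triangular B" "B \<in> carrier_mat n n"
    using triangular_form_wit[OF A] .
  have N: "(B - 1\<^sub>m n) ^\<^sub>m k = 0\<^sub>m n n"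
    by (rule similar_nilpotent[OF _ similar_mat_wit_minus_one[OF A B(1)] k]) auto
  have c: "B - 1\<^sub>m n \<in> carrier_mat n n" by (intro minus_carrier_mat) auto
  have u: "upper_triangular (B - 1\<^sub>m n)"
    using B by (intro upper_triangularI) (auto simp: upper_triangularD)
  have d: "B $$ (i,i) = 1" if "i < n" for i
    using upper_triangular_pow(2)[OF c u that, of k] that B(3) unfolding N by simp
  have "det A = det B" by (rule det_similar) (use B(1) in \<open>auto simp: similar_mat_def\<close>)
  also have "\<dots> = (\<Prod>i = 0..<n. B $$ (i,i))"
    using det_upper_triangular[OF B(2,3)] B(3) by (simp add: prod_list_diag_prod)
  finally show ?thesis by (simp add: d)
qed

text \<open>
  In triangular form the diagonal of \<open>A - 1\<close> vanishes.
\<close>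

lemma unipotent_if_eigenvalues_one:
  fixes A :: "'a::alg_closed_field mat"
  assumes A: "A \<in> carrier_mat n n" and e: "\<And>\<mu>. poly (char_poly A) \<mu> = 0 \<Longrightarrow> \<mu> = 1"
  shows "(A - 1\<^sub>m n) ^\<^sub>m n = 0\<^sub>m n n"
proof -
  obtain B P Q where B: "similar_mat_wit A B P Q" "upper_triangular B" "B \<in> carrier_mat n n"
    using triangular_form_wit[OF A] .
  have cp: "char_poly A = (\<Prod>a\<leftarrow>diag_mat B. [:- a, 1:])"
    using char_poly_upper_triangular[OF B(3,2)] char_poly_similar[of A B] B(1) by (auto simp: similar_mat_def)
  have d: "B $$ (i,i) = 1" if "i < n" for i
    by (rule e) (use that B(3) in \<open>auto simp: cp poly_prod_list prod_list_zero_iff diag_mat_def\<close>)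
  have c: "B - 1\<^sub>m n \<in> carrier_mat n n" by (intro minus_carrier_mat) auto
  have u: "upper_triangular (B - 1\<^sub>m n)"
    using B by (intro upper_triangularI) (auto simp: upper_triangularD)
  have "(B - 1\<^sub>m n) ^\<^sub>m n = 0\<^sub>m n n"
    by (rule strictly_upper_triangular_nilpotent[OF c u]) (use B(3) d in auto)
  then show ?thesis
    using similar_nilpotent[OF c similar_mat_wit_sym[OF similar_mat_wit_minus_one[OF A B(1)]]] by simp
qed

lemma eigenvalue_of_power:
  fixes A :: "'a::alg_closed_field mat"
  assumes A: "A \<in> carrier_mat n n" and l: "poly (char_poly (A ^\<^sub>m N)) l = 0"
  shows "\<exists>\<mu>. poly (char_poly A) \<mu> = 0 \<and> \<mu> ^ N = l"
proof -
  obtain B P Q where B: "similar_mat_wit A B P Q" "upper_triangular B" "B \<in> carrier_mat n n"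
    using triangular_form_wit[OF A] .
  have cp: "char_poly A = (\<Prod>a\<leftarrow>diag_mat B. [:- a, 1:])"
    using char_poly_upper_triangular[OF B(3,2)] char_poly_similar[of A B] B(1) by (auto simp: similar_mat_def)
  have "char_poly (A ^\<^sub>m N) = char_poly (B ^\<^sub>m N)"
    using char_poly_similar similar_mat_wit_pow[OF B(1)] unfolding similar_mat_def by blast
  also have "\<dots> = (\<Prod>a\<leftarrow>diag_mat (B ^\<^sub>m N). [:- a, 1:])"
    by (rule char_poly_upper_triangular[OF _ upper_triangular_pow(1)[OF B(3,2)]]) (use B(3) in auto)
  finally obtain i where "i < n" "l = (B ^\<^sub>m N) $$ (i,i)"
    using l B(3) by (auto simp: poly_prod_list prod_list_zero_iff diag_mat_def)
  then have "l = B $$ (i,i) ^ N" using upper_triangular_pow(2)[OF B(3,2)] by simp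
  moreover have "poly (char_poly A) (B $$ (i,i)) = 0"
    using \<open>i < n\<close> B(3) by (auto simp: cp poly_prod_list prod_list_zero_iff diag_mat_def)
  ultimately show ?thesis by blast
qed

section \<open>Groups of unipotent matrices\<close>

interpretation cvs: vector_space "\<lambda>(c::'c::field) (x::'c endo). sc c * x"
  by unfold_locales (auto simp: sc_simps algebra_simps)

definition munit :: "nat \<Rightarrow> nat \<Rightarrow> nat \<Rightarrow> 'c::field endo" where
  "munit n i j = emb (mat n n (\<lambda>(a,b). if a = i \<and> b = j then 1 else 0))"

lemma munit_Efin: "munit n i j \<in> Efin n"
  unfolding munit_def by (intro Efin_emb) simp

lemma ent_munit: "a < n \<Longrightarrow> b < n \<Longrightarrow> ent (munit n i j) a b = (if a = i \<and> b = j then 1 else 0)"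
  by (simp add: munit_def ent_emb)

lemma Efin_expand:
  assumes "f \<in> Efin n"
  shows "f = (\<Sum>i<n. \<Sum>j<n. sc (ent f i j) * munit n i j)"
proof (rule Efin_eqI[OF assms])
  show "(\<Sum>i<n. \<Sum>j<n. sc (ent f i j) * munit n i j) \<in> Efin n"
    by (intro Efin_sum Efin_closed munit_Efin)
  fix a b assume ab: "a < n" "b < n"
  have "ent (\<Sum>i<n. \<Sum>j<n. sc (ent f i j) * munit n i j) a b
      = (\<Sum>i<n. \<Sum>j<n. if i = a then if j = b then ent f i j else 0 else 0)"
    unfolding ent_sum using ab by (intro sum.cong refl) (auto simp: ent_simps ent_munit)
  also have "\<dots> = (\<Sum>i<n. if i = a then ent f i b else 0)"
    using ab by (intro sum.cong refl) auto
  also have "\<dots> = ent f a b" using ab by simp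
  finally show "ent f a b = ent (\<Sum>i<n. \<Sum>j<n. sc (ent f i j) * munit n i j) a b" by simp
qed

definition munits :: "nat \<Rightarrow> 'c::field endo set" where
  "munits n = (\<lambda>(i,j). munit n i j) ` ({..<n} \<times> {..<n})"

lemma finite_munits: "finite (munits n)" by (simp add: munits_def)

lemma Efin_span_munits: "Efin n \<subseteq> cvs.span (munits n)"
proof
  fix f assume "f \<in> Efin n"
  have "(\<Sum>i<n. \<Sum>j<n. sc (ent f i j) * munit n i j) \<in> cvs.span (munits n)"
    by (intro cvs.span_sum cvs.span_scale cvs.span_base) (auto simp: munits_def)
  then show "f \<in> cvs.span (munits n)" using Efin_expand[OF \<open>f \<in> Efin n\<close>] by simp
qed

lemma Efin_subspace: "cvs.subspace (Efin n)"
  by (auto simp: cvs.subspace_def Efin_closed)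

lemma (in vector_space) dim_strict_mono:
  assumes "U \<subseteq> W" "w \<in> W" "w \<notin> span U" "W \<subseteq> span T" "finite T"
  shows "dim U < dim W"
proof -
  obtain B where B: "B \<subseteq> U" "independent B" "U \<subseteq> span B" "card B = dim U" using basis_exists by metis
  obtain B' where B': "B' \<subseteq> W" "independent B'" "W \<subseteq> span B'" "card B' = dim W" using basis_exists by metis
  have fin: "finite B'" using independent_span_bound[OF assms(5) B'(2)] B'(1) assms(4) by blast
  have "span B \<subseteq> span U" using B(1) by (rule span_mono)
  then have wB: "w \<notin> span B" using assms(3) by auto
  have ind: "independent (insert w B)" by (rule independent_insertI[OF wB B(2)])
  have "insert w B \<subseteq> span B'" using B(1) assms(1,2) B'(3) by auto
  from independent_span_bound[OF fin ind this] have "finite (insert w B)" "card (insert w B) \<le> card B'" by auto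
  moreover have "w \<notin> B" using wB span_base by auto
  ultimately show ?thesis using B(4) B'(4) by simp
qed

lemma (in vector_space) dim_le_card_spanning:
  assumes "W \<subseteq> span T" "finite T" shows "dim W \<le> card T"
  by (rule dim_le_card[OF assms])

text \<open>
  Replaces the inversion of \<open>1 - b\<close>: if \<open>b ^ j = 0\<close>, then \<open>u\<close> is a sum of multiples of \<open>k\<close>.
\<close>

lemma fixed_point_iterate:
  fixes u :: "'a::ring_1"
  assumes "u = b * u + k"
  shows "u = b ^ j * u + (\<Sum>t<j. b ^ t * k)"
proof (induction j)
  case (Suc j)
  have "b ^ j * u = b ^ j * (b * u + k)" using assms by (rule arg_cong)
  also have "\<dots> = b ^ Suc j * u + b ^ j * k" by (simp add: distrib_left mult.assoc[symmetric] power_commutes)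
  finally have 1: "b ^ j * u = b ^ Suc j * u + b ^ j * k" .
  show ?case by (rule trans[OF Suc.IH]) (simp only: 1 sum.lessThan_Suc add_ac)
qed simp

text \<open>
  An algebra of nilpotent matrices is nilpotent. The annihilated subspaces \<open>K i\<close> of products of
  length \<open>i\<close> grow strictly until they exhaust everything: otherwise
  choose \<open>v\<close> outside \<open>K i\<close> for which \<open>A v + K i\<close> is as small as possible. If \<open>a v\<close> were not in
  \<open>K i\<close> then minimality would give \<open>a v = b a v + k\<close> with \<open>b \<in> A\<close>, \<open>k \<in> K i\<close>, and inverting
  \<open>1 - b\<close> puts \<open>a v\<close> into \<open>K i\<close>. So \<open>A v \<subseteq> K i\<close>, that is \<open>v \<in> K (i + 1)\<close>.
\<close>

lemma nil_algebra_nilpotent: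
  fixes A :: "'c::field endo set"
  assumes sub: "cvs.subspace A" and mult: "\<And>a b. a \<in> A \<Longrightarrow> b \<in> A \<Longrightarrow> a * b \<in> A"
    and fin: "A \<subseteq> Efin n" and nil: "\<And>a. a \<in> A \<Longrightarrow> \<exists>k. a ^ k = 0"
  shows "\<exists>J>0. \<forall>as. set as \<subseteq> A \<and> length as = J \<longrightarrow> prod_list as = 0"
proof -
  define K where "K i = {v\<in>Efin n. \<forall>as. set as \<subseteq> A \<and> length as = i \<longrightarrow> prod_list as * v = 0}" for i
  have Ksub: "cvs.subspace (K i)" for i
  proof -
    have "x * (sc c * y) = 0" if "x * y = 0" for x y :: "'c endo" and c
      using that by (simp add: sc_left_commute)
    then show ?thesis
      unfolding cvs.subspace_def K_def by (auto simp: Efin_closed distrib_left)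
  qed
  have Kdown: "a * v \<in> K i" if "a \<in> A" "v \<in> K (Suc i)" for a v i
  proof -
    have "prod_list as * (a * v) = 0" if "set as \<subseteq> A" "length as = i" for as
      using \<open>v \<in> K (Suc i)\<close> that \<open>a \<in> A\<close> unfolding K_def
      by (auto dest!: spec[of _ "as @ [a]"] simp: mult.assoc)
    then show ?thesis using that fin by (auto simp: K_def intro: Efin_closed)
  qed
  have Kmono: "v \<in> K (Suc i)" if "v \<in> K i" for v i
  proof -
    have "prod_list as * v = 0" if "set as \<subseteq> A" "length as = Suc i" for as
      using that \<open>v \<in> K i\<close> by (cases as) (auto simp: K_def mult.assoc)
    then show ?thesis using that by (auto simp: K_def)
  qed
  have Kinv: "a * v \<in> K i" if "a \<in> A" "v \<in> K i" for a v i
    using Kdown Kmono that by blast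
  have KE: "K i \<subseteq> Efin n" for i by (auto simp: K_def)
  define W where "W i v = cvs.span ((\<lambda>a. a * v) ` A \<union> K i)" for i v
  have WE: "W i v \<subseteq> Efin n" if "v \<in> Efin n" for i v
    unfolding W_def by (rule cvs.span_minimal[OF _ Efin_subspace]) (use that fin KE in \<open>auto intro: Efin_closed\<close>)
  have grow: "\<exists>v\<in>K (Suc i). v \<notin> K i" if ne: "K i \<noteq> Efin n" for i
  proof -
    obtain v0 where "v0 \<in> Efin n \<and> v0 \<notin> K i" using ne KE by auto
    from ex_has_least_nat[of "\<lambda>v. v \<in> Efin n \<and> v \<notin> K i" v0 "\<lambda>v. cvs.dim (W i v)", OF this]
    obtain v where v: "v \<in> Efin n" "v \<notin> K i"
      and min: "\<And>y. y \<in> Efin n \<Longrightarrow> y \<notin> K i \<Longrightarrow> cvs.dim (W i v) \<le> cvs.dim (W i y)"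
      by blast
    have "a * v \<in> K i" if a: "a \<in> A" for a
    proof (rule ccontr)
      assume notin: "a * v \<notin> K i"
      let ?u = "a * v"
      have uE: "?u \<in> Efin n" using a v fin by (auto intro: Efin_closed)
      have sub1: "W i ?u \<subseteq> W i v" unfolding W_def
      proof (rule cvs.span_mono, rule Un_mono[OF _ subset_refl], rule subsetI)
        fix x assume "x \<in> (\<lambda>b. b * ?u) ` A"
        then obtain b where "b \<in> A" "x = (b * a) * v" by (auto simp: mult.assoc)
        then show "x \<in> (\<lambda>a. a * v) ` A" using mult a by blast
      qed
      have uW: "?u \<in> W i v" unfolding W_def using a by (intro cvs.span_base) auto
      have "?u \<in> W i ?u"
      proof (rule ccontr)
        assume "?u \<notin> W i ?u"
        then have "?u \<notin> cvs.span (W i ?u)" by (simp add: W_def cvs.span_span)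
        from cvs.dim_strict_mono[OF sub1 uW this _ finite_munits[of n]] WE[OF v(1)] Efin_span_munits[of n]
        have "cvs.dim (W i ?u) < cvs.dim (W i v)" by blast
        then show False using min[OF uE notin] by simp
      qed
      moreover have "cvs.span ((\<lambda>b. b * ?u) ` A) = (\<lambda>b. b * ?u) ` A"
      proof (rule cvs.span_eq_iff[THEN iffD2])
        show "cvs.subspace ((\<lambda>b. b * ?u) ` A)"
          unfolding cvs.subspace_def
        proof (intro conjI ballI allI)
          show "0 \<in> (\<lambda>b. b * ?u) ` A" using cvs.subspace_0[OF sub] by (force intro: image_eqI[of _ _ 0])
        next
          fix x y assume "x \<in> (\<lambda>b. b * ?u) ` A" "y \<in> (\<lambda>b. b * ?u) ` A"
          then obtain b c where "b \<in> A" "c \<in> A" "x = b * ?u" "y = c * ?u" by auto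
          then show "x + y \<in> (\<lambda>b. b * ?u) ` A" using cvs.subspace_add[OF sub, of b c]
            by (intro image_eqI[of _ _ "b + c"]) (simp_all only: distrib_right)
        next
          fix c x assume "x \<in> (\<lambda>b. b * ?u) ` A"
          then obtain b where "b \<in> A" "x = b * ?u" by auto
          then show "sc c * x \<in> (\<lambda>b. b * ?u) ` A" using cvs.subspace_scale[OF sub, of b c]
            by (intro image_eqI[of _ _ "sc c * b"]) (simp_all only: mult.assoc)
        qed
      qed
      moreover have "cvs.span (K i) = K i" using Ksub by (rule cvs.span_eq_iff[THEN iffD2])
      ultimately have "\<exists>b\<in>A. \<exists>k\<in>K i. ?u = b * ?u + k"
        unfolding W_def cvs.span_Un by auto
      then obtain b k where b: "b \<in> A" and k: "k \<in> K i" and eq: "?u = b * ?u + k" by blast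
      obtain l where l: "b ^ l = 0" using nil[OF b] by auto
      from fixed_point_iterate[OF eq, of l] have u: "?u = (\<Sum>t<l. b ^ t * k)" by (simp add: l)
      have "b ^ t * k \<in> K i" for t
        by (induction t) (use k Kinv b in \<open>auto simp: mult.assoc\<close>)
      then have "?u \<in> K i" unfolding u by (intro cvs.subspace_sum[OF Ksub]) auto
      with notin show False by simp
    qed
    then have "prod_list as * v = 0" if "set as \<subseteq> A" "length as = Suc i" for as
      using that by (cases as rule: rev_cases) (auto simp: K_def mult.assoc)
    then have "v \<in> K (Suc i)" using v by (auto simp: K_def)
    with v show ?thesis by blast
  qed
  have "\<exists>i. K i = Efin n"
  proof (rule ccontr)
    assume *: "\<nexists>i. K i = Efin n"
    have dimstep: "cvs.dim (K i) < cvs.dim (K (Suc i))" for i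
    proof -
      obtain v where v: "v \<in> K (Suc i)" "v \<notin> K i" using grow * by blast
      moreover have "K i \<subseteq> K (Suc i)" using Kmono by auto
      moreover have "K (Suc i) \<subseteq> cvs.span (munits n)" using KE Efin_span_munits by blast
      moreover have "cvs.span (K i) = K i" using Ksub by (rule cvs.span_eq_iff[THEN iffD2])
      then have "v \<notin> cvs.span (K i)" using v(2) by (simp only: not_False_eq_True)
      ultimately show ?thesis using cvs.dim_strict_mono finite_munits by blast
    qed
    have "i \<le> cvs.dim (K i)" for i
    proof (induction i)
      case (Suc i) then show ?case using dimstep[of i] by simp
    qed simp
    moreover have "cvs.dim (K i) \<le> card (munits n :: 'c endo set)" for i
      using KE Efin_span_munits by (intro cvs.dim_le_card_spanning finite_munits) blast
    ultimately show False by (metis Suc_n_not_le_n order_trans)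
  qed
  then obtain i where i: "K i = Efin n" by auto
  have "prod_list as = 0" if "set as \<subseteq> A" "length as = Suc i" for as
  proof (cases as rule: rev_cases)
    case (snoc bs a)
    then have "a \<in> K i" using that i fin by auto
    then show ?thesis using that snoc by (auto simp: K_def)
  qed (use that in auto)
  then show ?thesis by blast
qed

lemma ent_trace_nilpotent:
  fixes a :: "'c::{alg_closed_field,field_char_0} endo"
  assumes a: "a \<in> Efin n" and tr: "\<And>k. k \<ge> 1 \<Longrightarrow> (\<Sum>i<n. ent (a ^ k) i i) = 0"
  shows "a ^ Suc n = 0"
proof -
  have "mtrace (mt n a ^\<^sub>m k) = 0" if "k \<ge> 1" for k
    using tr[OF that] mt_power[OF Efin_Cfin[OF a], of k, symmetric] by (simp add: mtrace_def)
  from nilpotent_if_traces_zero[OF mt_carrier(1) this]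
  have "mt n (a ^ Suc n) = 0\<^sub>m n n"
    by (simp only: mt_power[OF Efin_Cfin[OF a]] pow_mat.simps) simp
  moreover have "a ^ Suc n \<in> Efin n" using a by (intro Efin_power) auto
  ultimately show ?thesis using emb_mt emb_zero by metis
qed

lemma mt_unipotent:
  assumes "u - 1 \<in> Efin n"
  shows "(mt n u - 1\<^sub>m n) ^\<^sub>m k = mt n ((u - 1) ^ k)"
proof -
  have "mt n u - 1\<^sub>m n = mt n (u - 1)" by (intro eq_matI) (auto simp: ent_simps)
  then show ?thesis using mt_power[OF Efin_Cfin[OF assms]] by simp
qed

lemma ent_trace_unipotent:
  fixes u :: "'c::{alg_closed_field,field_char_0} endo"
  assumes "u - 1 \<in> Efin n" "(u - 1) ^ k = 0"
  shows "(\<Sum>i<n. ent (u - 1) i i) = 0"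
proof -
  have "mt n (u - 1) ^\<^sub>m k = mt n ((u - 1) ^ k)"
    by (simp only: mt_power[OF Efin_Cfin[OF assms(1)]])
  also have "\<dots> = 0\<^sub>m n n" unfolding assms(2) by (auto simp: mt_def ent_simps zero_mat_def)
  finally have "mt n (u - 1) ^\<^sub>m k = 0\<^sub>m n n" .
  from mtrace_nilpotent[OF _ this] show ?thesis by (simp add: mtrace_def)
qed

text \<open>
  For a multiplicatively closed \<open>S\<close> this span is closed under products and is the augmentation ideal
  of the algebra generated by \<open>S\<close>.
\<close>

definition lin_aug :: "'c::field endo set \<Rightarrow> 'c endo set" where
  "lin_aug S = cvs.span ((\<lambda>u. u - 1) ` S)"

lemma lin_aug_mult:
  assumes S: "\<And>u w. u \<in> S \<Longrightarrow> w \<in> S \<Longrightarrow> u * w \<in> S"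
    and a: "a \<in> lin_aug S" and b: "b \<in> lin_aug S"
  shows "a * b \<in> lin_aug S"
proof -
  note sub = cvs.subspace_span[of "(\<lambda>u. u - 1) ` S", folded lin_aug_def]
  have base: "u - 1 \<in> lin_aug S" if "u \<in> S" for u
    unfolding lin_aug_def using that by (intro cvs.span_base) auto
  have 1: "(u - 1) * b \<in> lin_aug S" if u: "u \<in> S" for u
    using b unfolding lin_aug_def
  proof (induction rule: cvs.span_induct)
    show "cvs.subspace {b. (u - 1) * b \<in> cvs.span ((\<lambda>u. u - 1) ` S)}"
      using sub[unfolded lin_aug_def] by (auto simp: cvs.subspace_def distrib_left sc_left_commute)
  next
    fix x assume "x \<in> (\<lambda>u. u - 1) ` S"
    then obtain w where w: "w \<in> S" "x = w - 1" by auto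
    have "(u - 1) * (w - 1) = (u * w - 1) - (u - 1) - (w - 1)" by (simp add: algebra_simps)
    then show "(u - 1) * x \<in> cvs.span ((\<lambda>u. u - 1) ` S)"
      using base[OF S[OF u w(1)]] base[OF u] base[OF w(1)] w(2) sub cvs.subspace_diff
      unfolding lin_aug_def by metis
  qed
  show ?thesis
    using a unfolding lin_aug_def
  proof (induction rule: cvs.span_induct)
    show "cvs.subspace {a. a * b \<in> cvs.span ((\<lambda>u. u - 1) ` S)}"
      using sub[unfolded lin_aug_def] by (auto simp: cvs.subspace_def distrib_right mult.assoc)
  next
    fix x assume "x \<in> (\<lambda>u. u - 1) ` S"
    then show "x * b \<in> cvs.span ((\<lambda>u. u - 1) ` S)" using 1 unfolding lin_aug_def by auto
  qed
qed

lemma lin_aug_Efin: "(\<And>u. u \<in> S \<Longrightarrow> u - 1 \<in> Efin n) \<Longrightarrow> lin_aug S \<subseteq> Efin n"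
  unfolding lin_aug_def by (rule cvs.span_minimal[OF _ Efin_subspace]) auto

text \<open>
  Kolchin's theorem in the form in which it is used: the traces of \<open>u - 1\<close>, hence of all elements
  of their linear span, vanish. Since the span is closed under products, all powers of its
  elements have trace 0, so it is an algebra of nilpotent matrices.
\<close>

theorem unipotent_products_vanish:
  fixes S :: "'c::{alg_closed_field,field_char_0} endo set"
  assumes S: "\<And>u w. u \<in> S \<Longrightarrow> w \<in> S \<Longrightarrow> u * w \<in> S" and fin: "\<And>u. u \<in> S \<Longrightarrow> u - 1 \<in> Efin n"
    and nil: "\<And>u. u \<in> S \<Longrightarrow> \<exists>k. (u - 1) ^ k = 0"
  shows "\<exists>J>0. \<forall>as. set as \<subseteq> lin_aug S \<and> length as = J \<longrightarrow> prod_list as = 0"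
proof (rule nil_algebra_nilpotent)
  show "cvs.subspace (lin_aug S)" unfolding lin_aug_def by (rule cvs.subspace_span)
  show "\<And>a b. a \<in> lin_aug S \<Longrightarrow> b \<in> lin_aug S \<Longrightarrow> a * b \<in> lin_aug S" by (rule lin_aug_mult[OF S])
  show "lin_aug S \<subseteq> Efin n" by (rule lin_aug_Efin[OF fin])
  fix a assume a: "a \<in> lin_aug S"
  have tr: "(\<Sum>i<n. ent x i i) = 0" if "x \<in> lin_aug S" for x
    using that unfolding lin_aug_def
  proof (induction rule: cvs.span_induct)
    show "cvs.subspace {x. (\<Sum>i<n. ent x i i) = 0}"
      by (auto simp: cvs.subspace_def ent_simps sum.distrib sum_distrib_left[symmetric])
  next
    fix x assume "x \<in> (\<lambda>u. u - 1) ` S"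
    then obtain u where u: "u \<in> S" "x = u - 1" by auto
    with nil obtain k where "(u - 1) ^ k = 0" by blast
    from ent_trace_unipotent[OF fin[OF u(1)] this] show "(\<Sum>i<n. ent x i i) = 0" by (simp only: u(2))
  qed
  have pow: "a ^ Suc k \<in> lin_aug S" for k
    by (induction k) (use a lin_aug_mult[OF S] in auto)
  have "a ^ Suc n = 0"
  proof (rule ent_trace_nilpotent)
    show "a \<in> Efin n" using a lin_aug_Efin[OF fin] by auto
    fix k :: nat assume "k \<ge> 1"
    then show "(\<Sum>i<n. ent (a ^ k) i i) = 0" using tr[OF pow[of "k - 1"]] by simp
  qed
  then show "\<exists>k. a ^ k = 0" by blast
qed

section \<open>Algebraic groups\<close>

lemma GL_simps: "x \<otimes>\<^bsub>GL n\<^esub> y = x * y" "one (GL n) = 1\<^sub>m n"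
  by (auto simp: GL_def units_of_def ring_mat_def)

lemma GL_carrier: "carrier (GL n :: 'c::field mat monoid) = {A \<in> carrier_mat n n. det A \<noteq> 0}"
proof -
  have "A \<in> Units (ring_mat TYPE('c) n ()) \<longleftrightarrow> A \<in> carrier_mat n n \<and> det A \<noteq> 0" for A
  proof
    assume A: "A \<in> Units (ring_mat TYPE('c) n ())"
    then have "A \<in> carrier_mat n n" by (simp add: Units_def ring_mat_def)
    then show "A \<in> carrier_mat n n \<and> det A \<noteq> 0"
      using unit_imp_det_non_zero[OF A] by auto
  qed (auto intro: det_non_zero_imp_unit)
  then show ?thesis by (auto simp: GL_def units_of_def)
qed

lemma GL_group: "group (GL n :: 'c::field mat monoid)"
proof -
  interpret R: ring "ring_mat TYPE('c) n ()" by (rule ring_mat)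
  show ?thesis unfolding GL_def by (rule R.units_group)
qed

lemma algebraic_groupD:
  assumes "algebraic_group k n U"
  shows "U \<subseteq> carrier (GL n)" "1\<^sub>m n \<in> U" "x \<in> U \<Longrightarrow> y \<in> U \<Longrightarrow> x * y \<in> U"
    "x \<in> U \<Longrightarrow> inv\<^bsub>GL n\<^esub> x \<in> U" "subgroup U (GL n)"
proof -
  show s: "subgroup U (GL n)" using assms by (simp add: algebraic_group_def)
  show "U \<subseteq> carrier (GL n)" by (rule subgroup.subset[OF s])
  show "1\<^sub>m n \<in> U" using subgroup.one_closed[OF s] by (simp add: GL_simps)
  show "x \<in> U \<Longrightarrow> y \<in> U \<Longrightarrow> x * y \<in> U" using subgroup.m_closed[OF s, of x y] by (simp add: GL_simps)
  show "x \<in> U \<Longrightarrow> inv\<^bsub>GL n\<^esub> x \<in> U" using subgroup.m_inv_closed[OF s, of x] by simp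
qed

lemma algebraic_group_closed:
  assumes "algebraic_group k n U" "x \<in> carrier (GL n)"
    "\<And>f. f \<in> vanishing_ideal UNIV (GL_coords n) U \<Longrightarrow> f x = 0"
  shows "x \<in> U"
proof -
  obtain S where S: "S \<subseteq> generated_algebra UNIV (GL_coords n)" "U = {x \<in> carrier (GL n). \<forall>f\<in>S. f x = 0}"
    using assms(1) unfolding algebraic_group_def variety_over_def zariski_closed_def by blast
  then have "S \<subseteq> vanishing_ideal UNIV (GL_coords n) U" by (auto simp: vanishing_ideal_def)
  then show ?thesis using S assms(2,3) by blast
qed

lemma regular_GL:
  fixes k :: "'c::field set"
  assumes "f \<in> generated_algebra k (GL_coords n)" "regmat k C D n F"
    "regular k C D (\<lambda>x. inverse (det (mt n (F x))))"
  shows "regular k C D (\<lambda>x. f (mt n (F x)))"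
proof (rule regular_compose[OF assms(1)])
  fix c :: "'c mat \<Rightarrow> 'c" assume "c \<in> GL_coords n"
  then consider i j where "i < n" "j < n" "c = (\<lambda>A. A $$ (i, j))" | "c = (\<lambda>A. inverse (det A))"
    unfolding GL_coords_def by blast
  then show "regular k C D (\<lambda>x. c (mt n (F x)))"
  proof cases
    case 1 then show ?thesis using assms(2) by (simp add: regmat_def)
  qed (use assms(3) in simp)
qed

lemma regular_GL_det_1:
  assumes "f \<in> generated_algebra k (GL_coords n)" "regmat k C D n F" "1 \<in> k"
    "\<And>x. x \<in> D \<Longrightarrow> det (mt n (F x)) = 1"
  shows "regular k C D (\<lambda>x. f (mt n (F x)))"
  by (rule regular_GL[OF assms(1,2)], subst regular_cong[of D _ "\<lambda>_. 1"])
    (auto simp: assms(3,4) intro: regular_const)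

lemma regmat_stab:
  assumes "D \<subseteq> carrier_mat n n"
  shows "regmat k (GL_coords n) D n (stab n)"
  unfolding regmat_def
proof (intro conjI ballI allI impI)
  fix x assume "x \<in> D" then show "stab n x \<in> Cfin n" using assms stab_Cfin by auto
next
  fix i j assume ij: "i < n" "j < n"
  have "regular k (GL_coords n) D (\<lambda>x. x $$ (i,j))"
    by (rule regular_gen) (use ij in \<open>auto simp: GL_coords_def\<close>)
  moreover have "ent (stab n x) i j = x $$ (i,j)" if "x \<in> D" for x
    using mt_index[OF ij, of "stab n x"] mt_stab[of x n] that assms by auto
  ultimately show "regular k (GL_coords n) D (\<lambda>x. ent (stab n x) i j)" by (simp cong: regular_cong)
qed

lemma det_mt_unipotent:
  fixes u :: "'c::{alg_closed_field,field_char_0} endo"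
  assumes "u - 1 \<in> Efin n" "(u - 1) ^ k = 0"
  shows "det (mt n u) = 1"
proof (rule det_unipotent[OF mt_carrier(1)])
  show "(mt n u - 1\<^sub>m n) ^\<^sub>m k = 0\<^sub>m n n"
    unfolding mt_unipotent[OF assms(1)] assms(2) by (auto simp: mt_def ent_simps zero_mat_def)
qed

lemma det_mt_Exp:
  fixes X :: "'c::{alg_closed_field,field_char_0} endo"
  assumes "X \<in> Efin n" "X ^ J = 0"
  shows "det (mt n (Exp J X)) = 1"
  by (rule det_mt_unipotent[OF Exp_Efin[OF assms] Exp_minus_nilpotent(2)[OF assms(2)]])

lemma regmat_Exp_line:
  assumes "X \<in> Efin n"
  shows "regmat UNIV {\<lambda>t. t} UNIV n (\<lambda>t. Exp J (sc t * X))"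
  by (intro regmat_Exp Qclosed_UNIV regmat_mult regmat_sc regmat_const regular_gen)
    (use Efin_Cfin[OF assms] in auto)

lemma Exp_line_poly:
  fixes X :: "'c::{alg_closed_field,field_char_0} endo"
  assumes f: "f \<in> generated_algebra UNIV (GL_coords n)" and X: "X \<in> Efin n" "X ^ J = 0"
  shows "\<exists>p. \<forall>t. f (mt n (Exp J (sc t * X))) = poly p t"
proof (rule regular_imp_poly[OF regular_GL_det_1[OF f regmat_Exp_line[OF X(1)]]])
  show "det (mt n (Exp J (sc t * X))) = 1" for t
    by (intro det_mt_Exp Efin_closed nilpotent_sc X)
qed auto

text \<open>
  The way in which statements pass from the powers \<open>u ^ i\<close> to the one-parameter group
  \<open>exp (t log u)\<close>.
\<close>

lemma poly_zero_on_nat: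
  fixes p :: "'c::field_char_0 poly"
  assumes "\<And>i::nat. poly p (of_nat i) = 0"
  shows "p = 0"
proof (rule ccontr)
  assume "p \<noteq> 0"
  then have "finite {x. poly p x = 0}" by (rule poly_roots_finite)
  moreover have "range (of_nat :: nat \<Rightarrow> 'c) \<subseteq> {x. poly p x = 0}" using assms by auto
  ultimately have "finite (range (of_nat :: nat \<Rightarrow> 'c))" by (rule finite_subset[rotated])
  moreover have "inj (of_nat :: nat \<Rightarrow> 'c)" by (simp add: inj_def)
  ultimately show False using range_inj_infinite by blast
qed

lemma poly_all_zero: "(\<And>t. poly p t = 0) \<Longrightarrow> p = (0 :: 'c::field_char_0 poly)"
  by (rule poly_zero_on_nat)

lemma regular_UNIV_D:
  assumes "regular k C UNIV h" shows "h \<in> generated_algebra k C"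
proof -
  obtain g where g: "g \<in> generated_algebra k C" "\<And>x. h x = g x" using assms unfolding regular_def by auto
  have "h = g" using g(2) by (rule ext)
  then show ?thesis using g(1) by simp
qed

lemma poly_eqI_fun: "(\<And>t. poly p t = poly q t) \<Longrightarrow> p = (q :: 'c::field_char_0 poly)"
  using poly_all_zero[of "p - q"] by simp

text \<open>
  Used to turn a matrix outside the augmentation algebra into an equation of the group.
\<close>

lemma separating_functional:
  assumes "X \<notin> cvs.span A"
  shows "\<exists>l. (\<forall>x y. l (x + y) = l x + l y) \<and> (\<forall>c x. l (sc c * x) = c * l x) \<and> (\<forall>x\<in>cvs.span A. l x = 0) \<and> l X = (1::'c::field)"
proof -
  interpret f: vector_space "(*) :: 'c \<Rightarrow> 'c \<Rightarrow> 'c" by unfold_locales (auto simp: algebra_simps)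
  interpret p: vector_space_pair "\<lambda>(c::'c) (x::'c endo). sc c * x" "(*) :: 'c \<Rightarrow> 'c \<Rightarrow> 'c" ..
  obtain B where B: "B \<subseteq> A" "cvs.independent B" "A \<subseteq> cvs.span B"
    using cvs.maximal_independent_subset[of A] by blast
  have sp: "cvs.span B = cvs.span A" using B by (metis cvs.span_mono cvs.span_span subset_antisym)
  then have X: "X \<notin> cvs.span B" using assms by simp
  have "cvs.independent (insert X B)" by (rule cvs.independent_insertI[OF X B(2)])
  from p.linear_independent_extend[OF this, of "\<lambda>x. if x = X then 1 else 0"]
  obtain l where l: "Vector_Spaces.linear (\<lambda>(c::'c) (x::'c endo). sc c * x) (*) l"
    "\<forall>x\<in>insert X B. l x = (if x = X then 1 else 0)" by blast
  interpret l: Vector_Spaces.linear "\<lambda>(c::'c) (x::'c endo). sc c * x" "(*)" l by fact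
  have XB: "X \<notin> B" using X cvs.span_base by blast
  have "l x = 0" if "x \<in> cvs.span B" for x
    using that
  proof (induction rule: cvs.span_induct)
    show "cvs.subspace {x. l x = 0}" by (auto simp: cvs.subspace_def l.add l.scale l.zero)
  qed (use l(2) XB in auto)
  then show ?thesis using l(2) sp by (intro exI[of _ l]) (auto simp: l.add l.scale)
qed

section \<open>First-order expansions\<close>

lemma coeff_mult_1: "Polynomial.coeff (p * q) (Suc 0) =
    Polynomial.coeff p 0 * Polynomial.coeff q (Suc 0) + Polynomial.coeff p (Suc 0) * Polynomial.coeff q 0"
  by (simp add: coeff_mult)

lemma coeff_mult_zero: "Polynomial.coeff (p * q) 0 = Polynomial.coeff p 0 * Polynomial.coeff q 0"
  by (simp add: coeff_mult)

lemma Exp_entry_poly: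
  fixes X :: "'c::field_char_0 endo"
  assumes X: "X ^ J = 0" "J > 0"
  obtains e where "\<And>s i j. ent (Exp J (sc s * X)) i j = poly (e i j) s"
    "\<And>i j. Polynomial.coeff (e i j) 0 = (if i = j then 1 else 0)"
    "\<And>i j. Polynomial.coeff (e i j) (Suc 0) = ent X i j"
proof
  define e where "e i j = (\<Sum>l<J. Polynomial.monom (ent (X ^ l) i j / fact l) l)" for i j
  have c: "Polynomial.coeff (e i j) l = (if l < J then ent (X ^ l) i j / fact l else 0)" for i j l
    by (simp add: e_def coeff_sum)
  show "ent (Exp J (sc s * X)) i j = poly (e i j) s" for s i j
    by (simp add: Exp_sc ev_def ent_sum ent_simps e_def poly_sum poly_monom mult.commute)
  show "Polynomial.coeff (e i j) 0 = (if i = j then 1 else 0)" for i j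
    using X(2) by (simp add: c ent_simps)
  show "Polynomial.coeff (e i j) (Suc 0) = ent X i j" for i j
  proof (cases "Suc 0 < J")
    case False
    then have "J = Suc 0" using X(2) by simp
    then have "X = 0" using X(1) by simp
    then show ?thesis using False by (simp add: c ent_simps)
  qed (simp add: c)
qed

text \<open>
  The function \<open>f1\<close> is the image of \<open>f\<close> under the derivation of the coordinate ring given by an
  infinitesimal right translation along \<open>X\<close>. For the coordinate \<open>1 / det\<close> it is 0 because \<open>exp\<close> of a
  nilpotent matrix has determinant 1.
\<close>

lemma translation_derivative:
  fixes X :: "'c::{alg_closed_field,field_char_0} endo"
  assumes X: "X \<in> Efin n" "X ^ J = 0" "J > 0" and f: "f \<in> generated_algebra UNIV (GL_coords n)"
  shows "\<exists>f1\<in>generated_algebra UNIV (GL_coords n). \<forall>w\<in>carrier (GL n).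
    \<exists>p. (\<forall>s. f (w * mt n (Exp J (sc s * X))) = poly p s) \<and>
        Polynomial.coeff p 0 = f w \<and> Polynomial.coeff p (Suc 0) = f1 w"
  using f
proof induction
  case (const a)
  show ?case
    by (intro bexI[of _ "\<lambda>_. 0"] ballI exI[of _ "[:a:]"]) (auto intro: generated_algebra.const)
next
  case (gen f)
  then consider i j where "i < n" "j < n" "f = (\<lambda>A. A $$ (i, j))" | "f = (\<lambda>A. inverse (det A))"
    unfolding GL_coords_def by blast
  then show ?case
  proof cases
    case 1
    obtain e where e: "\<And>s i j. ent (Exp J (sc s * X)) i j = poly (e i j) s"
      "\<And>i j. Polynomial.coeff (e i j) 0 = (if i = j then 1 else 0)"
      "\<And>i j. Polynomial.coeff (e i j) (Suc 0) = ent X i j"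
      using Exp_entry_poly[OF X(2,3)] by metis
    have "regular UNIV (GL_coords n) UNIV (\<lambda>w. \<Sum>l<n. w $$ (i,l) * ent X l j)"
      by (intro regular_sum regular_mult regular_const regular_gen) (use 1 in \<open>auto simp: GL_coords_def\<close>)
    then have g: "(\<lambda>w. \<Sum>l<n. w $$ (i,l) * ent X l j) \<in> generated_algebra UNIV (GL_coords n)"
      by (rule regular_UNIV_D)
    show ?thesis
    proof (intro bexI[OF _ g] ballI exI conjI allI)
      fix w :: "'c mat" assume w: "w \<in> carrier (GL n)"
      let ?p = "\<Sum>l<n. Polynomial.smult (w $$ (i,l)) (e l j)"
      show "f (w * mt n (Exp J (sc s * X))) = poly ?p s" for s
        using w 1 by (auto simp: GL_carrier scalar_prod_def atLeast0LessThan e poly_sum intro!: sum.cong)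
      have "Polynomial.coeff ?p 0 = (\<Sum>l<n. w $$ (i,l) * (if l = j then 1 else 0))"
        by (simp only: coeff_sum coeff_smult e(2))
      also have "\<dots> = (\<Sum>l<n. if l = j then w $$ (i,l) else 0)"
        by (intro sum.cong) auto
      finally show "Polynomial.coeff ?p 0 = f w" using 1 by simp
      show "Polynomial.coeff ?p (Suc 0) = (\<Sum>l<n. w $$ (i,l) * ent X l j)"
        by (simp add: coeff_sum e(3))
    qed
  next
    case 2
    show ?thesis
    proof (intro bexI[of _ "\<lambda>_. 0"] ballI exI conjI allI)
      fix w :: "'c mat" assume w: "w \<in> carrier (GL n)"
      let ?p = "[:inverse (det w):]"
      have "det (w * mt n (Exp J (sc s * X))) = det w" for s
        using w det_mult[of w n "mt n (Exp J (sc s * X))"]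
          det_mt_Exp[OF Efin_closed(5)[OF X(1)] nilpotent_sc[OF X(2)]] by (simp add: GL_carrier)
      then show "f (w * mt n (Exp J (sc s * X))) = poly ?p s" for s by (simp add: 2)
    qed (auto simp: 2 intro: generated_algebra.const)
  qed
next
  case (add f g)
  from add.IH(1) obtain f1 where f1: "f1 \<in> generated_algebra UNIV (GL_coords n)"
    and 2: "\<And>w. w \<in> carrier (GL n) \<Longrightarrow> \<exists>p. (\<forall>s. f (w * mt n (Exp J (sc s * X))) = poly p s) \<and>
        Polynomial.coeff p 0 = f w \<and> Polynomial.coeff p (Suc 0) = f1 w" by (elim bexE) (rule that, auto)
  from add.IH(2) obtain g1 where g1: "g1 \<in> generated_algebra UNIV (GL_coords n)"
    and 3: "\<And>w. w \<in> carrier (GL n) \<Longrightarrow> \<exists>p. (\<forall>s. g (w * mt n (Exp J (sc s * X))) = poly p s) \<and>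
        Polynomial.coeff p 0 = g w \<and> Polynomial.coeff p (Suc 0) = g1 w" by (elim bexE) (rule that, auto)
  note 1 = f1 g1
  show ?case
  proof (intro bexI[OF _ generated_algebra.add[OF 1]] ballI)
    fix w :: "'c mat" assume w: "w \<in> carrier (GL n)"
    obtain p where "\<forall>s. f (w * mt n (Exp J (sc s * X))) = poly p s"
        "Polynomial.coeff p 0 = f w" "Polynomial.coeff p (Suc 0) = f1 w"
      using 2[OF w] by (elim exE conjE) (rule that)
    moreover obtain q where "\<forall>s. g (w * mt n (Exp J (sc s * X))) = poly q s"
        "Polynomial.coeff q 0 = g w" "Polynomial.coeff q (Suc 0) = g1 w"
      using 3[OF w] by (elim exE conjE) (rule that)
    ultimately show "\<exists>p. (\<forall>s. f (w * mt n (Exp J (sc s * X))) + g (w * mt n (Exp J (sc s * X))) = poly p s) \<and>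
        Polynomial.coeff p 0 = f w + g w \<and> Polynomial.coeff p (Suc 0) = f1 w + g1 w"
      by (intro exI[of _ "p + q"]) auto
  qed
next
  case (mult f g)
  from mult.IH(1) obtain f1 where f1: "f1 \<in> generated_algebra UNIV (GL_coords n)"
    and 2: "\<And>w. w \<in> carrier (GL n) \<Longrightarrow> \<exists>p. (\<forall>s. f (w * mt n (Exp J (sc s * X))) = poly p s) \<and>
        Polynomial.coeff p 0 = f w \<and> Polynomial.coeff p (Suc 0) = f1 w" by (elim bexE) (rule that, auto)
  from mult.IH(2) obtain g1 where g1: "g1 \<in> generated_algebra UNIV (GL_coords n)"
    and 3: "\<And>w. w \<in> carrier (GL n) \<Longrightarrow> \<exists>p. (\<forall>s. g (w * mt n (Exp J (sc s * X))) = poly p s) \<and>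
        Polynomial.coeff p 0 = g w \<and> Polynomial.coeff p (Suc 0) = g1 w" by (elim bexE) (rule that, auto)
  note 1 = f1 g1
  have 4: "(\<lambda>w. f w * g1 w + f1 w * g w) \<in> generated_algebra UNIV (GL_coords n)"
    using mult.hyps 1 by (intro generated_algebra.add generated_algebra.mult)
  show ?case
  proof (intro bexI[OF _ 4] ballI)
    fix w :: "'c mat" assume w: "w \<in> carrier (GL n)"
    obtain p where "\<forall>s. f (w * mt n (Exp J (sc s * X))) = poly p s"
        "Polynomial.coeff p 0 = f w" "Polynomial.coeff p (Suc 0) = f1 w"
      using 2[OF w] by (elim exE conjE) (rule that)
    moreover obtain q where "\<forall>s. g (w * mt n (Exp J (sc s * X))) = poly q s"
        "Polynomial.coeff q 0 = g w" "Polynomial.coeff q (Suc 0) = g1 w"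
      using 3[OF w] by (elim exE conjE) (rule that)
    ultimately show "\<exists>p. (\<forall>s. f (w * mt n (Exp J (sc s * X))) * g (w * mt n (Exp J (sc s * X))) = poly p s) \<and>
        Polynomial.coeff p 0 = f w * g w \<and> Polynomial.coeff p (Suc 0) = f w * g1 w + f1 w * g w"
      by (intro exI[of _ "p * q"]) (auto simp: coeff_mult_1 coeff_mult_zero)
  qed
qed

definition mcoords :: "nat \<Rightarrow> ('c mat \<Rightarrow> 'c) set" where
  "mcoords n = {\<lambda>A. A $$ (i, j) | i j. i < n \<and> j < n}"

text \<open>
  A first-order expansion of \<open>f\<close> at the identity along a curve: \<open>P\<close> is a matrix of polynomials in one
  variable and \<open>p\<close> is the polynomial \<open>f (P t)\<close>, whose linear coefficient is the value of the linear form
  \<open>w\<close> at the derivative of the curve.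
\<close>

definition jet_along :: "nat \<Rightarrow> ('c::field mat \<Rightarrow> 'c) \<Rightarrow> (nat \<times> nat \<Rightarrow> 'c) \<Rightarrow> (nat \<Rightarrow> nat \<Rightarrow> 'c poly) \<Rightarrow> 'c poly \<Rightarrow> bool" where
  "jet_along n f w P p \<longleftrightarrow>
     (\<forall>x t. (\<forall>i<n. \<forall>j<n. x $$ (i,j) = poly (P i j) t) \<longrightarrow> f x = poly p t) \<and>
     Polynomial.coeff p 0 = f (1\<^sub>m n) \<and>
     Polynomial.coeff p (Suc 0) = (\<Sum>(i,j)\<in>{..<n} \<times> {..<n}. w (i,j) * Polynomial.coeff (P i j) (Suc 0))"

text \<open>
  The linear form \<open>w\<close> is the differential of \<open>f\<close> at the identity matrix.
\<close>

definition is_jet :: "nat \<Rightarrow> ('c::field mat \<Rightarrow> 'c) \<Rightarrow> (nat \<times> nat \<Rightarrow> 'c) \<Rightarrow> bool" where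
  "is_jet n f w \<longleftrightarrow> (\<forall>P. (\<forall>i<n. \<forall>j<n. Polynomial.coeff (P i j) 0 = (if i = j then 1 else 0)) \<longrightarrow>
     (\<exists>p. jet_along n f w P p))"

lemma jet_along_add:
  assumes f: "jet_along n f v P p" and g: "jet_along n g w P q"
  shows "jet_along n (\<lambda>x. f x + g x) (\<lambda>i. v i + w i) P (p + q)"
proof -
  note f = f[unfolded jet_along_def] and g = g[unfolded jet_along_def]
  have "Polynomial.coeff (p + q) (Suc 0)
      = (\<Sum>x\<in>{..<n} \<times> {..<n}. case x of (i,j) \<Rightarrow> v (i,j) * Polynomial.coeff (P i j) (Suc 0))
        + (\<Sum>x\<in>{..<n} \<times> {..<n}. case x of (i,j) \<Rightarrow> w (i,j) * Polynomial.coeff (P i j) (Suc 0))"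
    unfolding coeff_add f[THEN conjunct2, THEN conjunct2] g[THEN conjunct2, THEN conjunct2] ..
  also have "\<dots> = (\<Sum>x\<in>{..<n} \<times> {..<n}. case x of (i,j) \<Rightarrow> (v (i,j) + w (i,j)) * Polynomial.coeff (P i j) (Suc 0))"
    unfolding sum.distrib[symmetric] by (intro sum.cong refl) (auto simp: distrib_right)
  finally have 1: "Polynomial.coeff (p + q) (Suc 0) = \<dots>" .
  have 2: "f x + g x = poly (p + q) t" if "\<forall>i<n. \<forall>j<n. x $$ (i,j) = poly (P i j) t" for x t
    using f[THEN conjunct1, THEN spec, THEN spec, THEN mp, OF that]
      g[THEN conjunct1, THEN spec, THEN spec, THEN mp, OF that] by (simp only: poly_add)
  have 3: "Polynomial.coeff (p + q) 0 = f (1\<^sub>m n) + g (1\<^sub>m n)"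
    unfolding coeff_add f[THEN conjunct2, THEN conjunct1] g[THEN conjunct2, THEN conjunct1] ..
  show ?thesis unfolding jet_along_def using 2 by (intro conjI allI impI 1 3)
qed

lemma jet_along_mult:
  assumes f: "jet_along n f v P p" and g: "jet_along n g w P q"
  shows "jet_along n (\<lambda>x. f x * g x) (\<lambda>i. f (1\<^sub>m n) * w i + v i * g (1\<^sub>m n)) P (p * q)"
proof -
  note f = f[unfolded jet_along_def] and g = g[unfolded jet_along_def]
  have "Polynomial.coeff (p * q) (Suc 0)
      = f (1\<^sub>m n) * (\<Sum>x\<in>{..<n} \<times> {..<n}. case x of (i,j) \<Rightarrow> w (i,j) * Polynomial.coeff (P i j) (Suc 0))
        + (\<Sum>x\<in>{..<n} \<times> {..<n}. case x of (i,j) \<Rightarrow> v (i,j) * Polynomial.coeff (P i j) (Suc 0)) * g (1\<^sub>m n)"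
    unfolding coeff_mult_1 f[THEN conjunct2, THEN conjunct2] g[THEN conjunct2, THEN conjunct2]
      f[THEN conjunct2, THEN conjunct1] g[THEN conjunct2, THEN conjunct1] ..
  also have "\<dots> = (\<Sum>x\<in>{..<n} \<times> {..<n}. case x of (i,j) \<Rightarrow>
      (f (1\<^sub>m n) * w (i,j) + v (i,j) * g (1\<^sub>m n)) * Polynomial.coeff (P i j) (Suc 0))"
    unfolding sum_distrib_left sum_distrib_right sum.distrib[symmetric]
    by (intro sum.cong refl) (auto simp: algebra_simps)
  finally have 1: "Polynomial.coeff (p * q) (Suc 0) = \<dots>" .
  have 2: "f x * g x = poly (p * q) t" if "\<forall>i<n. \<forall>j<n. x $$ (i,j) = poly (P i j) t" for x t
    using f[THEN conjunct1, THEN spec, THEN spec, THEN mp, OF that]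
      g[THEN conjunct1, THEN spec, THEN spec, THEN mp, OF that] by (simp only: poly_mult)
  have 3: "Polynomial.coeff (p * q) 0 = f (1\<^sub>m n) * g (1\<^sub>m n)"
    unfolding coeff_mult_zero f[THEN conjunct2, THEN conjunct1] g[THEN conjunct2, THEN conjunct1] ..
  show ?thesis unfolding jet_along_def using 2 by (intro conjI allI impI 1 3)
qed

lemma jet_exists:
  fixes k :: "'c::field_char_0 set"
  assumes k: "Qclosed k" and f: "f \<in> generated_algebra k (mcoords n)"
  shows "\<exists>w. (\<forall>i<n. \<forall>j<n. w (i,j) \<in> k) \<and> is_jet n f w"
  using f
proof induction
  case (const a)
  show ?case
  proof (intro exI[of _ "\<lambda>_. 0"] conjI allI impI)
    show "is_jet n (\<lambda>_. a) (\<lambda>_. 0)"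
      unfolding is_jet_def
    proof (intro allI impI)
      fix P :: "nat \<Rightarrow> nat \<Rightarrow> 'c poly"
      have "jet_along n (\<lambda>_. a) (\<lambda>_. 0) P [:a:]" by (simp add: jet_along_def case_prod_unfold)
      then show "\<exists>p. jet_along n (\<lambda>_. a) (\<lambda>_. 0) P p" by (rule exI)
    qed
  qed (rule QclosedD(1)[OF k])
next
  case (gen f)
  then obtain a b where ab: "a < n" "b < n" "f = (\<lambda>A. A $$ (a, b))" unfolding mcoords_def by blast
  have "is_jet n f (\<lambda>x. if x = (a,b) then 1 else 0)"
    unfolding is_jet_def jet_along_def
  proof (intro allI impI, goal_cases)
    case (1 P)
    have "(\<Sum>(i,j)\<in>{..<n} \<times> {..<n}. (if (i,j) = (a,b) then 1 else 0) * Polynomial.coeff (P i j) (Suc 0))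
       = (\<Sum>x\<in>{..<n} \<times> {..<n}. if x = (a,b) then Polynomial.coeff (P a b) (Suc 0) else 0)"
    proof (rule sum.cong[OF refl])
      fix x show "(case x of (i,j) \<Rightarrow> (if (i,j) = (a,b) then 1 else 0) * Polynomial.coeff (P i j) (Suc 0))
        = (if x = (a,b) then Polynomial.coeff (P a b) (Suc 0) else 0)"
        by (cases x; cases "x = (a,b)") auto
    qed
    then show ?case using 1 ab by (intro exI[of _ "P a b"]) auto
  qed
  then show ?case by (intro exI[of _ "\<lambda>x. if x = (a,b) then 1 else 0"]) (auto simp: QclosedD(1,2)[OF k])
next
  case (add f g)
  from add.IH(1) obtain v where v: "\<forall>i<n. \<forall>j<n. v (i,j) \<in> k" "is_jet n f v" by (elim exE conjE)
  from add.IH(2) obtain w where w: "\<forall>i<n. \<forall>j<n. w (i,j) \<in> k" "is_jet n g w" by (elim exE conjE)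
  have "is_jet n (\<lambda>x. f x + g x) (\<lambda>i. v i + w i)"
    unfolding is_jet_def
  proof (intro allI impI)
    fix P :: "nat \<Rightarrow> nat \<Rightarrow> 'c poly" assume P: "\<forall>i<n. \<forall>j<n. Polynomial.coeff (P i j) 0 = (if i = j then 1 else 0)"
    obtain p q where "jet_along n f v P p" "jet_along n g w P q"
      using v(2)[unfolded is_jet_def, THEN spec, THEN mp, OF P] w(2)[unfolded is_jet_def, THEN spec, THEN mp, OF P] by blast
    from jet_along_add[OF this] show "\<exists>p. jet_along n (\<lambda>x. f x + g x) (\<lambda>i. v i + w i) P p" by (rule exI)
  qed
  then show ?case using v w by (intro exI[of _ "\<lambda>i. v i + w i"]) (auto intro!: QclosedD(5)[OF k])
next
  case (mult f g)
  from mult.IH(1) obtain v where v: "\<forall>i<n. \<forall>j<n. v (i,j) \<in> k" "is_jet n f v" by (elim exE conjE)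
  from mult.IH(2) obtain w where w: "\<forall>i<n. \<forall>j<n. w (i,j) \<in> k" "is_jet n g w" by (elim exE conjE)
  let ?w = "\<lambda>i. f (1\<^sub>m n) * w i + v i * g (1\<^sub>m n)"
  have "is_jet n (\<lambda>x. f x * g x) ?w"
    unfolding is_jet_def
  proof (intro allI impI)
    fix P :: "nat \<Rightarrow> nat \<Rightarrow> 'c poly" assume P: "\<forall>i<n. \<forall>j<n. Polynomial.coeff (P i j) 0 = (if i = j then 1 else 0)"
    obtain p q where "jet_along n f v P p" "jet_along n g w P q"
      using v(2)[unfolded is_jet_def, THEN spec, THEN mp, OF P] w(2)[unfolded is_jet_def, THEN spec, THEN mp, OF P] by blast
    from jet_along_mult[OF this] show "\<exists>p. jet_along n (\<lambda>x. f x * g x) ?w P p" by (rule exI)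
  qed
  moreover have one: "h (1\<^sub>m n) \<in> k" if "h \<in> generated_algebra k (mcoords n)" for h
    by (rule generated_algebra_values[OF that]) (auto simp: mcoords_def intro: QclosedD(1,2,5,6)[OF k])
  ultimately show ?case using v(1) w(1) one[OF mult.hyps(1)] one[OF mult.hyps(2)]
    by (intro exI[of _ ?w]) (auto intro!: QclosedD(5,6)[OF k])
qed

lemma regular_det:
  assumes "Qclosed k"
  shows "regular k (mcoords n) (carrier_mat n n) det"
proof -
  have "regular k (mcoords n) (carrier_mat n n)
      (\<lambda>x. \<Sum>p\<in>{p. p permutes {0..<n}}. signof p * (\<Prod>i\<in>{0..<n}. x $$ (i, p i)))"
  proof (intro regular_sum regular_mult regular_prod regular_const regular_gen)
    fix p i assume "p \<in> {p. p permutes {0..<n}}" "i \<in> {0..<n}"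
    then have "i < n" "p i < n" using permutes_in_image[of p "{0..<n}" i] by auto
    then show "(\<lambda>x. x $$ (i, p i)) \<in> mcoords n" unfolding mcoords_def by blast
  next
    fix p show "signof p \<in> k" using QclosedD(2,3)[OF assms] by (auto simp: sign_def)
  qed (use QclosedD(1,2)[OF assms] in auto)
  then show ?thesis
    by (subst regular_cong[of _ det]) (auto simp: det_def')
qed

text \<open>
  Jets are defined for polynomials in the matrix entries; functions involving \<open>1 / det\<close> are brought
  into this form.
\<close>

lemma clear_denominators:
  assumes k: "Qclosed k" and f: "f \<in> generated_algebra k (GL_coords n)"
  shows "\<exists>d. \<exists>g\<in>generated_algebra k (mcoords n). \<forall>x\<in>carrier (GL n). det x ^ d * f x = g x"
proof -
  obtain \<delta> where \<delta>: "\<delta> \<in> generated_algebra k (mcoords n)" "\<And>x. x \<in> carrier_mat n n \<Longrightarrow> det x = \<delta> x"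
    using regular_det[OF k, of n] unfolding regular_def by blast
  have \<delta>p: "regular k (mcoords n) (carrier (GL n)) (\<lambda>x. det x ^ d)" for d
    by (rule regular_subset[OF regular_power[OF _ regular_det[OF k]]]) (auto simp: GL_carrier QclosedD(2)[OF k])
  have "\<exists>d. regular k (mcoords n) (carrier (GL n)) (\<lambda>x. det x ^ d * f x)"
    using f
  proof induction
    case (const a)
    then show ?case by (intro exI[of _ 0]) (auto intro: regular_const)
  next
    case (gen f)
    then consider i j where "i < n" "j < n" "f = (\<lambda>A. A $$ (i, j))" | "f = (\<lambda>A. inverse (det A))"
      unfolding GL_coords_def by blast
    then show ?case
    proof cases
      case 1
      then have "regular k (mcoords n) (carrier (GL n)) f" by (intro regular_gen) (auto simp: mcoords_def)
      then show ?thesis by (intro exI[of _ 0]) simp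
    next
      case 2
      have "regular k (mcoords n) (carrier (GL n)) (\<lambda>x. 1)" using QclosedD(2)[OF k] by (auto intro: regular_const)
      then show ?thesis unfolding 2
        by (intro exI[of _ 1], subst regular_cong[of _ _ "\<lambda>_. 1"]) (auto simp: GL_carrier)
    qed
  next
    case (add f g)
    then obtain a b where ab: "regular k (mcoords n) (carrier (GL n)) (\<lambda>x. det x ^ a * f x)"
      "regular k (mcoords n) (carrier (GL n)) (\<lambda>x. det x ^ b * g x)" by blast
    have "regular k (mcoords n) (carrier (GL n))
        (\<lambda>x. det x ^ b * (det x ^ a * f x) + det x ^ a * (det x ^ b * g x))"
      by (rule regular_add[OF regular_mult[OF \<delta>p ab(1)] regular_mult[OF \<delta>p ab(2)]])
    then show ?case by (intro exI[of _ "a + b"]) (simp add: power_add algebra_simps)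
  next
    case (mult f g)
    then obtain a b where ab: "regular k (mcoords n) (carrier (GL n)) (\<lambda>x. det x ^ a * f x)"
      "regular k (mcoords n) (carrier (GL n)) (\<lambda>x. det x ^ b * g x)" by blast
    have "regular k (mcoords n) (carrier (GL n))
        (\<lambda>x. (det x ^ a * f x) * (det x ^ b * g x))"
      by (rule regular_mult[OF ab])
    then show ?case by (intro exI[of _ "a + b"]) (simp add: power_add algebra_simps)
  qed
  then show ?thesis unfolding regular_def by blast
qed

text \<open>
  A system of linear equations with coefficients in \<open>k\<close>, possibly infinite, has a projection onto its
  space of solutions with coefficients in \<open>k\<close>. Gaussian elimination: if some equation \<open>e\<close> involves the new
  variable \<open>i\<close>, it eliminates \<open>i\<close> from all others, and \<open>i\<close> is solved for by \<open>e\<close>; otherwise \<open>i\<close> is free.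
\<close>

lemma rational_projection:
  fixes k :: "'c::field set"
  assumes k: "subfield k class_ring" and I: "finite I" and W: "\<And>w a. w \<in> W \<Longrightarrow> a \<in> I \<Longrightarrow> w a \<in> k"
  shows "\<exists>q. (\<forall>a\<in>I. \<forall>b\<in>I. q a b \<in> k) \<and>
    (\<forall>x. \<forall>w\<in>W. (\<Sum>a\<in>I. w a * (\<Sum>b\<in>I. q a b * x b)) = 0) \<and>
    (\<forall>x. (\<forall>w\<in>W. (\<Sum>a\<in>I. w a * x a) = 0) \<longrightarrow> (\<forall>a\<in>I. (\<Sum>b\<in>I. q a b * x b) = x a))"
  using I W
proof (induction I arbitrary: W)
  case (insert i I)
  note kc = subfield_closed[OF k]
  have ksum: "(\<And>a. a \<in> I \<Longrightarrow> f a \<in> k) \<Longrightarrow> sum f I \<in> k" for f :: "'a \<Rightarrow> 'c"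
    by (induction I rule: infinite_finite_induct) (auto intro: kc)
  have ne: "a \<noteq> i" if "a \<in> I" for a using that insert.hyps by auto
  show ?case
  proof (cases "\<forall>w\<in>W. w i = 0")
    case True
    obtain q where q: "\<forall>a\<in>I. \<forall>b\<in>I. q a b \<in> k"
      "\<And>x w. w \<in> W \<Longrightarrow> (\<Sum>a\<in>I. w a * (\<Sum>b\<in>I. q a b * x b)) = 0"
      "\<And>x a. (\<forall>w\<in>W. (\<Sum>a\<in>I. w a * x a) = 0) \<Longrightarrow> a \<in> I \<Longrightarrow> (\<Sum>b\<in>I. q a b * x b) = x a"
      using insert.IH[of W] insert.prems by blast
    define q' where "q' a b = (if a = i then if b = i then 1 else 0 else if b = i then 0 else q a b)" for a b
    have qI: "(\<Sum>b\<in>insert i I. q' a b * x b) = (\<Sum>b\<in>I. q a b * x b)" if "a \<in> I" for a x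
    proof -
      have "(\<Sum>b\<in>I. q' a b * x b) = (\<Sum>b\<in>I. q a b * x b)"
        using that ne by (intro sum.cong) (auto simp: q'_def)
      then show ?thesis using insert.hyps that ne by (simp add: q'_def)
    qed
    have qi: "(\<Sum>b\<in>insert i I. q' i b * x b) = x i" for x
    proof -
      have "(\<Sum>b\<in>I. q' i b * x b) = 0" using ne by (intro sum.neutral) (auto simp: q'_def)
      then show ?thesis using insert.hyps by (simp add: q'_def)
    qed
    show ?thesis
    proof (intro exI[of _ q'] conjI allI ballI impI)
      fix a b assume "a \<in> insert i I" "b \<in> insert i I"
      then show "q' a b \<in> k" using q(1) kc ne by (auto simp: q'_def)
    next
      fix x w assume w: "w \<in> W"
      have "(\<Sum>a\<in>I. w a * (\<Sum>b\<in>insert i I. q' a b * x b)) = (\<Sum>a\<in>I. w a * (\<Sum>b\<in>I. q a b * x b))"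
        by (intro sum.cong refl) (simp only: qI)
      then show "(\<Sum>a\<in>insert i I. w a * (\<Sum>b\<in>insert i I. q' a b * x b)) = 0"
        using True w q(2)[OF w, of x] by (simp add: sum.insert[OF insert.hyps] del: sum.insert)
    next
      fix x a assume *: "\<forall>w\<in>W. (\<Sum>a\<in>insert i I. w a * x a) = 0" and a: "a \<in> insert i I"
      have "(\<Sum>a\<in>I. w a * x a) = 0" if "w \<in> W" for w
        using *[rule_format, OF that] True[rule_format, OF that] insert.hyps by simp
      then have "\<forall>w\<in>W. (\<Sum>a\<in>I. w a * x a) = 0" by blast
      then show "(\<Sum>b\<in>insert i I. q' a b * x b) = x a"
        using a q(3)[of x a] qI[of a x] qi[of x] by (cases "a = i") (simp_all only: insert_iff, simp_all)
    qed
  next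
    case False
    then obtain e where e: "e \<in> W" "e i \<noteq> 0" by auto
    define W' where "W' = (\<lambda>w a. w a - w i / e i * e a) ` W"
    have W'k: "w a \<in> k" if "w \<in> W'" "a \<in> I" for w a
      using that insert.prems e by (auto simp: W'_def intro!: kc(7) kc(4) kc(8))
    obtain q where q: "\<forall>a\<in>I. \<forall>b\<in>I. q a b \<in> k"
      "\<And>x w. w \<in> W' \<Longrightarrow> (\<Sum>a\<in>I. w a * (\<Sum>b\<in>I. q a b * x b)) = 0"
      "\<And>x a. (\<forall>w\<in>W'. (\<Sum>a\<in>I. w a * x a) = 0) \<Longrightarrow> a \<in> I \<Longrightarrow> (\<Sum>b\<in>I. q a b * x b) = x a"
    proof -
      have "\<exists>q. (\<forall>a\<in>I. \<forall>b\<in>I. q a b \<in> k) \<and>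
        (\<forall>x. \<forall>w\<in>W'. (\<Sum>a\<in>I. w a * (\<Sum>b\<in>I. q a b * x b)) = 0) \<and>
        (\<forall>x. (\<forall>w\<in>W'. (\<Sum>a\<in>I. w a * x a) = 0) \<longrightarrow> (\<forall>a\<in>I. (\<Sum>b\<in>I. q a b * x b) = x a))"
        by (rule insert.IH) (rule W'k)
      then show ?thesis using that by blast
    qed
    have W'eq: "(\<Sum>a\<in>I. (w a - w i / e i * e a) * y a) = (\<Sum>a\<in>I. w a * y a) - w i / e i * (\<Sum>a\<in>I. e a * y a)" for w y
      by (simp add: algebra_simps sum_subtractf sum_distrib_left)
    define q' where "q' a b = (if b = i then 0 else if a = i then - (\<Sum>a\<in>I. e a * q a b) / e i else q a b)" for a b
    have qI: "(\<Sum>b\<in>insert i I. q' a b * x b) = (\<Sum>b\<in>I. q a b * x b)" if "a \<in> I" for a x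
    proof -
      have "(\<Sum>b\<in>I. q' a b * x b) = (\<Sum>b\<in>I. q a b * x b)"
        using that ne by (intro sum.cong) (auto simp: q'_def)
      then show ?thesis using insert.hyps that ne by (simp add: q'_def)
    qed
    have qi: "(\<Sum>b\<in>insert i I. q' i b * x b) = - (\<Sum>a\<in>I. e a * (\<Sum>b\<in>I. q a b * x b)) / e i" for x
    proof -
      have "(\<Sum>b\<in>I. q' i b * x b) = (\<Sum>b\<in>I. - ((\<Sum>a\<in>I. e a * q a b) * x b) / e i)"
        using ne by (intro sum.cong) (auto simp: q'_def)
      also have "\<dots> = - (\<Sum>b\<in>I. (\<Sum>a\<in>I. e a * q a b * x b)) / e i"
        by (simp add: sum_divide_distrib sum_negf sum_distrib_right)
      also have "(\<Sum>b\<in>I. (\<Sum>a\<in>I. e a * q a b * x b)) = (\<Sum>a\<in>I. e a * (\<Sum>b\<in>I. q a b * x b))"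
        by (subst sum.swap) (simp add: sum_distrib_left mult.assoc)
      finally show ?thesis using insert.hyps by (simp add: q'_def)
    qed
    show ?thesis
    proof (intro exI[of _ q'] conjI allI ballI impI)
      fix a b assume ab: "a \<in> insert i I" "b \<in> insert i I"
      have "(\<Sum>a\<in>I. e a * q a b) \<in> k" if "b \<in> I"
        using insert.prems e q(1) that by (intro ksum kc) auto
      then show "q' a b \<in> k" using q(1) kc ne ab insert.prems[OF e(1)] by (auto simp: q'_def intro!: kc)
    next
      fix x w assume w: "w \<in> W"
      let ?y = "\<lambda>a. \<Sum>b\<in>I. q a b * x b"
      have "(\<Sum>a\<in>I. w a * (\<Sum>b\<in>insert i I. q' a b * x b)) = (\<Sum>a\<in>I. w a * ?y a)"
        by (intro sum.cong refl) (simp only: qI)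
      then have "(\<Sum>a\<in>insert i I. w a * (\<Sum>b\<in>insert i I. q' a b * x b))
          = (\<Sum>a\<in>I. w a * ?y a) - w i / e i * (\<Sum>a\<in>I. e a * ?y a)"
        by (simp add: sum.insert[OF insert.hyps(1,2), of "\<lambda>a. w a * _ a"] qi del: sum.insert)
      also have "\<dots> = 0"
      proof -
        have "(\<lambda>a. w a - w i / e i * e a) \<in> W'" using w by (auto simp: W'_def)
        from q(2)[OF this, of x] show ?thesis using W'eq[of w ?y] by simp
      qed
      finally show "(\<Sum>a\<in>insert i I. w a * (\<Sum>b\<in>insert i I. q' a b * x b)) = 0" .
    next
      fix x a assume *: "\<forall>w\<in>W. (\<Sum>a\<in>insert i I. w a * x a) = 0" and a: "a \<in> insert i I"
      have s: "(\<Sum>a\<in>I. w a * x a) = - (w i * x i)" if "w \<in> W" for w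
        using * that insert.hyps by (auto simp: eq_neg_iff_add_eq_0 add.commute)
      have "\<forall>w\<in>W'. (\<Sum>a\<in>I. w a * x a) = 0"
      proof
        fix w' assume "w' \<in> W'"
        then obtain w where w: "w \<in> W" "w' = (\<lambda>a. w a - w i / e i * e a)" by (auto simp: W'_def)
        show "(\<Sum>a\<in>I. w' a * x a) = 0"
          unfolding w(2) W'eq[of w x] s[OF w(1)] s[OF e(1)] using e(2) by simp
      qed
      then have y: "(\<Sum>b\<in>I. q a b * x b) = x a" if "a \<in> I" for a using q(3) that by blast
      have "(\<Sum>a\<in>I. e a * (\<Sum>b\<in>I. q a b * x b)) = - (e i * x i)"
        using s[OF e(1)] by (simp add: y cong: sum.cong)
      then show "(\<Sum>b\<in>insert i I. q' a b * x b) = x a"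
        using a y[of a] qI[of a x] qi[of x] e(2) by (cases "a = i") (simp_all only: insert_iff, simp_all)
    qed
  qed
qed auto

section \<open>Unipotent groups are images of affine spaces\<close>

lemma prod_list_replicate_power: "prod_list (replicate k (a::'a::monoid_mult)) = a ^ k"
  by (induction k) auto

text \<open>
  By Kolchin's theorem the condition \<open>vanish\<close> holds for suitable \<open>J\<close> in every unipotent group. It
  provides one exponent \<open>J\<close> at which all exponential and logarithmic series can be cut off.
\<close>

locale unipotent_alg_group =
  fixes k :: "'c::{alg_closed_field,field_char_0} set" and n :: nat and U :: "'c mat set" and J :: nat
  assumes k: "subfield k class_ring" and grp: "algebraic_group k n U"
    and J_pos: "J > 0"
    and vanish: "\<And>as. set as \<subseteq> lin_aug (stab n ` U) \<Longrightarrow> length as = J \<Longrightarrow> prod_list as = 0"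
begin

lemmas Qk = subfield_Qclosed[OF k]

lemma U_carrier: "x \<in> U \<Longrightarrow> x \<in> carrier_mat n n" "x \<in> U \<Longrightarrow> det x \<noteq> 0" "x \<in> U \<Longrightarrow> x \<in> carrier (GL n)"
  using algebraic_groupD(1)[OF grp] by (auto simp: GL_carrier)

lemma lin_aug_nilpotent: "a \<in> lin_aug (stab n ` U) \<Longrightarrow> a ^ J = 0"
  using vanish[of "replicate J a"] J_pos by (simp add: prod_list_replicate_power)

lemma stabU:
  assumes "u \<in> stab n ` U"
  shows "u - 1 \<in> Efin n" "(u - 1) ^ J = 0" "mt n u \<in> U" "stab n (mt n u) = u"
proof -
  obtain x where x: "x \<in> U" "u = stab n x" using assms by auto
  show "u - 1 \<in> Efin n" using stab_minus_1[OF U_carrier(1)[OF x(1)]] x by simp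
  show "(u - 1) ^ J = 0"
    by (rule lin_aug_nilpotent) (use assms in \<open>auto simp: lin_aug_def intro: cvs.span_base\<close>)
  show "mt n u \<in> U" using mt_stab[OF U_carrier(1)[OF x(1)]] x by simp
  then show "stab n (mt n u) = u" using mt_stab[OF U_carrier(1)[OF x(1)]] x by simp
qed

lemma stabU_mult: "u \<in> stab n ` U \<Longrightarrow> w \<in> stab n ` U \<Longrightarrow> u * w \<in> stab n ` U"
proof -
  assume "u \<in> stab n ` U" "w \<in> stab n ` U"
  then obtain x y where "x \<in> U" "y \<in> U" "u = stab n x" "w = stab n y" by auto
  then have "x * y \<in> U" "u * w = stab n (x * y)"
    using algebraic_groupD(3)[OF grp] stab_mult[of x n y] U_carrier(1) by auto
  then show ?thesis by blast
qed

lemma stabU_one: "1 \<in> stab n ` U"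
  using algebraic_groupD(2)[OF grp] stab_one[of n] by (metis image_eqI)

lemma stabU_power: "u \<in> stab n ` U \<Longrightarrow> u ^ i \<in> stab n ` U"
  by (induction i) (auto intro: stabU_one stabU_mult)

lemma stabU_I: "u - 1 \<in> Efin n \<Longrightarrow> mt n u \<in> U \<Longrightarrow> u \<in> stab n ` U"
  using stab_mt[of u n] by (metis image_eqI)

definition I where "I = vanishing_ideal UNIV (GL_coords n) U"

lemma I_D: "f \<in> I \<Longrightarrow> f \<in> generated_algebra UNIV (GL_coords n)" "f \<in> I \<Longrightarrow> x \<in> U \<Longrightarrow> f x = 0"
  by (auto simp: I_def vanishing_ideal_def)

lemma I_I: "f \<in> generated_algebra UNIV (GL_coords n) \<Longrightarrow> (\<And>x. x \<in> U \<Longrightarrow> f x = 0) \<Longrightarrow> f \<in> I"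
  by (auto simp: I_def vanishing_ideal_def)

lemma U_closed: "x \<in> carrier (GL n) \<Longrightarrow> (\<And>f. f \<in> I \<Longrightarrow> f x = 0) \<Longrightarrow> x \<in> U"
  unfolding I_def by (rule algebraic_group_closed[OF grp])

lemma Exp_in_stabU:
  assumes X: "X \<in> Efin n" "X ^ J = 0" and f: "\<And>f. f \<in> I \<Longrightarrow> f (mt n (Exp J X)) = 0"
  shows "Exp J X \<in> stab n ` U"
proof (rule stabU_I[OF Exp_Efin[OF X]], rule U_closed[OF _ f])
  show "mt n (Exp J X) \<in> carrier (GL n)" using det_mt_Exp[OF X] by (simp add: GL_carrier)
qed

text \<open>
  The equations of the group are polynomial along the line \<open>exp (t log u)\<close> and vanish for every
  natural number \<open>t\<close>.
\<close>

lemma Exp_Log_line: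
  assumes u: "u \<in> stab n ` U"
  shows "Exp J (sc t * Log J u) \<in> stab n ` U"
proof (rule Exp_in_stabU)
  note u1 = stabU[OF u]
  let ?X = "Log J u"
  have X: "?X \<in> Efin n" "?X ^ J = 0" using Log_Efin[OF u1(1)] Log_nilpotent[OF u1(2)] by auto
  show "sc t * ?X \<in> Efin n" "(sc t * ?X) ^ J = 0" using X by (auto intro: Efin_closed nilpotent_sc)
  fix f assume f: "f \<in> I"
  obtain p where p: "\<And>t. f (mt n (Exp J (sc t * ?X))) = poly p t"
    using Exp_line_poly[OF I_D(1)[OF f] X] by auto
  have "poly p (of_nat i) = 0" for i
  proof -
    have "Exp J (sc (of_nat i) * ?X) = Exp J (sc 1 * ?X) ^ i"
      using Exp_power[OF X(2), of i 1] by simp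
    also have "\<dots> = u ^ i" using Exp_Log[OF u1(2)] by (simp add: sc_simps)
    finally have "mt n (Exp J (sc (of_nat i) * ?X)) \<in> U" using stabU(3)[OF stabU_power[OF u]] by simp
    then show ?thesis using I_D(2)[OF f] p[of "of_nat i"] by simp
  qed
  then have "p = 0" by (rule poly_zero_on_nat)
  then show "f (mt n (Exp J (sc t * ?X))) = 0" by (simp add: p)
qed

text \<open>
  The Lie algebra: the tangent space at 1, cut out by the linear parts of the polynomials with
  coefficients in \<open>k\<close> that vanish on the group.
\<close>

definition jets :: "(nat \<times> nat \<Rightarrow> 'c) set" where
  "jets = {w. (\<forall>i<n. \<forall>j<n. w (i,j) \<in> k) \<and>
     (\<exists>g\<in>generated_algebra k (mcoords n). (\<forall>x\<in>U. g x = 0) \<and> is_jet n g w)}"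

definition T :: "'c endo set" where
  "T = {X \<in> Efin n. \<forall>w\<in>jets. (\<Sum>(i,j)\<in>{..<n} \<times> {..<n}. w (i,j) * ent X i j) = 0}"

lemma ideal_generated:
  assumes "f \<in> I"
  shows "\<exists>F c. finite F \<and> F \<subseteq> vanishing_ideal k (GL_coords n) U \<and>
    (\<forall>g\<in>F. c g \<in> generated_algebra UNIV (GL_coords n)) \<and>
    (\<forall>x\<in>carrier (GL n). f x = (\<Sum>g\<in>F. c g x * g x))"
proof -
  have "\<forall>f\<in>vanishing_ideal UNIV (GL_coords n) U.
     \<exists>F c. finite F \<and> F \<subseteq> vanishing_ideal k (GL_coords n) U \<and>
    (\<forall>g\<in>F. c g \<in> generated_algebra UNIV (GL_coords n)) \<and>
    (\<forall>x\<in>carrier (GL n). f x = (\<Sum>g\<in>F. c g x * g x))"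
    using grp unfolding algebraic_group_def variety_over_def by (elim conjE)
  from bspec[OF this] show ?thesis using assms unfolding I_def .
qed

lemma cleared_generator:
  assumes h: "h \<in> vanishing_ideal k (GL_coords n) U"
  shows "\<exists>d g w. g \<in> generated_algebra k (mcoords n) \<and> (\<forall>x\<in>carrier (GL n). det x ^ d * h x = g x) \<and>
    g (1\<^sub>m n) = 0 \<and> w \<in> jets \<and> is_jet n g w"
proof -
  have h1: "h \<in> generated_algebra k (GL_coords n)" "\<And>x. x \<in> U \<Longrightarrow> h x = 0"
    using h by (auto simp: vanishing_ideal_def)
  obtain d g where g: "g \<in> generated_algebra k (mcoords n)" "\<forall>x\<in>carrier (GL n). det x ^ d * h x = g x"
    using clear_denominators[OF Qk h1(1)] by blast
  have g0: "g x = 0" if "x \<in> U" for x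
    using g(2)[rule_format, OF U_carrier(3)[OF that]] h1(2)[OF that] by simp
  obtain w where w: "\<forall>i<n. \<forall>j<n. w (i,j) \<in> k" "is_jet n g w" using jet_exists[OF Qk g(1)] by blast
  have "w \<in> jets" unfolding jets_def using w g(1) g0 by blast
  then show ?thesis using g w(2) g0[OF algebraic_groupD(2)[OF grp]]
    by (intro exI[of _ d] exI[of _ g] exI[of _ w] conjI)
qed

lemma is_jet_Exp:
  assumes X: "X ^ J = 0" and w: "is_jet n g w"
  shows "\<exists>p. (\<forall>t. g (mt n (Exp J (sc t * X))) = poly p t) \<and> Polynomial.coeff p 0 = g (1\<^sub>m n) \<and>
    Polynomial.coeff p (Suc 0) = (\<Sum>(i,j)\<in>{..<n} \<times> {..<n}. w (i,j) * ent X i j)"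
proof -
  obtain e where e: "\<And>s i j. ent (Exp J (sc s * X)) i j = poly (e i j) s"
    "\<And>i j. Polynomial.coeff (e i j) 0 = (if i = j then 1 else 0)"
    "\<And>i j. Polynomial.coeff (e i j) (Suc 0) = ent X i j"
    using Exp_entry_poly[OF X J_pos] by metis
  have "\<forall>i<n. \<forall>j<n. Polynomial.coeff (e i j) 0 = (if i = j then 1 else 0)" using e(2) by simp
  from w[unfolded is_jet_def, THEN spec, THEN mp, OF this] obtain p where p: "jet_along n g w e p" ..
  note p = p[unfolded jet_along_def]
  show ?thesis
  proof (intro exI[of _ p] conjI allI)
    show "g (mt n (Exp J (sc t * X))) = poly p t" for t
      by (rule p[THEN conjunct1, THEN spec, THEN spec, THEN mp]) (simp add: e(1))
    show "Polynomial.coeff p 0 = g (1\<^sub>m n)" by (rule p[THEN conjunct2, THEN conjunct1])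
    show "Polynomial.coeff p (Suc 0) = (\<Sum>(i,j)\<in>{..<n} \<times> {..<n}. w (i,j) * ent X i j)"
      using p[THEN conjunct2, THEN conjunct2] unfolding e(3) .
  qed
qed

text \<open>
  A tangent vector is defined by the equations over \<open>k\<close>. Since these generate the whole ideal, the
  linear term along \<open>exp (t X)\<close> vanishes for every equation of the group. The conclusion is restricted to
  nilpotent \<open>X\<close>, where the exponential is available.
\<close>

lemma tangent_coeff_zero:
  assumes f: "f \<in> I" and X: "X \<in> T" "X ^ J = 0" and p: "\<And>t. f (mt n (Exp J (sc t * X))) = poly p t"
  shows "Polynomial.coeff p (Suc 0) = 0"
proof -
  have XE: "X \<in> Efin n" using X(1) by (simp add: T_def)
  obtain F c where F: "finite F" "F \<subseteq> vanishing_ideal k (GL_coords n) U"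
    "\<forall>g\<in>F. c g \<in> generated_algebra UNIV (GL_coords n)"
    "\<forall>x\<in>carrier (GL n). f x = (\<Sum>g\<in>F. c g x * g x)"
    using ideal_generated[OF f] by (elim exE conjE) (rule that)
  note F = F(1,2) F(3)[rule_format] F(4)[rule_format]
  have det1: "det (mt n (Exp J (sc t * X))) = 1" for t
    by (intro det_mt_Exp Efin_closed nilpotent_sc XE X(2))
  have G: "mt n (Exp J (sc t * X)) \<in> carrier (GL n)" for t using det1[of t] by (simp add: GL_carrier)
  have "\<exists>q. (\<forall>t. h (mt n (Exp J (sc t * X))) = poly q t) \<and> Polynomial.coeff q 0 = 0 \<and> Polynomial.coeff q (Suc 0) = 0"
    if "h \<in> F" for h
  proof -
    obtain d g w where g: "\<forall>x\<in>carrier (GL n). det x ^ d * h x = g x" "g (1\<^sub>m n) = 0" "w \<in> jets" "is_jet n g w"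
      using cleared_generator[OF subsetD[OF F(2) \<open>h \<in> F\<close>]] by (elim exE conjE) (rule that)
    obtain q where q: "\<forall>t. g (mt n (Exp J (sc t * X))) = poly q t" "Polynomial.coeff q 0 = g (1\<^sub>m n)"
      "Polynomial.coeff q (Suc 0) = (\<Sum>(i,j)\<in>{..<n} \<times> {..<n}. w (i,j) * ent X i j)"
      using is_jet_Exp[OF X(2) g(4)] by (elim exE conjE) (rule that)
    have "h (mt n (Exp J (sc t * X))) = poly q t" for t
      using g(1)[rule_format, OF G[of t]] by (simp add: det1 q(1)[rule_format])
    moreover have "Polynomial.coeff q (Suc 0) = 0" using X(1) g(3) unfolding q(3) T_def by blast
    ultimately show ?thesis using q(2) g(2) by (intro exI[of _ q]) simp
  qed
  then have "\<forall>h\<in>F. \<exists>q. (\<forall>t. h (mt n (Exp J (sc t * X))) = poly q t) \<and> Polynomial.coeff q 0 = 0 \<and> Polynomial.coeff q (Suc 0) = 0"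
    by (rule ballI)
  from bchoice[OF this] obtain q where "\<forall>h\<in>F. (\<forall>t. h (mt n (Exp J (sc t * X))) = poly (q h) t) \<and>
      Polynomial.coeff (q h) 0 = 0 \<and> Polynomial.coeff (q h) (Suc 0) = 0" ..
  then have q: "\<And>h t. h \<in> F \<Longrightarrow> h (mt n (Exp J (sc t * X))) = poly (q h) t"
    "\<And>h. h \<in> F \<Longrightarrow> Polynomial.coeff (q h) 0 = 0" "\<And>h. h \<in> F \<Longrightarrow> Polynomial.coeff (q h) (Suc 0) = 0"
    by simp_all
  have "\<forall>h\<in>F. \<exists>r. \<forall>t. c h (mt n (Exp J (sc t * X))) = poly r t"
    by (intro ballI Exp_line_poly XE X(2) F(3))
  from bchoice[OF this] obtain r where "\<forall>h\<in>F. \<forall>t. c h (mt n (Exp J (sc t * X))) = poly (r h) t" ..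
  then have r: "\<And>h t. h \<in> F \<Longrightarrow> c h (mt n (Exp J (sc t * X))) = poly (r h) t" by simp
  have "poly p t = poly (\<Sum>h\<in>F. r h * q h) t" for t
    unfolding p[symmetric] F(4)[OF G] poly_sum poly_mult by (intro sum.cong refl) (simp add: r q(1))
  then have "p = (\<Sum>h\<in>F. r h * q h)" by (intro poly_eqI_fun) simp
  then show ?thesis using q(2,3) by (simp add: coeff_sum coeff_mult_1)
qed

text \<open>
  Tangent vectors are nilpotent because they lie in the augmentation algebra. Otherwise a linear form
  \<open>\<theta>\<close> vanishes on all \<open>u - 1\<close> and has value 1 at \<open>X\<close>. Then \<open>f x = \<theta> (x - 1)\<close> is an equation of the
  group, so it is a combination of equations over \<open>k\<close>. Along the line \<open>1 + t X\<close> the function \<open>f\<close> is \<open>t\<close>,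
  but the equations over \<open>k\<close> vanish to second order at \<open>t = 0\<close>.
\<close>

lemma T_subset_lin_aug: "T \<subseteq> lin_aug (stab n ` U)"
proof
  fix X assume X: "X \<in> T"
  then have XE: "X \<in> Efin n" by (simp add: T_def)
  show "X \<in> lin_aug (stab n ` U)"
  proof (rule ccontr)
    assume nX: "X \<notin> lin_aug (stab n ` U)"
    obtain \<theta> :: "'c endo \<Rightarrow> 'c" where \<theta>: "\<forall>x y. \<theta> (x + y) = \<theta> x + \<theta> y" "\<forall>c x. \<theta> (sc c * x) = c * \<theta> x"
      "\<forall>x\<in>lin_aug (stab n ` U). \<theta> x = 0" "\<theta> X = 1"
      using separating_functional[OF nX[unfolded lin_aug_def], folded lin_aug_def] by (elim exE conjE) (rule that)
    note add = \<theta>(1)[rule_format] and scal = \<theta>(2)[rule_format] and zero = \<theta>(3)[rule_format] and one = \<theta>(4)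
    have \<theta>0: "\<theta> 0 = 0" using scal[of 0 0] by (simp add: sc_simps)
    have \<theta>sum: "\<theta> (sum f A) = (\<Sum>a\<in>A. \<theta> (f a))" for f and A :: "nat set"
      by (induction A rule: infinite_finite_induct) (auto simp: add \<theta>0)
    define l where "l i j = \<theta> (munit n i j)" for i j
    have \<theta>E: "\<theta> Y = (\<Sum>i<n. \<Sum>j<n. l i j * ent Y i j)" if "Y \<in> Efin n" for Y
    proof -
      have "\<theta> Y = \<theta> (\<Sum>i<n. \<Sum>j<n. sc (ent Y i j) * munit n i j)" using Efin_expand[OF that] by simp
      then show ?thesis by (simp add: \<theta>sum scal l_def mult.commute)
    qed
    define f where "f x = (\<Sum>i<n. \<Sum>j<n. l i j * (x $$ (i,j) + (if i = j then - 1 else 0)))" for x :: "'c mat"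
    have f_gen: "f \<in> generated_algebra UNIV (GL_coords n)"
      by (rule regular_UNIV_D, unfold f_def)
        (intro regular_sum regular_mult regular_add regular_const regular_gen, auto simp: GL_coords_def)
    have f_ent: "f x = (\<Sum>i<n. \<Sum>j<n. l i j * (x $$ (i,j) - (if i = j then 1 else 0)))" for x
      unfolding f_def by (intro sum.cong refl) auto
    have "f \<in> I"
    proof (rule I_I[OF f_gen])
      fix x assume x: "x \<in> U"
      then have S: "stab n x \<in> stab n ` U" by auto
      have "stab n x - 1 \<in> lin_aug (stab n ` U)" unfolding lin_aug_def using S by (intro cvs.span_base) auto
      from zero[OF this] have "(\<Sum>i<n. \<Sum>j<n. l i j * ent (stab n x - 1) i j) = 0"
        unfolding \<theta>E[OF stabU(1)[OF S]] .
      moreover have "ent (stab n x - 1) i j = x $$ (i,j) - (if i = j then 1 else 0)" if "i < n" "j < n" for i j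
        using mt_index[OF that, of "stab n x"] mt_stab[OF U_carrier(1)[OF x]] by (simp add: ent_simps)
      ultimately show "f x = 0" unfolding f_ent by simp
    qed
    from ideal_generated[OF this] obtain F c where F: "finite F" "F \<subseteq> vanishing_ideal k (GL_coords n) U"
      "\<forall>g\<in>F. c g \<in> generated_algebra UNIV (GL_coords n)"
      "\<forall>x\<in>carrier (GL n). f x = (\<Sum>g\<in>F. c g x * g x)"
      by (elim exE conjE) (rule that)
    note F = F(1,2) F(3)[rule_format] F(4)[rule_format]
    have "\<forall>h\<in>F. \<exists>d g w. g \<in> generated_algebra k (mcoords n) \<and> (\<forall>x\<in>carrier (GL n). det x ^ d * h x = g x) \<and>
      g (1\<^sub>m n) = 0 \<and> w \<in> jets \<and> is_jet n g w" by (intro ballI cleared_generator subsetD[OF F(2)])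
    from bchoice[OF this] obtain d where "\<forall>h\<in>F. \<exists>g w. g \<in> generated_algebra k (mcoords n) \<and>
      (\<forall>x\<in>carrier (GL n). det x ^ d h * h x = g x) \<and> g (1\<^sub>m n) = 0 \<and> w \<in> jets \<and> is_jet n g w" ..
    from bchoice[OF this] obtain g where "\<forall>h\<in>F. \<exists>w. g h \<in> generated_algebra k (mcoords n) \<and>
      (\<forall>x\<in>carrier (GL n). det x ^ d h * h x = g h x) \<and> g h (1\<^sub>m n) = 0 \<and> w \<in> jets \<and> is_jet n (g h) w" ..
    from bchoice[OF this] obtain w where "\<forall>h\<in>F. g h \<in> generated_algebra k (mcoords n) \<and>
      (\<forall>x\<in>carrier (GL n). det x ^ d h * h x = g h x) \<and> g h (1\<^sub>m n) = 0 \<and> w h \<in> jets \<and> is_jet n (g h) (w h)" ..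
    then have g: "\<And>h x. h \<in> F \<Longrightarrow> x \<in> carrier (GL n) \<Longrightarrow> det x ^ d h * h x = g h x"
      "\<And>h. h \<in> F \<Longrightarrow> g h (1\<^sub>m n) = 0" "\<And>h. h \<in> F \<Longrightarrow> w h \<in> jets" "\<And>h. h \<in> F \<Longrightarrow> is_jet n (g h) (w h)"
      by blast+
    have "\<forall>h\<in>F. \<exists>d g. g \<in> generated_algebra UNIV (mcoords n) \<and> (\<forall>x\<in>carrier (GL n). det x ^ d * c h x = g x)"
      using clear_denominators[OF Qclosed_UNIV F(3)] unfolding Bex_def by (intro ballI)
    from bchoice[OF this] obtain d' where "\<forall>h\<in>F. \<exists>g. g \<in> generated_algebra UNIV (mcoords n) \<and>
      (\<forall>x\<in>carrier (GL n). det x ^ d' h * c h x = g x)" ..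
    from bchoice[OF this] obtain c' where "\<forall>h\<in>F. c' h \<in> generated_algebra UNIV (mcoords n) \<and>
      (\<forall>x\<in>carrier (GL n). det x ^ d' h * c h x = c' h x)" ..
    then have c': "\<And>h. h \<in> F \<Longrightarrow> c' h \<in> generated_algebra UNIV (mcoords n)"
      "\<And>h x. h \<in> F \<Longrightarrow> x \<in> carrier (GL n) \<Longrightarrow> det x ^ d' h * c h x = c' h x" by blast+
    define M where "M = (\<Sum>h\<in>F. d h + d' h)"
    have M: "d h + d' h \<le> M" if "h \<in> F" for h unfolding M_def using F(1) that by (intro member_le_sum) auto
    have eq: "det x ^ M * f x = (\<Sum>h\<in>F. det x ^ (M - (d h + d' h)) * (c' h x * g h x))" if x: "x \<in> carrier (GL n)" for x
    proof -
      have "det x ^ M * f x = (\<Sum>h\<in>F. det x ^ M * (c h x * h x))"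
        unfolding F(4)[OF x] by (rule sum_distrib_left)
      also have "\<dots> = (\<Sum>h\<in>F. det x ^ (M - (d h + d' h)) * (c' h x * g h x))"
      proof (rule sum.cong[OF refl])
        fix h assume h: "h \<in> F"
        have "det x ^ M = det x ^ (M - (d h + d' h)) * (det x ^ d h * det x ^ d' h)"
          unfolding power_add[symmetric] using M[OF h] by simp
        then show "det x ^ M * (c h x * h x) = det x ^ (M - (d h + d' h)) * (c' h x * g h x)"
          unfolding g(1)[OF h x, symmetric] c'(2)[OF h x, symmetric] by (simp add: mult_ac)
      qed
      finally show ?thesis .
    qed
    define P where "P i j = [:if i = j then 1 else 0, ent X i j:]" for i j :: nat
    have P0: "\<forall>i<n. \<forall>j<n. Polynomial.coeff (P i j) 0 = (if i = j then 1 else 0)" by (simp add: P_def)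
    have P1: "Polynomial.coeff (P i j) (Suc 0) = ent X i j" for i j by (simp add: P_def)
    define x where "x t = mat n n (\<lambda>(i,j). poly (P i j) t)" for t
    have xc: "x t \<in> carrier_mat n n" for t by (simp add: x_def)
    have xe: "\<forall>i<n. \<forall>j<n. x t $$ (i,j) = poly (P i j) t" for t by (simp add: x_def)
    have jet: "\<exists>p. (\<forall>t. h (x t) = poly p t) \<and> Polynomial.coeff p 0 = h (1\<^sub>m n) \<and>
        Polynomial.coeff p (Suc 0) = (\<Sum>(i,j)\<in>{..<n} \<times> {..<n}. w (i,j) * ent X i j)" if "is_jet n h w" for h w
    proof -
      from that[unfolded is_jet_def, THEN spec, THEN mp, OF P0] obtain p where "jet_along n h w P p" ..
      note p = this[unfolded jet_along_def]
      show ?thesis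
        using p[THEN conjunct1, THEN spec, THEN spec, THEN mp, OF xe] p[THEN conjunct2] unfolding P1
        by (intro exI[of _ p] conjI allI) (elim conjE, assumption)+
    qed
    have "\<forall>h\<in>F. \<exists>p. (\<forall>t. g h (x t) = poly p t) \<and> Polynomial.coeff p 0 = 0 \<and> Polynomial.coeff p (Suc 0) = 0"
    proof
      fix h assume h: "h \<in> F"
      have "(\<Sum>(i,j)\<in>{..<n} \<times> {..<n}. w h (i,j) * ent X i j) = 0" using X g(3)[OF h] unfolding T_def by blast
      then show "\<exists>p. (\<forall>t. g h (x t) = poly p t) \<and> Polynomial.coeff p 0 = 0 \<and> Polynomial.coeff p (Suc 0) = 0"
        using jet[OF g(4)[OF h]] g(2)[OF h] by simp
    qed
    from bchoice[OF this] obtain pg where "\<forall>h\<in>F. (\<forall>t. g h (x t) = poly (pg h) t) \<and>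
      Polynomial.coeff (pg h) 0 = 0 \<and> Polynomial.coeff (pg h) (Suc 0) = 0" ..
    then have pg: "\<And>h t. h \<in> F \<Longrightarrow> g h (x t) = poly (pg h) t"
      "\<And>h. h \<in> F \<Longrightarrow> Polynomial.coeff (pg h) 0 = 0" "\<And>h. h \<in> F \<Longrightarrow> Polynomial.coeff (pg h) (Suc 0) = 0"
      by simp_all
    have "\<forall>h\<in>F. \<exists>p. \<forall>t. c' h (x t) = poly p t"
    proof
      fix h assume "h \<in> F"
      from jet_exists[OF Qclosed_UNIV c'(1)[OF this]] obtain v where "is_jet n (c' h) v" by (elim exE conjE)
      from jet[OF this] show "\<exists>p. \<forall>t. c' h (x t) = poly p t" by (elim exE conjE) (rule exI)
    qed
    from bchoice[OF this] obtain pc where "\<forall>h\<in>F. \<forall>t. c' h (x t) = poly (pc h) t" ..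
    then have pc: "\<And>h t. h \<in> F \<Longrightarrow> c' h (x t) = poly (pc h) t" by simp
    obtain \<delta> :: "'c mat \<Rightarrow> 'c" where \<delta>: "\<delta> \<in> generated_algebra UNIV (mcoords n)" "\<forall>x\<in>carrier_mat n n. det x = \<delta> x"
      using regular_det[OF Qclosed_UNIV, of n] unfolding regular_def by (elim bexE) (rule that)
    note \<delta> = \<delta>(1) \<delta>(2)[rule_format]
    obtain pd where pd: "\<And>t. det (x t) = poly pd t" "Polynomial.coeff pd 0 = 1"
    proof -
      obtain v where "is_jet n \<delta> v" using jet_exists[OF Qclosed_UNIV \<delta>(1)] by (elim exE conjE)
      from jet[OF this] obtain p where p: "\<forall>t. \<delta> (x t) = poly p t" "Polynomial.coeff p 0 = \<delta> (1\<^sub>m n)"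
        by (elim exE conjE) (rule that)
      have "\<delta> (1\<^sub>m n) = 1" using \<delta>(2)[of "1\<^sub>m n"] by simp
      then have 1: "Polynomial.coeff p 0 = 1" using p(2) by simp
      have "det (x t) = poly p t" for t using \<delta>(2)[OF xc[of t]] p(1) by simp
      then show ?thesis using 1 by (rule that)
    qed
    have fx: "f (x t) = t" for t
    proof -
      have "f (x t) = (\<Sum>i<n. \<Sum>j<n. t * (l i j * ent X i j))"
        unfolding f_ent by (intro sum.cong refl) (simp add: x_def P_def mult_ac)
      also have "\<dots> = t * \<theta> X" unfolding \<theta>E[OF XE] by (simp add: sum_distrib_left)
      finally show ?thesis by (simp add: one)
    qed
    (* Both sides of eq along the line are compared as polynomials in t. The equation holds
       where the determinant pd of 1 + t X is nonzero, which is why the difference is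
       multiplied by pd before it is shown to vanish. *)
    define A where "A = pd ^ M * [:0,1:]"
    define B where "B = (\<Sum>h\<in>F. pd ^ (M - (d h + d' h)) * (pc h * pg h))"
    have "poly (pd * (A - B)) t = 0" for t
    proof (cases "poly pd t = 0")
      case False
      then have "x t \<in> carrier (GL n)" using xc by (simp add: GL_carrier pd(1))
      note eq' = eq[OF this]
      have "poly A t = det (x t) ^ M * f (x t)" by (simp add: A_def fx pd(1) mult.commute)
      moreover have "poly B t = (\<Sum>h\<in>F. det (x t) ^ (M - (d h + d' h)) * (c' h (x t) * g h (x t)))"
        unfolding B_def poly_sum by (intro sum.cong refl) (simp add: pd(1) pc pg(1))
      ultimately have "poly A t = poly B t" using eq' by simp
      then show ?thesis by simp
    qed simp
    then have "pd * (A - B) = 0" by (rule poly_all_zero)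
    moreover have "pd \<noteq> 0" using pd(2) by auto
    ultimately have "A = B" by simp
    moreover have "Polynomial.coeff A (Suc 0) = 1"
    proof -
      have "Polynomial.coeff (pd ^ M) 0 = 1" by (induction M) (auto simp: coeff_mult_zero pd(2))
      then show ?thesis by (simp add: A_def coeff_mult_1)
    qed
    moreover have "Polynomial.coeff B (Suc 0) = 0"
      unfolding B_def coeff_sum by (intro sum.neutral ballI) (simp add: coeff_mult_1 coeff_mult_zero pg)
    ultimately show False by simp
  qed
qed

lemma T_nilpotent: "X \<in> T \<Longrightarrow> X \<in> Efin n" "X \<in> T \<Longrightarrow> X ^ J = 0"
  using T_subset_lin_aug lin_aug_nilpotent by (auto simp: T_def)

text \<open>
  The derivation along a tangent vector maps the ideal of the group to itself, so all derivatives
  at 0 of \<open>f\<close> along the one-parameter group vanish for \<open>f\<close> in the ideal.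
\<close>

lemma I_derivation:
  assumes X: "X \<in> T" and f: "f \<in> I"
  shows "\<exists>f1\<in>I. \<forall>w\<in>carrier (GL n). \<exists>p. (\<forall>s. f (w * mt n (Exp J (sc s * X))) = poly p s) \<and>
        Polynomial.coeff p 0 = f w \<and> Polynomial.coeff p (Suc 0) = f1 w"
proof -
  note XT = T_nilpotent[OF X]
  obtain f1 where f1: "f1 \<in> generated_algebra UNIV (GL_coords n)"
    "\<And>w. w \<in> carrier (GL n) \<Longrightarrow> \<exists>p. (\<forall>s. f (w * mt n (Exp J (sc s * X))) = poly p s) \<and>
        Polynomial.coeff p 0 = f w \<and> Polynomial.coeff p (Suc 0) = f1 w"
    using translation_derivative[OF XT J_pos I_D(1)[OF f]] by (elim bexE) (rule that, auto)
  have "f1 x = 0" if x: "x \<in> U" for x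
  proof -
    have "regular UNIV (GL_coords n) (carrier (GL n)) (\<lambda>y. f (mt n (stab n x * stab n y)))"
    proof (rule regular_GL[OF I_D(1)[OF f]])
      show "regmat UNIV (GL_coords n) (carrier (GL n)) n (\<lambda>y. stab n x * stab n y)"
        by (intro regmat_mult regmat_const regmat_stab stab_Cfin) (auto simp: GL_carrier U_carrier[OF x])
      have "det (mt n (stab n x * stab n y)) = det x * det y" if "y \<in> carrier (GL n)" for y
        using that U_carrier[OF x] by (simp add: GL_carrier mt_mult stab_Cfin mt_stab det_mult[of _ n])
      moreover have "regular UNIV (GL_coords n) (carrier (GL n)) (\<lambda>y. inverse (det x) * inverse (det y))"
        by (intro regular_mult regular_const regular_gen) (auto simp: GL_coords_def)
      ultimately show "regular UNIV (GL_coords n) (carrier (GL n)) (\<lambda>y. inverse (det (mt n (stab n x * stab n y))))"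
        by (subst regular_cong) auto
    qed
    then obtain g where g: "g \<in> generated_algebra UNIV (GL_coords n)"
      "\<And>y. y \<in> carrier (GL n) \<Longrightarrow> f (mt n (stab n x * stab n y)) = g y"
      unfolding regular_def by blast
    have gxy: "g y = f (x * y)" if "y \<in> carrier (GL n)" for y
      using g(2)[OF that] that U_carrier[OF x] by (simp add: GL_carrier mt_mult stab_Cfin mt_stab)
    have "g \<in> I"
    proof (rule I_I[OF g(1)])
      fix y assume y: "y \<in> U"
      show "g y = 0" unfolding gxy[OF U_carrier(3)[OF y]]
        by (rule I_D(2)[OF f algebraic_groupD(3)[OF grp x y]])
    qed
    obtain p where p: "\<And>s. f (x * mt n (Exp J (sc s * X))) = poly p s" "Polynomial.coeff p (Suc 0) = f1 x"
      using f1(2)[OF U_carrier(3)[OF x]] by blast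
    have "mt n (Exp J (sc s * X)) \<in> carrier (GL n)" for s
      using det_mt_Exp[OF Efin_closed(5)[OF XT(1)] nilpotent_sc[OF XT(2)], of s] by (simp add: GL_carrier)
    then have "g (mt n (Exp J (sc s * X))) = poly p s" for s using gxy p(1) by simp
    from tangent_coeff_zero[OF \<open>g \<in> I\<close> X XT(2) this] p(2) show ?thesis by simp
  qed
  then have "f1 \<in> I" by (intro I_I f1(1))
  then show ?thesis using f1(2) by (intro bexI[of _ f1] ballI)
qed

lemma coeff_shift: "Polynomial.coeff (pcompose p [:t, 1:]) (Suc 0) = poly (pderiv p) (t :: 'c)"
proof -
  have "Polynomial.coeff (pcompose p [:t, 1:]) (Suc 0) = Polynomial.coeff (pderiv (pcompose p [:t, 1:])) 0"
    by (simp add: coeff_pderiv)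
  also have "\<dots> = poly (pderiv p) t"
    by (simp add: pderiv_pcompose pderiv_pCons poly_0_coeff_0[symmetric] poly_pcompose)
  finally show ?thesis .
qed

text \<open>
  Induction on the degree: the derivative of \<open>p\<close> is the polynomial that belongs to the derivative of
  \<open>f\<close> along \<open>X\<close>, which lies in the ideal again, and \<open>p\<close> has no constant term.
\<close>

lemma I_zero_on_Exp:
  assumes X: "X \<in> T" and f: "f \<in> I" and p: "\<And>t. f (mt n (Exp J (sc t * X))) = poly p t"
  shows "p = 0"
  using f p
proof (induction "degree p" arbitrary: f p rule: less_induct)
  case less
  note XT = T_nilpotent[OF X]
  obtain f1 where f1: "f1 \<in> I" "\<And>w. w \<in> carrier (GL n) \<Longrightarrow> \<exists>p. (\<forall>s. f (w * mt n (Exp J (sc s * X))) = poly p s) \<and>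
        Polynomial.coeff p 0 = f w \<and> Polynomial.coeff p (Suc 0) = f1 w"
    using I_derivation[OF X less.prems(1)] by (elim bexE) (rule that, auto)
  let ?E = "\<lambda>t. mt n (Exp J (sc t * X))"
  have E: "?E t \<in> carrier (GL n)" for t
    using det_mt_Exp[OF Efin_closed(5)[OF XT(1)] nilpotent_sc[OF XT(2)], of t] by (simp add: GL_carrier)
  have ECfin: "Exp J (sc t * X) \<in> Cfin n" for t
  proof -
    have "Exp J (sc t * X) - 1 \<in> Efin n" by (intro Exp_Efin Efin_closed nilpotent_sc XT)
    then have "(Exp J (sc t * X) - 1) + 1 \<in> Cfin n" by (intro Cfin_closed Efin_Cfin)
    then show ?thesis by simp
  qed
  have p0: "poly p 0 = 0"
    using less.prems(2)[of 0] I_D(2)[OF less.prems(1) algebraic_groupD(2)[OF grp]]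
    by (simp only: Exp_sc_zero[OF XT(2)] mt_one)
  have f1p: "f1 (?E t) = poly (pderiv p) t" for t
  proof -
    obtain q where q: "\<And>s. f (?E t * ?E s) = poly q s" "Polynomial.coeff q (Suc 0) = f1 (?E t)"
      using f1(2)[OF E] by blast
    have "?E t * ?E s = ?E (t + s)" for s
      by (simp only: Exp_add[OF XT(2)] mt_mult[OF ECfin])
    then have "poly q s = poly (pcompose p [:t,1:]) s" for s
      using q(1)[of s] less.prems(2)[of "t + s"] by (simp add: poly_pcompose)
    then have "q = pcompose p [:t,1:]" by (intro poly_eqI_fun)
    then show ?thesis using q(2) coeff_shift by simp
  qed
  show ?case
  proof (cases "degree p = 0")
    case True
    then obtain a where "p = [:a:]" by (auto elim: degree_eq_zeroE)
    then show ?thesis using p0 by simp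
  next
    case False
    then have "degree (pderiv p) < degree p" by (simp add: degree_pderiv)
    from less.hyps[OF this f1(1) f1p] have "pderiv p = 0" .
    then have "degree p = 0" by (simp add: pderiv_eq_0_iff)
    with False show ?thesis by simp
  qed
qed

lemma Exp_T: "X \<in> T \<Longrightarrow> Exp J X \<in> stab n ` U"
proof (rule Exp_in_stabU)
  assume X: "X \<in> T"
  note XT = T_nilpotent[OF X]
  show "X \<in> Efin n" "X ^ J = 0" by (rule XT)+
  fix f assume f: "f \<in> I"
  obtain p where p: "\<And>t. f (mt n (Exp J (sc t * X))) = poly p t"
    using Exp_line_poly[OF I_D(1)[OF f] XT] by auto
  from I_zero_on_Exp[OF X f p] p[of 1] show "f (mt n (Exp J X)) = 0" by (simp add: sc_simps)
qed

lemma Log_T: "u \<in> stab n ` U \<Longrightarrow> Log J u \<in> T"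
proof -
  assume u: "u \<in> stab n ` U"
  note u1 = stabU[OF u]
  have X: "Log J u \<in> Efin n" "Log J u ^ J = 0" using Log_Efin[OF u1(1)] Log_nilpotent[OF u1(2)] by auto
  have "(\<Sum>(i,j)\<in>{..<n} \<times> {..<n}. w (i,j) * ent (Log J u) i j) = 0" if w: "w \<in> jets" for w
  proof -
    obtain g where g: "\<And>x. x \<in> U \<Longrightarrow> g x = 0" "is_jet n g w" using w unfolding jets_def by blast
    obtain p where p: "\<forall>t. g (mt n (Exp J (sc t * Log J u))) = poly p t"
      "Polynomial.coeff p (Suc 0) = (\<Sum>(i,j)\<in>{..<n} \<times> {..<n}. w (i,j) * ent (Log J u) i j)"
      using is_jet_Exp[OF X(2) g(2)] by (elim exE conjE) (rule that)
    have "poly p t = 0" for t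
      unfolding p(1)[rule_format, symmetric] by (rule g(1)[OF stabU(3)[OF Exp_Log_line[OF u]]])
    then have "p = 0" by (rule poly_all_zero)
    then show ?thesis using p(2) by simp
  qed
  then show ?thesis using X(1) by (simp add: T_def)
qed

end

text \<open>The linear map of the space of matrices with coefficient matrix \<open>q\<close>.\<close>

definition lproj :: "nat \<Rightarrow> (nat \<times> nat \<Rightarrow> nat \<times> nat \<Rightarrow> 'c::field) \<Rightarrow> 'c endo \<Rightarrow> 'c endo" where
  "lproj n q X = emb (mat n n (\<lambda>a. \<Sum>b\<in>{..<n} \<times> {..<n}. q a b * ent X (fst b) (snd b)))"

lemma lproj_Efin: "lproj n q X \<in> Efin n"
  unfolding lproj_def by (intro Efin_emb) simp

lemma ent_lproj: "i < n \<Longrightarrow> j < n \<Longrightarrow>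
    ent (lproj n q X) i j = (\<Sum>b\<in>{..<n} \<times> {..<n}. q (i,j) b * ent X (fst b) (snd b))"
  by (simp add: lproj_def ent_emb)

lemma regmat_lproj:
  assumes "0 \<in> k" "\<And>a b. a \<in> {..<n} \<times> {..<n} \<Longrightarrow> b \<in> {..<n} \<times> {..<n} \<Longrightarrow> q a b \<in> k" "regmat k C D n F"
  shows "regmat k C D n (\<lambda>x. lproj n q (F x))"
  unfolding regmat_def
proof (intro conjI ballI allI impI)
  show "lproj n q (F x) \<in> Cfin n" for x by (rule Efin_Cfin[OF lproj_Efin])
  fix i j assume ij: "i < n" "j < n"
  have "regular k C D (\<lambda>x. \<Sum>b\<in>{..<n} \<times> {..<n}. q (i,j) b * ent (F x) (fst b) (snd b))"
    using assms ij by (intro regular_sum regular_mult regular_const) (auto simp: regmat_def)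
  then show "regular k C D (\<lambda>x. ent (lproj n q (F x)) i j)" by (simp add: ent_lproj[OF ij])
qed

text \<open>
  The matrix \<open>q\<close> describes a projection onto the Lie algebra, so \<open>X \<mapsto> exp (q X)\<close> is a surjective
  polynomial map, with coefficients in \<open>k\<close>, from an affine space onto the group.
\<close>

theorem (in unipotent_alg_group) parametrisation:
  obtains q where "\<And>a b. a \<in> {..<n} \<times> {..<n} \<Longrightarrow> b \<in> {..<n} \<times> {..<n} \<Longrightarrow> q a b \<in> k"
    "\<And>X. lproj n q X ^ J = 0" "\<And>X. Exp J (lproj n q X) \<in> stab n ` U"
    "\<And>u. u \<in> stab n ` U \<Longrightarrow> lproj n q (Log J u) = Log J u"
proof -
  let ?I = "{..<n} \<times> {..<n}"
  have "\<exists>q. (\<forall>a\<in>?I. \<forall>b\<in>?I. q a b \<in> k) \<and>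
    (\<forall>x. \<forall>w\<in>jets. (\<Sum>a\<in>?I. w a * (\<Sum>b\<in>?I. q a b * x b)) = 0) \<and>
    (\<forall>x. (\<forall>w\<in>jets. (\<Sum>a\<in>?I. w a * x a) = 0) \<longrightarrow> (\<forall>a\<in>?I. (\<Sum>b\<in>?I. q a b * x b) = x a))"
  proof (rule rational_projection[OF k])
    fix w and a :: "nat \<times> nat" assume "w \<in> jets" "a \<in> ?I"
    then show "w a \<in> k" unfolding jets_def by (cases a) simp
  qed simp
  then obtain q where q: "\<forall>a\<in>?I. \<forall>b\<in>?I. q a b \<in> k"
    "\<forall>x. \<forall>w\<in>jets. (\<Sum>a\<in>?I. w a * (\<Sum>b\<in>?I. q a b * x b)) = 0"
    "\<forall>x. (\<forall>w\<in>jets. (\<Sum>a\<in>?I. w a * x a) = 0) \<longrightarrow> (\<forall>a\<in>?I. (\<Sum>b\<in>?I. q a b * x b) = x a)"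
    by (elim exE conjE) (rule that)
  note q = q(1)[rule_format] q(2)[THEN spec, THEN bspec] q(3)[THEN spec, THEN mp, THEN bspec]
  have T: "lproj n q X \<in> T" for X
  proof -
    have "(\<Sum>(i,j)\<in>?I. w (i,j) * ent (lproj n q X) i j) = 0" if "w \<in> jets" for w
    proof -
      have "(\<Sum>(i,j)\<in>?I. w (i,j) * ent (lproj n q X) i j)
          = (\<Sum>a\<in>?I. w a * (\<Sum>b\<in>?I. q a b * (case b of (i,j) \<Rightarrow> ent X i j)))"
        by (intro sum.cong refl) (auto simp: ent_lproj case_prod_unfold)
      then show ?thesis using q(2)[OF that, of "\<lambda>(i,j). ent X i j"] by simp
    qed
    then show ?thesis by (simp add: T_def lproj_Efin)
  qed
  show ?thesis
  proof (rule that[OF q(1)])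
    show "lproj n q X ^ J = 0" for X by (rule T_nilpotent(2)[OF T])
    show "Exp J (lproj n q X) \<in> stab n ` U" for X by (rule Exp_T[OF T])
    fix u assume u: "u \<in> stab n ` U"
    have L: "Log J u \<in> T" by (rule Log_T[OF u])
    have "\<forall>w\<in>jets. (\<Sum>a\<in>?I. w a * (case a of (i,j) \<Rightarrow> ent (Log J u) i j)) = 0"
    proof
      fix w assume "w \<in> jets"
      then have "(\<Sum>(i,j)\<in>?I. w (i,j) * ent (Log J u) i j) = 0" using L unfolding T_def by blast
      moreover have "(\<Sum>(i,j)\<in>?I. w (i,j) * ent (Log J u) i j) = (\<Sum>a\<in>?I. w a * (case a of (i,j) \<Rightarrow> ent (Log J u) i j))"
        by (intro sum.cong refl) auto
      ultimately show "(\<Sum>a\<in>?I. w a * (case a of (i,j) \<Rightarrow> ent (Log J u) i j)) = 0" by simp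
    qed
    from q(3)[OF this] have fixed: "(\<Sum>b\<in>?I. q (i,j) b * ent (Log J u) (fst b) (snd b)) = ent (Log J u) i j"
      if "i < n" "j < n" for i j
      using that by (auto simp: case_prod_unfold)
    show "lproj n q (Log J u) = Log J u"
      by (rule Efin_eqI[OF lproj_Efin T_nilpotent(1)[OF L]]) (simp add: ent_lproj fixed)
  qed
qed

lemma unipotent_alg_group_exists:
  fixes k :: "'c::{alg_closed_field,field_char_0} set"
  assumes "subfield k class_ring" "algebraic_group k n U" "unipotent_group n U"
  shows "\<exists>J. unipotent_alg_group k n U J"
proof -
  have Uc: "x \<in> carrier_mat n n" if "x \<in> U" for x
    using algebraic_groupD(1)[OF assms(2)] that by (auto simp: GL_carrier)
  have "\<exists>J>0. \<forall>as. set as \<subseteq> lin_aug (stab n ` U) \<and> length as = J \<longrightarrow> prod_list as = 0"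
  proof (rule unipotent_products_vanish)
    show "u * w \<in> stab n ` U" if uw: "u \<in> stab n ` U" "w \<in> stab n ` U" for u w
    proof -
      obtain x y where "x \<in> U" "y \<in> U" "u = stab n x" "w = stab n y" using uw by auto
      then have "x * y \<in> U" "u * w = stab n (x * y)"
        using algebraic_groupD(3)[OF assms(2)] stab_mult[of x n y] Uc by auto
      then show ?thesis by blast
    qed
    show "u - 1 \<in> Efin n" if "u \<in> stab n ` U" for u using that stab_minus_1 Uc by auto
    fix u assume "u \<in> stab n ` U"
    then obtain x where x: "x \<in> U" "u = stab n x" by auto
    obtain l where l: "(x - 1\<^sub>m n) ^\<^sub>m l = 0\<^sub>m n n" using assms(3) x(1) unfolding unipotent_group_def by blast
    have c: "x - 1\<^sub>m n \<in> carrier_mat n n" using Uc[OF x(1)] by (intro minus_carrier_mat) auto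
    have "emb (x - 1\<^sub>m n) ^ Suc l = emb ((x - 1\<^sub>m n) ^\<^sub>m Suc l)"
    proof -
      have "mt n (emb (x - 1\<^sub>m n) ^ Suc l) = (x - 1\<^sub>m n) ^\<^sub>m Suc l"
        using mt_power[OF Efin_Cfin[OF Efin_emb[OF c]], of "Suc l"] by (simp only: mt_emb[OF c])
      moreover have "emb (x - 1\<^sub>m n) ^ Suc l \<in> Efin n" by (rule Efin_power[OF Efin_emb[OF c]]) simp
      ultimately show ?thesis using emb_mt by metis
    qed
    also have "(x - 1\<^sub>m n) ^\<^sub>m Suc l = 0\<^sub>m n n" using l c by simp
    finally have "emb (x - 1\<^sub>m n) ^ Suc l = 0" by (simp only: emb_zero)
    then have "(u - 1) ^ Suc l = 0" unfolding x(2) stab_def by (simp only: add_diff_cancel_left')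
    then show "\<exists>l. (u - 1) ^ l = 0" by (rule exI)
  qed
  then obtain J where "J > 0" "\<forall>as. set as \<subseteq> lin_aug (stab n ` U) \<and> length as = J \<longrightarrow> prod_list as = 0"
    by (elim exE conjE)
  then have "unipotent_alg_group k n U J" using assms(1,2) by (intro unipotent_alg_group.intro) simp_all
  then show ?thesis by (rule exI)
qed

section \<open>Divisible families of rational matrices\<close>

lemma rational_char_poly:
  fixes B :: "'c::field_char_0 mat"
  assumes B: "B \<in> carrier_mat m m" and rat: "\<And>i j. i < m \<Longrightarrow> j < m \<Longrightarrow> B $$ (i,j) \<in> \<rat>"
  obtains p :: "rat poly" where "char_poly B = map_poly of_rat p" "p \<noteq> 0" "degree p = m"
proof -
  define B0 :: "rat mat" where "B0 = mat m m (\<lambda>ij. SOME q. B $$ ij = of_rat q)"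
  have B0: "B0 \<in> carrier_mat m m" by (simp add: B0_def)
  have "B $$ (i,j) = of_rat (B0 $$ (i,j))" if "i < m" "j < m" for i j
  proof -
    have "\<exists>q. B $$ (i,j) = of_rat q" using rat[OF that] by (auto elim: Rats_cases)
    from someI_ex[OF this] show ?thesis using that by (simp add: B0_def)
  qed
  then have "B = map_mat of_rat B0" using B B0 by (intro eq_matI) auto
  then have 1: "char_poly B = map_poly of_rat (char_poly B0)"
    using of_rat_hom.char_poly_hom[OF B0] by metis
  have "degree (char_poly B0) = m" "char_poly B0 \<noteq> 0"
    using degree_monic_char_poly[OF B0] by auto
  with 1 show ?thesis by (intro that)
qed

definition ipoly_root :: "int poly \<Rightarrow> 'c::field_char_0 \<Rightarrow> bool" where
  "ipoly_root h x \<longleftrightarrow> poly (map_poly of_int h) x = 0"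

lemma of_rat_of_int_poly: "map_poly of_rat (map_poly of_int h :: rat poly) = (map_poly of_int h :: 'c::field_char_0 poly)"
  by (subst map_poly_map_poly) (auto simp: o_def)

text \<open>
  The polynomial \<open>h\<close> is the primitive multiple of the minimal polynomial of \<open>x\<close>; it divides integral
  polynomials with root \<open>x\<close> over the integers by Gauss's lemma.
\<close>

lemma integral_factor:
  fixes x :: "'c::field_char_0"
  assumes p: "p \<noteq> 0" "poly (map_poly of_rat p) x = 0"
  obtains h where "h \<noteq> 0" "degree h \<le> degree p" "ipoly_root h x"
    "\<And>f. ipoly_root f x \<Longrightarrow> h dvd f"
proof -
  obtain g where g: "g \<noteq> 0 \<and> poly (map_poly of_rat g) x = 0"
    and min: "\<And>q. q \<noteq> 0 \<and> poly (map_poly of_rat q) x = 0 \<Longrightarrow> degree g \<le> degree q"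
    using ex_has_least_nat[of "\<lambda>q. q \<noteq> 0 \<and> poly (map_poly of_rat q) x = 0" p degree] p by blast
  obtain d h where dh: "rat_to_normalized_int_poly g = (d, h)" by fastforce
  note r = rat_to_normalized_int_poly[OF dh]
  have "map_poly of_rat g = smult (of_rat d) (map_poly of_int h :: 'c poly)"
    by (subst r(1)) (simp add: of_rat_hom.map_poly_hom_smult of_rat_of_int_poly)
  then have root: "ipoly_root h x" using g r(2) by (simp add: ipoly_root_def)
  show ?thesis
  proof (rule that)
    show "h \<noteq> 0" using r(1) g by auto
    show "degree h \<le> degree p" using min[of p] p r(4) by simp
    show "ipoly_root h x" by (rule root)
    fix f assume f: "ipoly_root f x"
    let ?f = "map_poly of_int f :: rat poly"
    have "poly (map_poly of_rat (?f mod g)) x = 0"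
    proof -
      interpret rp: map_poly_idom_hom "of_rat :: rat \<Rightarrow> 'c" ..
      have "(map_poly of_rat ?f :: 'c poly) = map_poly of_rat (?f div g * g + ?f mod g)" by simp
      also have "\<dots> = map_poly of_rat (?f div g) * map_poly of_rat g + map_poly of_rat (?f mod g)"
        by (simp only: rp.hom_add rp.hom_mult)
      finally have "poly (map_poly of_rat ?f) x = poly (map_poly of_rat (?f mod g)) x" using g by simp
      then show ?thesis using f by (simp add: ipoly_root_def of_rat_of_int_poly)
    qed
    then have "?f mod g = 0"
      using min[of "?f mod g"] degree_mod_less[of g ?f] g by fastforce
    then have "?f = g * (?f div g)" by (metis add.right_neutral mult.commute div_mult_mod_eq)
    from rat_to_int_factor_explicit[OF this dh] show "h dvd f" by (metis dvd_triv_left)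
  qed
qed

lemma sum_coeffs_squares: "(\<Sum>a\<leftarrow>coeffs p. a * a) = (\<Sum>k\<le>degree p. Polynomial.coeff p k * Polynomial.coeff p k)"
  for p :: "int poly"
proof (cases "p = 0")
  case False
  then show ?thesis
    by (simp add: coeffs_def sum_list_distinct_conv_sum_set o_def atLeast0LessThan
        flip: lessThan_Suc_atMost)
qed simp

text \<open>
  The polynomial \<open>f (X ^ N)\<close>.
\<close>

definition inflate :: "nat \<Rightarrow> int poly \<Rightarrow> int poly" where
  "inflate N f = (\<Sum>i\<le>degree f. Polynomial.monom (Polynomial.coeff f i) (N * i))"

lemma poly_inflate: "poly (map_poly of_int (inflate N f)) x = poly (map_poly of_int f) (x ^ N :: 'c::field_char_0)"
proof -
  have "(map_poly of_int (inflate N f) :: 'c poly) = (\<Sum>i\<le>degree f. Polynomial.monom (of_int (Polynomial.coeff f i)) (N * i))"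
    unfolding inflate_def by (simp add: of_int_poly_hom.hom_sum map_poly_monom)
  then show ?thesis
    by (simp add: poly_sum poly_monom poly_altdef[of "map_poly of_int f"] power_mult)
qed

text \<open>
  The coefficients of \<open>f (X ^ N)\<close> are those of \<open>f\<close>, and Landau's inequality involves nothing else.
\<close>

lemma mahler_measure_inflate:
  fixes f :: "int poly"
  assumes "N > 0"
  shows "mahler_measure (inflate N f) \<le> sqrt (\<Sum>k\<le>degree f. (real_of_int (Polynomial.coeff f k))\<^sup>2)"
proof -
  let ?g = "inflate N f"
  note g = inflate_def[of N f]
  have c: "Polynomial.coeff ?g (N * i) = Polynomial.coeff f i" if "i \<le> degree f" for i
    unfolding g coeff_sum using assms that by simp
  have z: "Polynomial.coeff ?g k = 0" if "k \<notin> (\<lambda>i. N * i) ` {..degree f}" for k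
    unfolding g coeff_sum using that by (auto intro!: sum.neutral)
  have "(\<Sum>k\<le>degree ?g. Polynomial.coeff ?g k * Polynomial.coeff ?g k)
      = (\<Sum>k\<in>{..degree ?g} \<inter> (\<lambda>i. N * i) ` {..degree f}. Polynomial.coeff ?g k * Polynomial.coeff ?g k)"
    using z by (intro sum.mono_neutral_right) auto
  also have "\<dots> \<le> (\<Sum>k\<in>(\<lambda>i. N * i) ` {..degree f}. Polynomial.coeff ?g k * Polynomial.coeff ?g k)"
    by (intro sum_mono2) auto
  also have "\<dots> = (\<Sum>i\<le>degree f. Polynomial.coeff f i * Polynomial.coeff f i)"
    using assms by (subst sum.reindex) (auto simp: inj_on_def c)
  finally have "real_of_int (\<Sum>a\<leftarrow>coeffs ?g. a * a) \<le> real_of_int (\<Sum>i\<le>degree f. Polynomial.coeff f i * Polynomial.coeff f i)"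
    unfolding sum_coeffs_squares by linarith
  then have "sqrt (real_of_int (\<Sum>a\<leftarrow>coeffs ?g. a * a)) \<le> sqrt (\<Sum>k\<le>degree f. (real_of_int (Polynomial.coeff f k))\<^sup>2)"
    by (simp add: power2_eq_square)
  then show ?thesis using Landau_inequality_mahler_measure[of ?g] by linarith
qed

lemma finite_bounded_int_polys: "finite {h :: int poly. degree h \<le> m \<and> (\<forall>k. \<bar>Polynomial.coeff h k\<bar> \<le> c)}"
proof (rule finite_subset)
  show "finite (Poly ` {xs. set xs \<subseteq> {-c..c} \<and> length xs \<le> Suc m})"
    by (intro finite_imageI finite_lists_length_le) simp
  show "{h :: int poly. degree h \<le> m \<and> (\<forall>k. \<bar>Polynomial.coeff h k\<bar> \<le> c)} \<subseteq> Poly ` {xs. set xs \<subseteq> {-c..c} \<and> length xs \<le> Suc m}"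
  proof
    fix h assume "h \<in> {h :: int poly. degree h \<le> m \<and> (\<forall>k. \<bar>Polynomial.coeff h k\<bar> \<le> c)}"
    then have h: "degree h \<le> m" "\<And>k. \<bar>Polynomial.coeff h k\<bar> \<le> c" by auto
    have "length (coeffs h) \<le> Suc m" using h(1) by (cases "h = 0") (auto simp: length_coeffs)
    moreover have "set (coeffs h) \<subseteq> {-c..c}"
    proof
      fix a assume "a \<in> set (coeffs h)"
      then obtain k where "a = Polynomial.coeff h k" by (auto simp: coeffs_def split: if_splits)
      then show "a \<in> {-c..c}" using h(2)[of k] by auto
    qed
    ultimately show "h \<in> Poly ` {xs. set xs \<subseteq> {-c..c} \<and> length xs \<le> Suc m}"
      by (intro image_eqI[of _ _ "coeffs h"]) auto
  qed
qed

text \<open>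
  Numbers of bounded degree having a fixed number as a power with arbitrary exponent form a
  finite set: their primitive minimal polynomials divide \<open>f (X ^ N)\<close> for a fixed polynomial \<open>f\<close>,
  and Mignotte's bound for the coefficients of a divisor involves only its degree and the Mahler
  measure of \<open>f (X ^ N)\<close>, which is bounded independently of \<open>N\<close>.
\<close>

lemma finite_roots_of_roots:
  assumes f: "f \<noteq> (0::int poly)"
  shows "finite {x :: 'c::field_char_0. \<exists>N>0. ipoly_root f (x ^ N) \<and>
    (\<exists>p::rat poly. p \<noteq> 0 \<and> degree p \<le> m \<and> poly (map_poly of_rat p) x = 0)}"
proof -
  let ?S = "sqrt (\<Sum>k\<le>degree f. (real_of_int (Polynomial.coeff f k))\<^sup>2)"
  let ?c = "\<lceil>2 ^ m * ?S\<rceil>"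
  let ?H = "{h :: int poly. degree h \<le> m \<and> (\<forall>k. \<bar>Polynomial.coeff h k\<bar> \<le> ?c)} - {0}"
  have "finite (\<Union>h\<in>?H. {x :: 'c. ipoly_root h x})"
  proof (intro finite_UN_I finite_Diff finite_bounded_int_polys)
    fix h assume "h \<in> ?H"
    then have "(map_poly of_int h :: 'c poly) \<noteq> 0" by simp
    then show "finite {x :: 'c. ipoly_root h x}" unfolding ipoly_root_def by (rule poly_roots_finite)
  qed
  moreover have "x \<in> (\<Union>h\<in>?H. {x. ipoly_root h x})"
    if N: "N > 0" and fx: "ipoly_root f (x ^ N)" and p: "p \<noteq> 0" "degree p \<le> m" "poly (map_poly of_rat p) x = 0"
    for x :: 'c and N p
  proof -
    obtain h where h: "h \<noteq> 0" "degree h \<le> degree p" "ipoly_root h x"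
      "\<And>f. ipoly_root f x \<Longrightarrow> h dvd f" using integral_factor[OF p(1,3)] by metis
    let ?g = "inflate N f"
    have "ipoly_root ?g x" using fx by (simp add: ipoly_root_def poly_inflate)
    then have dvd: "h dvd ?g" by (rule h(4))
    have "Polynomial.coeff ?g (N * degree f) = lead_coeff f"
      using N by (simp add: inflate_def coeff_sum)
    then have g0: "?g \<noteq> 0" using f by (metis coeff_0 leading_coeff_0_iff)
    have "mahler_measure h \<le> mahler_measure ?g" by (rule mahler_measure_dvd[OF g0 dvd])
    then have mh: "mahler_measure h \<le> ?S" using mahler_measure_inflate[OF N, of f] by linarith
    have "\<bar>Polynomial.coeff h k\<bar> \<le> ?c" for k
    proof -
      have "real_of_int \<bar>Polynomial.coeff h k\<bar> \<le> (degree h choose k) * mahler_measure h" by (rule Mignotte_bound)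
      also have "\<dots> \<le> 2 ^ m * ?S"
      proof (rule mult_mono[OF _ mh])
        have "degree h choose k \<le> 2 ^ degree h" by (rule binomial_le_pow2)
        also have "\<dots> \<le> 2 ^ m" using h(2) p(2) by (intro power_increasing) auto
        finally show "real (degree h choose k) \<le> 2 ^ m" 
          using of_nat_mono[of "degree h choose k" "2 ^ m", where 'a = real] by simp
      qed (auto simp: mahler_measure_ge_0)
      finally show ?thesis by linarith
    qed
    then show ?thesis using h(1,2,3) p(2) by auto
  qed
  ultimately show ?thesis by (elim finite_subset[rotated]) blast
qed

lemma eigenvalue_power:
  fixes A :: "'c::field mat"
  assumes A: "A \<in> carrier_mat m m" and "poly (char_poly A) x = 0"
  shows "poly (char_poly (A ^\<^sub>m N)) (x ^ N) = 0"
proof -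
  have "eigenvalue A x" using assms eigenvalue_root_char_poly by blast
  then obtain v where v: "eigenvector A v x" by (auto simp: eigenvalue_def)
  have "v \<in> carrier_vec m" "v \<noteq> 0\<^sub>v m" using v A by (auto simp: eigenvector_def)
  then have "eigenvector (A ^\<^sub>m N) v (x ^ N)"
    using eigenvector_pow[OF A v] A by (simp add: eigenvector_def)
  then show ?thesis using eigenvalue_root_char_poly[of "A ^\<^sub>m N" m] A by (auto simp: eigenvalue_def)
qed

lemma eigenvalue_nonzero:
  fixes A :: "'c::field mat"
  assumes A: "A \<in> carrier_mat m m" and "poly (char_poly A) x = 0" "det A \<noteq> 0"
  shows "x \<noteq> 0"
proof
  assume "x = 0"
  then have "eigenvalue A 0" using assms eigenvalue_root_char_poly by blast
  then obtain v where v: "v \<in> carrier_vec m" "v \<noteq> 0\<^sub>v m" "A *\<^sub>v v = 0 \<cdot>\<^sub>v v"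
    using A by (auto simp: eigenvalue_def eigenvector_def)
  have "0 \<cdot>\<^sub>v v = 0\<^sub>v m" using v(1) by auto
  then show False using det_0_iff_vec_prod_zero_field[OF A] v assms(3) by auto
qed

lemma common_root_of_unity_order:
  assumes "finite E" "\<And>x. x \<in> E \<Longrightarrow> \<exists>k>0. x ^ k = (1::'c::field)"
  shows "\<exists>M>0. \<forall>x\<in>E. x ^ M = 1"
  using assms
proof (induction E)
  case (insert a E)
  then obtain M k where "M > 0" "\<forall>x\<in>E. x ^ M = 1" "k > 0" "a ^ k = 1" by (metis insert_iff)
  then show ?case
    by (intro exI[of _ "M * k"]) (auto simp: power_mult, metis mult.commute power_mult power_one)
qed auto

text \<open>
  A rational matrix with compatible rational roots of all orders is unipotent: the eigenvalues of
  all these roots form a finite set \<open>E\<close> in which every element has roots of all orders. Two of the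
  roots of \<open>x \<in> E\<close> coincide, so \<open>x\<close> is a root of unity. If \<open>M\<close> is a common order of the elements of
  \<open>E\<close>, then an eigenvalue of \<open>A 1\<close>, being the \<open>M\<close>-th power of an element of \<open>E\<close>, is 1.
\<close>

theorem divisible_rational_unipotent:
  fixes A :: "nat \<Rightarrow> 'c::{alg_closed_field,field_char_0} mat"
  assumes A: "\<And>N. N > 0 \<Longrightarrow> A N \<in> carrier_mat m m" "\<And>N. N > 0 \<Longrightarrow> det (A N) \<noteq> 0"
    and rat: "\<And>N i j. N > 0 \<Longrightarrow> i < m \<Longrightarrow> j < m \<Longrightarrow> A N $$ (i,j) \<in> \<rat>"
    and pow: "\<And>N k. N > 0 \<Longrightarrow> k > 0 \<Longrightarrow> A (N * k) ^\<^sub>m k = A N"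
  shows "(A 1 - 1\<^sub>m m) ^\<^sub>m m = 0\<^sub>m m m"
proof -
  let ?ev = "\<lambda>N x. poly (char_poly (A N)) x = 0"
  define E where "E = {x. \<exists>N>0. ?ev N x}"
  obtain p where p: "char_poly (A 1) = map_poly of_rat p" "p \<noteq> 0" "degree p = m"
    using rational_char_poly[OF A(1) rat, of 1] by auto
  obtain d f where df: "rat_to_normalized_int_poly p = (d, f)" by fastforce
  note r = rat_to_normalized_int_poly[OF df]
  have f0: "f \<noteq> 0" using r(1) p(2) by auto
  have cf: "char_poly (A 1) = smult (of_rat d) (map_poly of_int f)"
    unfolding p(1) by (subst r(1)) (simp add: of_rat_hom.map_poly_hom_smult of_rat_of_int_poly)
  have "E \<subseteq> {x. \<exists>N>0. ipoly_root f (x ^ N) \<and>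
    (\<exists>p::rat poly. p \<noteq> 0 \<and> degree p \<le> m \<and> poly (map_poly of_rat p) x = 0)}"
  proof
    fix x assume "x \<in> E"
    then obtain N where N: "N > 0" "?ev N x" by (auto simp: E_def)
    obtain q where q: "char_poly (A N) = map_poly of_rat q" "q \<noteq> 0" "degree q = m"
      using rational_char_poly[OF A(1)[OF N(1)] rat[OF N(1)]] by metis
    have "poly (char_poly (A 1)) (x ^ N) = 0"
      using eigenvalue_power[OF A(1)[OF N(1)] N(2), of N] pow[of 1 N] N(1) by simp
    then have "ipoly_root f (x ^ N)" using r(2) by (simp add: cf[unfolded One_nat_def] ipoly_root_def)
    moreover have "poly (map_poly of_rat q) x = 0" using N(2) q(1) by simp
    ultimately show "x \<in> {x. \<exists>N>0. ipoly_root f (x ^ N) \<and>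
      (\<exists>p::rat poly. p \<noteq> 0 \<and> degree p \<le> m \<and> poly (map_poly of_rat p) x = 0)}"
      using N(1) q(2,3) by blast
  qed
  then have finE: "finite E" using finite_roots_of_roots[OF f0] by (rule finite_subset)
  have root: "\<exists>y\<in>E. y ^ k = x \<and> ?ev (N * k) y" if "N > 0" "k > 0" "?ev N x" for N k x
  proof -
    have "poly (char_poly (A (N * k) ^\<^sub>m k)) x = 0" using pow that by simp
    then obtain y where "?ev (N * k) y" "y ^ k = x"
      using eigenvalue_of_power[of "A (N * k)" m k x] A(1)[of "N * k"] \<open>N > 0\<close> \<open>k > 0\<close> by auto
    then show ?thesis using that by (intro bexI[of _ y]) (auto simp: E_def intro!: exI[of _ "N * k"])
  qed
  have "\<exists>k>0. x ^ k = 1" if x: "x \<in> E" for x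
  proof -
    obtain N where N: "N > 0" "?ev N x" using x by (auto simp: E_def)
    have "\<forall>k. \<exists>y. y \<in> E \<and> y ^ Suc k = x" using root[OF N(1) _ N(2)] by blast
    then obtain y where y: "\<And>k. y k \<in> E" "\<And>k. y k ^ Suc k = x" by metis
    (* Two roots of different orders of x coincide: y a = y b. Dividing their powers, both
       equal to x, shows that y a is a root of unity. *)
    have "\<not> inj y" using finE y(1) by (meson finite_imageD finite_subset image_subsetI infinite_UNIV_nat)
    then obtain a b where ab: "a < b" "y a = y b" unfolding inj_def by (metis linorder_neqE_nat)
    obtain N' where "N' > 0" "?ev N' (y a)" using y(1)[of a] by (auto simp: E_def)
    then have ya: "y a \<noteq> 0" using eigenvalue_nonzero[OF A(1) _ A(2)] by blast
    have "Suc b = Suc a + (b - a)" using ab(1) by simp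
    then have "y a ^ Suc b = y a ^ Suc a * y a ^ (b - a)" by (metis power_add)
    then have "x * y a ^ (b - a) = x" using y(2)[of a] y(2)[of b] ab(2) by metis
    moreover have "y a ^ Suc a \<noteq> 0" using ya by (simp del: power_Suc)
    then have "x \<noteq> 0" unfolding y(2) .
    ultimately have "y a ^ (b - a) = 1" by simp
    then have "x ^ (b - a) = 1" using y(2)[of a] by (metis mult.commute power_mult power_one)
    then show ?thesis using ab(1) by (intro exI[of _ "b - a"]) simp
  qed
  then obtain M where M: "M > 0" "\<forall>x\<in>E. x ^ M = 1" using common_root_of_unity_order[OF finE] by blast
  show ?thesis
  proof (rule unipotent_if_eigenvalues_one)
    show "A 1 \<in> carrier_mat m m" using A(1) by simp
    fix x assume "?ev 1 x"
    then obtain y where "y \<in> E" "y ^ M = x" using root[of 1 M x] M(1) by auto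
    then show "x = 1" using M(2) by auto
  qed
qed

section \<open>Homomorphisms between rational unipotent groups\<close>

interpretation qvs: vector_space "\<lambda>(q::rat) (x::'c::field_char_0 endo). sc (of_rat q) * x"
proof unfold_locales
  fix a b :: rat and x y :: "'c endo"
  show "sc (of_rat a) * (x + y) = sc (of_rat a) * x + sc (of_rat a) * y" by (rule distrib_left)
  show "sc (of_rat (a + b)) * x = sc (of_rat a) * x + sc (of_rat b) * x"
    by (simp only: of_rat_add sc_simps distrib_right)
  show "sc (of_rat a) * (sc (of_rat b) * x) = sc (of_rat (a * b)) * x"
    by (simp only: of_rat_mult sc_simps mult.assoc)
  show "sc (of_rat 1) * x = x" by (simp only: of_rat_1 sc_simps mult_1_left)
qed

definition ec :: "nat \<Rightarrow> ('c::field endo \<Rightarrow> 'c) set" where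
  "ec n = {\<lambda>u. ent u i j | i j. i < n \<and> j < n}"

definition ratmat :: "nat \<Rightarrow> 'c::field_char_0 endo set" where
  "ratmat n = {f \<in> Efin n. \<forall>i<n. \<forall>j<n. ent f i j \<in> \<rat>}"

lemma ratmat_subspace: "qvs.subspace (ratmat n)"
  unfolding qvs.subspace_def
proof (intro conjI ballI allI)
  show "0 \<in> ratmat n" by (simp add: ratmat_def Efin_closed(1) ent_simps)
  show "f + g \<in> ratmat n" if "f \<in> ratmat n" "g \<in> ratmat n" for f g
    using that by (simp add: ratmat_def Efin_closed(2) ent_simps(3))
  show "sc (of_rat q) * f \<in> ratmat n" if "f \<in> ratmat n" for f q
    using that by (simp add: ratmat_def Efin_closed(5) ent_simps(7))
qed

lemma ratmat_mult: "f \<in> ratmat n \<Longrightarrow> g \<in> ratmat n \<Longrightarrow> f * g \<in> ratmat n"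
proof -
  assume f: "f \<in> ratmat n" and g: "g \<in> ratmat n"
  then have E: "f \<in> Efin n" "g \<in> Efin n" by (auto simp: ratmat_def)
  have "ent (f * g) i j \<in> \<rat>" if ij: "i < n" "j < n" for i j
    unfolding ent_mult[OF Efin_Cfin[OF E(2)] ij(2)]
    using f g ij by (intro Qclosed_sum[OF Qclosed_Rats] Rats_mult) (auto simp: ratmat_def)
  then show ?thesis using E by (simp add: ratmat_def Efin_closed)
qed

lemma ratmat_expand:
  assumes "f \<in> ratmat n"
  shows "\<exists>r. (\<forall>i<n. \<forall>j<n. ent f i j = of_rat (r i j)) \<and>
    f = (\<Sum>i<n. \<Sum>j<n. sc (of_rat (r i j)) * munit n i j)"
proof -
  define r where "r i j = (SOME q. ent f i j = of_rat q)" for i j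
  have r: "ent f i j = of_rat (r i j)" if "i < n" "j < n" for i j
  proof -
    have "ent f i j \<in> \<rat>" using assms that by (simp add: ratmat_def)
    then obtain q where "ent f i j = of_rat q" by (rule Rats_cases)
    then show ?thesis unfolding r_def by (rule someI)
  qed
  have "f = (\<Sum>i<n. \<Sum>j<n. sc (ent f i j) * munit n i j)"
    using assms by (intro Efin_expand) (simp add: ratmat_def)
  also have "\<dots> = (\<Sum>i<n. \<Sum>j<n. sc (of_rat (r i j)) * munit n i j)"
    by (intro sum.cong refl) (simp add: r)
  finally show ?thesis using r by (intro exI[of _ r]) simp
qed

lemma ratmat_span_munits: "ratmat n \<subseteq> qvs.span (munits n)"
proof
  fix f :: "'a endo" assume "f \<in> ratmat n"
  from ratmat_expand[OF this] obtain r where f: "f = (\<Sum>i<n. \<Sum>j<n. sc (of_rat (r i j)) * munit n i j)"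
    by (elim exE conjE) (rule that)
  show "f \<in> qvs.span (munits n)"
    unfolding f by (intro qvs.span_sum qvs.span_scale qvs.span_base) (auto simp: munits_def)
qed

lemma rational_functional:
  assumes "a \<notin> qvs.span A"
  shows "\<exists>l. (\<forall>x y. l (x + y) = l x + l y) \<and> (\<forall>q x. l (sc (of_rat q) * x) = q * l x) \<and>
    (\<forall>x\<in>qvs.span A. l x = 0) \<and> l a = (1::rat)"
proof -
  interpret f: vector_space "(*) :: rat \<Rightarrow> rat \<Rightarrow> rat" by unfold_locales (auto simp: algebra_simps)
  interpret p: vector_space_pair "\<lambda>(q::rat) (x::'a endo). sc (of_rat q) * x" "(*) :: rat \<Rightarrow> rat \<Rightarrow> rat" ..
  obtain B where B: "B \<subseteq> A" "qvs.independent B" "A \<subseteq> qvs.span B"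
    using qvs.maximal_independent_subset[of A] by blast
  have sp: "qvs.span B = qvs.span A" using B by (metis qvs.span_mono qvs.span_span subset_antisym)
  then have X: "a \<notin> qvs.span B" using assms by simp
  have "qvs.independent (insert a B)" by (rule qvs.independent_insertI[OF X B(2)])
  from p.linear_independent_extend[OF this, of "\<lambda>x. if x = a then 1 else 0"]
  obtain l where l: "Vector_Spaces.linear (\<lambda>(q::rat) (x::'a endo). sc (of_rat q) * x) (*) l"
    "\<forall>x\<in>insert a B. l x = (if x = a then 1 else 0)" by blast
  interpret l: Vector_Spaces.linear "\<lambda>(q::rat) (x::'a endo). sc (of_rat q) * x" "(*)" l by fact
  have XB: "a \<notin> B" using X qvs.span_base by blast
  have "l x = 0" if "x \<in> qvs.span B" for x
    using that
  proof (induction rule: qvs.span_induct)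
    show "qvs.subspace {x. l x = 0}" by (auto simp: qvs.subspace_def l.add l.scale l.zero)
  qed (use l(2) XB in auto)
  then show ?thesis using l(2) sp by (intro exI[of _ l]) (auto simp: l.add l.scale)
qed

text \<open>
  Up to a factor \<open>b\<close>, the logarithm of a \<open>b\<close>-th root is determined, hence so is a unipotent root.
\<close>

lemma Log_power:
  assumes "(z - 1) ^ K = 0"
  shows "Log K (z ^ b) = sc (of_nat b) * Log K z"
proof -
  have L: "Log K z ^ K = 0" by (rule Log_nilpotent[OF assms])
  have "z ^ b = Exp K (sc (of_nat b * 1) * Log K z)"
    unfolding Exp_power[OF L] using Exp_Log[OF assms] by (simp add: sc_simps)
  then show ?thesis using Log_Exp[OF nilpotent_sc[OF L]] by simp
qed

lemma binomial_series_0: "fps_nth (fps_exp t oo fps_ln 1) 0 = (1::'c::field_char_0)"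
  by simp

lemma binomial_series_1: "fps_nth (fps_exp t oo fps_ln 1) (Suc 0) = (t::'c::field_char_0)"
  by (simp add: fps_compose_nth fps_ln_nth)

lemma binomial_series_Rats:
  assumes "t \<in> \<rat>" shows "fps_nth (fps_exp t oo fps_ln 1) k \<in> (\<rat> :: 'c::field_char_0 set)"
proof -
  have p: "fps_nth (fps_ln 1 ^ i) k \<in> (\<rat> :: 'c set)" for i k
  proof (induction i arbitrary: k)
    case (Suc i)
    show ?case
      unfolding power_Suc fps_mult_nth
      by (intro Qclosed_sum[OF Qclosed_Rats] Rats_mult ln_coeff_Rats Suc)
  qed (simp add: fps_one_nth)
  show ?thesis
    unfolding fps_compose_nth fps_exp_nth
    by (intro Qclosed_sum[OF Qclosed_Rats] Rats_mult p Rats_divide Rats_power assms Rats_of_nat)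
qed

lemma Exp_sc_Log:
  assumes "(u - 1) ^ J = 0"
  shows "Exp J (sc t * Log J u) = ev J (u - 1) (fps_exp t oo fps_ln 1)"
  unfolding Exp_sc unfolding Log_def by (rule ev_compose[OF assms]) simp

text \<open>
  The set \<open>S\<close> stands for the rational points of a unipotent group. Closure under rational powers
  includes inverses, and \<open>Svan\<close> says that the augmentation algebra is nilpotent.
\<close>

locale rational_unipotent_hom =
  fixes n m J K :: nat and S :: "'c::{alg_closed_field,field_char_0} endo set" and \<phi> :: "'c endo \<Rightarrow> 'c endo"
  assumes S1: "1 \<in> S" and Smult: "\<And>u w. u \<in> S \<Longrightarrow> w \<in> S \<Longrightarrow> u * w \<in> S"
    and Spow: "\<And>u t. u \<in> S \<Longrightarrow> t \<in> \<rat> \<Longrightarrow> Exp J (sc t * Log J u) \<in> S"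
    and Srat: "\<And>u. u \<in> S \<Longrightarrow> u - 1 \<in> ratmat n"
    and Jpos: "J > 0"
    and Svan: "\<And>as. set as \<subseteq> (\<lambda>u. u - 1) ` S \<Longrightarrow> length as = J \<Longrightarrow> prod_list as = 0"
    and \<phi>1: "\<phi> 1 = 1" and \<phi>mult: "\<And>u w. u \<in> S \<Longrightarrow> w \<in> S \<Longrightarrow> \<phi> (u * w) = \<phi> u * \<phi> w"
    and \<phi>rat: "\<And>u. u \<in> S \<Longrightarrow> \<phi> u - 1 \<in> ratmat m" and \<phi>nil: "\<And>u. u \<in> S \<Longrightarrow> (\<phi> u - 1) ^ K = 0"
begin

lemma Snil: "u \<in> S \<Longrightarrow> (u - 1) ^ J = 0"
  using Svan[of "replicate J (u - 1)"] Jpos by (simp add: prod_list_replicate_power)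

lemma Spower: "u \<in> S \<Longrightarrow> u ^ i \<in> S" and \<phi>power: "u \<in> S \<Longrightarrow> \<phi> (u ^ i) = \<phi> u ^ i"
proof -
  show *: "u ^ i \<in> S" if "u \<in> S" for u i by (induction i) (auto intro: S1 Smult that)
  show "u \<in> S \<Longrightarrow> \<phi> (u ^ i) = \<phi> u ^ i" by (induction i) (auto simp: \<phi>1 \<phi>mult *)
qed

text \<open>
  For \<open>t = 1 / b\<close> both sides are unipotent roots of \<open>\<phi> u\<close> of order \<open>b\<close>.
\<close>

lemma \<phi>_rational_power:
  assumes u: "u \<in> S" and t: "t \<in> \<rat>"
  shows "\<phi> (Exp J (sc t * Log J u)) = Exp K (sc t * Log K (\<phi> u))"
proof -
  note L = Log_nilpotent[OF Snil[OF u]] and L' = Log_nilpotent[OF \<phi>nil[OF u]]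
  have pos: "\<phi> (Exp J (sc (of_nat a / of_nat b) * Log J u)) = Exp K (sc (of_nat a / of_nat b) * Log K (\<phi> u))"
    if b: "b > 0" for a b
  proof -
    define w where "w = Exp J (sc (1 / of_nat b) * Log J u)"
    have w: "w \<in> S" unfolding w_def by (rule Spow[OF u]) simp
    have wp: "w ^ i = Exp J (sc (of_nat i / of_nat b) * Log J u)" for i
      unfolding w_def using Exp_power[OF L, of i "1 / of_nat b"] by simp
    have "w ^ b = u" unfolding wp using b Exp_Log[OF Snil[OF u]] by (simp add: sc_simps)
    then have "\<phi> w ^ b = \<phi> u" using \<phi>power[OF w] by metis
    then have "Log K (\<phi> u) = sc (of_nat b) * Log K (\<phi> w)" using Log_power[OF \<phi>nil[OF w], of b] by simp
    then have "sc (of_nat a / of_nat b) * Log K (\<phi> u) = sc (of_nat a * 1) * Log K (\<phi> w)"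
      using b by (simp add: mult.assoc[symmetric] flip: sc_simps(4))
    then have "Exp K (sc (of_nat a / of_nat b) * Log K (\<phi> u)) = Exp K (sc 1 * Log K (\<phi> w)) ^ a"
      using Exp_power[OF Log_nilpotent[OF \<phi>nil[OF w]], of a 1] by simp
    also have "\<dots> = \<phi> w ^ a" using Exp_Log[OF \<phi>nil[OF w]] by (simp add: sc_simps)
    also have "\<dots> = \<phi> (w ^ a)" by (rule \<phi>power[OF w, symmetric])
    finally show ?thesis unfolding wp by simp
  qed
  obtain x y where xy: "t = of_int x / of_int y" "y > 0" using t by (elim Rats_cases') auto
  define b where "b = nat y"
  have b: "b > 0" "of_int y = of_nat b" using xy(2) by (auto simp: b_def)
  show ?thesis
  proof (cases "x \<ge> 0")
    case True
    then have "t = of_nat (nat x) / of_nat b" unfolding xy(1) b(2) by simp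
    then show ?thesis using pos[OF b(1)] by simp
  next
    case False
    define s where "s = of_nat (nat (- x)) / (of_nat b :: 'c)"
    have ts: "t = - s" unfolding xy(1) b(2) s_def using False by simp
    have sQ: "s \<in> \<rat>" by (simp add: s_def)
    have ps: "\<phi> (Exp J (sc s * Log J u)) = Exp K (sc s * Log K (\<phi> u))" unfolding s_def by (rule pos[OF b(1)])
    have 1: "Exp J (sc t * Log J u) * Exp J (sc s * Log J u) = 1"
      using Exp_add[OF L, of t s] Exp_sc_zero[OF L] by (simp add: ts)
    have 2: "Exp K (sc s * Log K (\<phi> u)) * Exp K (sc t * Log K (\<phi> u)) = 1"
      using Exp_add[OF L', of s t] Exp_sc_zero[OF L'] by (simp add: ts)
    have 3: "\<phi> (Exp J (sc t * Log J u)) * Exp K (sc s * Log K (\<phi> u)) = 1"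
      using \<phi>mult[OF Spow[OF u t] Spow[OF u sQ]] unfolding 1 ps \<phi>1 by simp
    have "\<phi> (Exp J (sc t * Log J u)) = \<phi> (Exp J (sc t * Log J u)) * (Exp K (sc s * Log K (\<phi> u)) * Exp K (sc t * Log K (\<phi> u)))"
      by (simp add: 2)
    also have "\<dots> = Exp K (sc t * Log K (\<phi> u))" unfolding mult.assoc[symmetric] 3 by simp
    finally show ?thesis .
  qed
qed

text \<open>The filtration of the augmentation algebra by its powers.\<close>

definition Fil :: "nat \<Rightarrow> 'c endo set" where
  "Fil j = qvs.span {prod_list as | as. set as \<subseteq> (\<lambda>u. u - 1) ` S \<and> length as \<ge> j}"

lemma Fil_subspace: "qvs.subspace (Fil j)"
  unfolding Fil_def by (rule qvs.subspace_span)

lemma Fil_antimono: "i \<le> j \<Longrightarrow> Fil j \<subseteq> Fil i"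
  unfolding Fil_def by (rule qvs.span_mono) auto

lemma Fil_base: "u \<in> S \<Longrightarrow> u - 1 \<in> Fil 1"
  unfolding Fil_def by (rule qvs.span_base) (auto intro!: exI[of _ "[u - 1]"])

lemma Fil_mult:
  assumes a: "a \<in> Fil i" and b: "b \<in> Fil j"
  shows "a * b \<in> Fil (i + j)"
proof -
  have 1: "prod_list as * b \<in> Fil (i + j)" if as: "set as \<subseteq> (\<lambda>u. u - 1) ` S" "length as \<ge> i" for as
    using b unfolding Fil_def[of j]
  proof (induction rule: qvs.span_induct)
    show "qvs.subspace {b. prod_list as * b \<in> Fil (i + j)}"
      using Fil_subspace[of "i + j"] by (auto simp: qvs.subspace_def distrib_left sc_left_commute)
  next
    fix x assume "x \<in> {prod_list as | as. set as \<subseteq> (\<lambda>u. u - 1) ` S \<and> length as \<ge> j}"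
    then obtain bs where bs: "x = prod_list bs" "set bs \<subseteq> (\<lambda>u. u - 1) ` S" "length bs \<ge> j" by blast
    show "prod_list as * x \<in> Fil (i + j)"
      unfolding Fil_def by (rule qvs.span_base, rule CollectI, rule exI[of _ "as @ bs"]) (use as bs in auto)
  qed
  show ?thesis
    using a unfolding Fil_def[of i]
  proof (induction rule: qvs.span_induct)
    show "qvs.subspace {a. a * b \<in> Fil (i + j)}"
      using Fil_subspace[of "i + j"] by (auto simp: qvs.subspace_def distrib_right mult.assoc)
  next
    fix x assume "x \<in> {prod_list as | as. set as \<subseteq> (\<lambda>u. u - 1) ` S \<and> length as \<ge> i}"
    then show "x * b \<in> Fil (i + j)" using 1 by blast
  qed
qed

lemma Fil_power: "a \<in> Fil j \<Longrightarrow> k \<ge> 1 \<Longrightarrow> a ^ k \<in> Fil (k * j)"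
proof (induction k)
  case (Suc k)
  then show ?case using Fil_mult[of a j "a ^ k" "k * j"] by (cases "k = 0") auto
qed simp

lemma Fil_J: "Fil J = {0}"
proof -
  have "prod_list as = 0" if "set as \<subseteq> (\<lambda>u. u - 1) ` S" "length as \<ge> J" for as
  proof -
    have "prod_list (take J as) = 0" using that by (intro Svan) (auto dest: in_set_takeD)
    then show ?thesis by (metis append_take_drop_id mult_zero_left prod_list.append)
  qed
  then have "{prod_list as | as. set as \<subseteq> (\<lambda>u. u - 1) ` S \<and> length as \<ge> J} \<subseteq> {0}" by auto
  then have "Fil J \<subseteq> {0}" unfolding Fil_def by (rule qvs.span_minimal) (rule qvs.subspace_single_0)
  then show ?thesis using qvs.subspace_0[OF Fil_subspace[of J]] by auto
qed

lemma Fil_ratmat: "j \<ge> 1 \<Longrightarrow> Fil j \<subseteq> ratmat n"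
proof -
  assume j: "j \<ge> 1"
  have "prod_list as \<in> ratmat n" if "set as \<subseteq> (\<lambda>u. u - 1) ` S" "as \<noteq> []" for as
    using that
  proof (induction as)
    case (Cons a as)
    then show ?case using Srat ratmat_mult by (cases "as = []") auto
  qed simp
  then show ?thesis
    unfolding Fil_def by (intro qvs.span_minimal[OF _ ratmat_subspace]) (use j in fastforce)
qed

text \<open>
  The binomial series: on a layer of the filtration the rational power \<open>u\<^sup>t\<close> acts as multiplication of
  \<open>u - 1\<close> by \<open>t\<close>.
\<close>

lemma rational_power_mod_Fil:
  assumes u: "u \<in> S" "u - 1 \<in> Fil j" and j: "j \<ge> 1" and t: "t \<in> \<rat>"
  shows "Exp J (sc t * Log J u) - 1 - sc t * (u - 1) \<in> Fil (Suc j)"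
proof -
  let ?c = "fps_nth (fps_exp t oo fps_ln 1)"
  have "Exp J (sc t * Log J u) = (\<Sum>k<J. sc (?c k) * (u - 1) ^ k)"
    unfolding Exp_sc_Log[OF Snil[OF u(1)]] ev_def ..
  also have "\<dots> = (\<Sum>k<Suc (Suc J). sc (?c k) * (u - 1) ^ k)"
    using nilpotent_power_zero[OF Snil[OF u(1)]] by (intro sum.mono_neutral_left) auto
  also have "\<dots> = 1 + sc t * (u - 1) + (\<Sum>k<J. sc (?c (Suc (Suc k))) * (u - 1) ^ Suc (Suc k))"
    by (simp only: sum.lessThan_Suc_shift binomial_series_0 binomial_series_1 sc_simps power_0 power_Suc)
      (simp add: add.assoc)
  finally have "Exp J (sc t * Log J u) - 1 - sc t * (u - 1) = (\<Sum>k<J. sc (?c (Suc (Suc k))) * (u - 1) ^ Suc (Suc k))"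
    by simp
  also have "\<dots> \<in> Fil (Suc j)"
  proof (rule qvs.subspace_sum[OF Fil_subspace])
    fix k
    have "(u - 1) ^ Suc (Suc k) \<in> Fil (Suc (Suc k) * j)" by (rule Fil_power[OF u(2)]) simp
    moreover have "Suc j \<le> Suc (Suc k) * j" using j by simp
    ultimately have "(u - 1) ^ Suc (Suc k) \<in> Fil (Suc j)" using Fil_antimono by blast
    moreover obtain q where "?c (Suc (Suc k)) = of_rat q" using binomial_series_Rats[OF t] by (rule Rats_cases)
    ultimately show "sc (?c (Suc (Suc k))) * (u - 1) ^ Suc (Suc k) \<in> Fil (Suc j)"
      using qvs.subspace_scale[OF Fil_subspace] by metis
  qed
  finally show ?thesis .
qed

text \<open>
  Regularity is required on the whole affine space \<open>1 + Efin n\<close> and not only on \<open>S\<close>, so that the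
  coefficients are rational polynomials that can later be evaluated on the algebraic group.
\<close>

definition polynomial_on :: "'c endo set \<Rightarrow> bool" where
  "polynomial_on B \<longleftrightarrow> (\<exists>F. regmat \<rat> (ec n) {u. u - 1 \<in> Efin n} m F \<and> (\<forall>u\<in>S. u - 1 \<in> B \<longrightarrow> F u = \<phi> u))"

lemma polynomial_on_subset: "polynomial_on B \<Longrightarrow> B' \<subseteq> B \<Longrightarrow> polynomial_on B'"
  unfolding polynomial_on_def by blast

text \<open>
  One step of the construction: if \<open>u\<^sub>0 - 1\<close> has a nonzero component outside \<open>B\<close>, measured by the
  linear form \<open>l\<close>, then every \<open>u\<close> is the product of an element \<open>G u\<close> of the part belonging to \<open>B\<close> and of
  the rational power of \<open>u\<^sub>0\<close> with exponent \<open>\<tau> u\<close>, which is linear in \<open>u\<close>. On the first factor \<open>\<phi>\<close> is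
  polynomial by assumption, on the second by \<open>\<phi>_rational_power\<close>. If there is no such \<open>u\<^sub>0\<close>, the
  larger space contains no new elements.
\<close>

lemma polynomial_on_insert:
  assumes j: "j \<ge> 1" and B: "qvs.subspace B" "Fil (Suc j) \<subseteq> B" "B \<subseteq> Fil j" and a: "a \<in> Fil j"
    and P: "polynomial_on B"
  shows "polynomial_on (qvs.span (insert a B))"
proof (cases "a \<in> B")
  case True
  then have "qvs.span (insert a B) = B" using B(1) by (simp add: insert_absorb qvs.span_eq_iff)
  then show ?thesis using P by simp
next
  case False
  have spB: "qvs.span B = B" using B(1) by (rule qvs.span_eq_iff[THEN iffD2])
  have "a \<notin> qvs.span B" unfolding spB by (rule False)
  from rational_functional[OF this] obtain l where l: "\<forall>x y. l (x + y) = l x + l y"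
    "\<forall>q x. l (sc (of_rat q) * x) = q * l x" "\<forall>x\<in>qvs.span B. l x = 0" "l a = (1::rat)"
    by (elim exE conjE) (rule that)
  note ladd = l(1)[rule_format] and lscale = l(2)[rule_format] and lB = l(3)[unfolded spB, rule_format]
  have spj: "qvs.span (insert a B) \<subseteq> Fil j"
    by (rule qvs.span_minimal[OF _ Fil_subspace]) (use a B(3) in auto)
  have inB: "x \<in> B" if x: "x \<in> qvs.span (insert a B)" and lx: "l x = 0" for x
  proof -
    have "\<exists>q. x - sc (of_rat q) * a \<in> B" using x unfolding qvs.span_insert spB by (rule CollectD)
    then obtain q where q: "x - sc (of_rat q) * a \<in> B" ..
    have "l x = l (x - sc (of_rat q) * a) + l (sc (of_rat q) * a)" using ladd[of "x - sc (of_rat q) * a" "sc (of_rat q) * a"] by simp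
    then have "q = 0" using lx lB[OF q] lscale[of q a] l(4) by simp
    then show ?thesis using q by (simp add: sc_simps)
  qed
  obtain F where F: "regmat \<rat> (ec n) {u. u - 1 \<in> Efin n} m F" "\<forall>u\<in>S. u - 1 \<in> B \<longrightarrow> F u = \<phi> u"
    using P unfolding polynomial_on_def by (elim exE conjE)
  show ?thesis
  proof (cases "\<exists>u\<in>S. u - 1 \<in> qvs.span (insert a B) \<and> l (u - 1) \<noteq> 0")
    case False
    then have "\<forall>u\<in>S. u - 1 \<in> qvs.span (insert a B) \<longrightarrow> F u = \<phi> u" using inB F(2) by blast
    then show ?thesis unfolding polynomial_on_def using F(1) by blast
  next
    case True
    then obtain u0 where u0: "u0 \<in> S" "u0 - 1 \<in> qvs.span (insert a B)" "l (u0 - 1) \<noteq> 0" by blast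
    define c where "c = l (u0 - 1)"
    (* The value of l at u - 1, divided by the one at u0 - 1 and written as a linear function
       of the entries so that it makes sense for all matrices. *)
    define \<tau> where "\<tau> u = (\<Sum>i<n. \<Sum>j<n. of_rat (l (munit n i j) / c) * (ent u i j + (if i = j then - 1 else 0)))" for u :: "'c endo"
    have l0: "l 0 = 0" using lscale[of 0 0] by simp
    have lsum: "l (sum f A) = (\<Sum>a\<in>A. l (f a))" for f and A :: "nat set"
      by (induction A rule: infinite_finite_induct) (auto simp: ladd l0)
    have \<tau>: "\<tau> u = of_rat (l (u - 1) / c)" if u: "u \<in> S" for u
    proof -
      obtain r where r: "\<forall>i<n. \<forall>j<n. ent (u - 1) i j = of_rat (r i j)"
        "u - 1 = (\<Sum>i<n. \<Sum>j<n. sc (of_rat (r i j)) * munit n i j)"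
        using ratmat_expand[OF Srat[OF u]] by (elim exE conjE) (rule that)
      have "l (u - 1) = (\<Sum>i<n. \<Sum>j<n. r i j * l (munit n i j))"
        unfolding r(2) by (simp add: lsum lscale)
      moreover have "\<tau> u = (\<Sum>i<n. \<Sum>j<n. of_rat (l (munit n i j) / c) * of_rat (r i j))"
        unfolding \<tau>_def
      proof (intro sum.cong refl)
        fix i j assume "i \<in> {..<n}" "j \<in> {..<n}"
        then have "of_rat (r i j) = ent u i j + (if i = j then - 1 else 0)"
          using r(1)[rule_format, of i j, symmetric] by (cases "i = j") (simp_all add: ent_simps)
        then show "of_rat (l (munit n i j) / c) * (ent u i j + (if i = j then - 1 else 0)) =
          of_rat (l (munit n i j) / c) * of_rat (r i j)" by simp
      qed
      ultimately show ?thesis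
        by (simp add: of_rat_sum of_rat_mult[symmetric] sum_divide_distrib mult_ac)
    qed
    have \<tau>reg: "regular \<rat> (ec n) D \<tau>" for D
      unfolding \<tau>_def
    proof (intro regular_sum regular_mult regular_add regular_const regular_gen)
      fix i j assume "i \<in> {..<n}" "j \<in> {..<n}"
      then show "(\<lambda>u. ent u i j) \<in> ec n" by (auto simp: ec_def)
    qed auto
    define G where "G u = u * Exp J (sc (- \<tau> u) * Log J u0)" for u
    define H where "H u = Exp K (sc (\<tau> u) * Log K (\<phi> u0))" for u
    have idreg: "regmat \<rat> (ec n) {u. u - 1 \<in> Efin n} n (\<lambda>u. u)"
    proof -
      have "u \<in> Cfin n" if "u - 1 \<in> Efin n" for u
        using Cfin_closed(4)[OF Efin_Cfin[OF that] Cfin_closed(2)] by simp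
      moreover have "regular \<rat> (ec n) {u. u - 1 \<in> Efin n} (\<lambda>u. ent u i j)" if "i < n" "j < n" for i j
        by (rule regular_gen) (use that in \<open>auto simp: ec_def\<close>)
      ultimately show ?thesis unfolding regmat_def by blast
    qed
    have Lu0: "Log J u0 \<in> Efin n" "Log J u0 ^ J = 0"
      using Log_Efin Log_nilpotent[OF Snil[OF u0(1)]] Srat[OF u0(1)] by (auto simp: ratmat_def)
    have rat_const: "regmat \<rat> C D p (\<lambda>_. Log L w)" if "w - 1 \<in> ratmat p" for C D p L w
    proof -
      have wc: "w - 1 \<in> Cfin p" using that Efin_Cfin by (auto simp: ratmat_def)
      have "regmat \<rat> C D p (\<lambda>_. w - 1)"
        by (rule regmat_const[OF wc]) (use that in \<open>auto simp: ratmat_def\<close>)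
      then show ?thesis unfolding Log_def by (rule regmat_ev[rotated 3]) (auto intro: ln_coeff_Rats)
    qed
    have ntau: "regular \<rat> (ec n) D (\<lambda>u. - \<tau> u)" for D
      using regular_mult[OF regular_const[of "-1"] \<tau>reg] by simp
    have Gexp: "regmat \<rat> (ec n) {u. u - 1 \<in> Efin n} n (\<lambda>u. Exp J (sc (- \<tau> u) * Log J u0))"
      by (intro regmat_Exp[OF Qclosed_Rats] regmat_mult regmat_sc ntau rat_const Srat u0(1)) auto
    have Greg: "regmat \<rat> (ec n) {u. u - 1 \<in> Efin n} n G"
      unfolding G_def by (rule regmat_mult[OF _ idreg Gexp]) simp
    have Gdom: "G u - 1 \<in> Efin n" if "u - 1 \<in> Efin n" for u
      unfolding G_def by (intro Efin_mult_minus_1 that Exp_Efin Efin_closed Lu0 nilpotent_sc)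
    have "regmat \<rat> (ec n) {u. u - 1 \<in> Efin n} m (\<lambda>u. F (G u))"
    proof (rule regmat_compose[OF F(1)])
      fix c :: "'c endo \<Rightarrow> 'c" assume "c \<in> ec n"
      then obtain i j where "i < n" "j < n" "c = (\<lambda>u. ent u i j)" by (auto simp: ec_def)
      then show "regular \<rat> (ec n) {u. u - 1 \<in> Efin n} (\<lambda>x. c (G x))" using Greg by (simp add: regmat_def)
    qed (use Gdom in auto)
    moreover have "regmat \<rat> (ec n) {u. u - 1 \<in> Efin n} m H"
      unfolding H_def by (intro regmat_Exp[OF Qclosed_Rats] regmat_mult regmat_sc \<tau>reg rat_const \<phi>rat u0(1)) auto
    ultimately have reg: "regmat \<rat> (ec n) {u. u - 1 \<in> Efin n} m (\<lambda>u. F (G u) * H u)"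
      by (intro regmat_mult) auto
    have "F (G u) * H u = \<phi> u" if u: "u \<in> S" "u - 1 \<in> qvs.span (insert a B)" for u
    proof -
      let ?p = "\<lambda>t. Exp J (sc t * Log J u0)"
      have \<tau>Q: "\<tau> u \<in> \<rat>" "- \<tau> u \<in> \<rat>" unfolding \<tau>[OF u(1)] by auto
      have GS: "G u \<in> S" unfolding G_def by (intro Smult u(1) Spow u0(1) \<tau>Q)
      have uj: "u - 1 \<in> Fil j" "u0 - 1 \<in> Fil j" by (rule subsetD[OF spj u(2)], rule subsetD[OF spj u0(2)])
      define q where "q = - (l (u - 1) / c)"
      have qt: "- \<tau> u = of_rat q" unfolding \<tau>[OF u(1)] q_def by (simp add: of_rat_minus)
      let ?R = "?p (- \<tau> u) - 1 - sc (- \<tau> u) * (u0 - 1)"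
      have R: "?R \<in> Fil (Suc j)" by (rule rational_power_mod_Fil[OF u0(1) uj(2) j \<tau>Q(2)])
      have pj: "?p (- \<tau> u) - 1 \<in> Fil j"
      proof -
        have "?p (- \<tau> u) - 1 = ?R + sc (of_rat q) * (u0 - 1)" by (simp add: qt)
        also have "\<dots> \<in> Fil j"
          by (intro qvs.subspace_add[OF Fil_subspace] qvs.subspace_scale[OF Fil_subspace] uj(2))
            (use R Fil_antimono[of j "Suc j"] in auto)
        finally show ?thesis .
      qed
      have prod: "(u - 1) * (?p (- \<tau> u) - 1) \<in> Fil (Suc j)"
        using subsetD[OF Fil_antimono[of "Suc j" "j + j"] Fil_mult[OF uj(1) pj]] j by simp
      let ?e = "(u - 1) * (?p (- \<tau> u) - 1) + ?R"
      have e: "?e \<in> B" by (rule subsetD[OF B(2) qvs.subspace_add[OF Fil_subspace prod R]])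
      have G1: "G u - 1 = ((u - 1) + sc (of_rat q) * (u0 - 1)) + ?e"
        unfolding G_def qt[symmetric] by (simp add: algebra_simps)
      have "G u - 1 \<in> qvs.span (insert a B)"
        unfolding G1
        by (rule qvs.span_add[OF qvs.span_add[OF u(2) qvs.span_scale[OF u0(2)]] qvs.span_base]) (rule insertI2[OF e])
      moreover have "l (G u - 1) = 0"
      proof -
        have "l (G u - 1) = (l (u - 1) + l (sc (of_rat q) * (u0 - 1))) + l ?e"
          unfolding G1 ladd[of "(u - 1) + sc (of_rat q) * (u0 - 1)" ?e] ladd[of "u - 1" "sc (of_rat q) * (u0 - 1)"] ..
        also have "\<dots> = 0" unfolding lB[OF e] lscale q_def c_def using u0(3) by simp
        finally show ?thesis .
      qed
      ultimately have "G u - 1 \<in> B" by (rule inB)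
      then have "F (G u) = \<phi> (G u)" using F(2) GS by blast
      moreover have "H u = \<phi> (?p (\<tau> u))" unfolding H_def by (rule \<phi>_rational_power[OF u0(1) \<tau>Q(1), symmetric])
      ultimately have "F (G u) * H u = \<phi> (G u * ?p (\<tau> u))"
        using \<phi>mult[OF GS Spow[OF u0(1) \<tau>Q(1)]] by simp
      also have "G u * ?p (\<tau> u) = u * (?p (- \<tau> u) * ?p (\<tau> u))" by (simp add: G_def mult.assoc)
      also have "?p (- \<tau> u) * ?p (\<tau> u) = 1"
        using Exp_add[OF Lu0(2), of "- \<tau> u" "\<tau> u"] Exp_sc_zero[OF Lu0(2)] by simp
      finally show ?thesis by simp
    qed
    then show ?thesis unfolding polynomial_on_def using reg by (intro exI[of _ "\<lambda>u. F (G u) * H u"]) blast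
  qed
qed

text \<open>
  The generators of \<open>Fil j\<close> modulo \<open>Fil (Suc j)\<close> are added one at a time.
\<close>

lemma polynomial_on_Fil_step:
  assumes j: "j \<ge> 1" and P: "polynomial_on (Fil (Suc j))"
  shows "polynomial_on (Fil j)"
proof -
  obtain B where B: "B \<subseteq> Fil j" "qvs.independent B" "Fil j \<subseteq> qvs.span B"
    using qvs.maximal_independent_subset[of "Fil j"] by blast
  have "finite B"
    using qvs.independent_span_bound[OF finite_munits B(2)] B(1) Fil_ratmat[OF j] ratmat_span_munits by blast
  have "polynomial_on (qvs.span (Fil (Suc j) \<union> X))" if "finite X" "X \<subseteq> Fil j" for X
    using that
  proof (induction X)
    case empty
    have eq: "qvs.span (Fil (Suc j)) = Fil (Suc j)" using Fil_subspace by (rule qvs.span_eq_iff[THEN iffD2])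
    show ?case unfolding Un_empty_right eq by (rule P)
  next
    case (insert a X)
    have 1: "qvs.span (Fil (Suc j) \<union> X) \<subseteq> Fil j"
      using insert.prems Fil_antimono[of j "Suc j"] by (intro qvs.span_minimal[OF _ Fil_subspace]) auto
    have "polynomial_on (qvs.span (insert a (qvs.span (Fil (Suc j) \<union> X))))"
    proof (rule polynomial_on_insert[OF j qvs.subspace_span _ 1])
      show "Fil (Suc j) \<subseteq> qvs.span (Fil (Suc j) \<union> X)" using qvs.span_superset by blast
    qed (use insert in auto)
    moreover have "qvs.span (Fil (Suc j) \<union> insert a X) \<subseteq> qvs.span (insert a (qvs.span (Fil (Suc j) \<union> X)))"
      using qvs.span_superset by (intro qvs.span_mono) blast
    ultimately show ?case by (rule polynomial_on_subset)
  qed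
  from this[OF \<open>finite B\<close> B(1)] show ?thesis
    by (rule polynomial_on_subset) (use B(3) qvs.span_mono[of B "Fil (Suc j) \<union> B"] in auto)
qed

theorem polynomial_extension:
  "\<exists>F. regmat \<rat> (ec n) {u. u - 1 \<in> Efin n} m F \<and> (\<forall>u\<in>S. F u = \<phi> u)"
proof -
  have "polynomial_on (Fil J)"
    unfolding polynomial_on_def Fil_J
    by (intro exI[of _ "\<lambda>_. 1"]) (auto simp: \<phi>1 intro: regmat_one)
  then have "polynomial_on (Fil (J - i))" if "i < J" for i
    using that
  proof (induction i)
    case (Suc i)
    then have "J - i = Suc (J - Suc i)" "J - Suc i \<ge> 1" by simp_all
    then show ?case using Suc polynomial_on_Fil_step[of "J - Suc i"] by simp
  qed simp
  from this[of "J - 1"] have "polynomial_on (Fil 1)" using Jpos by simp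
  then show ?thesis unfolding polynomial_on_def using Fil_base by blast
qed

end

section \<open>Rational points of unipotent groups\<close>

text \<open>
  The coordinates are freed from rationality one at a time, since a polynomial in one variable that
  vanishes at the rational numbers is 0.
\<close>

lemma vec_coords_dense:
  fixes h :: "'c::field_char_0 vec \<Rightarrow> 'c"
  assumes h: "regular UNIV (vec_coords N) (carrier_vec N) h"
    and z: "\<And>v. v \<in> carrier_vec N \<Longrightarrow> (\<And>i. i < N \<Longrightarrow> v $ i \<in> \<rat>) \<Longrightarrow> h v = 0"
    and v: "v \<in> carrier_vec N"
  shows "h v = 0"
proof -
  obtain g where g: "g \<in> generated_algebra UNIV (vec_coords N)" "\<forall>v\<in>carrier_vec N. h v = g v"
    using h unfolding regular_def by (elim bexE) (rule that)
  have "\<forall>v\<in>carrier_vec N. (\<forall>i<N. i \<ge> j \<longrightarrow> v $ i \<in> \<rat>) \<longrightarrow> g v = 0" for j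
  proof (induction j)
    case 0
    show ?case using z g(2) by auto
  next
    case (Suc j)
    show ?case
    proof (intro ballI impI)
      fix v :: "'c vec" assume v: "v \<in> carrier_vec N" and r: "\<forall>i<N. i \<ge> Suc j \<longrightarrow> v $ i \<in> \<rat>"
      define w where "w t = vec N (\<lambda>i. if i = j then t else v $ i)" for t
      have "regular UNIV {\<lambda>t. t} UNIV (\<lambda>t. g (w t))"
      proof (rule regular_compose[OF g(1)])
        fix c :: "'c vec \<Rightarrow> 'c" assume "c \<in> vec_coords N"
        then obtain i where "i < N" "c = (\<lambda>v. v $ i)" by (auto simp: vec_coords_def)
        then show "regular UNIV {\<lambda>t. t} UNIV (\<lambda>t. c (w t))"
          by (cases "i = j") (auto simp: w_def intro: regular_const regular_gen)
      qed
      then obtain p where p: "\<forall>t. g (w t) = poly p t" using regular_imp_poly by blast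
      have "poly p (of_nat i) = 0" for i
      proof -
        have "\<forall>l<N. l \<ge> j \<longrightarrow> w (of_nat i) $ l \<in> \<rat>" using r by (auto simp: w_def)
        then have "g (w (of_nat i)) = 0" using Suc by (simp add: w_def)
        then show ?thesis using p by simp
      qed
      then have "p = 0" by (rule poly_zero_on_nat)
      moreover have "w (v $ j) = v" using v by (intro eq_vecI) (auto simp: w_def)
      ultimately show "g v = 0" using p[rule_format, of "v $ j"] by simp
    qed
  qed
  from this[of N] show ?thesis using v g(2) by simp
qed

definition vmat :: "nat \<Rightarrow> 'c::field vec \<Rightarrow> 'c endo" where
  "vmat n v = emb (mat n n (\<lambda>(i,j). v $ (i * n + j)))"

lemma index_bound: "i < n \<Longrightarrow> j < n \<Longrightarrow> i * n + j < n * (n::nat)"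
proof -
  assume "i < n" "j < n"
  then have "i * n + j < i * n + n" by simp
  also have "\<dots> = Suc i * n" by simp
  also have "\<dots> \<le> n * n" using \<open>i < n\<close> by (intro mult_right_mono) auto
  finally show ?thesis .
qed

lemma vmat_Efin: "vmat n v \<in> Efin n"
  unfolding vmat_def by (intro Efin_emb) simp

lemma ent_vmat: "i < n \<Longrightarrow> j < n \<Longrightarrow> ent (vmat n v) i j = v $ (i * n + j)"
  by (simp add: vmat_def ent_emb)

lemma regmat_vmat:
  assumes "n * n \<le> N"
  shows "regmat k (vec_coords N) D n (vmat n)"
  unfolding regmat_def
proof (intro conjI ballI allI impI)
  show "vmat n v \<in> Cfin n" for v by (rule Efin_Cfin[OF vmat_Efin])
  fix i j assume ij: "i < n" "j < n"
  have "(\<lambda>v. v $ (i * n + j)) \<in> vec_coords N"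
    using index_bound[OF ij] assms by (auto simp: vec_coords_def intro!: exI[of _ "i * n + j"])
  then show "regular k (vec_coords N) D (\<lambda>v. ent (vmat n v) i j)"
    unfolding ent_vmat[OF ij] by (rule regular_gen)
qed

lemma elements_mat_subset_iff:
  assumes "A \<in> carrier_mat n n"
  shows "elements_mat A \<subseteq> k \<longleftrightarrow> (\<forall>i<n. \<forall>j<n. A $$ (i,j) \<in> k)"
  using assms by (force simp: elements_mat_def)

lemma rational_points_simps:
  "carrier (rational_points k n G) = {A \<in> G. elements_mat A \<subseteq> k}"
  "x \<otimes>\<^bsub>rational_points k n G\<^esub> y = x * y"
  by (simp_all add: rational_points_def GL_simps)

lemma rational_pointsI:
  assumes "x \<in> G" "x \<in> carrier_mat n n" "\<And>i j. i < n \<Longrightarrow> j < n \<Longrightarrow> x $$ (i,j) \<in> k"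
  shows "x \<in> carrier (rational_points k n G)"
  using assms by (simp add: rational_points_simps elements_mat_subset_iff)

lemma rational_pointsD:
  assumes "x \<in> carrier (rational_points k n G)" "x \<in> carrier_mat n n"
  shows "x \<in> G" "i < n \<Longrightarrow> j < n \<Longrightarrow> x $$ (i,j) \<in> k"
  using assms by (auto simp: rational_points_simps elements_mat_subset_iff)

text \<open>
  The rational parametrisation reduces this to the density of rational vectors in an affine space.
\<close>

lemma unipotent_rational_points_dense:
  assumes grp: "unipotent_alg_group \<rat> n U J"
    and f: "regular UNIV (GL_coords n) U f"
    and z: "\<And>x. x \<in> carrier (rational_points \<rat> n U) \<Longrightarrow> f x = 0"
    and x: "x \<in> U"
  shows "f x = 0"
proof -
  interpret unipotent_alg_group \<rat> n U J by fact
  obtain q where q: "\<And>a b. a \<in> {..<n} \<times> {..<n} \<Longrightarrow> b \<in> {..<n} \<times> {..<n} \<Longrightarrow> q a b \<in> \<rat>"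
    "\<And>X. lproj n q X ^ J = 0" "\<And>X. Exp J (lproj n q X) \<in> stab n ` U"
    "\<And>u. u \<in> stab n ` U \<Longrightarrow> lproj n q (Log J u) = Log J u"
    by (rule parametrisation) (rule that)
  define E where "E v = Exp J (lproj n q (vmat n v))" for v
  have Ereg: "regmat \<rat> (vec_coords (n * n)) (carrier_vec (n * n)) n E"
    unfolding E_def by (intro regmat_Exp[OF Qclosed_Rats] regmat_lproj q(1) regmat_vmat) auto
  have ES: "E v \<in> stab n ` U" for v unfolding E_def by (rule q(3))
  obtain g where g: "g \<in> generated_algebra UNIV (GL_coords n)" "\<forall>x\<in>U. f x = g x"
    using f unfolding regular_def by (elim bexE) (rule that)
  have "regular UNIV (vec_coords (n * n)) (carrier_vec (n * n)) (\<lambda>v. g (mt n (E v)))"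
  proof (rule regular_GL_det_1[OF g(1) regmat_mono[OF Ereg]])
    show "det (mt n (E v)) = 1" for v by (rule det_mt_unipotent[OF stabU(1,2)[OF ES]])
  qed auto
  moreover have "g (mt n (E v)) = 0" if "v \<in> carrier_vec (n * n)" "\<And>i. i < n * n \<Longrightarrow> v $ i \<in> \<rat>" for v
  proof -
    note v = that
    have "ent (E v) i j \<in> \<rat>" if "i < n" "j < n" for i j
    proof -
      have "regular \<rat> (vec_coords (n * n)) (carrier_vec (n * n)) (\<lambda>v. ent (E v) i j)"
        using Ereg that by (simp add: regmat_def)
      from regular_values[OF this v(1)] show ?thesis using v(2) by (auto simp: vec_coords_def)
    qed
    then have "mt n (E v) \<in> carrier (rational_points \<rat> n U)"
      using stabU(3)[OF ES] by (intro rational_pointsI[OF _ mt_carrier(1)]) auto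
    from z[OF this] show ?thesis using bspec[OF g(2) stabU(3)[OF ES[of v]]] by simp
  qed
  ultimately have all: "g (mt n (E v)) = 0" if "v \<in> carrier_vec (n * n)" for v
    by (rule vec_coords_dense[OF _ _ that])
  let ?u = "stab n x"
  have u: "?u \<in> stab n ` U" using x by auto
  define v where "v = vec (n * n) (\<lambda>i. ent (Log J ?u) (i div n) (i mod n))"
  have "vmat n v = Log J ?u"
  proof (rule Efin_eqI[OF vmat_Efin Log_Efin[OF stabU(1)[OF u]]])
    fix i j assume ij: "i < n" "j < n"
    then show "ent (vmat n v) i j = ent (Log J ?u) i j"
      using index_bound[OF ij] by (simp add: ent_vmat v_def)
  qed
  then have "E v = ?u" unfolding E_def by (simp add: q(4)[OF u] Exp_Log[OF stabU(2)[OF u]])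
  then have "mt n (E v) = x" using mt_stab[OF U_carrier(1)[OF x]] by simp
  then show ?thesis using all[of v] g(2) x by (simp add: v_def)
qed

lemma morphism_regular:
  assumes "f \<in> morphisms_over k C V C' V'" "h \<in> generated_algebra k C'"
  shows "regular k C V (\<lambda>x. h (f x))"
proof -
  have "\<forall>h\<in>generated_algebra k C'. \<exists>g\<in>generated_algebra k C. \<forall>x\<in>V. h (f x) = g x"
    using assms(1) by (simp add: morphisms_over_def)
  from bspec[OF this assms(2)] show ?thesis unfolding regular_def .
qed

lemma morphisms_eq_if_dense:
  assumes grp: "unipotent_alg_group \<rat> n U J" and G: "G \<subseteq> carrier_mat m m"
    and f: "f \<in> morphisms_over \<rat> (GL_coords n) U (GL_coords m) G"
    and g: "g \<in> morphisms_over \<rat> (GL_coords n) U (GL_coords m) G"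
    and eq: "\<And>x. x \<in> carrier (rational_points \<rat> n U) \<Longrightarrow> f x = g x"
  shows "f = g"
proof
  have fg: "f \<in> U \<rightarrow>\<^sub>E G" "g \<in> U \<rightarrow>\<^sub>E G" using f g by (simp_all add: morphisms_over_def)
  fix x
  show "f x = g x"
  proof (cases "x \<in> U")
    case True
    have "f x $$ (i,j) = g x $$ (i,j)" if ij: "i < m" "j < m" for i j
    proof -
      have c: "(\<lambda>A. A $$ (i,j)) \<in> generated_algebra \<rat> (GL_coords m)"
        by (rule generated_algebra.gen) (use ij in \<open>auto simp: GL_coords_def\<close>)
      have "regular UNIV (GL_coords n) U (\<lambda>x. f x $$ (i,j) + (- 1) * g x $$ (i,j))"
        by (intro regular_add regular_mult regular_const regular_mono[OF morphism_regular[OF f c]]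
            regular_mono[OF morphism_regular[OF g c]]) auto
      from unipotent_rational_points_dense[OF grp this _ True] eq show ?thesis by simp
    qed
    moreover have "f x \<in> carrier_mat m m" "g x \<in> carrier_mat m m"
      using PiE_mem[OF fg(1) True] PiE_mem[OF fg(2) True] G by blast+
    ultimately show ?thesis by (intro eq_matI) auto
  next
    case False
    then show ?thesis using PiE_arb[OF fg(1)] PiE_arb[OF fg(2)] by metis
  qed
qed

lemma stab_nilpotent:
  assumes x: "x \<in> carrier_mat n n" and l: "(x - 1\<^sub>m n) ^\<^sub>m l = 0\<^sub>m n n"
  shows "(stab n x - 1) ^ Suc l = 0"
proof -
  have c: "x - 1\<^sub>m n \<in> carrier_mat n n" using x by (intro minus_carrier_mat) auto
  have "mt n (emb (x - 1\<^sub>m n) ^ Suc l) = (x - 1\<^sub>m n) ^\<^sub>m Suc l"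
    using mt_power[OF Efin_Cfin[OF Efin_emb[OF c]], of "Suc l"] by (simp only: mt_emb[OF c])
  also have "\<dots> = 0\<^sub>m n n" using l c by simp
  finally have "mt n (emb (x - 1\<^sub>m n) ^ Suc l) = 0\<^sub>m n n" .
  then have 0: "emb (mt n (emb (x - 1\<^sub>m n) ^ Suc l)) = 0" by (simp only: emb_zero)
  have "emb (x - 1\<^sub>m n) ^ Suc l \<in> Efin n" by (rule Efin_power[OF Efin_emb[OF c]]) simp
  from emb_mt[OF this] 0 have "emb (x - 1\<^sub>m n) ^ Suc l = 0" by (simp only:)
  then show ?thesis unfolding stab_def by (simp only: add_diff_cancel_left')
qed

lemma ev_ratmat:
  assumes "N \<in> ratmat n" "\<And>k. fps_nth f k \<in> \<rat>" "fps_nth f 0 = 0"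
  shows "ev J N f \<in> ratmat n"
  unfolding ev_def
proof (rule qvs.subspace_sum[OF ratmat_subspace])
  fix k
  obtain q where q: "fps_nth f k = of_rat q" using assms(2) by (rule Rats_cases)
  show "sc (fps_nth f k) * N ^ k \<in> ratmat n"
  proof (cases k)
    case 0
    then have "sc (fps_nth f k) * N ^ k = 0" using assms(3) by (simp add: sc_simps)
    then show ?thesis using qvs.subspace_0[OF ratmat_subspace] by (simp only:)
  next
    case (Suc i)
    have "N ^ Suc i \<in> ratmat n"
    proof (induction i)
      case (Suc i)
      show ?case unfolding power_Suc[of N "Suc i"] by (rule ratmat_mult[OF assms(1) Suc])
    qed (simp add: assms(1))
    from qvs.subspace_scale[OF ratmat_subspace this, of q] show ?thesis unfolding q unfolding Suc .
  qed
qed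

lemma rational_power_ratmat:
  assumes "u - 1 \<in> ratmat n" "(u - 1) ^ J = 0" "t \<in> \<rat>"
  shows "Exp J (sc t * Log J u) - 1 \<in> ratmat n"
proof -
  have "Exp J (sc t * Log J u) - 1 = ev J (u - 1) ((fps_exp t oo fps_ln 1) - 1)"
    unfolding Exp_sc_Log[OF assms(2)] ev_minus ev_one[OF assms(2)] ..
  also have "\<dots> \<in> ratmat n"
  proof (rule ev_ratmat[OF assms(1)])
    fix k show "fps_nth ((fps_exp t oo fps_ln 1) - 1) k \<in> \<rat>"
      using binomial_series_Rats[OF assms(3), of k] by (cases "k = 0") (auto simp: fps_one_nth)
  qed simp
  finally show ?thesis .
qed

lemma idempotent_GL:
  fixes z :: "'c::field mat"
  assumes "z \<in> carrier (GL m)" "z * z = z"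
  shows "z = 1\<^sub>m m"
proof -
  interpret group "GL m :: 'c mat monoid" by (rule GL_group)
  have "z \<otimes>\<^bsub>GL m\<^esub> z = z" using assms(2) by (simp add: GL_simps)
  then show ?thesis using assms(1) by (simp add: GL_simps(2)[symmetric])
qed

text \<open>
  The polynomial map \<open>P\<close> that extends \<open>\<phi>\<close> has determinant 1, takes values in \<open>G\<close> and is multiplicative,
  because all of these are equations that hold on the dense set of rational points.
\<close>

theorem rational_hom_extends:
  fixes U G :: "'c::{alg_closed_field,field_char_0} mat set"
  assumes ugrp: "unipotent_alg_group \<rat> n U J" and G: "algebraic_group \<rat> m G"
    and \<phi>: "\<phi> \<in> hom (rational_points \<rat> n U) (rational_points \<rat> m G)"
  shows "\<exists>!\<psi>. \<psi> \<in> algebraic_homs \<rat> n U m G \<and> (\<forall>x \<in> carrier (rational_points \<rat> n U). \<phi> x = \<psi> x)"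
proof -
  interpret unipotent_alg_group \<rat> n U J by fact
  let ?UQ = "carrier (rational_points \<rat> n U)"
  let ?S = "stab n ` ?UQ"
  have Gc: "x \<in> carrier_mat m m" "det x \<noteq> 0" if "x \<in> G" for x
    using algebraic_groupD(1)[OF G] that by (auto simp: GL_carrier)
  have UQ: "x \<in> U" "x \<in> carrier_mat n n" "i < n \<Longrightarrow> j < n \<Longrightarrow> x $$ (i,j) \<in> \<rat>" if "x \<in> ?UQ" for x i j
  proof -
    show "x \<in> U" using that by (simp add: rational_points_simps)
    then show "x \<in> carrier_mat n n" by (rule U_carrier)
    then show "i < n \<Longrightarrow> j < n \<Longrightarrow> x $$ (i,j) \<in> \<rat>" using rational_pointsD(2)[OF that] by blast
  qed
  have \<phi>Q: "\<phi> x \<in> G" "\<phi> x \<in> carrier_mat m m" "i < m \<Longrightarrow> j < m \<Longrightarrow> \<phi> x $$ (i,j) \<in> \<rat>" if "x \<in> ?UQ" for x i j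
  proof -
    have "\<phi> x \<in> carrier (rational_points \<rat> m G)" by (rule hom_in_carrier[OF \<phi> that])
    then show "\<phi> x \<in> G" by (simp add: rational_points_simps)
    then show "\<phi> x \<in> carrier_mat m m" by (rule Gc)
    then show "i < m \<Longrightarrow> j < m \<Longrightarrow> \<phi> x $$ (i,j) \<in> \<rat>"
      using rational_pointsD(2)[OF \<open>\<phi> x \<in> carrier (rational_points \<rat> m G)\<close>] by blast
  qed
  have \<phi>m: "\<phi> (x * y) = \<phi> x * \<phi> y" if "x \<in> ?UQ" "y \<in> ?UQ" for x y
    using hom_mult[OF \<phi> that] by (simp add: rational_points_simps)
  have ratE: "stab p x - 1 \<in> ratmat p" if "x \<in> carrier_mat p p" "\<And>i j. i < p \<Longrightarrow> j < p \<Longrightarrow> x $$ (i,j) \<in> \<rat>" for p and x :: "'c mat"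
  proof -
    have "ent (stab p x - 1) i j \<in> \<rat>" if "i < p" "j < p" for i j
      using mt_index[OF that, of "stab p x"] mt_stab[OF \<open>x \<in> carrier_mat p p\<close>]
        \<open>\<And>i j. i < p \<Longrightarrow> j < p \<Longrightarrow> x $$ (i,j) \<in> \<rat>\<close>[OF that] by (auto simp: ent_simps)
    then show ?thesis using stab_minus_1[OF that(1)] by (simp add: ratmat_def)
  qed
  have SI: "u \<in> ?S" if "u \<in> stab n ` U" "u - 1 \<in> ratmat n" for u
  proof -
    have "ent u i j \<in> \<rat>" if "i < n" "j < n" for i j
    proof -
      have "ent (u - 1) i j + ent 1 i j \<in> \<rat>"
        using \<open>u - 1 \<in> ratmat n\<close> that by (intro Rats_add) (auto simp: ratmat_def ent_simps(2))
      then show ?thesis by (simp add: ent_simps)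
    qed
    then have "mt n u \<in> ?UQ" using stabU(3)[OF that(1)] by (intro rational_pointsI[OF _ mt_carrier(1)]) auto
    then show ?thesis using stabU(4)[OF that(1)] by (metis image_eqI)
  qed
  have SU: "u \<in> stab n ` U" if "u \<in> ?S" for u using that UQ(1) by auto
  have Srat: "u - 1 \<in> ratmat n" if "u \<in> ?S" for u using that ratE UQ(2,3) by auto
  have mtS: "mt n u \<in> ?UQ" if u: "u \<in> ?S" for u 
  proof -
    obtain x where x: "x \<in> ?UQ" "u = stab n x" using u by blast
    show ?thesis unfolding x(2) mt_stab[OF UQ(2)[OF x(1)]] by (rule x(1))
  qed
  have S1: "1 \<in> ?S" by (rule SI[OF stabU_one]) (simp add: qvs.subspace_0[OF ratmat_subspace])
  have Smult: "u * w \<in> ?S" if "u \<in> ?S" "w \<in> ?S" for u w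
  proof (rule SI[OF stabU_mult[OF SU[OF that(1)] SU[OF that(2)]]])
    have "u * w - 1 = (u - 1) * (w - 1) + ((u - 1) + (w - 1))" by (simp add: algebra_simps)
    then show "u * w - 1 \<in> ratmat n"
      using Srat that ratmat_mult qvs.subspace_add[OF ratmat_subspace] by metis
  qed
  have Spow: "Exp J (sc t * Log J u) \<in> ?S" if "u \<in> ?S" "t \<in> \<rat>" for u t
    by (rule SI[OF Exp_Log_line[OF SU[OF that(1)]] rational_power_ratmat[OF Srat[OF that(1)] stabU(2)[OF SU[OF that(1)]] that(2)]])
  have one: "1\<^sub>m n \<in> ?UQ" using mtS[OF S1] unfolding mt_one .
  have \<phi>one: "\<phi> (1\<^sub>m n) = 1\<^sub>m m"
  proof (rule idempotent_GL)
    show "\<phi> (1\<^sub>m n) \<in> carrier (GL m)" using \<phi>Q(1)[OF one] Gc by (simp add: GL_carrier)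
    show "\<phi> (1\<^sub>m n) * \<phi> (1\<^sub>m n) = \<phi> (1\<^sub>m n)" using \<phi>m[OF one one] by simp
  qed
  have UQmult: "x * y \<in> ?UQ" if x: "x \<in> ?UQ" and y: "y \<in> ?UQ" for x y
  proof -
    have "stab n (x * y) \<in> ?S" unfolding stab_mult[OF UQ(2)[OF x] UQ(2)[OF y]] using x y by (intro Smult imageI)
    from mtS[OF this] show ?thesis unfolding mt_stab[OF mult_carrier_mat[OF UQ(2)[OF x] UQ(2)[OF y]]] .
  qed
  have UQpow: "x ^\<^sub>m i \<in> ?UQ \<and> \<phi> (x ^\<^sub>m i) = \<phi> x ^\<^sub>m i" if x: "x \<in> ?UQ" for x i
  proof (induction i)
    case 0
    show ?case using one \<phi>one UQ(2)[OF x] \<phi>Q(2)[OF x] by simp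
  next
    case (Suc i)
    then show ?case using UQmult[of "x ^\<^sub>m i" x] \<phi>m[of "x ^\<^sub>m i" x] x by simp
  qed
  define \<phi>' where "\<phi>' u = stab m (\<phi> (mt n u))" for u
  (* The matrices phi (x^(1/N)) are the compatible rational roots of phi x. *)
  have \<phi>unip: "(\<phi> x - 1\<^sub>m m) ^\<^sub>m m = 0\<^sub>m m m" if x: "x \<in> ?UQ" for x
  proof -
    let ?u = "stab n x"
    have u: "?u \<in> ?S" using x by auto
    note L = Log_nilpotent[OF stabU(2)[OF SU[OF u]]]
    define B where "B N = mt n (Exp J (sc (1 / of_nat N) * Log J ?u))" for N :: nat
    have B: "B N \<in> ?UQ" for N unfolding B_def by (rule mtS[OF Spow[OF u]]) simp
    have Cf: "Exp J (sc t * Log J ?u) \<in> Cfin n" for t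
      using stab_Cfin[OF U_carrier(1)[OF stabU(3)[OF Exp_Log_line[OF SU[OF u]]]]] stabU(4)[OF Exp_Log_line[OF SU[OF u]]] by metis
    have Bpow: "B (N * k) ^\<^sub>m k = B N" if "N > 0" "k > 0" for N k
    proof -
      have "of_nat k * (1 / of_nat (N * k)) = (1 / of_nat N :: 'c)" using that by simp
      then have "Exp J (sc (1 / of_nat N) * Log J ?u) = Exp J (sc (1 / of_nat (N * k)) * Log J ?u) ^ k"
        using Exp_power[OF L, of k "1 / of_nat (N * k)"] by simp
      then show ?thesis unfolding B_def by (simp only: mt_power[OF Cf])
    qed
    have "B 1 = x" unfolding B_def
      using Exp_Log[OF stabU(2)[OF SU[OF u]]] mt_stab[OF UQ(2)[OF x]] by (simp add: sc_simps)
    moreover have "(\<phi> (B 1) - 1\<^sub>m m) ^\<^sub>m m = 0\<^sub>m m m"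
    proof (rule divisible_rational_unipotent[of "\<lambda>N. \<phi> (B N)"])
      fix N k :: nat assume "N > 0" "k > 0"
      then show "\<phi> (B (N * k)) ^\<^sub>m k = \<phi> (B N)" using UQpow[OF B, of "N * k" k] Bpow by metis
    qed (use \<phi>Q[OF B] Gc in auto)
    ultimately show ?thesis by simp
  qed
  interpret rational_unipotent_hom n m J "Suc m" ?S \<phi>'
  proof
    show "prod_list as = 0" if "set as \<subseteq> (\<lambda>u. u - 1) ` ?S" "length as = J" for as
    proof (rule vanish[OF _ that(2)])
      have "?S \<subseteq> stab n ` U" using SU by blast
      then have "(\<lambda>u. u - 1) ` ?S \<subseteq> (\<lambda>u. u - 1) ` stab n ` U" by (rule image_mono)
      also have "\<dots> \<subseteq> lin_aug (stab n ` U)" unfolding lin_aug_def by (rule cvs.span_superset)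
      finally show "set as \<subseteq> lin_aug (stab n ` U)" using that(1) by (rule subset_trans[rotated])
    qed
    show "\<phi>' 1 = 1"
      unfolding \<phi>'_def mt_one \<phi>one by (rule stab_one)
    show "\<phi>' (u * w) = \<phi>' u * \<phi>' w" if uw: "u \<in> ?S" "w \<in> ?S" for u w
    proof -
      have "w \<in> Cfin n" using uw(2) stab_Cfin UQ(2) by auto
      then show ?thesis
        using \<phi>m[OF mtS[OF uw(1)] mtS[OF uw(2)]] stab_mult[OF \<phi>Q(2)[OF mtS[OF uw(1)]] \<phi>Q(2)[OF mtS[OF uw(2)]]]
        by (simp add: \<phi>'_def mt_mult)
    qed
    show "\<phi>' u - 1 \<in> ratmat m" if "u \<in> ?S" for u
      unfolding \<phi>'_def using \<phi>Q(2,3)[OF mtS[OF that]] by (rule ratE)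
    show "(\<phi>' u - 1) ^ Suc m = 0" if "u \<in> ?S" for u
      unfolding \<phi>'_def by (rule stab_nilpotent[OF \<phi>Q(2)[OF mtS[OF that]] \<phi>unip[OF mtS[OF that]]])
  qed (fact S1 Smult Spow Srat J_pos)+
  obtain F where F: "regmat \<rat> (ec n) {u. u - 1 \<in> Efin n} m F" "\<forall>u\<in>?S. F u = \<phi>' u"
    using polynomial_extension by (elim exE conjE)
  define P where "P x = mt m (F (stab n x))" for x
  have F\<phi>: "F (stab n x) = stab m (\<phi> x)" if "x \<in> ?UQ" for x
  proof -
    have "F (stab n x) = \<phi>' (stab n x)" using F(2) that by blast
    then show ?thesis unfolding \<phi>'_def mt_stab[OF UQ(2)[OF that]] .
  qed
  have P\<phi>: "P x = \<phi> x" if "x \<in> ?UQ" for x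
    unfolding P_def F\<phi>[OF that] by (rule mt_stab[OF \<phi>Q(2)[OF that]])
  have Pc: "P x \<in> carrier_mat m m" for x by (simp add: P_def)
  have comp: "regmat k (GL_coords n) U m (\<lambda>x. F (W x))"
    if "\<rat> \<subseteq> k" "regmat k (GL_coords n) U n W" "\<And>x. x \<in> U \<Longrightarrow> W x - 1 \<in> Efin n" for k W
  proof (rule regmat_compose[OF regmat_mono[OF F(1) that(1)]])
    fix c :: "'c endo \<Rightarrow> 'c" assume "c \<in> ec n"
    then obtain i j where "i < n" "j < n" "c = (\<lambda>u. ent u i j)" by (auto simp: ec_def)
    then show "regular k (GL_coords n) U (\<lambda>x. c (W x))" using that(2) by (simp add: regmat_def)
  qed (use that(3) in auto)
  have Ust: "stab n x - 1 \<in> Efin n" if "x \<in> U" for x by (rule stab_minus_1[OF U_carrier(1)[OF that]])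
  have stU: "regmat k (GL_coords n) U n (stab n)" for k by (rule regmat_stab) (use U_carrier in auto)
  have Freg: "regmat \<rat> (GL_coords n) U m (\<lambda>x. F (stab n x))" by (rule comp[OF _ stU Ust]) auto
  have detP: "det (P x) = 1" if x: "x \<in> U" for x
  proof -
    obtain \<delta> :: "'c mat \<Rightarrow> 'c" where \<delta>: "\<delta> \<in> generated_algebra \<rat> (mcoords m)" "\<forall>x\<in>carrier_mat m m. det x = \<delta> x"
      using regular_det[OF Qclosed_Rats, of m] unfolding regular_def by (elim bexE) (rule that)
    have "regular \<rat> (GL_coords n) U (\<lambda>x. \<delta> (P x))"
    proof (rule regular_compose[OF \<delta>(1)])
      fix c :: "'c mat \<Rightarrow> 'c" assume "c \<in> mcoords m"
      then obtain i j where "i < m" "j < m" "c = (\<lambda>u. u $$ (i,j))" by (auto simp: mcoords_def)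
      then show "regular \<rat> (GL_coords n) U (\<lambda>x. c (P x))" using Freg by (simp add: P_def regmat_def)
    qed
    then have "regular \<rat> (GL_coords n) U (\<lambda>x. det (P x))" unfolding bspec[OF \<delta>(2) Pc] .
    from regular_add[OF regular_mono[OF this subset_UNIV] regular_const[of "- 1"]]
    have "regular UNIV (GL_coords n) U (\<lambda>x. det (P x) + - 1)" by simp
    moreover have "det (P x) + - 1 = 0" if "x \<in> ?UQ" for x
      using det_unipotent[OF \<phi>Q(2)[OF that] \<phi>unip[OF that]] by (simp add: P\<phi>[OF that])
    ultimately have "det (P x) + - 1 = 0" by (rule unipotent_rational_points_dense[OF ugrp _ _ x])
    then show ?thesis by simp
  qed
  have Preg: "regular k (GL_coords n) U (\<lambda>x. f (P x))" if "f \<in> generated_algebra k (GL_coords m)" "\<rat> \<subseteq> k" for f k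
    unfolding P_def
  proof (rule regular_GL_det_1[OF that(1) regmat_mono[OF Freg that(2)]])
    show "1 \<in> k" using that(2) by auto
    show "det (mt m (F (stab n x))) = 1" if "x \<in> U" for x using detP[OF that] unfolding P_def .
  qed
  have PG: "P x \<in> G" if x: "x \<in> U" for x
  proof (rule algebraic_group_closed[OF G])
    show "P x \<in> carrier (GL m)" using Pc detP[OF x] by (simp add: GL_carrier)
    fix f :: "'c mat \<Rightarrow> 'c" assume f: "f \<in> vanishing_ideal UNIV (GL_coords m) G"
    then have "regular UNIV (GL_coords n) U (\<lambda>x. f (P x))" by (intro Preg) (auto simp: vanishing_ideal_def)
    moreover have "f (P x) = 0" if "x \<in> ?UQ" for x
      using f \<phi>Q(1)[OF that] by (simp add: P\<phi>[OF that] vanishing_ideal_def)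
    ultimately show "f (P x) = 0" by (rule unipotent_rational_points_dense[OF ugrp _ _ x])
  qed
  have eq_dense: "mt m (H x) = mt m (H' x)"
    if "regmat UNIV (GL_coords n) U m H" "regmat UNIV (GL_coords n) U m H'" "\<And>x. x \<in> ?UQ \<Longrightarrow> mt m (H x) = mt m (H' x)" "x \<in> U" for H H' x
  proof (rule eq_matI)
    fix i j assume ij: "i < dim_row (mt m (H' x))" "j < dim_col (mt m (H' x))"
    have "regular UNIV (GL_coords n) U (\<lambda>x. ent (H x) i j + (- 1) * ent (H' x) i j)"
      using that(1,2) ij by (intro regular_add regular_mult regular_const) (auto simp: regmat_def)
    moreover have "ent (H x) i j + (- 1) * ent (H' x) i j = 0" if "x \<in> ?UQ" for x
      using \<open>\<And>x. x \<in> ?UQ \<Longrightarrow> mt m (H x) = mt m (H' x)\<close>[OF that] ij mt_index[of i m j "H x"] mt_index[of i m j "H' x"] by simp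
    ultimately have "ent (H x) i j + (- 1) * ent (H' x) i j = 0"
      by (rule unipotent_rational_points_dense[OF ugrp _ _ that(4)])
    then show "mt m (H x) $$ (i,j) = mt m (H' x) $$ (i,j)" using ij by simp
  qed auto
  have FC: "F (stab n x) \<in> Cfin m" if "x \<in> U" for x using Freg that by (simp add: regmat_def)
  have stC: "stab n x \<in> Cfin n" if "x \<in> U" for x by (rule stab_Cfin[OF U_carrier(1)[OF that]])
  have constE: "regmat UNIV (GL_coords n) U p (\<lambda>_. w)" if "w \<in> Cfin p" for w p
    by (rule regmat_const[OF that]) simp
  have FU: "regmat UNIV (GL_coords n) U m (\<lambda>x. F (stab n x))" by (rule regmat_mono[OF Freg]) simp
  (* Multiplicativity is extended from rational points to all points in one argument at a
     time, since density is known for U and not for the product of U with itself. *)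
  have one: "mt m (F (stab n x * stab n y)) = mt m (F (stab n x) * F (stab n y))" if x: "x \<in> U" and y: "y \<in> ?UQ" for x y
  proof (rule eq_dense[OF _ _ _ x])
    show "regmat UNIV (GL_coords n) U m (\<lambda>x. F (stab n x * stab n y))"
      by (rule comp[OF _ regmat_mult[OF _ stU constE[OF stC[OF UQ(1)[OF y]]]]])
        (auto intro: Efin_mult_minus_1 Ust UQ(1)[OF y])
    show "regmat UNIV (GL_coords n) U m (\<lambda>x. F (stab n x) * F (stab n y))"
      by (rule regmat_mult[OF _ FU constE[OF FC[OF UQ(1)[OF y]]]]) simp
    fix x assume x: "x \<in> ?UQ"
    have xy: "x * y \<in> ?UQ" by (rule UQmult[OF x y])
    show "mt m (F (stab n x * stab n y)) = mt m (F (stab n x) * F (stab n y))"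
      unfolding stab_mult[OF UQ(2)[OF x] UQ(2)[OF y], symmetric] F\<phi>[OF xy] F\<phi>[OF x] F\<phi>[OF y] \<phi>m[OF x y]
        stab_mult[OF \<phi>Q(2)[OF x] \<phi>Q(2)[OF y]] ..
  qed
  have two: "mt m (F (stab n x * stab n y)) = mt m (F (stab n x) * F (stab n y))" if x: "x \<in> U" and y: "y \<in> U" for x y
  proof (rule eq_dense[of "\<lambda>y. F (stab n x * stab n y)" "\<lambda>y. F (stab n x) * F (stab n y)", OF _ _ _ y])
    show "regmat UNIV (GL_coords n) U m (\<lambda>y. F (stab n x * stab n y))"
      by (rule comp[OF _ regmat_mult[OF _ constE[OF stC[OF x]] stU]]) (auto intro: Efin_mult_minus_1 Ust x)
    show "regmat UNIV (GL_coords n) U m (\<lambda>y. F (stab n x) * F (stab n y))"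
      by (rule regmat_mult[OF _ constE[OF FC[OF x]] FU]) simp
  qed (rule one[OF x])
  have Pm: "P (x * y) = P x * P y" if "x \<in> U" "y \<in> U" for x y
    unfolding P_def stab_mult[OF U_carrier(1)[OF that(1)] U_carrier(1)[OF that(2)]] two[OF that] mt_mult[OF FC[OF that(2)]] ..
  define \<psi> where "\<psi> = restrict P U"
  have \<psi>x: "\<psi> x = P x" if "x \<in> U" for x using that by (simp add: \<psi>_def)
  have mor: "\<psi> \<in> morphisms_over \<rat> (GL_coords n) U (GL_coords m) G"
    unfolding morphisms_over_def
  proof (intro CollectI conjI ballI)
    show "\<psi> \<in> U \<rightarrow>\<^sub>E G" using PG by (auto simp: \<psi>_def)
    fix h :: "'c mat \<Rightarrow> 'c" assume h: "h \<in> generated_algebra \<rat> (GL_coords m)"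
    from Preg[OF h subset_refl] show "\<exists>g\<in>generated_algebra \<rat> (GL_coords n). \<forall>x\<in>U. h (\<psi> x) = g x"
      unfolding regular_def by (simp add: \<psi>x)
  qed
  have "\<psi> \<in> hom ((GL n)\<lparr>carrier := U\<rparr>) ((GL m)\<lparr>carrier := G\<rparr>)"
    by (rule homI) (auto simp: GL_simps \<psi>x PG Pm algebraic_groupD(3)[OF grp])
  with mor have hom: "\<psi> \<in> algebraic_homs \<rat> n U m G" by (simp add: algebraic_homs_def)
  show ?thesis
  proof (rule ex1I[of _ \<psi>])
    show "\<psi> \<in> algebraic_homs \<rat> n U m G \<and> (\<forall>x \<in> ?UQ. \<phi> x = \<psi> x)"
      using hom P\<phi> UQ(1) \<psi>x by auto
    fix \<psi>' assume \<psi>': "\<psi>' \<in> algebraic_homs \<rat> n U m G \<and> (\<forall>x \<in> ?UQ. \<phi> x = \<psi>' x)"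
    show "\<psi>' = \<psi>"
    proof (rule morphisms_eq_if_dense[OF ugrp _ _ mor])
      show "G \<subseteq> carrier_mat m m" using Gc by auto
      show "\<psi>' \<in> morphisms_over \<rat> (GL_coords n) U (GL_coords m) G" using \<psi>' by (simp add: algebraic_homs_def)
      fix x assume "x \<in> ?UQ"
      then show "\<psi>' x = \<psi> x" using \<psi>' P\<phi> UQ(1) \<psi>x by metis
    qed
  qed
qed

section \<open>The general linear group as an affine variety\<close>

lemma carrier_vec_variety: "variety_over (k :: 'c::field set) (carrier_vec N) (vec_coords N) (carrier_vec N)"
  unfolding variety_over_def
proof (intro conjI ballI)
  show "zariski_closed (carrier_vec N) (vec_coords N) (carrier_vec N)"
    unfolding zariski_closed_def by (intro exI[of _ "{}"]) auto
  fix f :: "'c vec \<Rightarrow> 'c" assume "f \<in> vanishing_ideal UNIV (vec_coords N) (carrier_vec N)"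
  then show "\<exists>F c. finite F \<and> F \<subseteq> vanishing_ideal k (vec_coords N) (carrier_vec N) \<and>
      (\<forall>g\<in>F. c g \<in> generated_algebra UNIV (vec_coords N)) \<and> (\<forall>x\<in>carrier_vec N. f x = (\<Sum>g\<in>F. c g x * g x))"
    by (intro exI[of _ "{}"] exI[of _ "\<lambda>_ _. 0"]) (auto simp: vanishing_ideal_def)
qed

text \<open>
  The closed embedding of the general linear group in affine space, with \<open>1 / det\<close> as the last
  coordinate. Test varieties for the universal property live in affine space, so this makes subgroups
  of the general linear group available as test varieties.
\<close>

definition aff :: "nat \<Rightarrow> 'c::field mat \<Rightarrow> 'c vec" where
  "aff r x = vec (r * r + 1) (\<lambda>i. if i < r * r then x $$ (i div r, i mod r) else inverse (det x))"

definition unaff :: "nat \<Rightarrow> 'c::field vec \<Rightarrow> 'c mat" where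
  "unaff r v = mat r r (\<lambda>(i,j). v $ (i * r + j))"

lemma unaff_carrier: "unaff r v \<in> carrier_mat r r"
  by (simp add: unaff_def)

lemma unaff_index: "i < r \<Longrightarrow> j < r \<Longrightarrow> unaff r v $$ (i,j) = v $ (i * r + j)"
  by (simp add: unaff_def)

lemma aff_carrier: "aff r x \<in> carrier_vec (r * r + 1)"
  by (simp add: aff_def)

lemma unaff_aff: "x \<in> carrier_mat r r \<Longrightarrow> unaff r (aff r x) = x"
proof (rule eq_matI)
  fix i j assume x: "x \<in> carrier_mat r r" and "i < dim_row x" "j < dim_col x"
  then have ij: "i < r" "j < r" by auto
  show "unaff r (aff r x) $$ (i,j) = x $$ (i,j)"
    using index_bound[OF ij] ij by (simp add: unaff_index[OF ij] aff_def)
qed (auto simp: unaff_def)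

lemma aff_last: "aff r x $ (r * r) = inverse (det x)"
  by (simp add: aff_def)

lemma aff_unaff:
  assumes v: "v \<in> carrier_vec (r * r + 1)" and d: "det (unaff r v) * v $ (r * r) = 1"
  shows "aff r (unaff r v) = v"
proof (rule eq_vecI)
  fix i assume "i < dim_vec v"
  then have i: "i < r * r + 1" using v by simp
  show "aff r (unaff r v) $ i = v $ i"
  proof (cases "i < r * r")
    case True
    then have "r > 0" by (cases r) auto
    have "i div r < r" using True by (simp add: less_mult_imp_div_less)
    moreover have "i mod r < r" using \<open>r > 0\<close> by simp
    ultimately show ?thesis using True by (simp add: aff_def unaff_def)
  next
    case False
    then have "i = r * r" using i by simp
    moreover have "v $ (r * r) = inverse (det (unaff r v))" using d by (metis inverse_unique)
    ultimately show ?thesis using aff_last by metis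
  qed
qed (use v in \<open>auto simp: aff_def\<close>)

definition first_coords :: "nat \<Rightarrow> ('c vec \<Rightarrow> 'c) set" where
  "first_coords r = {\<lambda>v. v $ i | i. i < r * r}"

lemma unaff_coord: "i < r \<Longrightarrow> j < r \<Longrightarrow> (\<lambda>v. v $ (i * r + j)) \<in> first_coords r"
  using index_bound unfolding first_coords_def by blast

lemma generated_algebra_coords_mono:
  assumes "f \<in> generated_algebra k C" "C \<subseteq> C'"
  shows "f \<in> generated_algebra k C'"
  using assms by induction (auto intro: generated_algebra.intros)

lemma first_coords_subset: "first_coords r \<subseteq> vec_coords (r * r + 1)"
  by (auto simp: first_coords_def vec_coords_def)

lemma det_unaff_regular:
  assumes "Qclosed k"
  shows "\<exists>\<delta>\<in>generated_algebra k (first_coords r). \<forall>v. det (unaff r v) = \<delta> v"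
proof -
  obtain d where d: "d \<in> generated_algebra k (mcoords r)" "\<forall>x\<in>carrier_mat r r. det x = d x"
    using regular_det[OF assms, of r] unfolding regular_def by (elim bexE) (rule that)
  have "regular k (first_coords r) UNIV (\<lambda>v. d (unaff r v))"
  proof (rule regular_compose[OF d(1)])
    fix c :: "'a mat \<Rightarrow> 'a" assume "c \<in> mcoords r"
    then obtain i j where ij: "i < r" "j < r" "c = (\<lambda>x. x $$ (i,j))" by (auto simp: mcoords_def)
    show "regular k (first_coords r) UNIV (\<lambda>v. c (unaff r v))"
      unfolding ij(3) unaff_index[OF ij(1,2)] by (rule regular_gen[OF unaff_coord[OF ij(1,2)]])
  qed
  from regular_UNIV_D[OF this] show ?thesis
    using bspec[OF d(2) unaff_carrier] by (intro bexI[of _ "\<lambda>v. d (unaff r v)"]) simp_all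
qed

text \<open>
  Modulo \<open>\<delta> z - 1\<close>, where \<open>\<delta>\<close> is a polynomial in the other coordinates (the determinant in the
  application) and \<open>z\<close> the last coordinate, a polynomial becomes independent of \<open>z\<close> after
  multiplication by a power of \<open>\<delta>\<close>.
\<close>

lemma eliminate_last_coordinate:
  fixes e :: "'c::field vec \<Rightarrow> 'c"
  assumes \<delta>: "\<delta> \<in> generated_algebra UNIV (first_coords r)"
    and e: "e \<in> generated_algebra UNIV (vec_coords (r * r + 1))"
  shows "\<exists>K H q. H \<in> generated_algebra UNIV (first_coords r) \<and> q \<in> generated_algebra UNIV (vec_coords (r * r + 1)) \<and>
    (\<forall>v. \<delta> v ^ K * e v = H v + q v * (\<delta> v * v $ (r * r) - 1))"
  using e
proof induction
  case (const a)
  show ?case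
    by (rule exI[of _ 0], rule exI[of _ "\<lambda>_. a"], rule exI[of _ "\<lambda>_. 0"]) (auto intro: generated_algebra.const)
next
  case (gen f)
  then obtain i where i: "i < r * r + 1" "f = (\<lambda>v. v $ i)" by (auto simp: vec_coords_def)
  show ?case
  proof (cases "i < r * r")
    case True
    then have "f \<in> generated_algebra UNIV (first_coords r)"
      unfolding i(2) by (intro generated_algebra.gen) (auto simp: first_coords_def)
    then show ?thesis
      by (intro exI[of _ 0] exI[of _ f] exI[of _ "\<lambda>_. 0"]) (auto intro: generated_algebra.const)
  next
    case False
    then have "i = r * r" using i(1) by simp
    then show ?thesis unfolding i(2)
      by (intro exI[of _ 1] exI[of _ "\<lambda>_. 1"]) (auto intro: generated_algebra.const)
  qed
next
  case (add f g)
  from add.IH(1) obtain K1 H1 q1 where 1: "H1 \<in> generated_algebra UNIV (first_coords r)"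
    "q1 \<in> generated_algebra UNIV (vec_coords (r * r + 1))"
    "\<forall>v. \<delta> v ^ K1 * f v = H1 v + q1 v * (\<delta> v * v $ (r * r) - 1)" by (elim exE conjE) (rule that)
  from add.IH(2) obtain K2 H2 q2 where 2: "H2 \<in> generated_algebra UNIV (first_coords r)"
    "q2 \<in> generated_algebra UNIV (vec_coords (r * r + 1))"
    "\<forall>v. \<delta> v ^ K2 * g v = H2 v + q2 v * (\<delta> v * v $ (r * r) - 1)" by (elim exE conjE) (rule that)
  have \<delta>p: "(\<lambda>v. \<delta> v ^ K) \<in> generated_algebra UNIV (first_coords r)" for K
    by (rule regular_UNIV_D[OF regular_power[OF _ regular_generated[OF \<delta>]]]) simp
  note \<delta>p' = generated_algebra_coords_mono[OF \<delta>p first_coords_subset]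
  let ?H = "\<lambda>v. \<delta> v ^ K2 * H1 v + \<delta> v ^ K1 * H2 v" and ?q = "\<lambda>v. \<delta> v ^ K2 * q1 v + \<delta> v ^ K1 * q2 v"
  have "\<delta> v ^ (K1 + K2) * (f v + g v) = ?H v + ?q v * (\<delta> v * v $ (r * r) - 1)" for v
  proof -
    have "\<delta> v ^ (K1 + K2) * (f v + g v) = \<delta> v ^ K2 * (\<delta> v ^ K1 * f v) + \<delta> v ^ K1 * (\<delta> v ^ K2 * g v)"
      by (simp add: power_add algebra_simps)
    then show ?thesis unfolding 1(3)[rule_format] 2(3)[rule_format] by (simp add: algebra_simps)
  qed
  moreover have "?H \<in> generated_algebra UNIV (first_coords r)"
    by (intro generated_algebra.add generated_algebra.mult \<delta>p 1(1) 2(1))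
  moreover have "?q \<in> generated_algebra UNIV (vec_coords (r * r + 1))"
    by (intro generated_algebra.add generated_algebra.mult \<delta>p' 1(2) 2(2))
  ultimately show ?case by (intro exI[of _ "K1 + K2"] exI[of _ ?H] exI[of _ ?q] conjI allI)
next
  case (mult f g)
  from mult.IH(1) obtain K1 H1 q1 where 1: "H1 \<in> generated_algebra UNIV (first_coords r)"
    "q1 \<in> generated_algebra UNIV (vec_coords (r * r + 1))"
    "\<forall>v. \<delta> v ^ K1 * f v = H1 v + q1 v * (\<delta> v * v $ (r * r) - 1)" by (elim exE conjE) (rule that)
  from mult.IH(2) obtain K2 H2 q2 where 2: "H2 \<in> generated_algebra UNIV (first_coords r)"
    "q2 \<in> generated_algebra UNIV (vec_coords (r * r + 1))"
    "\<forall>v. \<delta> v ^ K2 * g v = H2 v + q2 v * (\<delta> v * v $ (r * r) - 1)" by (elim exE conjE) (rule that)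
  have \<delta>p: "(\<lambda>v. \<delta> v ^ K) \<in> generated_algebra UNIV (first_coords r)" for K
    by (rule regular_UNIV_D[OF regular_power[OF _ regular_generated[OF \<delta>]]]) simp
  note \<delta>p' = generated_algebra_coords_mono[OF \<delta>p first_coords_subset]
  let ?H = "\<lambda>v. H1 v * H2 v" and ?q = "\<lambda>v. H1 v * q2 v + q1 v * (\<delta> v ^ K2 * g v)"
  have "\<delta> v ^ (K1 + K2) * (f v * g v) = ?H v + ?q v * (\<delta> v * v $ (r * r) - 1)" for v
  proof -
    have "\<delta> v ^ (K1 + K2) * (f v * g v) = (\<delta> v ^ K1 * f v) * (\<delta> v ^ K2 * g v)"
      by (simp add: power_add algebra_simps)
    also have "\<dots> = H1 v * (\<delta> v ^ K2 * g v) + q1 v * (\<delta> v ^ K2 * g v) * (\<delta> v * v $ (r * r) - 1)"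
      unfolding 1(3)[rule_format] by (simp add: algebra_simps)
    also have "H1 v * (\<delta> v ^ K2 * g v) = H1 v * H2 v + H1 v * q2 v * (\<delta> v * v $ (r * r) - 1)"
      unfolding 2(3)[rule_format] by (simp add: algebra_simps)
    finally show ?thesis by (simp add: algebra_simps)
  qed
  moreover have "?H \<in> generated_algebra UNIV (first_coords r)"
    by (intro generated_algebra.mult 1(1) 2(1))
  moreover have "?q \<in> generated_algebra UNIV (vec_coords (r * r + 1))"
    by (intro generated_algebra.add generated_algebra.mult \<delta>p' 1(2) 2(2) mult.hyps(2)
        generated_algebra_coords_mono[OF 1(1) first_coords_subset])
  ultimately show ?case by (intro exI[of _ "K1 + K2"] exI[of _ ?H] exI[of _ ?q] conjI allI)
qed

text \<open>
  The ideal of the hypersurface \<open>\<delta> z = 1\<close> is generated by its equation. After elimination of \<open>z\<close> the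
  remaining polynomial \<open>H\<close> vanishes wherever \<open>\<delta>\<close> does not, so \<open>\<delta> H = 0\<close> and \<open>\<delta> z - 1\<close> divides
  \<open>\<delta>\<^sup>K\<^sup>+\<^sup>1 e\<close>; the power of \<open>\<delta>\<close> is removed with \<open>z\<^sup>K\<^sup>+\<^sup>1\<close>, as \<open>\<delta> z\<close> is 1 modulo \<open>\<delta> z - 1\<close>.
\<close>

lemma multiple_of_hypersurface:
  fixes e :: "'c::field vec \<Rightarrow> 'c"
  assumes \<delta>: "\<delta> \<in> generated_algebra UNIV (first_coords r)"
    and e: "e \<in> generated_algebra UNIV (vec_coords (r * r + 1))"
    and z: "\<And>v. v \<in> carrier_vec (r * r + 1) \<Longrightarrow> \<delta> v * v $ (r * r) = 1 \<Longrightarrow> e v = 0"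
  shows "\<exists>q\<in>generated_algebra UNIV (vec_coords (r * r + 1)).
    \<forall>v\<in>carrier_vec (r * r + 1). e v = q v * (\<delta> v * v $ (r * r) - 1)"
proof -
  obtain K H q where H: "H \<in> generated_algebra UNIV (first_coords r)"
    and q: "q \<in> generated_algebra UNIV (vec_coords (r * r + 1))"
    and eq: "\<forall>v. \<delta> v ^ K * e v = H v + q v * (\<delta> v * v $ (r * r) - 1)"
    using eliminate_last_coordinate[OF \<delta> e] by (elim exE conjE) (rule that)
  have indep: "h v = h w" if "h \<in> generated_algebra UNIV (first_coords r)" "\<And>i. i < r * r \<Longrightarrow> v $ i = w $ i" for h and v w :: "'c vec"
    using that(1) by induction (auto simp: first_coords_def that(2))
  have \<delta>H: "\<delta> v * H v = 0" if v: "v \<in> carrier_vec (r * r + 1)" for v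
  proof (cases "\<delta> v = 0")
    case False
    define w where "w = vec (r * r + 1) (\<lambda>i. if i < r * r then v $ i else inverse (\<delta> v))"
    have w: "w \<in> carrier_vec (r * r + 1)" and wi: "\<And>i. i < r * r \<Longrightarrow> v $ i = w $ i"
      and wl: "w $ (r * r) = inverse (\<delta> v)" by (auto simp: w_def)
    have "\<delta> w = \<delta> v" "H w = H v" using indep[OF \<delta> wi] indep[OF H wi] by auto
    then have 1: "\<delta> w * w $ (r * r) = 1" using False wl by simp
    have "H w = 0" using eq[rule_format, of w] z[OF w 1] 1 by simp
    then show ?thesis using \<open>H w = H v\<close> by simp
  qed simp
  let ?y = "\<lambda>v::'c vec. v $ (r * r)"
  let ?Q = "\<lambda>v. ?y v ^ Suc K * (\<delta> v * q v) - (\<Sum>i<Suc K. (?y v * \<delta> v) ^ i) * e v"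
  have "e v = ?Q v * (\<delta> v * ?y v - 1)" if v: "v \<in> carrier_vec (r * r + 1)" for v
  proof -
    let ?a = "?y v * \<delta> v"
    have alg: "A * d - d * S * x = (A - S * x) * d" for A d S x :: 'c by (simp add: algebra_simps)
    have g: "?a ^ Suc K - 1 = (?a - 1) * (\<Sum>i<Suc K. ?a ^ i)" by (rule power_diff_1_eq)
    have "?a ^ Suc K * e v = ?y v ^ Suc K * (\<delta> v * (\<delta> v ^ K * e v))"
      by (simp add: power_mult_distrib algebra_simps)
    also have "\<dots> = ?y v ^ Suc K * (\<delta> v * H v + \<delta> v * q v * (\<delta> v * ?y v - 1))"
      unfolding eq[rule_format] by (simp add: algebra_simps)
    also have "\<dots> = ?y v ^ Suc K * (\<delta> v * q v) * (\<delta> v * ?y v - 1)" unfolding \<delta>H[OF v] by simp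
    finally have 1: "?a ^ Suc K * e v = ?y v ^ Suc K * (\<delta> v * q v) * (\<delta> v * ?y v - 1)" .
    have "e v = ?a ^ Suc K * e v - (?a ^ Suc K - 1) * e v" by (simp add: algebra_simps)
    also have "\<dots> = ?y v ^ Suc K * (\<delta> v * q v) * (\<delta> v * ?y v - 1) - (?a - 1) * (\<Sum>i<Suc K. ?a ^ i) * e v"
      unfolding 1 g ..
    also have "\<dots> = ?Q v * (\<delta> v * ?y v - 1)" unfolding mult.commute[of "?y v" "\<delta> v"] by (rule alg)
    finally show ?thesis .
  qed
  moreover have "?Q \<in> generated_algebra UNIV (vec_coords (r * r + 1))"
  proof -
    note \<delta>' = regular_generated[OF generated_algebra_coords_mono[OF \<delta> first_coords_subset]]
    have y: "regular UNIV (vec_coords (r * r + 1)) UNIV ?y" by (rule regular_gen) (auto simp: vec_coords_def)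
    have "regular UNIV (vec_coords (r * r + 1)) UNIV
        (\<lambda>v. ?y v ^ Suc K * (\<delta> v * q v) + (- 1) * ((\<Sum>i<Suc K. (?y v * \<delta> v) ^ i) * e v))"
      by (intro regular_add regular_mult regular_sum regular_power regular_const y \<delta>'
          regular_generated[OF q] regular_generated[OF e]) auto
    then show ?thesis by (intro regular_UNIV_D) simp
  qed
  ultimately show ?thesis by (intro bexI[of _ ?Q] ballI)
qed

lemma regular_unaff:
  fixes f :: "'c::field mat \<Rightarrow> 'c"
  assumes f: "f \<in> generated_algebra k (GL_coords r)" and M: "r * r < M"
    and D: "\<And>v. v \<in> D \<Longrightarrow> det (unaff r v) * v $ (r * r) = 1"
  shows "regular k (vec_coords M) D (\<lambda>v. f (unaff r v))"
proof (rule regular_compose[OF f])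
  fix c :: "'c mat \<Rightarrow> 'c" assume "c \<in> GL_coords r"
  then consider i j where "i < r" "j < r" "c = (\<lambda>A. A $$ (i, j))" | "c = (\<lambda>A. inverse (det A))"
    unfolding GL_coords_def by blast
  then show "regular k (vec_coords M) D (\<lambda>v. c (unaff r v))"
  proof cases
    case 1
    have "i * r + j < M" using index_bound[OF 1(1,2)] M by simp
    then show ?thesis unfolding 1(3) unaff_index[OF 1(1,2)]
      by (intro regular_gen) (auto simp: vec_coords_def)
  next
    case 2
    have y: "regular k (vec_coords M) D (\<lambda>v. v $ (r * r))"
      using M by (intro regular_gen) (auto simp: vec_coords_def)
    have "inverse (det (unaff r v)) = v $ (r * r)" if "v \<in> D" for v
      using D[OF that] by (rule inverse_unique)
    then show ?thesis unfolding 2 using y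
      by (subst regular_cong[of _ _ "\<lambda>v. v $ (r * r)"]) auto
  qed
qed

lemma lift_to_affine:
  assumes "f \<in> generated_algebra k (GL_coords r)"
  shows "\<exists>h\<in>generated_algebra k (vec_coords (r * r + 1)).
    \<forall>v\<in>carrier_vec (r * r + 1). det (unaff r v) * v $ (r * r) = 1 \<longrightarrow> f (unaff r v) = h v"
proof -
  have "regular k (vec_coords (r * r + 1))
      {v \<in> carrier_vec (r * r + 1). det (unaff r v) * v $ (r * r) = 1} (\<lambda>v. f (unaff r v))"
    by (rule regular_unaff[OF assms]) auto
  then show ?thesis unfolding regular_def by blast
qed

text \<open>
  Combinations in the definition of a variety are indexed by the generators themselves. A family of
  generators may have repetitions, whose coefficients are collected here.
\<close>

lemma sum_over_image:
  fixes C :: "('p \<Rightarrow> 'c::field) set"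
  assumes I: "finite I" and c: "\<And>i. i \<in> I \<Longrightarrow> c i \<in> generated_algebra UNIV C"
  shows "\<exists>c'. (\<forall>h\<in>g ` I. c' h \<in> generated_algebra UNIV C) \<and>
    (\<forall>x. (\<Sum>i\<in>I. c i x * g i x) = (\<Sum>h\<in>g ` I. c' h x * h x))"
proof (intro exI conjI ballI allI)
  let ?c = "\<lambda>h x. \<Sum>i\<in>{i\<in>I. g i = h}. c i x"
  show "?c h \<in> generated_algebra UNIV C" for h
    by (rule regular_UNIV_D[OF regular_sum]) (auto intro!: regular_generated c)
  fix x
  have "(\<Sum>i\<in>I. c i x * g i x) = (\<Sum>h\<in>g ` I. \<Sum>i\<in>{i\<in>I. g i = h}. c i x * g i x)"
    by (rule sum.image_gen[OF I])
  also have "\<dots> = (\<Sum>h\<in>g ` I. ?c h x * h x)"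
    unfolding sum_distrib_right by (intro sum.cong refl) auto
  finally show "(\<Sum>i\<in>I. c i x * g i x) = (\<Sum>h\<in>g ` I. ?c h x * h x)" .
qed

text \<open>
  The ideal of the image is generated by \<open>\<delta> z - 1\<close> and by lifts of the generators of the ideal in the
  coordinate ring of the general linear group: what remains of an equation after subtracting a
  combination of the lifts vanishes on the hypersurface \<open>\<delta> z = 1\<close>.
\<close>

theorem affine_embedding_variety:
  fixes R :: "'c::field_char_0 mat set"
  assumes k: "Qclosed k" and R: "algebraic_group k r R"
  shows "variety_over k (carrier_vec (r * r + 1)) (vec_coords (r * r + 1)) (aff r ` R)"
proof -
  let ?X = "carrier_vec (r * r + 1)" and ?C = "vec_coords (r * r + 1)" and ?V = "aff r ` R"
  let ?y = "\<lambda>v::'c vec. v $ (r * r)"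
  have Rc: "x \<in> carrier_mat r r" "det x \<noteq> 0" "x \<in> carrier (GL r)" if "x \<in> R" for x
    using algebraic_groupD(1)[OF R] that by (auto simp: GL_carrier)
  obtain \<delta> where \<delta>: "\<delta> \<in> generated_algebra k (first_coords r)" "\<forall>v. det (unaff r v) = \<delta> v"
    using det_unaff_regular[OF k, of r] by (elim bexE) (rule that)
  note \<delta>U = generated_algebra_mono[OF \<delta>(1) subset_UNIV]
  define P where "P v = \<delta> v * ?y v + - 1" for v
  have Pgen: "P \<in> generated_algebra k' ?C" if "k \<subseteq> k'" for k'
  proof -
    have "regular k ?C UNIV P" unfolding P_def
      by (intro regular_add regular_mult regular_const regular_gen QclosedD(3)[OF k]
          regular_generated[OF generated_algebra_coords_mono[OF \<delta>(1) first_coords_subset]]) (auto simp: vec_coords_def)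
    from generated_algebra_mono[OF regular_UNIV_D[OF this] that] show ?thesis .
  qed
  have Pzero: "P v = 0 \<longleftrightarrow> det (unaff r v) * ?y v = 1" for v using \<delta>(2) by (simp add: P_def)
  have PV: "P (aff r x) = 0" if "x \<in> R" for x
    using Rc[OF that] by (simp add: Pzero unaff_aff aff_last)
  have lift: "\<exists>h\<in>generated_algebra k' ?C. \<forall>v\<in>?X. P v = 0 \<longrightarrow> f (unaff r v) = h v"
    if "f \<in> generated_algebra k' (GL_coords r)" for f k'
    unfolding Pzero by (rule lift_to_affine[OF that])
  have liftV: "h (aff r x) = f x" if "\<forall>v\<in>?X. P v = 0 \<longrightarrow> f (unaff r v) = h v" "x \<in> R" for h f x
    using bspec[OF that(1) aff_carrier[of r x]] PV[OF that(2)] unaff_aff[OF Rc(1)[OF that(2)]] by simp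
  have onGL: "unaff r v \<in> carrier (GL r)" "v = aff r (unaff r v)" if "v \<in> ?X" "P v = 0" for v
  proof -
    have d: "det (unaff r v) * ?y v = 1" using that(2) Pzero by simp
    then show "unaff r v \<in> carrier (GL r)" using unaff_carrier[of r v] by (auto simp: GL_carrier)
    show "v = aff r (unaff r v)" using aff_unaff[OF that(1) d] by simp
  qed
  show ?thesis
    unfolding variety_over_def
  proof (intro conjI ballI)
    show "zariski_closed ?X ?C ?V"
      unfolding zariski_closed_def
    proof (intro exI conjI)
      let ?S = "vanishing_ideal UNIV ?C ?V"
      show "?S \<subseteq> generated_algebra UNIV ?C" by (auto simp: vanishing_ideal_def)
      show "?V = {x \<in> ?X. \<forall>f\<in>?S. f x = 0}"
      proof (intro equalityI subsetI)
        fix v assume "v \<in> {x \<in> ?X. \<forall>f\<in>?S. f x = 0}"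
        then have v: "v \<in> ?X" "\<And>f. f \<in> ?S \<Longrightarrow> f v = 0" by auto
        have "P \<in> ?S" using Pgen[of UNIV] PV by (auto simp: vanishing_ideal_def)
        then have Pv: "P v = 0" by (rule v(2))
        have "unaff r v \<in> R"
        proof (rule algebraic_group_closed[OF R onGL(1)[OF v(1) Pv]])
          fix f :: "'c mat \<Rightarrow> 'c" assume f: "f \<in> vanishing_ideal UNIV (GL_coords r) R"
          then have f1: "f \<in> generated_algebra UNIV (GL_coords r)" "\<And>x. x \<in> R \<Longrightarrow> f x = 0"
            by (auto simp: vanishing_ideal_def)
          obtain h where h: "h \<in> generated_algebra UNIV ?C" "\<forall>v\<in>?X. P v = 0 \<longrightarrow> f (unaff r v) = h v"
            using lift[OF f1(1)] by (elim bexE) (rule that)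
          have "h \<in> ?S" using h(1) liftV[OF h(2)] f1(2) by (auto simp: vanishing_ideal_def)
          then show "f (unaff r v) = 0" using v(2) h(2) v(1) Pv by simp
        qed
        then show "v \<in> ?V" using onGL(2)[OF v(1) Pv] by (rule image_eqI[rotated])
      next
        fix v assume "v \<in> ?V"
        then show "v \<in> {x \<in> ?X. \<forall>f\<in>?S. f x = 0}" using aff_carrier[of r] by (auto simp: vanishing_ideal_def)
      qed
    qed
  next
    fix f assume f: "f \<in> vanishing_ideal UNIV ?C ?V"
    then have f1: "f \<in> generated_algebra UNIV ?C" "\<And>x. x \<in> R \<Longrightarrow> f (aff r x) = 0"
      by (auto simp: vanishing_ideal_def)
    have "regular UNIV (GL_coords r) (carrier (GL r)) (\<lambda>x. f (aff r x))"
    proof (rule regular_compose[OF f1(1)])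
      fix c :: "'c vec \<Rightarrow> 'c" assume "c \<in> ?C"
      then obtain i where i: "i < r * r + 1" "c = (\<lambda>v. v $ i)" by (auto simp: vec_coords_def)
      show "regular UNIV (GL_coords r) (carrier (GL r)) (\<lambda>x. c (aff r x))"
      proof (cases "i < r * r")
        case True
        then have "r > 0" by (cases r) auto
        have "i div r < r" "i mod r < r" using True \<open>r > 0\<close> by (simp_all add: less_mult_imp_div_less)
        then have "(\<lambda>A. A $$ (i div r, i mod r)) \<in> GL_coords r" unfolding GL_coords_def by blast
        then show ?thesis using True unfolding i(2) by (simp add: aff_def) (rule regular_gen)
      next
        case False
        then have "i = r * r" using i(1) by simp
        then show ?thesis unfolding i(2) by (simp add: aff_last) (rule regular_gen, simp add: GL_coords_def)
      qed
    qed
    then obtain G where G: "G \<in> generated_algebra UNIV (GL_coords r)" "\<forall>x\<in>carrier (GL r). f (aff r x) = G x"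
      unfolding regular_def by (elim bexE) (rule that)
    have GR: "G \<in> vanishing_ideal UNIV (GL_coords r) R"
      using G(1) bspec[OF G(2) Rc(3)] f1(2) by (auto simp: vanishing_ideal_def)
    have "\<forall>f\<in>vanishing_ideal UNIV (GL_coords r) R.
      \<exists>F c. finite F \<and> F \<subseteq> vanishing_ideal k (GL_coords r) R \<and> (\<forall>g\<in>F. c g \<in> generated_algebra UNIV (GL_coords r)) \<and>
        (\<forall>x\<in>carrier (GL r). f x = (\<Sum>g\<in>F. c g x * g x))"
      using R unfolding algebraic_group_def variety_over_def by (elim conjE)
    from bspec[OF this GR] obtain F c where F: "finite F" "F \<subseteq> vanishing_ideal k (GL_coords r) R"
      "\<forall>g\<in>F. c g \<in> generated_algebra UNIV (GL_coords r)"
      "\<forall>x\<in>carrier (GL r). G x = (\<Sum>g\<in>F. c g x * g x)"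
      by (elim exE conjE) (rule that)
    have "\<forall>g\<in>F. \<exists>h. h \<in> generated_algebra k ?C \<and> (\<forall>v\<in>?X. P v = 0 \<longrightarrow> g (unaff r v) = h v)"
      using lift F(2) unfolding vanishing_ideal_def Bex_def by blast
    from bchoice[OF this] obtain G' where G': "\<forall>g\<in>F. G' g \<in> generated_algebra k ?C \<and> (\<forall>v\<in>?X. P v = 0 \<longrightarrow> g (unaff r v) = G' g v)" ..
    have "\<forall>g\<in>F. \<exists>h. h \<in> generated_algebra UNIV ?C \<and> (\<forall>v\<in>?X. P v = 0 \<longrightarrow> c g (unaff r v) = h v)"
      using lift F(3) unfolding Bex_def by blast
    from bchoice[OF this] obtain c' where c': "\<forall>g\<in>F. c' g \<in> generated_algebra UNIV ?C \<and> (\<forall>v\<in>?X. P v = 0 \<longrightarrow> c g (unaff r v) = c' g v)" ..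
    define e where "e v = f v + (- 1) * (\<Sum>g\<in>F. c' g v * G' g v)" for v
    have G'U: "G' g \<in> generated_algebra UNIV ?C" if "g \<in> F" for g
      using generated_algebra_mono[OF _ subset_UNIV] G' that by blast
    have e_gen: "e \<in> generated_algebra UNIV ?C"
      by (rule regular_UNIV_D, unfold e_def)
        (intro regular_add regular_mult regular_sum regular_const regular_generated f1(1), use c' G'U in auto)
    have e0: "e v = 0" if v: "v \<in> ?X" "\<delta> v * ?y v = 1" for v
    proof -
      have Pv: "P v = 0" using v(2) by (simp add: P_def)
      have "f v = G (unaff r v)" using bspec[OF G(2) onGL(1)[OF v(1) Pv]] onGL(2)[OF v(1) Pv] by simp
      also have "\<dots> = (\<Sum>g\<in>F. c g (unaff r v) * g (unaff r v))" by (rule bspec[OF F(4) onGL(1)[OF v(1) Pv]])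
      also have "\<dots> = (\<Sum>g\<in>F. c' g v * G' g v)" using c' G' v(1) Pv by (intro sum.cong refl) simp
      finally show ?thesis by (simp add: e_def)
    qed
    have "\<exists>q\<in>generated_algebra UNIV ?C. \<forall>v\<in>?X. e v = q v * (\<delta> v * ?y v - 1)"
      by (rule multiple_of_hypersurface[OF \<delta>U e_gen]) (rule e0)
    then obtain q where q: "q \<in> generated_algebra UNIV ?C" "\<forall>v\<in>?X. e v = q v * (\<delta> v * ?y v - 1)"
      by (elim bexE) (rule that)
    (* The generators are indexed by F and one further index None for the equation P of the hypersurface. *)
    let ?I = "insert None (Some ` F)"
    define g where "g i = (case i of None \<Rightarrow> P | Some g \<Rightarrow> G' g)" for i
    define d where "d i = (case i of None \<Rightarrow> q | Some g \<Rightarrow> c' g)" for i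
    have fin: "finite ?I" using F(1) by simp
    have dgen: "d i \<in> generated_algebra UNIV ?C" if "i \<in> ?I" for i
      using that q(1) c' by (auto simp: d_def)
    have "\<exists>c''. (\<forall>h\<in>g ` ?I. c'' h \<in> generated_algebra UNIV ?C) \<and>
      (\<forall>x. (\<Sum>i\<in>?I. d i x * g i x) = (\<Sum>h\<in>g ` ?I. c'' h x * h x))"
      by (rule sum_over_image[OF fin]) (rule dgen)
    then obtain c'' where c'': "\<forall>h\<in>g ` ?I. c'' h \<in> generated_algebra UNIV ?C"
      "\<forall>x. (\<Sum>i\<in>?I. d i x * g i x) = (\<Sum>h\<in>g ` ?I. c'' h x * h x)"
      by (elim exE conjE) (rule that)
    have G'V: "G' h (aff r x) = 0" if "h \<in> F" "x \<in> R" for h x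
    proof -
      have "\<forall>v\<in>?X. P v = 0 \<longrightarrow> h (unaff r v) = G' h v" using G' that(1) by blast
      from liftV[OF this that(2)] show ?thesis using F(2) that by (auto simp: vanishing_ideal_def)
    qed
    have "g ` ?I \<subseteq> vanishing_ideal k ?C ?V"
      using Pgen[OF subset_refl] PV G' G'V by (auto simp: g_def vanishing_ideal_def)
    moreover have "f v = (\<Sum>h\<in>g ` ?I. c'' h v * h v)" if "v \<in> ?X" for v
    proof -
      have "f v = e v + (\<Sum>g\<in>F. c' g v * G' g v)" by (simp add: e_def)
      also have "e v = q v * P v" using q(2) that by (simp add: P_def)
      also have "q v * P v + (\<Sum>g\<in>F. c' g v * G' g v) = (\<Sum>i\<in>?I. d i v * g i v)"
        using F(1) by (subst sum.insert) (auto simp: d_def g_def sum.reindex)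
      finally show ?thesis using c''(2) by simp
    qed
    ultimately show "\<exists>F c. finite F \<and> F \<subseteq> vanishing_ideal k ?C ?V \<and>
      (\<forall>g\<in>F. c g \<in> generated_algebra UNIV ?C) \<and> (\<forall>x\<in>?X. f x = (\<Sum>g\<in>F. c g x * g x))"
      using fin c''(1) by (intro exI[of _ "g ` ?I"] exI[of _ c''] conjI) auto
  qed
qed

section \<open>Cylinders\<close>

definition trunc_vec :: "nat \<Rightarrow> 'c vec \<Rightarrow> 'c vec" where
  "trunc_vec N v = vec N (\<lambda>i. v $ i)"

definition extend_vec :: "nat \<Rightarrow> 'c vec \<Rightarrow> 'c \<Rightarrow> 'c vec" where
  "extend_vec N v t = vec (Suc N) (\<lambda>i. if i < N then v $ i else t)"

text \<open>
  The product of \<open>V\<close> with an affine line, which is the last coordinate.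
\<close>

definition cylinder :: "nat \<Rightarrow> 'c vec set \<Rightarrow> 'c vec set" where
  "cylinder N V = {v \<in> carrier_vec (Suc N). trunc_vec N v \<in> V}"

lemma trunc_vec_carrier: "trunc_vec N v \<in> carrier_vec N"
  by (simp add: trunc_vec_def)

lemma extend_vec_index: "i < N \<Longrightarrow> extend_vec N v t $ i = v $ i" "extend_vec N v t $ N = t"
  by (simp_all add: extend_vec_def)

lemma trunc_extend_vec: "v \<in> carrier_vec N \<Longrightarrow> trunc_vec N (extend_vec N v t) = v"
  by (intro eq_vecI) (auto simp: trunc_vec_def extend_vec_def)

lemma extend_in_cylinder: "v \<in> carrier_vec N \<Longrightarrow> v \<in> V \<Longrightarrow> extend_vec N v t \<in> cylinder N V"
  unfolding cylinder_def by (simp add: trunc_extend_vec) (simp add: extend_vec_def)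

lemma generated_algebra_agree:
  assumes "f \<in> generated_algebra k (vec_coords N)" "\<And>i. i < N \<Longrightarrow> v $ i = w $ i"
  shows "f v = f w"
  using assms(1) by induction (auto simp: vec_coords_def assms(2))

lemma generated_algebra_trunc:
  assumes "f \<in> generated_algebra k (vec_coords N)"
  shows "f (trunc_vec N v) = f v"
  by (rule generated_algebra_agree[OF assms]) (simp add: trunc_vec_def)

lemma polynomial_in_last_coordinate:
  fixes f :: "'c::field vec \<Rightarrow> 'c"
  assumes "f \<in> generated_algebra UNIV (vec_coords (Suc N))"
  shows "\<exists>P d. (\<forall>j. (\<lambda>v. Polynomial.coeff (P v) j) \<in> generated_algebra UNIV (vec_coords N)) \<and>
    (\<forall>v. degree (P v) \<le> d \<and> f v = poly (P v) (v $ N))"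
  using assms
proof induction
  case (const a)
  have "(\<lambda>v::'c vec. Polynomial.coeff [:a:] j) \<in> generated_algebra UNIV (vec_coords N)" for j
    by (rule generated_algebra.const) simp
  then show ?case by (intro exI[of _ "\<lambda>_. [:a:]"] exI[of _ 0]) simp
next
  case (gen f)
  then obtain i where i: "i < Suc N" "f = (\<lambda>v. v $ i)" by (auto simp: vec_coords_def)
  show ?case
  proof (cases "i < N")
    case True
    have 0: "(\<lambda>v::'c vec. 0) \<in> generated_algebra UNIV (vec_coords N)" by (rule generated_algebra.const) simp
    have 1: "(\<lambda>v::'c vec. v $ i) \<in> generated_algebra UNIV (vec_coords N)"
      using True by (intro generated_algebra.gen) (auto simp: vec_coords_def)
    have "(\<lambda>v::'c vec. Polynomial.coeff [:v $ i:] j) \<in> generated_algebra UNIV (vec_coords N)" for j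
      using 0 1 by (cases j) simp_all
    then show ?thesis unfolding i(2) by (intro exI[of _ "\<lambda>v. [:v $ i:]"] exI[of _ 0]) simp
  next
    case False
    then have "i = N" using i(1) by simp
    have "(\<lambda>v::'c vec. Polynomial.coeff [:0, 1:] j) \<in> generated_algebra UNIV (vec_coords N)" for j
      by (rule generated_algebra.const) simp
    then show ?thesis unfolding i(2) \<open>i = N\<close> by (intro exI[of _ "\<lambda>v. [:0, 1:]"] exI[of _ 1]) simp
  qed
next
  case (add f g)
  from add.IH(1) obtain P d where P: "\<forall>j. (\<lambda>v. Polynomial.coeff (P v) j) \<in> generated_algebra UNIV (vec_coords N)"
    "\<forall>v. degree (P v) \<le> d \<and> f v = poly (P v) (v $ N)" by (elim exE conjE) (rule that)
  from add.IH(2) obtain Q e where Q: "\<forall>j. (\<lambda>v. Polynomial.coeff (Q v) j) \<in> generated_algebra UNIV (vec_coords N)"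
    "\<forall>v. degree (Q v) \<le> e \<and> g v = poly (Q v) (v $ N)" by (elim exE conjE) (rule that)
  have "degree (P v + Q v) \<le> max d e" for v
    using P(2) Q(2) by (intro degree_add_le) (auto intro: le_max_iff_disj[THEN iffD2])
  moreover have "(\<lambda>v. Polynomial.coeff (P v + Q v) j) \<in> generated_algebra UNIV (vec_coords N)" for j
    unfolding coeff_add by (rule generated_algebra.add[OF P(1)[rule_format] Q(1)[rule_format]])
  ultimately show ?case using P(2) Q(2)
    by (intro exI[of _ "\<lambda>v. P v + Q v"] exI[of _ "max d e"]) simp
next
  case (mult f g)
  from mult.IH(1) obtain P d where P: "\<forall>j. (\<lambda>v. Polynomial.coeff (P v) j) \<in> generated_algebra UNIV (vec_coords N)"
    "\<forall>v. degree (P v) \<le> d \<and> f v = poly (P v) (v $ N)" by (elim exE conjE) (rule that)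
  from mult.IH(2) obtain Q e where Q: "\<forall>j. (\<lambda>v. Polynomial.coeff (Q v) j) \<in> generated_algebra UNIV (vec_coords N)"
    "\<forall>v. degree (Q v) \<le> e \<and> g v = poly (Q v) (v $ N)" by (elim exE conjE) (rule that)
  have "degree (P v * Q v) \<le> d + e" for v
    using degree_mult_le[of "P v" "Q v"] add_mono[of "degree (P v)" d "degree (Q v)" e] P(2) Q(2) by fastforce
  moreover have "(\<lambda>v. Polynomial.coeff (P v * Q v) j) \<in> generated_algebra UNIV (vec_coords N)" for j
    unfolding coeff_mult
    by (rule regular_UNIV_D)
      (intro regular_sum regular_mult UNIV_I regular_generated[OF P(1)[rule_format]] regular_generated[OF Q(1)[rule_format]])
  ultimately show ?case using P(2) Q(2)
    by (intro exI[of _ "\<lambda>v. P v * Q v"] exI[of _ "d + e"]) simp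
qed

text \<open>
  As a polynomial in the last coordinate, an equation of the cylinder has coefficients that are
  equations of \<open>V\<close>.
\<close>

theorem cylinder_variety:
  fixes V :: "'c::field_char_0 vec set"
  assumes V: "variety_over k (carrier_vec N) (vec_coords N) V"
  shows "variety_over k (carrier_vec (Suc N)) (vec_coords (Suc N)) (cylinder N V)"
  unfolding variety_over_def
proof (intro conjI ballI)
  have sub: "vec_coords N \<subseteq> (vec_coords (Suc N) :: ('c vec \<Rightarrow> 'c) set)"
    by (auto simp: vec_coords_def)
  note lift = generated_algebra_coords_mono[OF _ sub]
  obtain S where S: "S \<subseteq> generated_algebra UNIV (vec_coords N)" "V = {x \<in> carrier_vec N. \<forall>f\<in>S. f x = 0}"
    using V unfolding variety_over_def zariski_closed_def by (elim exE conjE) (rule that)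
  have trS: "f (trunc_vec N v) = f v" if "f \<in> S" for f v
    by (rule generated_algebra_trunc[OF subsetD[OF S(1) that]])
  have "cylinder N V = {x \<in> carrier_vec (Suc N). \<forall>f\<in>S. f x = 0}"
    unfolding cylinder_def S(2) by (simp add: trunc_vec_carrier trS cong: ball_cong)
  moreover have "S \<subseteq> generated_algebra UNIV (vec_coords (Suc N))" using S(1) lift by (meson subset_iff)
  ultimately show "zariski_closed (carrier_vec (Suc N)) (vec_coords (Suc N)) (cylinder N V)"
    unfolding zariski_closed_def by (intro exI[of _ S] conjI)
  fix f :: "'c vec \<Rightarrow> 'c" assume "f \<in> vanishing_ideal UNIV (vec_coords (Suc N)) (cylinder N V)"
  then have f: "f \<in> generated_algebra UNIV (vec_coords (Suc N))" "\<And>v. v \<in> cylinder N V \<Longrightarrow> f v = 0"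
    by (auto simp: vanishing_ideal_def)
  obtain P d where P: "\<forall>j. (\<lambda>v. Polynomial.coeff (P v) j) \<in> generated_algebra UNIV (vec_coords N)"
    "\<forall>v. degree (P v) \<le> d \<and> f v = poly (P v) (v $ N)"
    using polynomial_in_last_coordinate[OF f(1)] by (elim exE conjE) (rule that)
  have "P v = 0" if v: "v \<in> V" for v
  proof (rule poly_all_zero)
    fix t
    have vc: "v \<in> carrier_vec N" using v S(2) by simp
    have "P (extend_vec N v t) = P v"
      by (rule poly_eqI) (rule generated_algebra_agree[OF P(1)[rule_format]], rule extend_vec_index(1))
    then have "poly (P v) t = f (extend_vec N v t)" using P(2) by (simp add: extend_vec_index)
    then show "poly (P v) t = 0" using f(2)[OF extend_in_cylinder[OF vc v]] by simp
  qed
  then have "\<forall>j. (\<lambda>v. Polynomial.coeff (P v) j) \<in> vanishing_ideal UNIV (vec_coords N) V"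
    using P(1) by (simp add: vanishing_ideal_def)
  then have "\<forall>j. \<exists>A c. finite A \<and> A \<subseteq> vanishing_ideal k (vec_coords N) V \<and>
      (\<forall>g\<in>A. c g \<in> generated_algebra UNIV (vec_coords N)) \<and>
      (\<forall>x\<in>carrier_vec N. Polynomial.coeff (P x) j = (\<Sum>g\<in>A. c g x * g x))"
    using V unfolding variety_over_def by (elim conjE) (intro allI, erule bspec, erule spec)
  from choice[OF this] obtain A where "\<forall>j. \<exists>c. finite (A j) \<and> A j \<subseteq> vanishing_ideal k (vec_coords N) V \<and>
      (\<forall>g\<in>A j. c g \<in> generated_algebra UNIV (vec_coords N)) \<and>
      (\<forall>x\<in>carrier_vec N. Polynomial.coeff (P x) j = (\<Sum>g\<in>A j. c g x * g x))" ..
  from choice[OF this] obtain c where "\<forall>j. finite (A j) \<and> A j \<subseteq> vanishing_ideal k (vec_coords N) V \<and>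
      (\<forall>g\<in>A j. c j g \<in> generated_algebra UNIV (vec_coords N)) \<and>
      (\<forall>x\<in>carrier_vec N. Polynomial.coeff (P x) j = (\<Sum>g\<in>A j. c j g x * g x))" ..
  then have A: "finite (A j)" "A j \<subseteq> vanishing_ideal k (vec_coords N) V"
    and c: "g \<in> A j \<Longrightarrow> c j g \<in> generated_algebra UNIV (vec_coords N)"
    and Pc: "x \<in> carrier_vec N \<Longrightarrow> Polynomial.coeff (P x) j = (\<Sum>g\<in>A j. c j g x * g x)" for j g x
    by simp_all
  have Agen: "g \<in> generated_algebra k (vec_coords N)" "x \<in> V \<Longrightarrow> g x = 0" if "g \<in> A j" for g j x
    using subsetD[OF A(2) that] by (auto simp: vanishing_ideal_def)
  have Pv: "Polynomial.coeff (P v) j = (\<Sum>g\<in>A j. c j g v * g v)" for v j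
  proof -
    have "Polynomial.coeff (P v) j = Polynomial.coeff (P (trunc_vec N v)) j"
      using generated_algebra_trunc[OF P(1)[rule_format, of j], of v] by simp
    also have "\<dots> = (\<Sum>g\<in>A j. c j g (trunc_vec N v) * g (trunc_vec N v))" by (rule Pc[OF trunc_vec_carrier])
    also have "\<dots> = (\<Sum>g\<in>A j. c j g v * g v)"
      using generated_algebra_trunc[OF c] generated_algebra_trunc[OF Agen(1)] by (intro sum.cong refl) simp
    finally show ?thesis .
  qed
  let ?I = "Sigma {..d} A" and ?c = "\<lambda>x v. c (fst x) (snd x) v * v $ N ^ fst x"
  have fin: "finite ?I" using A(1) by simp
  have last: "regular UNIV (vec_coords (Suc N)) UNIV (\<lambda>v::'c vec. v $ N)"
    by (rule regular_gen) (auto simp: vec_coords_def)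
  have "\<exists>c'. (\<forall>h\<in>snd ` ?I. c' h \<in> generated_algebra UNIV (vec_coords (Suc N))) \<and>
    (\<forall>x. (\<Sum>i\<in>?I. ?c i x * snd i x) = (\<Sum>h\<in>snd ` ?I. c' h x * h x))"
  proof (rule sum_over_image[OF fin])
    fix x assume x: "x \<in> ?I"
    show "?c x \<in> generated_algebra UNIV (vec_coords (Suc N))"
      by (rule regular_UNIV_D, intro regular_mult regular_power last UNIV_I regular_generated[OF lift] c)
        (use x in auto)
  qed
  then obtain c' where c': "\<forall>h\<in>snd ` ?I. c' h \<in> generated_algebra UNIV (vec_coords (Suc N))"
    "\<forall>x. (\<Sum>i\<in>?I. ?c i x * snd i x) = (\<Sum>h\<in>snd ` ?I. c' h x * h x)" by (elim exE conjE) (rule that)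
  have "f v = (\<Sum>h\<in>snd ` ?I. c' h v * h v)" for v
  proof -
    have "f v = (\<Sum>j\<le>d. Polynomial.coeff (P v) j * v $ N ^ j)"
    proof -
      have "(\<Sum>j\<le>degree (P v). Polynomial.coeff (P v) j * v $ N ^ j) = (\<Sum>j\<le>d. Polynomial.coeff (P v) j * v $ N ^ j)"
        using P(2) by (intro sum.mono_neutral_left) (auto simp: coeff_eq_0)
      then show ?thesis using P(2) by (simp add: poly_altdef)
    qed
    also have "\<dots> = (\<Sum>j\<le>d. \<Sum>g\<in>A j. c j g v * v $ N ^ j * g v)"
      unfolding Pv sum_distrib_right by (simp add: mult_ac)
    also have "\<dots> = (\<Sum>x\<in>?I. ?c x v * snd x v)" using A(1) by (subst sum.Sigma) (auto simp: case_prod_beta)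
    finally show ?thesis using c'(2) by simp
  qed
  moreover have "snd ` ?I \<subseteq> vanishing_ideal k (vec_coords (Suc N)) (cylinder N V)"
  proof
    fix g assume "g \<in> snd ` ?I"
    then obtain j where j: "g \<in> A j" by auto
    have "g v = 0" if "trunc_vec N v \<in> V" for v
      using Agen(2)[OF j that] generated_algebra_trunc[OF Agen(1)[OF j]] by simp
    then show "g \<in> vanishing_ideal k (vec_coords (Suc N)) (cylinder N V)"
      using lift[OF Agen(1)[OF j]] by (auto simp: vanishing_ideal_def cylinder_def)
  qed
  ultimately show "\<exists>F c. finite F \<and> F \<subseteq> vanishing_ideal k (vec_coords (Suc N)) (cylinder N V) \<and>
      (\<forall>g\<in>F. c g \<in> generated_algebra UNIV (vec_coords (Suc N))) \<and>
      (\<forall>x\<in>carrier_vec (Suc N). f x = (\<Sum>g\<in>F. c g x * g x))"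
    using fin c'(1) by (intro exI[of _ "snd ` ?I"] exI[of _ c'] conjI) auto
qed

section \<open>Morphisms\<close>

lemma subfield_Rats: "subfield (\<rat> :: 'c::field_char_0 set) class_ring"
proof -
  have inv: "m_inv class_ring a = inverse a" if "a \<noteq> 0" for a :: 'c
    by (rule class_cring.comm_inv_char) (use that in \<open>simp_all add: class_ring_simps\<close>)
  show ?thesis
  proof (rule field.subfieldI'[OF class_field])
    show "subring (\<rat> :: 'c set) class_ring"
      by (rule ring.subringI[OF class_ring.ring_axioms]) (simp_all add: class_ring_simps)
    show "m_inv class_ring a \<in> \<rat>" if "a \<in> \<rat> - {zero class_ring}" for a :: 'c
      using that by (simp add: class_ring_simps inv)
  qed
qed

lemma GL_coords_values:
  fixes k :: "'c::field_char_0 set"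
  assumes k: "subfield k class_ring" and x: "x \<in> carrier_mat n n"
    and e: "\<And>i j. i < n \<Longrightarrow> j < n \<Longrightarrow> x $$ (i,j) \<in> k" and c: "c \<in> GL_coords n"
  shows "c x \<in> k"
proof -
  note Q = subfield_Qclosed[OF k]
  have "det x \<in> k"
  proof (rule regular_values[OF regular_det[OF Q] x])
    show "c x \<in> k" if "c \<in> mcoords n" for c using that e by (auto simp: mcoords_def)
  qed (rule QclosedD(5,6)[OF Q]; assumption)+
  then show ?thesis using c e subfield_closed(6)[OF k] by (auto simp: GL_coords_def)
qed

lemma morphisms_overI:
  assumes "\<And>x. x \<in> V \<Longrightarrow> f x \<in> V'"
    and "\<And>h. h \<in> generated_algebra k C' \<Longrightarrow> regular k C V (\<lambda>x. h (f x))"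
  shows "restrict f V \<in> morphisms_over k C V C' V'"
  unfolding morphisms_over_def
proof (intro CollectI conjI ballI)
  show "restrict f V \<in> V \<rightarrow>\<^sub>E V'" using assms(1) by auto
  fix h assume "h \<in> generated_algebra k C'"
  from assms(2)[OF this] show "\<exists>g\<in>generated_algebra k C. \<forall>x\<in>V. h (restrict f V x) = g x"
    unfolding regular_def by simp
qed

lemma morphism_maps: "f \<in> morphisms_over k C V C' V' \<Longrightarrow> x \<in> V \<Longrightarrow> f x \<in> V'"
  by (auto simp: morphisms_over_def)

lemma morphism_compose:
  assumes f: "f \<in> morphisms_over k C V C' V'" and g: "g \<in> morphisms_over k' C' V' C'' V''" and kk: "k \<subseteq> k'"
  shows "(\<lambda>x\<in>V. g (f x)) \<in> morphisms_over k' C V C'' V''"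
proof (rule morphisms_overI)
  fix h assume "h \<in> generated_algebra k' C''"
  from morphism_regular[OF g this] obtain q where q: "q \<in> generated_algebra k' C'" "\<forall>y\<in>V'. h (g y) = q y"
    unfolding regular_def by (elim bexE) (rule that)
  have "regular k' C V (\<lambda>x. q (f x))"
    by (rule regular_compose[OF q(1)], rule regular_mono[OF morphism_regular[OF f] kk], rule generated_algebra.gen)
  then show "regular k' C V (\<lambda>x. h (g (f x)))"
    using q(2) morphism_maps[OF f] by (subst regular_cong[of V _ "\<lambda>x. q (f x)"]) auto
qed (use morphism_maps f g in metis)

lemma rational_points_group_carrier:
  assumes "algebraic_group k n U" "x \<in> carrier (rational_points k' n U)"
  shows "x \<in> U" "x \<in> carrier_mat n n" "i < n \<Longrightarrow> j < n \<Longrightarrow> x $$ (i,j) \<in> k'"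
proof -
  show "x \<in> U" using assms(2) by (simp add: rational_points_simps)
  then show "x \<in> carrier_mat n n" using algebraic_groupD(1)[OF assms(1)] by (auto simp: GL_carrier)
  from rational_pointsD(2)[OF assms(2) this] show "i < n \<Longrightarrow> j < n \<Longrightarrow> x $$ (i,j) \<in> k'" .
qed

lemma constant_morphism:
  fixes U :: "'c::field_char_0 mat set"
  assumes k: "subfield k class_ring" and U: "algebraic_group k' n U" and x: "x \<in> carrier (rational_points k n U)"
  shows "(\<lambda>_\<in>V. x) \<in> morphisms_over k C V (GL_coords n) U"
proof (rule morphisms_overI)
  note Q = subfield_Qclosed[OF k] and x' = rational_points_group_carrier[OF U x]
  fix h :: "'c mat \<Rightarrow> 'c" assume h: "h \<in> generated_algebra k (GL_coords n)"
  have "h x \<in> k"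
    by (rule generated_algebra_values[OF h GL_coords_values[OF k x'(2,3)]]; (rule QclosedD(5,6)[OF Q])?)
  then show "regular k C V (\<lambda>_. h x)" by (rule regular_const)
qed (rule rational_points_group_carrier(1)[OF U x])

lemma morphism_rational_points:
  fixes U :: "'c::field_char_0 mat set"
  assumes k: "subfield k class_ring" and kk: "k \<subseteq> k'" and k': "subfield k' class_ring"
    and U: "algebraic_group K n U" and W: "algebraic_group K' m W"
    and f: "f \<in> morphisms_over k' (GL_coords n) U (GL_coords m) W" and x: "x \<in> carrier (rational_points k n U)"
  shows "f x \<in> carrier (rational_points k' m W)"
proof (rule rational_pointsI)
  note x' = rational_points_group_carrier[OF U x] and Q = subfield_Qclosed[OF k']
  show fx: "f x \<in> W" by (rule morphism_maps[OF f x'(1)])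
  show "f x \<in> carrier_mat m m" using fx algebraic_groupD(1)[OF W] by (auto simp: GL_carrier)
  fix i j assume "i < m" "j < m"
  then have "(\<lambda>A. A $$ (i,j)) \<in> generated_algebra k' (GL_coords m)"
    by (intro generated_algebra.gen) (auto simp: GL_coords_def)
  from morphism_regular[OF f this] x'(1) show "f x $$ (i,j) \<in> k'"
  proof (rule regular_values)
    show "c x \<in> k'" if "c \<in> GL_coords n" for c
      using GL_coords_values[OF k x'(2,3) that] kk by auto
  qed (rule QclosedD(5,6)[OF Q]; assumption)+
qed

section \<open>Restriction of scalars\<close>

lemma weil_restrictionD:
  assumes "weil_restriction L n U r R p"
  shows "algebraic_group \<rat> r R" "p \<in> algebraic_homs L r R n U"
  using assms unfolding weil_restriction_def by simp_all

lemma weil_restriction_lift: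
  assumes "weil_restriction L n U r R p" "variety_over \<rat> (carrier_vec N) (vec_coords N) V"
    "f \<in> morphisms_over L (vec_coords N) V (GL_coords n) U"
  shows "\<exists>!g. g \<in> morphisms_over \<rat> (vec_coords N) V (GL_coords r) R \<and> (\<forall>x\<in>V. f x = p (g x))"
  using assms(1) unfolding weil_restriction_def
  by (elim conjE) (erule allE, erule allE, erule allE, erule mp[OF mp, OF _ assms(2,3)])

text \<open>
  The uniqueness of lifts is the only way in which two points or two maps into the restriction of
  scalars are shown to be equal: it suffices to compare their projections.
\<close>

lemma weil_restriction_lift_unique:
  fixes L :: "'c::field_char_0 set"
  assumes L: "subfield L class_ring" and w: "weil_restriction L n U r R p"
    and V: "variety_over \<rat> (carrier_vec N) (vec_coords N) V"
    and g: "g1 \<in> morphisms_over \<rat> (vec_coords N) V (GL_coords r) R" "g2 \<in> morphisms_over \<rat> (vec_coords N) V (GL_coords r) R"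
    and eq: "\<And>x. x \<in> V \<Longrightarrow> p (g1 x) = p (g2 x)"
  shows "g1 = g2"
proof -
  have p: "p \<in> morphisms_over L (GL_coords r) R (GL_coords n) U"
    using weil_restrictionD(2)[OF w] by (simp add: algebraic_homs_def)
  have "\<rat> \<subseteq> L" using subfield_Qclosed[OF L] by (simp add: Qclosed_def)
  from weil_restriction_lift[OF w V morphism_compose[OF g(1) p this]]
  show ?thesis
  proof (rule ex1E)
    fix g assume "\<forall>h. h \<in> morphisms_over \<rat> (vec_coords N) V (GL_coords r) R \<and> (\<forall>x\<in>V. (\<lambda>x\<in>V. p (g1 x)) x = p (h x)) \<longrightarrow> h = g"
    from this[rule_format, of g1] this[rule_format, of g2] show ?thesis using g eq by simp
  qed
qed

text \<open>
  The affine space of dimension 0 is a point, and morphisms from it over \<open>k\<close> are the points with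
  coordinates in \<open>k\<close>. For this test variety existence and uniqueness of lifts are surjectivity and
  injectivity of the projection.
\<close>

theorem weil_restriction_iso:
  fixes L :: "'c::field_char_0 set"
  assumes L: "subfield L class_ring" and U: "algebraic_group L n U" and w: "weil_restriction L n U r R p"
  shows "p \<in> iso (rational_points \<rat> r R) (rational_points L n U)"
proof -
  let ?RQ = "carrier (rational_points \<rat> r R)" and ?UL = "carrier (rational_points L n U)"
  note R = weil_restrictionD(1)[OF w]
  have p: "p \<in> morphisms_over L (GL_coords r) R (GL_coords n) U"
    "p \<in> hom ((GL r)\<lparr>carrier := R\<rparr>) ((GL n)\<lparr>carrier := U\<rparr>)"
    using weil_restrictionD(2)[OF w] by (simp_all add: algebraic_homs_def)
  have QL: "\<rat> \<subseteq> L" using subfield_Qclosed[OF L] by (simp add: Qclosed_def)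
  note pt = carrier_vec_variety[of \<rat> 0]
  have maps: "p y \<in> ?UL" if "y \<in> ?RQ" for y
    by (rule morphism_rational_points[OF subfield_Rats QL L R U p(1) that])
  have "p (x * y) = p x * p y" if "x \<in> ?RQ" "y \<in> ?RQ" for x y
    using p(2) rational_points_group_carrier(1)[OF R that(1)] rational_points_group_carrier(1)[OF R that(2)]
    by (simp add: hom_def GL_simps)
  then have hom: "p \<in> hom (rational_points \<rat> r R) (rational_points L n U)"
    using maps by (auto simp: hom_def rational_points_simps(2))
  have inj: "inj_on p ?RQ"
  proof (rule inj_onI)
    fix y z assume yz: "y \<in> ?RQ" "z \<in> ?RQ" "p y = p z"
    have "(\<lambda>_\<in>(carrier_vec 0 :: 'c vec set). y) = (\<lambda>_\<in>carrier_vec 0. z)"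
      using weil_restriction_lift_unique[OF L w pt constant_morphism[OF subfield_Rats R yz(1)]
          constant_morphism[OF subfield_Rats R yz(2)]] yz(3) by simp
    from fun_cong[OF this, of vNil] show "y = z" by simp
  qed
  have surj: "x \<in> p ` ?RQ" if x: "x \<in> ?UL" for x
  proof -
    obtain g where g: "g \<in> morphisms_over \<rat> (vec_coords 0) (carrier_vec 0) (GL_coords r) R"
      "\<forall>v\<in>carrier_vec 0. (\<lambda>_\<in>carrier_vec 0. x) v = p (g v)"
      using weil_restriction_lift[OF w pt constant_morphism[OF L U x]] by (elim ex1E conjE) (rule that)
    have v: "vNil \<in> carrier_vec 0" by simp
    have "g vNil \<in> ?RQ"
    proof (rule rational_pointsI)
      show gR: "g vNil \<in> R" by (rule morphism_maps[OF g(1) v])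
      then show "g vNil \<in> carrier_mat r r" using algebraic_groupD(1)[OF R] by (auto simp: GL_carrier)
      fix i j assume "i < r" "j < r"
      then have "(\<lambda>A. A $$ (i,j)) \<in> generated_algebra \<rat> (GL_coords r)"
        by (intro generated_algebra.gen) (auto simp: GL_coords_def)
      from morphism_regular[OF g(1) this] v show "g vNil $$ (i,j) \<in> \<rat>"
        by (rule regular_values) (auto simp: vec_coords_def)
    qed
    moreover have "x = p (g vNil)" using bspec[OF g(2) v] v by simp
    ultimately show ?thesis by (rule image_eqI[rotated])
  qed
  have "bij_betw p ?RQ ?UL" unfolding bij_betw_def using inj maps surj by blast
  then show ?thesis using hom by (simp add: iso_def)
qed

section \<open>Restriction of scalars preserves unipotence\<close>

lemma coeff_forward_difference:
  fixes q :: "'c::comm_ring_1 poly"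
  assumes "\<forall>k\<ge>Suc d. Polynomial.coeff q k = 0"
  shows "\<forall>k\<ge>d. Polynomial.coeff (pcompose q [:1, 1:] - q) k = 0"
  using assms
proof (induction q arbitrary: d)
  case (pCons a q)
  let ?w = "pcompose q [:1, 1:]"
  have q: "Polynomial.coeff q k = 0" if "k \<ge> d" for k
    using pCons.prems that by (metis Suc_le_mono coeff_pCons_Suc)
  have eq: "pcompose (pCons a q) [:1, 1:] = [:a:] + (?w + pCons 0 ?w)" by (simp add: pcompose_pCons)
  show ?case
  proof (cases d)
    case 0
    then have "q = 0" using q by (intro poly_eqI) simp
    then show ?thesis unfolding eq by simp
  next
    case (Suc e)
    have IH: "Polynomial.coeff (?w - q) k = 0" if "k \<ge> e" for k
      using pCons.IH[of e] q that unfolding Suc by blast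
    have "Polynomial.coeff (pcompose (pCons a q) [:1, 1:] - pCons a q) (Suc j) = 0" if "j \<ge> e" for j
    proof -
      have "Polynomial.coeff (pcompose (pCons a q) [:1, 1:] - pCons a q) (Suc j)
          = Polynomial.coeff (?w - q) (Suc j) + Polynomial.coeff q (Suc j) + Polynomial.coeff (?w - q) j"
        unfolding eq by simp
      then show ?thesis using IH[of "Suc j"] IH[of j] q[of "Suc j"] that Suc by simp
    qed
    then show ?thesis unfolding Suc by (metis Suc_le_D Suc_le_mono)
  qed
qed simp

text \<open>
  Multiplication by \<open>s - 1\<close> is the difference operator on the exponent \<open>i\<close>, which lowers the degree of
  a polynomial. The condition that the coefficients from \<open>d\<close> on vanish expresses degree less than \<open>d\<close>
  with the polynomial 0 included for \<open>d = 0\<close>.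
\<close>

lemma polynomial_powers_nilpotent:
  fixes Z s :: "'c::field_char_0 endo"
  assumes "\<forall>a<n. \<forall>b<n. \<exists>q. (\<forall>k\<ge>d. Polynomial.coeff q k = 0) \<and> (\<forall>i. ent (Z * s ^ i) a b = poly q (of_nat i))"
  shows "\<forall>a<n. \<forall>b<n. ent (Z * (s - 1) ^ d) a b = 0"
  using assms
proof (induction d arbitrary: Z)
  case 0
  show ?case
  proof (intro allI impI)
    fix a b assume "a < n" "b < n"
    with 0 obtain q where q: "\<forall>k\<ge>0. Polynomial.coeff q k = 0" "\<forall>i. ent (Z * s ^ i) a b = poly q (of_nat i)" by meson
    have "q = 0" using q(1) by (intro poly_eqI) simp
    then show "ent (Z * (s - 1) ^ 0) a b = 0" using q(2)[rule_format, of 0] by simp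
  qed
next
  case (Suc d)
  have "\<forall>a<n. \<forall>b<n. \<exists>q. (\<forall>k\<ge>d. Polynomial.coeff q k = 0) \<and>
      (\<forall>i. ent (Z * (s - 1) * s ^ i) a b = poly q (of_nat i))"
  proof (intro allI impI)
    fix a b assume "a < n" "b < n"
    with Suc.prems obtain q where q: "\<forall>k\<ge>Suc d. Polynomial.coeff q k = 0"
      "\<forall>i. ent (Z * s ^ i) a b = poly q (of_nat i)" by meson
    have eq: "ent (Z * (s - 1) * s ^ i) a b = poly (pcompose q [:1, 1:] - q) (of_nat i)" for i
    proof -
      have "Z * (s - 1) * s ^ i = Z * s ^ Suc i - Z * s ^ i" by (simp add: algebra_simps)
      then have "ent (Z * (s - 1) * s ^ i) a b = poly q (of_nat (Suc i)) - poly q (of_nat i)"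
        using q(2) by (simp only: ent_simps)
      then show ?thesis by (simp add: poly_pcompose)
    qed
    show "\<exists>q. (\<forall>k\<ge>d. Polynomial.coeff q k = 0) \<and> (\<forall>i. ent (Z * (s - 1) * s ^ i) a b = poly q (of_nat i))"
      by (rule exI[of _ "pcompose q [:1, 1:] - q"], rule conjI[OF coeff_forward_difference[OF q(1)]], rule allI, rule eq)
  qed
  from Suc.IH[OF this] show ?case by (simp add: mult.assoc)
qed

lemma unipotent_if_powers_polynomial:
  fixes y :: "'c::field_char_0 mat"
  assumes y: "y \<in> carrier_mat r r"
    and P: "\<forall>a<r. \<forall>b<r. \<exists>q. \<forall>i. ent (stab r y ^ i) a b = poly q (of_nat i)"
  shows "\<exists>d. (y - 1\<^sub>m r) ^\<^sub>m d = 0\<^sub>m r r"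
proof -
  let ?s = "stab r y" and ?I = "{..<r} \<times> {..<r}"
  have "\<forall>x\<in>?I. \<exists>q. \<forall>i. ent (?s ^ i) (fst x) (snd x) = poly q (of_nat i)" using P by simp
  from bchoice[OF this] obtain q where q: "\<forall>x\<in>?I. \<forall>i. ent (?s ^ i) (fst x) (snd x) = poly (q x) (of_nat i)" ..
  define d where "d = Suc (\<Sum>x\<in>?I. degree (q x))"
  have "degree (q x) < d" if "x \<in> ?I" for x
    unfolding d_def using member_le_sum[OF that, of "\<lambda>x. degree (q x)"] by (simp add: less_Suc_eq_le)
  then have "\<forall>k\<ge>d. Polynomial.coeff (q x) k = 0" if "x \<in> ?I" for x
    using that by (meson coeff_eq_0 less_le_trans)
  then have "\<forall>a<r. \<forall>b<r. \<exists>q. (\<forall>k\<ge>d. Polynomial.coeff q k = 0) \<and> (\<forall>i. ent (1 * ?s ^ i) a b = poly q (of_nat i))"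
    using q by (intro allI impI, rule_tac x = "q (a,b)" in exI) auto
  from polynomial_powers_nilpotent[OF this] have z: "ent ((?s - 1) ^ d) a b = 0" if "a < r" "b < r" for a b
    using that by simp
  have "(y - 1\<^sub>m r) ^\<^sub>m d = mt r ((?s - 1) ^ d)"
    using mt_unipotent[OF stab_minus_1[OF y], of d] by (simp add: mt_stab[OF y])
  also have "\<dots> = 0\<^sub>m r r" using z by (intro eq_matI) auto
  finally show ?thesis ..
qed

lemma mt_stab_power_Suc:
  assumes "y \<in> carrier_mat r r"
  shows "mt r (stab r y ^ Suc i) = y * mt r (stab r y ^ i)"
  using mt_mult[OF Cfin_power[OF stab_Cfin[OF assms]], of "stab r y" i] by (simp add: mt_stab[OF assms])

text \<open>
  Let \<open>V\<close> be the affine image of \<open>R\<close> and \<open>W\<close> its product with a line. Over \<open>L\<close> there is the morphism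
  \<open>(y, t) \<mapsto> exp (t log (p y))\<close> from \<open>W\<close> to \<open>U\<close>. It lifts to a rational morphism \<open>g\<close> from \<open>W\<close> to \<open>R\<close>. For
  fixed \<open>t = i\<close> the morphisms \<open>y \<mapsto> g (y, i)\<close> and \<open>y \<mapsto> y ^ i\<close> have the same projection \<open>(p y) ^ i\<close>, so
  they are equal, and \<open>y ^ i\<close> is a polynomial in \<open>i\<close>.
\<close>

theorem weil_restriction_unipotent:
  fixes L :: "'c::{alg_closed_field,field_char_0} set"
  assumes U: "unipotent_alg_group L n U J" and w: "weil_restriction L n U r R p"
  shows "unipotent_group r R"
proof -
  interpret unipotent_alg_group L n U J by fact
  note R = weil_restrictionD(1)[OF w]
  have p: "p \<in> morphisms_over L (GL_coords r) R (GL_coords n) U"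
    "p \<in> hom ((GL r)\<lparr>carrier := R\<rparr>) ((GL n)\<lparr>carrier := U\<rparr>)"
    using weil_restrictionD(2)[OF w] by (simp_all add: algebraic_homs_def)
  have QL: "\<rat> \<subseteq> L" using Qk by (simp add: Qclosed_def)
  have Rc: "y \<in> carrier_mat r r" "det y \<noteq> 0" if "y \<in> R" for y
    using algebraic_groupD(1)[OF R] that by (auto simp: GL_carrier)
  have pU: "p y \<in> U" if "y \<in> R" for y by (rule morphism_maps[OF p(1) that])
  have stab_p: "stab n (p y) \<in> stab n ` U" if "y \<in> R" for y using pU[OF that] by simp
  define N where "N = r * r + 1"
  have rN: "r * r < N" by (simp add: N_def)
  let ?V = "aff r ` R"
  let ?W = "cylinder N ?V"
  have V: "variety_over \<rat> (carrier_vec N) (vec_coords N) ?V"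
    unfolding N_def by (rule affine_embedding_variety[OF Qclosed_Rats R])
  note W = cylinder_variety[OF V]
  have Vc: "v \<in> carrier_vec N" "unaff r v \<in> R" "det (unaff r v) * v $ (r * r) = 1" if v: "v \<in> ?V" for v
  proof -
    obtain y where y: "y \<in> R" "v = aff r y" using v by auto
    then show "v \<in> carrier_vec N" using aff_carrier[of r y] by (simp add: N_def)
    show "unaff r v \<in> R" "det (unaff r v) * v $ (r * r) = 1"
      using y Rc[OF y(1)] by (simp_all add: unaff_aff aff_last)
  qed
  have unaff_trunc: "unaff r (trunc_vec N v) = unaff r v" for v :: "'c vec"
  proof (rule eq_matI)
    fix i j assume "i < dim_row (unaff r v)" "j < dim_col (unaff r v)"
    then have ij: "i < r" "j < r" by (simp_all add: unaff_def)
    have "i * r + j < N" using index_bound[OF ij] rN by simp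
    then show "unaff r (trunc_vec N v) $$ (i,j) = unaff r v $$ (i,j)"
      by (simp add: unaff_index[OF ij] trunc_vec_def)
  qed (simp_all add: unaff_def)
  have Wc: "unaff r v \<in> R" "det (unaff r v) * v $ (r * r) = 1" if v: "v \<in> ?W" for v
  proof -
    have t: "trunc_vec N v \<in> ?V" using v by (simp add: cylinder_def)
    show "unaff r v \<in> R" "det (unaff r v) * v $ (r * r) = 1"
      using Vc(2,3)[OF t] rN unfolding unaff_trunc by (simp_all add: trunc_vec_def)
  qed
  define X where "X v = Exp J (sc (v $ N) * Log J (stab n (p (unaff r v))))" for v
  have Xstab: "X v \<in> stab n ` U" if "v \<in> ?W" for v
    unfolding X_def by (rule Exp_Log_line[OF stab_p[OF Wc(1)[OF that]]])
  have reg_p: "regmat L (GL_coords r) R n (\<lambda>y. stab n (p y))"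
    unfolding regmat_def
  proof (intro conjI ballI allI impI)
    show "stab n (p y) \<in> Cfin n" if "y \<in> R" for y by (rule stab_Cfin[OF U_carrier(1)[OF pU[OF that]]])
    fix i j assume ij: "i < n" "j < n"
    then have "(\<lambda>A. A $$ (i,j)) \<in> generated_algebra L (GL_coords n)"
      by (intro generated_algebra.gen) (auto simp: GL_coords_def)
    from morphism_regular[OF p(1) this] show "regular L (GL_coords r) R (\<lambda>y. ent (stab n (p y)) i j)"
    proof (subst regular_cong[of R _ "\<lambda>y. p y $$ (i,j)"])
      fix y assume "y \<in> R"
      then have "mt n (stab n (p y)) $$ (i,j) = p y $$ (i,j)" by (simp only: mt_stab[OF U_carrier(1)[OF pU]])
      then show "ent (stab n (p y)) i j = p y $$ (i,j)" using ij by simp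
    qed
  qed
  have reg_pW: "regmat L (vec_coords (Suc N)) ?W n (\<lambda>v. stab n (p (unaff r v)))"
  proof (rule regmat_compose[OF reg_p])
    show "regular L (vec_coords (Suc N)) ?W (\<lambda>v. c (unaff r v))" if "c \<in> GL_coords r" for c
      using rN by (intro regular_unaff[OF generated_algebra.gen[OF that]] Wc(2)) simp
  qed (use Wc(1) in blast)
  have reg_X: "regmat L (vec_coords (Suc N)) ?W n X"
    unfolding X_def
    by (intro regmat_Exp[OF Qk] regmat_mult[OF QclosedD(1)[OF Qk]] regmat_sc[OF QclosedD(1)[OF Qk]]
        regmat_Log[OF Qk reg_pW] regular_gen) (auto simp: vec_coords_def)
  have f: "(\<lambda>v\<in>?W. mt n (X v)) \<in> morphisms_over L (vec_coords (Suc N)) ?W (GL_coords n) U"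
  proof (rule morphisms_overI)
    show "mt n (X v) \<in> U" if "v \<in> ?W" for v by (rule stabU(3)[OF Xstab[OF that]])
    fix h :: "'c mat \<Rightarrow> 'c" assume h: "h \<in> generated_algebra L (GL_coords n)"
    show "regular L (vec_coords (Suc N)) ?W (\<lambda>v. h (mt n (X v)))"
      by (rule regular_GL_det_1[OF h reg_X QclosedD(2)[OF Qk]])
        (rule det_mt_unipotent[OF stabU(1,2)[OF Xstab]])
  qed
  obtain g where g: "g \<in> morphisms_over \<rat> (vec_coords (Suc N)) ?W (GL_coords r) R"
    "\<forall>v\<in>?W. (\<lambda>v\<in>?W. mt n (X v)) v = p (g v)"
    using weil_restriction_lift[OF w W f] by (elim ex1E conjE) (rule that)
  have ext: "extend_vec N v t \<in> ?W" "unaff r (extend_vec N v t) = unaff r v" if v: "v \<in> ?V" for v t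
  proof -
    show "extend_vec N v t \<in> ?W" by (rule extend_in_cylinder[OF Vc(1)[OF v] v])
    show "unaff r (extend_vec N v t) = unaff r v"
      using unaff_trunc[of "extend_vec N v t"] trunc_extend_vec[OF Vc(1)[OF v], of t] by simp
  qed
  have pow_R: "mt r (stab r y ^ i) \<in> R" if y: "y \<in> R" for y i
  proof (induction i)
    case (Suc i)
    show ?case unfolding mt_stab_power_Suc[OF Rc(1)[OF y]] by (rule algebraic_groupD(3)[OF R y Suc])
  qed (simp add: mt_one algebraic_groupD(2)[OF R])
  have p_mult: "\<forall>x\<in>R. \<forall>y\<in>R. p (x * y) = p x * p y" using p(2) by (simp add: hom_def GL_simps)
  have one: "p (1\<^sub>m r) = 1\<^sub>m n"
  proof (rule idempotent_GL[OF U_carrier(3)])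
    show 1: "p (1\<^sub>m r) \<in> U" by (rule pU[OF algebraic_groupD(2)[OF R]])
    have "p (1\<^sub>m r * 1\<^sub>m r) = p (1\<^sub>m r) * p (1\<^sub>m r)"
      by (rule bspec[OF bspec[OF p_mult algebraic_groupD(2)[OF R]] algebraic_groupD(2)[OF R]])
    then show "p (1\<^sub>m r) * p (1\<^sub>m r) = p (1\<^sub>m r)" by simp
  qed
  have p_pow: "p (mt r (stab r y ^ i)) = mt n (stab n (p y) ^ i)" if y: "y \<in> R" for y i
  proof (induction i)
    case (Suc i)
    have "p (y * mt r (stab r y ^ i)) = p y * p (mt r (stab r y ^ i))"
      by (rule bspec[OF bspec[OF p_mult y] pow_R[OF y]])
    then show ?case using Suc
      by (simp only: mt_stab_power_Suc[OF Rc(1)[OF y]] mt_stab_power_Suc[OF U_carrier(1)[OF pU[OF y]]])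
  qed (simp add: mt_one one)
  have det_pow: "inverse (det (mt r (stab r y ^ i))) = inverse (det y) ^ i" if y: "y \<in> R" for y i
  proof (induction i)
    case (Suc i)
    have "det (mt r (stab r y ^ Suc i)) = det y * det (mt r (stab r y ^ i))"
      unfolding mt_stab_power_Suc[OF Rc(1)[OF y]] by (rule det_mult[OF Rc(1)[OF y]]) simp
    then show ?case using Suc by simp
  qed (simp add: mt_one)
  have power_morphism: "(\<lambda>v\<in>?V. mt r (stab r (unaff r v) ^ i)) \<in> morphisms_over \<rat> (vec_coords N) ?V (GL_coords r) R" for i
  proof (rule morphisms_overI)
    show "mt r (stab r (unaff r v) ^ i) \<in> R" if "v \<in> ?V" for v by (rule pow_R[OF Vc(2)[OF that]])
    fix h :: "'c mat \<Rightarrow> 'c" assume h: "h \<in> generated_algebra \<rat> (GL_coords r)"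
    have c: "regular \<rat> (vec_coords N) ?V (\<lambda>v. c (unaff r v))" if "c \<in> GL_coords r" for c
      by (rule regular_unaff[OF generated_algebra.gen[OF that] rN Vc(3)])
    have inv: "regular \<rat> (vec_coords N) ?V (\<lambda>v. inverse (det (unaff r v)) ^ i)"
      by (rule regular_power[OF _ c]) (auto simp: GL_coords_def)
    show "regular \<rat> (vec_coords N) ?V (\<lambda>v. h (mt r (stab r (unaff r v) ^ i)))"
    proof (rule regular_GL[OF h])
      show "regmat \<rat> (vec_coords N) ?V r (\<lambda>v. stab r (unaff r v) ^ i)"
        by (intro regmat_power regmat_compose[OF regmat_stab[OF order_refl]] c) (use unaff_carrier in auto)
      show "regular \<rat> (vec_coords N) ?V (\<lambda>v. inverse (det (mt r (stab r (unaff r v) ^ i))))"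
        using inv by (subst regular_cong[OF det_pow[OF Vc(2)]])
    qed
  qed
  have ext_morphism: "(\<lambda>v\<in>?V. extend_vec N v (of_nat i)) \<in> morphisms_over \<rat> (vec_coords N) ?V (vec_coords (Suc N)) ?W" for i
  proof (rule morphisms_overI[OF ext(1)])
    fix h :: "'c vec \<Rightarrow> 'c" assume h: "h \<in> generated_algebra \<rat> (vec_coords (Suc N))"
    show "regular \<rat> (vec_coords N) ?V (\<lambda>v. h (extend_vec N v (of_nat i)))"
    proof (rule regular_compose[OF h])
      fix c :: "'c vec \<Rightarrow> 'c" assume "c \<in> vec_coords (Suc N)"
      then obtain j where j: "j < Suc N" "c = (\<lambda>v. v $ j)" by (auto simp: vec_coords_def)
      show "regular \<rat> (vec_coords N) ?V (\<lambda>v. c (extend_vec N v (of_nat i)))"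
      proof (cases "j < N")
        case True
        then show ?thesis unfolding j(2) extend_vec_index(1)[OF True]
          by (intro regular_gen) (auto simp: vec_coords_def)
      next
        case False
        then have "j = N" using j(1) by simp
        then show ?thesis unfolding j(2) by (simp add: extend_vec_index regular_const)
      qed
    qed
  qed
  have g_power: "g (extend_vec N (aff r y) (of_nat i)) = mt r (stab r y ^ i)" if y: "y \<in> R" for y i
  proof -
    have "(\<lambda>v\<in>?V. g ((\<lambda>v\<in>?V. extend_vec N v (of_nat i)) v)) = (\<lambda>v\<in>?V. mt r (stab r (unaff r v) ^ i))"
    proof (rule weil_restriction_lift_unique[OF k w V morphism_compose[OF ext_morphism g(1) subset_refl] power_morphism])
      fix v assume v: "v \<in> ?V"
      note y = Vc(2)[OF v]
      note u = stab_p[OF y]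
      have "p (g (extend_vec N v (of_nat i))) = mt n (X (extend_vec N v (of_nat i)))"
        using bspec[OF g(2) ext(1)[OF v]] ext(1)[OF v] by simp
      also have "X (extend_vec N v (of_nat i)) = Exp J (sc (of_nat i * 1) * Log J (stab n (p (unaff r v))))"
        unfolding X_def ext(2)[OF v] extend_vec_index(2) by simp
      also have "\<dots> = Exp J (sc 1 * Log J (stab n (p (unaff r v)))) ^ i"
        by (rule Exp_power[OF Log_nilpotent[OF stabU(2)[OF u]]])
      also have "Exp J (sc 1 * Log J (stab n (p (unaff r v)))) = stab n (p (unaff r v))"
        using Exp_Log[OF stabU(2)[OF u]] by (simp add: sc_simps(2))
      finally have "p (g (extend_vec N v (of_nat i))) = mt n (stab n (p (unaff r v)) ^ i)" .
      then show "p ((\<lambda>v\<in>?V. g ((\<lambda>v\<in>?V. extend_vec N v (of_nat i)) v)) v) = p ((\<lambda>v\<in>?V. mt r (stab r (unaff r v) ^ i)) v)"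
        using v p_pow[OF y] by simp
    qed
    from fun_cong[OF this, of "aff r y"] show ?thesis using y by (simp add: unaff_aff[OF Rc(1)[OF y]])
  qed
  show ?thesis
    unfolding unipotent_group_def
  proof
    fix y assume y: "y \<in> R"
    have v: "aff r y \<in> ?V" using y by simp
    show "\<exists>d. (y - 1\<^sub>m r) ^\<^sub>m d = 0\<^sub>m r r"
    proof (rule unipotent_if_powers_polynomial[OF Rc(1)[OF y]], intro allI impI)
      fix a b assume ab: "a < r" "b < r"
      then have "(\<lambda>A. A $$ (a,b)) \<in> generated_algebra \<rat> (GL_coords r)"
        by (intro generated_algebra.gen) (auto simp: GL_coords_def)
      from morphism_regular[OF g(1) this] obtain h where h: "h \<in> generated_algebra \<rat> (vec_coords (Suc N))"
        "\<forall>v\<in>?W. g v $$ (a,b) = h v" unfolding regular_def by (elim bexE) (rule that)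
      have "regular UNIV {\<lambda>t. t} UNIV (\<lambda>t. h (extend_vec N (aff r y) t))"
      proof (rule regular_compose[OF generated_algebra_mono[OF h(1) subset_UNIV]])
        fix c :: "'c vec \<Rightarrow> 'c" assume "c \<in> vec_coords (Suc N)"
        then obtain j where j: "j < Suc N" "c = (\<lambda>v. v $ j)" by (auto simp: vec_coords_def)
        show "regular UNIV {\<lambda>t. t} UNIV (\<lambda>t. c (extend_vec N (aff r y) t))"
        proof (cases "j < N")
          case True
          show ?thesis unfolding j(2) extend_vec_index(1)[OF True] by (rule regular_const) simp
        next
          case False
          then have "j = N" using j(1) by simp
          show ?thesis unfolding j(2) \<open>j = N\<close> extend_vec_index(2) by (rule regular_gen) simp
        qed
      qed
      from regular_imp_poly[OF this] obtain q where q: "\<forall>t. h (extend_vec N (aff r y) t) = poly q t" ..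
      have "ent (stab r y ^ i) a b = poly q (of_nat i)" for i
      proof -
        have "ent (stab r y ^ i) a b = g (extend_vec N (aff r y) (of_nat i)) $$ (a,b)"
          unfolding g_power[OF y] using ab by simp
        then show ?thesis using bspec[OF h(2) ext(1)[OF v]] q by simp
      qed
      then show "\<exists>q. \<forall>i. ent (stab r y ^ i) a b = poly q (of_nat i)" by blast
    qed
  qed
qed

theorem corollary3p8:
  fixes L1 L2 :: "'c::{alg_closed_field, field_char_0} set"
    and U G :: "'c mat set" and n m :: nat
    and \<phi> :: "'c mat \<Rightarrow> 'c mat"
  assumes "number_field L1" and "number_field L2"
    and "algebraic_group L1 n U" and "algebraic_group L2 m G"
    and "unipotent_group n U"
    and "\<phi> \<in> hom (rational_points L1 n U) (rational_points L2 m G)"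
  shows
    "(L1 = \<rat> \<and> L2 = \<rat> \<longrightarrow>
        (\<exists>!\<psi>. \<psi> \<in> algebraic_homs \<rat> n U m G \<and>
              (\<forall>x \<in> carrier (rational_points \<rat> n U). \<phi> x = \<psi> x)))
     \<and>
     (\<forall>r R1 \<pi>1 s R2 \<pi>2.
        weil_restriction L1 n U r R1 \<pi>1 \<and> weil_restriction L2 m G s R2 \<pi>2 \<longrightarrow>
          \<pi>1 \<in> iso (rational_points \<rat> r R1) (rational_points L1 n U) \<and>
          \<pi>2 \<in> iso (rational_points \<rat> s R2) (rational_points L2 m G) \<and>
          (\<exists>!\<psi>'. \<psi>' \<in> algebraic_homs \<rat> r R1 s R2 \<and>
                (\<forall>x \<in> carrier (rational_points L1 n U).
                   \<phi> x = \<pi>2 (\<psi>' (inv_into (carrier (rational_points \<rat> r R1)) \<pi>1 x)))))"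
proof (intro conjI impI allI)
  have L: "subfield L1 class_ring" "subfield L2 class_ring" using assms(1,2) by (simp_all add: number_field_def)
  obtain J where U: "unipotent_alg_group L1 n U J"
    using unipotent_alg_group_exists[OF L(1) assms(3,5)] ..
  show "\<exists>!\<psi>. \<psi> \<in> algebraic_homs \<rat> n U m G \<and> (\<forall>x \<in> carrier (rational_points \<rat> n U). \<phi> x = \<psi> x)"
    if "L1 = \<rat> \<and> L2 = \<rat>"
    using rational_hom_extends[of n U J m G \<phi>] U assms(4,6) that by simp
  fix r R1 \<pi>1 s R2 \<pi>2
  assume w: "weil_restriction L1 n U r R1 \<pi>1 \<and> weil_restriction L2 m G s R2 \<pi>2"
  let ?R1 = "rational_points \<rat> r R1" and ?R2 = "rational_points \<rat> s R2"
    and ?U = "rational_points L1 n U" and ?G = "rational_points L2 m G"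
  note w1 = conjunct1[OF w] and w2 = conjunct2[OF w]
  note R1 = weil_restrictionD(1)[OF w1] and R2 = weil_restrictionD(1)[OF w2]
  show i1: "\<pi>1 \<in> iso ?R1 ?U" by (rule weil_restriction_iso[OF L(1) assms(3) w1])
  show i2: "\<pi>2 \<in> iso ?R2 ?G" by (rule weil_restriction_iso[OF L(2) assms(4) w2])
  obtain K where K: "unipotent_alg_group \<rat> r R1 K"
    using unipotent_alg_group_exists[OF subfield_Rats R1 weil_restriction_unipotent[OF U w1]] ..
  have b: "bij_betw \<pi>1 (carrier ?R1) (carrier ?U)" "bij_betw \<pi>2 (carrier ?R2) (carrier ?G)"
    and h: "\<pi>1 \<in> hom ?R1 ?U" "\<pi>2 \<in> hom ?R2 ?G"
    using i1 i2 by (auto simp: iso_def)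
  define \<sigma> where "\<sigma> = inv_into (carrier ?R2) \<pi>2"
  (* The homomorphism phi, transported to the rational points of the restrictions of scalars. *)
  define \<phi>' where "\<phi>' y = \<sigma> (\<phi> (\<pi>1 y))" for y
  have \<sigma>: "\<sigma> z \<in> carrier ?R2" "\<pi>2 (\<sigma> z) = z" if "z \<in> carrier ?G" for z
    using that b(2) unfolding \<sigma>_def bij_betw_def by (auto intro: inv_into_into f_inv_into_f)
  have \<pi>1: "\<pi>1 y \<in> carrier ?U" if "y \<in> carrier ?R1" for y using b(1) that by (rule bij_betwE[rule_format])
  have \<phi>: "\<phi> x \<in> carrier ?G" if "x \<in> carrier ?U" for x using assms(6) that by (auto simp: hom_def)
  have inj: "y = z" if "\<pi>2 y = \<pi>2 z" "y \<in> carrier ?R2" "z \<in> carrier ?R2" for y z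
    using b(2) that by (auto simp: bij_betw_def inj_on_def)
  have R2_closed: "y * z \<in> carrier ?R2" if "y \<in> carrier ?R2" "z \<in> carrier ?R2" for y z
  proof -
    note y = rational_points_group_carrier[OF R2 that(1)] and z = rational_points_group_carrier[OF R2 that(2)]
    show ?thesis
    proof (rule rational_pointsI)
      show "y * z \<in> R2" by (rule algebraic_groupD(3)[OF R2 y(1) z(1)])
      show "y * z \<in> carrier_mat s s" using y(2) z(2) by simp
      show "(y * z) $$ (i,j) \<in> \<rat>" if "i < s" "j < s" for i j
        using that y(2,3) z(2,3) by (auto simp: scalar_prod_def intro!: Qclosed_sum[OF Qclosed_Rats])
    qed
  qed
  have "\<phi>' (y * z) = \<phi>' y * \<phi>' z" if yz: "y \<in> carrier ?R1" "z \<in> carrier ?R1" for y z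
  proof (rule inj)
    have yz1: "\<pi>1 (y * z) = \<pi>1 y * \<pi>1 z" using h(1) yz by (simp add: hom_def rational_points_simps(2))
    have yz2: "\<phi> (\<pi>1 y * \<pi>1 z) = \<phi> (\<pi>1 y) * \<phi> (\<pi>1 z)"
      using assms(6) \<pi>1 yz by (simp add: hom_def rational_points_simps(2))
    have prod: "\<phi> (\<pi>1 (y * z)) \<in> carrier ?G"
    proof -
      have "\<pi>2 (\<sigma> (\<phi> (\<pi>1 y)) * \<sigma> (\<phi> (\<pi>1 z))) = \<phi> (\<pi>1 y) * \<phi> (\<pi>1 z)"
        using h(2) \<sigma>[OF \<phi>[OF \<pi>1[OF yz(1)]]] \<sigma>[OF \<phi>[OF \<pi>1[OF yz(2)]]]
        by (simp add: hom_def rational_points_simps(2))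
      moreover have "\<pi>2 (\<sigma> (\<phi> (\<pi>1 y)) * \<sigma> (\<phi> (\<pi>1 z))) \<in> carrier ?G"
        by (rule bij_betwE[OF b(2), rule_format], rule R2_closed) (rule \<sigma>(1)[OF \<phi>[OF \<pi>1]], rule yz)+
      ultimately show ?thesis by (simp only: yz1 yz2)
    qed
    show "\<phi>' (y * z) \<in> carrier ?R2" unfolding \<phi>'_def by (rule \<sigma>(1)[OF prod])
    show "\<phi>' y * \<phi>' z \<in> carrier ?R2"
      unfolding \<phi>'_def by (rule R2_closed) (rule \<sigma>(1)[OF \<phi>[OF \<pi>1]], rule yz)+
    have "\<pi>2 (\<phi>' (y * z)) = \<phi> (\<pi>1 y) * \<phi> (\<pi>1 z)" unfolding \<phi>'_def \<sigma>(2)[OF prod] by (simp only: yz1 yz2)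
    also have "\<dots> = \<pi>2 (\<phi>' y * \<phi>' z)"
      unfolding \<phi>'_def using h(2) \<sigma>[OF \<phi>[OF \<pi>1[OF yz(1)]]] \<sigma>[OF \<phi>[OF \<pi>1[OF yz(2)]]]
      by (simp add: hom_def rational_points_simps(2))
    finally show "\<pi>2 (\<phi>' (y * z)) = \<pi>2 (\<phi>' y * \<phi>' z)" .
  qed
  moreover have "\<phi>' y \<in> carrier ?R2" if "y \<in> carrier ?R1" for y
    unfolding \<phi>'_def by (rule \<sigma>(1)[OF \<phi>[OF \<pi>1[OF that]]])
  ultimately have "\<phi>' \<in> hom ?R1 ?R2" by (simp add: hom_def rational_points_simps(2))
  note ext = rational_hom_extends[OF K R2 this]
  (* A rational homomorphism psi satisfies the required identity if and only if it extends
     the transported homomorphism, since pi2 is injective on rational points. *)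
  have eq: "(\<forall>x \<in> carrier ?U. \<phi> x = \<pi>2 (\<psi> (inv_into (carrier ?R1) \<pi>1 x))) \<longleftrightarrow>
      (\<forall>y \<in> carrier ?R1. \<phi>' y = \<psi> y)" if \<psi>: "\<psi> \<in> algebraic_homs \<rat> r R1 s R2" for \<psi>
  proof -
    have \<psi>R: "\<psi> y \<in> carrier ?R2" if "y \<in> carrier ?R1" for y
      by (rule morphism_rational_points[OF subfield_Rats subset_refl subfield_Rats R1 R2 _ that])
        (use \<psi> in \<open>simp add: algebraic_homs_def\<close>)
    have "(\<forall>x \<in> carrier ?U. \<phi> x = \<pi>2 (\<psi> (inv_into (carrier ?R1) \<pi>1 x))) \<longleftrightarrow>
        (\<forall>y \<in> carrier ?R1. \<phi> (\<pi>1 y) = \<pi>2 (\<psi> (inv_into (carrier ?R1) \<pi>1 (\<pi>1 y))))"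
      unfolding bij_betw_imp_surj_on[OF b(1), symmetric] by simp
    also have "\<dots> \<longleftrightarrow> (\<forall>y \<in> carrier ?R1. \<phi> (\<pi>1 y) = \<pi>2 (\<psi> y))"
      using inv_into_f_f[OF bij_betw_imp_inj_on[OF b(1)]] by simp
    also have "\<dots> \<longleftrightarrow> (\<forall>y \<in> carrier ?R1. \<phi>' y = \<psi> y)"
    proof (intro ball_cong refl)
      fix y assume y: "y \<in> carrier ?R1"
      note z = \<sigma>[OF \<phi>[OF \<pi>1[OF y]]]
      show "\<phi> (\<pi>1 y) = \<pi>2 (\<psi> y) \<longleftrightarrow> \<phi>' y = \<psi> y"
        using inj[OF _ z(1) \<psi>R[OF y]] z(2) unfolding \<phi>'_def by metis
    qed
    finally show ?thesis .
  qed
  from ext eq show "\<exists>!\<psi>'. \<psi>' \<in> algebraic_homs \<rat> r R1 s R2 \<and>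
      (\<forall>x \<in> carrier ?U. \<phi> x = \<pi>2 (\<psi>' (inv_into (carrier ?R1) \<pi>1 x)))"
    by (simp only: cong: conj_cong)
qed

end
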